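(* For any integer $d\ge3$, there exist a birational map $\phi:\mathbb{P}^d\dashrightarrow\mathbb{P}^d$ defined over $\overline{\mathbb{Q}}$ and a point $P\in\mathbb{P}^d(\overline{\mathbb{Q}})_\phi$ such that the arithmetic degree $\alpha_\phi(P)$ (exists and) is transcendental. Moreover, if $d=3$, one can take $P\in\mathbb{P}^3(\overline{\mathbb{Q}})_\phi$ such that in addition the forward orbit $\mathcal{O}_\phi(P)$ is Zariski dense, i.e. $\overline{\mathcal{O}_\phi(P)}=\mathbb{P}^3$.
   Context: Let $X$ be a smooth projective variety over $\overline{\mathbb{Q}}$ and $f:X\dashrightarrow X$ a dominant rational map. Put $X(\overline{\mathbb{Q}})_f=\{x\in X(\overline{\mathbb{Q}}) : f^n(x)\text{ can be defined for all }n\ge0\}$ (that is, the forward iterates of $x$ under $f$ never meet the indeterminacy locus of $f$), and for $x\in X(\overline{\mathbb{Q}})_f$ let $\mathcal{O}_f(x)=\{f^n(x): n\ge0\}$ be the forward orbit. Let $h_X:X(\overline{\mathbb{Q}})\to[0,\infty)$ be a fixed logarithmic Weil height function (associated with an ample divisor; on $\mathbb{P}^d$ one may take the standard absolute logarithmic height) and $h_X^+=\max\{1,h_X\}$. The upper and lower arithmetic degrees of $f$ at $x\in X(\overline{\mathbb{Q}})_f$ are $$\overline{\alpha}_f(x)=\limsup_{n\to\infty}h_X^+(f^n(x))^{1/n},\qquad \underline{\alpha}_f(x)=\liminf_{n\to\infty}h_X^+(f^n(x))^{1/n}.$$ If they are equal, the arithmetic degree $\alpha_f(x)$ is said to exist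 and is defined to be their common value. *)

theory Defs
  imports
    "HOL-Analysis.Infinite_Sum"
    "HOL-Library.Poly_Mapping"
    "HOL-Library.Extended_Real"
    "HOL-Library.Liminf_Limsup"
    "HOL-Algebra.Algebraic_Closure_Type"
    "HOL-Algebra.Generated_Fields"
    "HOL-Algebra.Embedded_Algebras"
begin

type_synonym qbar = "rat alg_closure"

abbreviation qbar_ring :: "qbar ring"
  where "qbar_ring \<equiv> ring_of_type_algebra"


section \<open>Projective space\<close>

text \<open>
  A vector of length d + 1 is a function on the naturals that vanishes beyond d. A point of
  projective d-space is the set of all its homogeneous coordinate vectors.
\<close>

definition coord_vectors :: "nat \<Rightarrow> (nat \<Rightarrow> qbar) set"
  where "coord_vectors d = {x. (\<forall>i>d. x i = 0) \<and> (\<exists>i. x i \<noteq> 0)}"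

definition scaling_rel :: "nat \<Rightarrow> ((nat \<Rightarrow> qbar) \<times> (nat \<Rightarrow> qbar)) set"
  where "scaling_rel d =
    {(x, y). x \<in> coord_vectors d \<and> y \<in> coord_vectors d \<and> (\<exists>c. c \<noteq> 0 \<and> y = (\<lambda>i. c * x i))}"

type_synonym point = "(nat \<Rightarrow> qbar) set"

definition proj_space :: "nat \<Rightarrow> point set"
  where "proj_space d = coord_vectors d // scaling_rel d"


section \<open>Homogeneous polynomials\<close>

text \<open>
  A monomial is the finitely supported map from variable indices to exponents, a polynomial the
  finitely supported map from monomials to coefficients.
\<close>

type_synonym mpoly = "(nat \<Rightarrow>\<^sub>0 nat) \<Rightarrow>\<^sub>0 qbar"

text \<open>The coefficients are mapped to the target ring by \<open>h\<close>, the \<open>i\<close>-th variable to \<open>x i\<close>.\<close>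

definition mpoly_eval :: "(qbar \<Rightarrow> 'b::comm_ring_1) \<Rightarrow> (nat \<Rightarrow> 'b) \<Rightarrow> mpoly \<Rightarrow> 'b"
  where "mpoly_eval h x p =
    (\<Sum>m\<in>Poly_Mapping.keys p. h (Poly_Mapping.lookup p m) *
       (\<Prod>i\<in>Poly_Mapping.keys m. x i ^ Poly_Mapping.lookup m i))"

definition mpoly_value :: "(nat \<Rightarrow> qbar) \<Rightarrow> mpoly \<Rightarrow> qbar"
  where "mpoly_value = mpoly_eval (\<lambda>c. c)"

definition mpoly_subst :: "(nat \<Rightarrow> mpoly) \<Rightarrow> mpoly \<Rightarrow> mpoly"
  where "mpoly_subst = mpoly_eval (Poly_Mapping.single 0)"

definition mpoly_var :: "nat \<Rightarrow> mpoly"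
  where "mpoly_var i = Poly_Mapping.single (Poly_Mapping.single i 1) 1"

text \<open>The zero polynomial is homogeneous of every degree.\<close>

definition homogeneous :: "nat \<Rightarrow> nat \<Rightarrow> mpoly \<Rightarrow> bool"
  where "homogeneous d e p \<longleftrightarrow>
    (\<forall>m\<in>Poly_Mapping.keys p. Poly_Mapping.keys m \<subseteq> {..d} \<and>
       (\<Sum>i\<in>Poly_Mapping.keys m. Poly_Mapping.lookup m i) = e)"


section \<open>Zariski topology\<close>

text \<open>For homogeneous \<open>F\<close>, vanishing does not depend on the coordinate vector of the point.\<close>

definition zero_locus :: "nat \<Rightarrow> mpoly set \<Rightarrow> point set"
  where "zero_locus d S = {p \<in> proj_space d. \<forall>F\<in>S. \<forall>x\<in>p. mpoly_value x F = 0}"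

definition zariski_closed :: "nat \<Rightarrow> point set \<Rightarrow> bool"
  where "zariski_closed d Z \<longleftrightarrow>
    (\<exists>S. (\<forall>F\<in>S. \<exists>e. homogeneous d e F) \<and> Z = zero_locus d S)"

definition zariski_closure :: "nat \<Rightarrow> point set \<Rightarrow> point set"
  where "zariski_closure d A = \<Inter>{Z. zariski_closed d Z \<and> A \<subseteq> Z}"


section \<open>Rational and birational maps\<close>

definition form_tuples :: "nat \<Rightarrow> (nat \<Rightarrow> mpoly) set"
  where "form_tuples d =
    {F. (\<exists>e. \<forall>i\<le>d. homogeneous d e (F i)) \<and> (\<forall>i>d. F i = 0) \<and> (\<exists>i. F i \<noteq> 0)}"

definition tuple_rel :: "nat \<Rightarrow> ((nat \<Rightarrow> mpoly) \<times> (nat \<Rightarrow> mpoly)) set"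
  where "tuple_rel d =
    {(F, G). F \<in> form_tuples d \<and> G \<in> form_tuples d \<and> (\<forall>i j. F i * G j = F j * G i)}"

text \<open>A rational self-map is the set of all tuples of forms that represent it.\<close>

type_synonym rational_map = "(nat \<Rightarrow> mpoly) set"

definition rational_maps :: "nat \<Rightarrow> rational_map set"
  where "rational_maps d = form_tuples d // tuple_rel d"

definition rat_id :: "nat \<Rightarrow> rational_map"
  where "rat_id d = tuple_rel d `` {\<lambda>i. if i \<le> d then mpoly_var i else 0}"

text \<open>The composite \<open>\<psi>\<close> after \<open>\<phi>\<close>; it is empty if the image of \<open>\<phi>\<close> lies in the indeterminacy
  locus of \<open>\<psi>\<close>, because then every substituted tuple vanishes identically.\<close>

definition rat_comp :: "nat \<Rightarrow> rational_map \<Rightarrow> rational_map \<Rightarrow> rational_map"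
  where "rat_comp d \<psi> \<phi> = {H. \<exists>G\<in>\<psi>. \<exists>F\<in>\<phi>. ((\<lambda>i. mpoly_subst F (G i)), H) \<in> tuple_rel d}"

definition birational :: "nat \<Rightarrow> rational_map \<Rightarrow> bool"
  where "birational d \<phi> \<longleftrightarrow> \<phi> \<in> rational_maps d \<and>
    (\<exists>\<psi>\<in>rational_maps d. rat_comp d \<psi> \<phi> = rat_id d \<and> rat_comp d \<phi> \<psi> = rat_id d)"

definition indeterminacy_locus :: "nat \<Rightarrow> rational_map \<Rightarrow> point set"
  where "indeterminacy_locus d \<phi> =
    {p \<in> proj_space d. \<forall>F\<in>\<phi>. \<forall>x\<in>p. \<forall>i. mpoly_value x (F i) = 0}"

text \<open>Well defined outside the indeterminacy locus, and unspecified on it.\<close>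

definition rat_apply :: "nat \<Rightarrow> rational_map \<Rightarrow> point \<Rightarrow> point"
  where "rat_apply d \<phi> p =
    (THE q. q \<in> proj_space d \<and> (\<exists>F\<in>\<phi>. \<exists>x\<in>p. (\<lambda>i. mpoly_value x (F i)) \<in> q))"

definition points_with_orbit :: "nat \<Rightarrow> rational_map \<Rightarrow> point set"
  where "points_with_orbit d \<phi> =
    {p \<in> proj_space d. \<forall>n. (rat_apply d \<phi> ^^ n) p \<notin> indeterminacy_locus d \<phi>}"

definition forward_orbit :: "nat \<Rightarrow> rational_map \<Rightarrow> point \<Rightarrow> point set"
  where "forward_orbit d \<phi> p = {(rat_apply d \<phi> ^^ n) p | n. True}"


section \<open>The absolute logarithmic height\<close>

text \<open>Maps on a subfield \<open>K\<close> are made extensional so that each is counted once.\<close>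

definition embeddings :: "qbar set \<Rightarrow> (qbar \<Rightarrow> complex) set"
  where "embeddings K =
    ring_hom (qbar_ring\<lparr>carrier := K\<rparr>) (ring_of_type_algebra :: complex ring) \<inter> extensional K"

text \<open>The finite places of a number field \<open>K\<close>, as its normalised discrete valuations.\<close>

definition finite_places :: "qbar set \<Rightarrow> (qbar \<Rightarrow> int) set"
  where "finite_places K = {v \<in> extensional (K - {0}).
    v ` (K - {0}) = UNIV \<and>
    (\<forall>x\<in>K - {0}. \<forall>y\<in>K - {0}. v (x * y) = v x + v y) \<and>
    (\<forall>x\<in>K - {0}. \<forall>y\<in>K - {0}. x + y \<noteq> 0 \<longrightarrow> v (x + y) \<ge> min (v x) (v y))}"

definition valuation_ring :: "qbar set \<Rightarrow> (qbar \<Rightarrow> int) \<Rightarrow> qbar set"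
  where "valuation_ring K v = {x \<in> K. x = 0 \<or> v x \<ge> 0}"

definition residue_card :: "qbar set \<Rightarrow> (qbar \<Rightarrow> int) \<Rightarrow> nat"
  where "residue_card K v = card (valuation_ring K v //
    {(x, y). x \<in> valuation_ring K v \<and> y \<in> valuation_ring K v \<and> (x = y \<or> v (x - y) > 0)})"

text \<open>With \<open>N\<close> the number of elements of the residue field, \<open>N powr (- v x)\<close> is the absolute value
  extending a standard p-adic one, raised to the local degree at the place.\<close>

definition finite_abs :: "qbar set \<Rightarrow> (qbar \<Rightarrow> int) \<Rightarrow> qbar \<Rightarrow> real"
  where "finite_abs K v x =
    (if x = 0 then 0 else real (residue_card K v) powr (- real_of_int (v x)))"

text \<open>Summing over embeddings instead of archimedean places counts a complex place twice, which is
  its local degree.\<close>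

definition height_over :: "nat \<Rightarrow> qbar set \<Rightarrow> (nat \<Rightarrow> qbar) \<Rightarrow> real"
  where "height_over d K x =
    ((\<Sum>\<sigma>\<in>embeddings K. ln (Max ((\<lambda>i. cmod (\<sigma> (x i))) ` {..d}))) +
     (\<Sum>\<^sub>\<infinity>v\<in>finite_places K. ln (Max ((\<lambda>i. finite_abs K v (x i)) ` {..d})))) /
    real (ring.dim qbar_ring \<rat> K)"

text \<open>The height does not depend on the coordinate vector nor on the number field containing it.
  Taken here are the vector whose first nonzero entry is 1, and the field of definition
  of the point, which its entries generate.\<close>

definition normalized_coords :: "point \<Rightarrow> nat \<Rightarrow> qbar"
  where "normalized_coords p = (THE x. x \<in> p \<and> (\<exists>k. x k = 1 \<and> (\<forall>i<k. x i = 0)))"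

definition field_of_definition :: "point \<Rightarrow> qbar set"
  where "field_of_definition p = generate_field qbar_ring (range (normalized_coords p))"

definition height :: "nat \<Rightarrow> point \<Rightarrow> real"
  where "height d p = height_over d (field_of_definition p) (normalized_coords p)"

definition height_plus :: "nat \<Rightarrow> point \<Rightarrow> real"
  where "height_plus d p = max 1 (height d p)"


section \<open>Arithmetic degrees\<close>

definition upper_arith_degree :: "nat \<Rightarrow> rational_map \<Rightarrow> point \<Rightarrow> ereal"
  where "upper_arith_degree d \<phi> p =
    limsup (\<lambda>n. ereal (height_plus d ((rat_apply d \<phi> ^^ n) p) powr (1 / real n)))"

definition lower_arith_degree :: "nat \<Rightarrow> rational_map \<Rightarrow> point \<Rightarrow> ereal"
  where "lower_arith_degree d \<phi> p =
    liminf (\<lambda>n. ereal (height_plus d ((rat_apply d \<phi> ^^ n) p) powr (1 / real n)))"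

definition has_arith_degree :: "nat \<Rightarrow> rational_map \<Rightarrow> point \<Rightarrow> real \<Rightarrow> bool"
  where "has_arith_degree d \<phi> p \<alpha> \<longleftrightarrow>
    upper_arith_degree d \<phi> p = ereal \<alpha> \<and> lower_arith_degree d \<phi> p = ereal \<alpha>"

end

theory Submission
  imports Defs "HOL-Analysis.Analysis" "HOL-Computational_Algebra.Computational_Algebra"
    "HOL-Computational_Algebra.Field_as_Ring" "HOL-Real_Asymp.Real_Asymp" "Jordan_Normal_Form.Determinant"
begin

text \<open>
  On the affine chart with coordinates \<open>(x, z, u)\<close> put \<open>N = 1 + 12 (z\<^sup>2 + x\<^sup>4)\<close> and consider the birational map
  \<open>u' = u - 18 u z\<^sup>2 / N + 1 / N\<^sup>2\<close>, \<open>z' = z + u'\<close>, \<open>x' = x + z - 2 u'\<close>, with starting point the origin.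
  At every prime \<open>p\<close> dividing a numerator of \<open>N\<close> to a high power, the orbit jumps towards infinity with
  \<open>|u'| = |N|\<^sup>-\<^sup>2\<close>, and from then on \<open>(x, z)\<close> stays close to \<open>u\<close> times an explicit integral path,
  along which the local height is constant. There \<open>|N| = |u|\<^sup>4\<close> up to a bounded factor, except at the ages
  \<open>s\<^sub>k = 20 2\<^sup>k - 15 k - 20\<close>, where the path has \<open>x = 0\<close> and \<open>|N| = |u|\<^sup>2\<close>. By the product formula, the jumps
  of a given time balance the denominators of \<open>N\<close> up to an archimedean term, which gives a linear recursion for the
  heights whose delays are the \<open>s\<^sub>k\<close>. Its growth rate is \<open>1 / y\<close> with
  \<open>4 (1 - y) \<Sum>\<^sub>k y ^ s\<^sub>k = 9 y - 1\<close>, and Mahler's method shows that such a \<open>y\<close> is transcendental.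
  The orbit is Zariski dense because the leading form of an equation for it would vanish on the path,
  which meets infinitely many conics in too many points.
\<close>

section \<open>The map at a single prime\<close>

text \<open>The coefficients 12 and 18 do three jobs. When \<open>x\<close> is negligible,
  \<open>18 z^2 / N\<close> is close to 18/12 = 3/2, so \<open>u\<close> becomes about
  \<open>- u / 2\<close>; in units of the new \<open>u\<close> the path enters a parabola about
  twice as long, and this doubling makes the \<open>s_k\<close> lacunary. At 2 and 3 the 12 keeps
  \<open>N\<close> a unit, so these primes never contribute, while 12, 18 and 1/2 are units at all
  others. Over the reals \<open>N >= 1\<close> and \<open>18 z^2 / N < 3/2\<close>, so the orbit
  meets no pole and the archimedean height grows only linearly. The 9 in the equation for
  \<open>y\<close> is 1 + 2 * 4: a jump of size \<open>|N|^-2\<close> creates a mass of twice the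
  negative part of \<open>ln |N|\<close>, and this part is balanced by 4 times the mass already
  present, with only half the share from primes at an age \<open>s_k\<close>. The obstacle is that
  single primes escape control: a path coordinate may be too divisible, or an increase too small,
  for the path to be followed. Only the total mass of such primes can be bounded. After the last
  jump the mass at a prime grows at most like 2^age, while the total grows by a factor 8 per step,
  so whatever is old or irregular is negligible.\<close>

definition gate :: "rat \<Rightarrow> rat \<Rightarrow> rat"
  where "gate a b = 1 + 12 * (b ^ 2 + a ^ 4)"

definition new_u :: "rat \<Rightarrow> rat \<Rightarrow> rat \<Rightarrow> rat"
  where "new_u a b u = u - 18 * u * b ^ 2 / gate a b + 1 / gate a b ^ 2"

definition new_z :: "rat \<Rightarrow> rat \<Rightarrow> rat \<Rightarrow> rat"
  where "new_z a b u = b + new_u a b u"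

definition new_x :: "rat \<Rightarrow> rat \<Rightarrow> rat \<Rightarrow> rat"
  where "new_x a b u = a + b - 2 * new_u a b u"

text \<open>Only even powers occur, so over the rationals the gate has no zero. The orbit therefore
  never meets a pole, and the archimedean term \<open>ln N\<close> of the product formula has a
  sign.\<close>

lemma gate_ge_1: "gate a b \<ge> 1"
  unfolding gate_def by simp

lemma gate_nonzero [simp]: "gate a b \<noteq> 0"
  using gate_ge_1[of a b] by linarith

text \<open>The quotients \<open>(x / u, z / u)\<close> to leading order once \<open>u\<close> is
  large at a prime. For \<open>x / u\<close> nonzero, \<open>N\<close> is of the size of
  \<open>x ^ 4\<close> and \<open>u\<close> hardly moves; for \<open>x / u = 0\<close> the gate is
  dominated by \<open>z ^ 2\<close>, \<open>u\<close> becomes \<open>- u / 2\<close>, and passing to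
  the new unit multiplies by -2. The value \<open>(0, 0)\<close> at age 0 is chosen because the rule
  for \<open>x = 0\<close> takes it to \<open>(-2, 1)\<close>, the direction right after a
  jump.\<close>

fun path :: "nat \<Rightarrow> int \<times> int" where
  "path 0 = (0, 0)"
| "path (Suc j) = (case path j of (x, z) \<Rightarrow>
     if x = 0 then (- 2 * z - 2, - 2 * z + 1) else (x + z - 2, z + 1))"

definition px :: "nat \<Rightarrow> int" where "px j = fst (path j)"
definition pz :: "nat \<Rightarrow> int" where "pz j = snd (path j)"

lemma px_Suc: "px (Suc j) = (if px j = 0 then - 2 * pz j - 2 else px j + pz j - 2)"
  and pz_Suc: "pz (Suc j) = (if px j = 0 then - 2 * pz j + 1 else pz j + 1)"
  by (simp_all add: px_def pz_def split: prod.splits)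

lemma path_0: "px 0 = 0" "pz 0 = 0" by (simp_all add: px_def pz_def)

lemma path_small: "px 1 = -2" "px 2 = -3" "px 3 = -3" "px 4 = -2" "px 5 = 0"
  "pz 1 = 1" "pz 2 = 2" "pz 3 = 3" "pz 4 = 4" "pz 5 = 5"
  by (simp_all add: px_Suc pz_Suc path_0 numeral_eq_Suc)

section \<open>Size estimates for one step under an ultrametric absolute value\<close>

locale nonarch =
  fixes v :: "rat \<Rightarrow> real"
  assumes v_nonneg: "v x \<ge> 0"
    and v_eq_0: "v x = 0 \<longleftrightarrow> x = 0"
    and v_mult: "v (x * y) = v x * v y"
    and v_add: "v (x + y) \<le> max (v x) (v y)"
begin

lemma v_0 [simp]: "v 0 = 0" by (simp add: v_eq_0)

lemma v_1 [simp]: "v 1 = 1"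
  using v_mult[of 1 1] v_eq_0[of 1] by simp

lemma v_minus [simp]: "v (- x) = v x"
proof -
  have "v (-1) * v (-1) = 1" using v_mult[of "-1" "-1"] by simp
  hence "v (-1) = 1" using v_nonneg[of "-1"] by (metis abs_of_nonneg abs_one power2_eq_square real_sqrt_abs real_sqrt_one)
  thus ?thesis using v_mult[of "-1" x] by simp
qed

lemma v_pos: "x \<noteq> 0 \<Longrightarrow> v x > 0"
  using v_nonneg[of x] v_eq_0[of x] by linarith

lemma v_power: "v (x ^ n) = v x ^ n"
  by (induction n) (simp_all add: v_mult)

lemma v_divide: "v (x / y) = v x / v y"
proof (cases "y = 0")
  case False
  have "v (x / y) * v y = v x" using v_mult[of "x / y" y] False by simp
  thus ?thesis using v_pos[OF False] by (simp add: field_simps)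
qed simp

lemma v_add_le: "v x \<le> c \<Longrightarrow> v y \<le> c \<Longrightarrow> v (x + y) \<le> c"
  using v_add[of x y] by linarith

lemma v_diff_le: "v x \<le> c \<Longrightarrow> v y \<le> c \<Longrightarrow> v (x - y) \<le> c"
  using v_add_le[of x c "- y"] by simp

lemma v_add_eq: "v y < v x \<Longrightarrow> v (x + y) = v x"
  using v_add[of x y] v_add[of "x + y" "- y"] by simp

lemma v_add_eq': "v x < v y \<Longrightarrow> v (x + y) = v y"
  using v_add_eq[of x y] by (simp add: add.commute)

lemma v_nat_le_1: "v (of_nat n) \<le> 1"
  by (induction n) (simp_all add: v_add_le)

lemma v_int_le_1: "v (of_int n) \<le> 1"
  by (cases n rule: int_cases2) (simp_all add: v_nat_le_1)

definition hh :: "rat \<Rightarrow> rat \<Rightarrow> rat \<Rightarrow> real"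
  where "hh a b u = max 1 (max (v a) (max (v b) (v u)))"

lemma hh_ge: "1 \<le> hh a b u" "v a \<le> hh a b u" "v b \<le> hh a b u" "v u \<le> hh a b u"
  unfolding hh_def by auto

lemma hh_le: "1 \<le> c \<Longrightarrow> v a \<le> c \<Longrightarrow> v b \<le> c \<Longrightarrow> v u \<le> c \<Longrightarrow> hh a b u \<le> c"
  unfolding hh_def by auto

lemma v_int_mult_le: "v x \<le> c \<Longrightarrow> v (of_int n * x) \<le> c"
  using mult_mono[OF v_int_le_1[of n], of "v x" c] v_nonneg by (simp add: v_mult)

lemma v_num_mult_le: "v x \<le> c \<Longrightarrow> v (numeral n * x) \<le> c"
  using v_int_mult_le[of x c "numeral n"] by simp

lemma v_gate_le: "v (gate a b) \<le> hh a b u ^ 4"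
proof -
  let ?H = "hh a b u"
  have 1: "1 \<le> ?H ^ 4" using hh_ge(1) one_le_power by blast
  have "v b ^ 2 \<le> ?H ^ 2" by (intro power_mono hh_ge v_nonneg)
  also have "\<dots> \<le> ?H ^ 4" by (intro power_increasing hh_ge) simp
  finally have 2: "v (b ^ 2) \<le> ?H ^ 4" by (simp add: v_power)
  have 3: "v (a ^ 4) \<le> ?H ^ 4" by (simp add: v_power power_mono hh_ge v_nonneg)
  show ?thesis unfolding gate_def by (intro v_add_le v_num_mult_le) (use 1 2 3 in auto)
qed

lemma v_gate_pos: "v (gate a b) > 0"
  by (simp add: v_pos)

lemma v_kick_le: "v (18 * u * b ^ 2 / gate a b) \<le> hh a b u ^ 3 / v (gate a b)"
proof -
  let ?H = "hh a b u"
  have "v (u * b ^ 2) \<le> ?H * ?H ^ 2" unfolding v_mult v_power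
    by (intro mult_mono power_mono hh_ge v_nonneg) (use hh_ge(1)[of a b u] in auto)
  hence "v (18 * (u * b ^ 2)) \<le> ?H ^ 3" by (intro v_num_mult_le) (simp add: power3_eq_cube power2_eq_square)
  thus ?thesis using v_gate_pos[of a b] by (simp add: v_divide mult.assoc divide_right_mono)
qed

lemma hh_new_le: "v (new_u a b u) \<le> c \<Longrightarrow> hh a b u \<le> c \<Longrightarrow> hh (new_x a b u) (new_z a b u) (new_u a b u) \<le> c"
  using hh_ge[where a=a and b=b and u=u] unfolding new_x_def new_z_def
  by (intro hh_le v_add_le v_diff_le v_num_mult_le) auto

lemma err_new: "v (new_x a b u + 2 * new_u a b u) \<le> hh a b u" "v (new_z a b u - new_u a b u) \<le> hh a b u"
  using hh_ge[where a=a and b=b and u=u] unfolding new_x_def new_z_def by (auto intro!: v_add_le)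

text \<open>The three terms of the new \<open>u\<close> have size at most \<open>H\<close>, at most
  \<open>H ^ 3 / g\<close> and exactly \<open>1 / g ^ 2\<close>. The threshold
  \<open>H ^ 5 * g < 1\<close> means \<open>1 / g > H ^ 5\<close>, so the last term beats the other
  two and also \<open>H ^ 10\<close>. This wide margin between old and new height later absorbs the
  path coordinates.\<close>

lemma entry_step:
  assumes ent: "hh a b u ^ 5 * v (gate a b) < 1"
  defines "B \<equiv> 1 / v (gate a b) ^ 2"
  shows "v (new_u a b u) = B" "hh a b u ^ 10 < B" "hh (new_x a b u) (new_z a b u) (new_u a b u) = B"
proof -
  let ?H = "hh a b u" and ?g = "v (gate a b)"
  have H1: "1 \<le> ?H" by (rule hh_ge)
  have g0: "?g > 0" by (rule v_gate_pos)
  have H5: "?H ^ 5 < 1 / ?g" using ent g0 by (simp add: field_simps)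
  have "?H ^ 5 * ?H ^ 5 < 1 / ?g * (1 / ?g)"
    by (intro mult_strict_mono H5) (use g0 H1 in auto)
  thus B10: "?H ^ 10 < B" unfolding B_def by (simp add: power2_eq_square flip: power_add)
  have "?H ^ 3 \<le> ?H ^ 5" by (intro power_increasing H1) simp
  hence "?H ^ 3 / ?g < (1 / ?g) / ?g" using H5 g0 by (intro divide_strict_right_mono) auto
  hence 1: "?H ^ 3 / ?g < B" by (simp add: B_def power2_eq_square)
  have "?H \<le> ?H ^ 10" using H1 by (simp add: self_le_power)
  hence 2: "?H < B" using B10 by linarith
  have "v (u - 18 * u * b ^ 2 / gate a b) \<le> max ?H (?H ^ 3 / ?g)"
    using hh_ge(4)[of u a b] v_kick_le[of u b a] by (intro v_diff_le) auto
  hence "v (u - 18 * u * b ^ 2 / gate a b) < v (1 / gate a b ^ 2)"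
    using 1 2 unfolding B_def by (auto simp: v_divide v_power)
  thus u: "v (new_u a b u) = B" unfolding new_u_def by (subst v_add_eq') (auto simp: B_def v_divide v_power)
  show "hh (new_x a b u) (new_z a b u) (new_u a b u) = B"
  proof (rule antisym)
    show "hh (new_x a b u) (new_z a b u) (new_u a b u) \<le> B" using u 2 by (intro hh_new_le) auto
    show "B \<le> hh (new_x a b u) (new_z a b u) (new_u a b u)" using u hh_ge(4) by metis
  qed
qed

text \<open>Above the threshold \<open>1 / g\<close> is at most \<open>H ^ 5\<close>, and
  \<open>1 / g ^ 2\<close> is still the worst term; hence the same exponent 10 as in
  \<open>entry_step\<close>.\<close>

lemma nonentry_step:
  assumes ent: "1 \<le> hh a b u ^ 5 * v (gate a b)"
  shows "hh (new_x a b u) (new_z a b u) (new_u a b u) \<le> hh a b u ^ 10"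
proof (rule hh_new_le)
  let ?H = "hh a b u" and ?g = "v (gate a b)"
  have H1: "1 \<le> ?H" by (rule hh_ge)
  have g0: "?g > 0" by (rule v_gate_pos)
  have H5: "1 / ?g \<le> ?H ^ 5" using ent g0 by (simp add: field_simps)
  show H: "?H \<le> ?H ^ 10" using H1 by (simp add: self_le_power)
  have "?H ^ 3 * (1 / ?g) \<le> ?H ^ 3 * ?H ^ 5" by (intro mult_left_mono H5) (use H1 in auto)
  also have "\<dots> = ?H ^ 8" by (simp flip: power_add)
  also have "\<dots> \<le> ?H ^ 10" by (intro power_increasing H1) simp
  finally have 1: "?H ^ 3 / ?g \<le> ?H ^ 10" by simp
  have "1 / ?g * (1 / ?g) \<le> ?H ^ 5 * ?H ^ 5" by (intro mult_mono H5) (use g0 H1 in auto)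
  hence 2: "1 / ?g ^ 2 \<le> ?H ^ 10" by (simp add: power2_eq_square flip: power_add)
  show "v (new_u a b u) \<le> ?H ^ 10" unfolding new_u_def
    using hh_ge(4)[of u a b] v_kick_le[of u b a] 1 2 H
    by (intro v_add_le v_diff_le) (auto simp: v_divide v_power)
qed

text \<open>The new \<open>x\<close> and \<open>z\<close> are integral combinations of old
  coordinates and the new \<open>u\<close>, so an increase can only come from the new
  \<open>u\<close>. Thus any increase, even one that is not an entry, starts a path.\<close>

lemma increase_step:
  assumes "hh a b u < hh (new_x a b u) (new_z a b u) (new_u a b u)"
  shows "v (new_u a b u) = hh (new_x a b u) (new_z a b u) (new_u a b u)"
proof -
  have "hh a b u < v (new_u a b u)" using hh_new_le[of a b u "hh a b u"] assms by linarith
  hence "hh (new_x a b u) (new_z a b u) (new_u a b u) \<le> v (new_u a b u)" by (intro hh_new_le) auto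
  thus ?thesis using hh_ge(4) by (meson antisym)
qed

text \<open>\<open>B\<close> is the height after the jump and \<open>E\<close> the height before it.
  The error \<open>E\<close> is absolute and does not grow with the age: the path is integral, and
  ultrametric errors do not add up.\<close>

definition onpath :: "real \<Rightarrow> real \<Rightarrow> int \<Rightarrow> int \<Rightarrow> rat \<Rightarrow> rat \<Rightarrow> rat \<Rightarrow> bool"
  where "onpath E B x z a b u \<longleftrightarrow> v u = B \<and> v (a - of_int x * u) \<le> E \<and> v (b - of_int z * u) \<le> E"

lemma onpath_hh:
  assumes "onpath E B x z a b u" "1 \<le> E" "E < B"
  shows "hh a b u = B"
proof (rule antisym)
  have u: "v u = B" and a: "v (a - of_int x * u) \<le> B" and b: "v (b - of_int z * u) \<le> B"
    using assms by (auto simp: onpath_def)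
  have "v a \<le> B" using v_add_le[OF a v_int_mult_le[of u B x]] u by simp
  moreover have "v b \<le> B" using v_add_le[OF b v_int_mult_le[of u B z]] u by simp
  ultimately show "hh a b u \<le> B" using assms u by (intro hh_le) auto
  show "B \<le> hh a b u" using hh_ge(4)[of u a b] u by simp
qed

lemma v_lead: "v (x - of_int n * u) \<le> E \<Longrightarrow> E < v (of_int n) * v u \<Longrightarrow> v x = v (of_int n) * v u"
  using v_add_eq'[of "x - of_int n * u" "of_int n * u"] by (simp add: v_mult)

end

section \<open>Following the path at primes other than 2 and 3\<close>

locale nonarch23 = nonarch +
  assumes v2: "v 2 = 1" and v3: "v 3 = 1"
begin

lemma v12: "v 12 = 1" "v 18 = 1" "v (3/2) = 1" "v (1/2) = 1"
  using v_mult[of 2 2] v_mult[of 4 3] v_mult[of 2 9] v_mult[of 3 3] v2 v3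
  by (simp_all add: v_divide)

text \<open>With \<open>k\<close> the size of the path coordinate \<open>x\<close>, the hypothesis
  \<open>1 <= k ^ 4 * B\<close> says that the fourth power of the first coordinate has size at least
  \<open>B ^ 3\<close>. This exceeds the square of the second one, so the fourth power alone
  determines the size of \<open>N\<close>. The kick is then at most \<open>B ^ 3 / |N| <= 1\<close>,
  and \<open>u\<close> moves by an integral amount, within the error \<open>E\<close>.\<close>

lemma normal_step:
  assumes on: "onpath E B x z a b u" and E: "1 \<le> E" "E < B"
    and c: "E < v (of_int x) * B" "1 \<le> v (of_int x) ^ 4 * B"
  shows "v (gate a b) = v (of_int x) ^ 4 * B ^ 4"
    "onpath E B (x + z - 2) (z + 1) (new_x a b u) (new_z a b u) (new_u a b u)"
proof -
  let ?k = "v (of_int x)" and ?g = "gate a b"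
  have u: "v u = B" and a: "v (a - of_int x * u) \<le> E" and b: "v (b - of_int z * u) \<le> E"
    using on by (auto simp: onpath_def)
  have B1: "1 < B" using E by simp
  have hB: "hh a b u = B" by (rule onpath_hh[OF on E])
  have vX: "v a = ?k * B" using v_lead[OF a] c u by simp
  have "v b \<le> B" using hh_ge(3)[of b a u] hB by simp
  hence vZ: "v (b ^ 2) \<le> B ^ 2" by (simp add: v_power power_mono v_nonneg)
  have "B ^ 3 * 1 \<le> B ^ 3 * (?k ^ 4 * B)" using c B1 by (intro mult_left_mono) auto
  also have "\<dots> = ?k ^ 4 * B ^ 4" by (simp add: algebra_simps power3_eq_cube power4_eq_xxxx)
  finally have b3: "B ^ 3 \<le> ?k ^ 4 * B ^ 4" by simp
  have b23: "B ^ 2 < B ^ 3" using B1 by (intro power_strict_increasing) auto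
  have b2: "1 \<le> B ^ 2" using B1 by (simp add: one_le_power)
  have vX4: "v (a ^ 4) = ?k ^ 4 * B ^ 4" by (simp add: v_power vX power_mult_distrib)
  have s: "v (b ^ 2 + a ^ 4) = ?k ^ 4 * B ^ 4" by (subst v_add_eq') (use vZ vX4 b3 b23 in auto)
  have s12: "v (12 * (b ^ 2 + a ^ 4)) = ?k ^ 4 * B ^ 4" by (simp only: v_mult v12 s mult_1_left)
  have "v (1 + 12 * (b ^ 2 + a ^ 4)) = ?k ^ 4 * B ^ 4"
    using v_add_eq'[of 1 "12 * (b ^ 2 + a ^ 4)"] s12 b3 b23 b2 by (simp only: v_1)
  thus g: "v ?g = ?k ^ 4 * B ^ 4" by (simp add: gate_def)
  have g3: "B ^ 3 \<le> v ?g" using g b3 by simp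
  have "B ^ 3 / v ?g \<le> 1" using g3 v_gate_pos[of a b] by simp
  hence k1: "v (18 * u * b ^ 2 / ?g) \<le> 1" using v_kick_le[of u b a] hB by simp
  have "1 \<le> v ?g" using g3 b23 b2 by linarith
  hence k2: "v (1 / ?g ^ 2) \<le> 1" by (simp add: v_divide v_power one_le_power)
  define e where "e = new_u a b u - u"
  have e: "v e \<le> 1" unfolding e_def new_u_def using v_diff_le[OF k2 k1] by (simp add: algebra_simps)
  have nu: "new_u a b u = u + e" by (simp add: e_def)
  have u': "v (new_u a b u) = B" unfolding nu by (subst v_add_eq) (use e B1 u in auto)
  have eE: "v e \<le> E" using e E by simp
  have "new_x a b u - of_int (x + z - 2) * new_u a b u = (a - of_int x * u) + (b - of_int z * u) - of_int (x + z) * e"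
    unfolding new_x_def nu by (simp add: algebra_simps)
  also have "v \<dots> \<le> E" by (intro v_diff_le v_add_le a b v_int_mult_le eE)
  finally have x': "v (new_x a b u - of_int (x + z - 2) * new_u a b u) \<le> E" .
  have "new_z a b u - of_int (z + 1) * new_u a b u = (b - of_int z * u) - of_int z * e"
    unfolding new_z_def nu by (simp add: algebra_simps)
  also have "v \<dots> \<le> E" by (intro v_diff_le b v_int_mult_le eE)
  finally have z': "v (new_z a b u - of_int (z + 1) * new_u a b u) \<le> E" .
  show "onpath E B (x + z - 2) (z + 1) (new_x a b u) (new_z a b u) (new_u a b u)"
    using u' x' z' by (simp add: onpath_def)
qed

text \<open>Now the first coordinate is pure error, at most \<open>E\<close>, and
  \<open>E ^ 3 <= |z| ^ 2 * B\<close> keeps its fourth power below the square of the second one. So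
  \<open>N\<close> has only the order \<open>B ^ 2\<close>; this drop from the fourth to the second
  power is the source of the delay terms in the recursion.\<close>

lemma event_step:
  assumes on: "onpath E B 0 z a b u" and E: "1 \<le> E" "E < B"
    and c: "E < v (of_int z) * B" "E ^ 3 \<le> v (of_int z) ^ 2 * B"
  shows "v (gate a b) = v (of_int z) ^ 2 * B ^ 2"
    "onpath E B (- 2 * z - 2) (- 2 * z + 1) (new_x a b u) (new_z a b u) (new_u a b u)"
proof -
  let ?k = "v (of_int z)" and ?g = "gate a b"
  have u: "v u = B" and a: "v a \<le> E" and b: "v (b - of_int z * u) \<le> E"
    using on by (auto simp: onpath_def)
  have B1: "1 < B" using E by simp
  have vZ: "v b = ?k * B" using v_lead[OF b] c u by simp
  have E4: "1 \<le> E ^ 4" using E by (simp add: one_le_power)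
  have X4: "v (a ^ 4) \<le> E ^ 4" by (simp add: v_power power_mono v_nonneg a)
  have "E ^ 4 = E * E ^ 3" by (simp add: power3_eq_cube power4_eq_xxxx)
  also have "\<dots> \<le> E * (?k ^ 2 * B)" using c E by (intro mult_left_mono) auto
  also have "\<dots> < B * (?k ^ 2 * B)"
  proof (rule mult_strict_right_mono[OF E(2)])
    have "0 < E ^ 3" using E by simp
    thus "0 < ?k ^ 2 * B" using c by linarith
  qed
  also have "\<dots> = ?k ^ 2 * B ^ 2" by (simp add: power2_eq_square)
  finally have big: "E ^ 4 < ?k ^ 2 * B ^ 2" .
  have s: "v (b ^ 2 + a ^ 4) = ?k ^ 2 * B ^ 2"
    by (subst v_add_eq) (use big X4 vZ in \<open>auto simp: v_power power_mult_distrib\<close>)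
  have s12: "v (12 * (b ^ 2 + a ^ 4)) = ?k ^ 2 * B ^ 2" by (simp only: v_mult v12 s mult_1_left)
  have "v (1 + 12 * (b ^ 2 + a ^ 4)) = ?k ^ 2 * B ^ 2"
    using v_add_eq'[of 1 "12 * (b ^ 2 + a ^ 4)"] s12 big E4 by (simp only: v_1)
  thus g: "v ?g = ?k ^ 2 * B ^ 2" by (simp add: gate_def)
  have g1: "1 \<le> v ?g" using g big E4 by linarith
  have "v (1 / ?g ^ 2) \<le> 1" using g1 by (simp add: v_divide v_power one_le_power)
  hence k2: "v (1 / ?g ^ 2) \<le> E" using E by linarith
  \<comment> \<open>Division of \<open>18 b ^ 2\<close> by
    \<open>N = 12 b ^ 2 + (1 + 12 a ^ 4)\<close>: the quotient 3/2 turns \<open>u\<close> into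
    \<open>- u / 2\<close>, and the remainder contributes at most
    \<open>B * E ^ 4 / |N| <= E\<close>.\<close>
  have id: "18 * b ^ 2 / ?g = 3 / 2 - (3 / 2) * (1 + 12 * a ^ 4) / ?g"
    using gate_nonzero[of a b] by (simp add: field_simps) (simp add: gate_def algebra_simps)
  define e where "e = (3 / 2) * (u * (1 + 12 * a ^ 4) / ?g) + 1 / ?g ^ 2"
  have "18 * u * b ^ 2 / ?g = u * (18 * b ^ 2 / ?g)" by simp
  hence nu: "new_u a b u = - (1 / 2) * u + e" unfolding new_u_def id e_def by (simp add: algebra_simps)
  have "v (1 + 12 * a ^ 4) \<le> E ^ 4" using E4 X4 by (intro v_add_le v_num_mult_le) auto
  hence "v (u * (1 + 12 * a ^ 4) / ?g) \<le> B * E ^ 4 / v ?g"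
    using u B1 v_gate_pos[of a b] by (simp add: v_divide v_mult divide_right_mono)
  also have "\<dots> \<le> E"
  proof -
    have "B * E ^ 4 = B * E * E ^ 3" by (simp add: power3_eq_cube power4_eq_xxxx)
    also have "\<dots> \<le> B * E * (?k ^ 2 * B)" using c E B1 by (intro mult_left_mono) auto
    also have "\<dots> = E * v ?g" by (simp add: g power2_eq_square)
    finally show ?thesis using v_gate_pos[of a b] by (simp add: field_simps)
  qed
  finally have "v ((3 / 2) * (u * (1 + 12 * a ^ 4) / ?g)) \<le> E" by (simp only: v_mult[of "3 / 2"] v12(3) mult_1_left)
  hence e: "v e \<le> E" unfolding e_def using k2 by (rule v_add_le)
  have u': "v (new_u a b u) = B" unfolding nu
    by (subst v_add_eq) (use e E u v12(4) v_mult[of "- (1 / 2)" u] v_minus[of "1/2"] in auto)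
  have e2: "v (2 * e) \<le> E" using e by (rule v_num_mult_le)
  have "new_x a b u - of_int (- 2 * z - 2) * new_u a b u = a + (b - of_int z * u) + of_int z * (2 * e)"
    unfolding new_x_def nu by (simp add: algebra_simps)
  also have "v \<dots> \<le> E" by (intro v_diff_le v_add_le a b v_int_mult_le e2)
  finally have x': "v (new_x a b u - of_int (- 2 * z - 2) * new_u a b u) \<le> E" .
  have "new_z a b u - of_int (- 2 * z + 1) * new_u a b u = (b - of_int z * u) + of_int z * (2 * e)"
    unfolding new_z_def nu by (simp add: algebra_simps)
  also have "v \<dots> \<le> E" by (intro v_add_le b v_int_mult_le e2)
  finally have z': "v (new_z a b u - of_int (- 2 * z + 1) * new_u a b u) \<le> E" .
  show "onpath E B (- 2 * z - 2) (- 2 * z + 1) (new_x a b u) (new_z a b u) (new_u a b u)"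
    using u' x' z' by (simp add: onpath_def)
qed

lemma path_step:
  assumes on: "onpath E B (px j) (pz j) a b u" and E: "1 \<le> E" "E < B"
    and c: "px j \<noteq> 0 \<Longrightarrow> E < v (of_int (px j)) * B \<and> 1 \<le> v (of_int (px j)) ^ 4 * B"
           "px j = 0 \<Longrightarrow> E < v (of_int (pz j)) * B \<and> E ^ 3 \<le> v (of_int (pz j)) ^ 2 * B"
  shows "onpath E B (px (Suc j)) (pz (Suc j)) (new_x a b u) (new_z a b u) (new_u a b u)"
    "v (gate a b) = (if px j = 0 then v (of_int (pz j)) ^ 2 * B ^ 2 else v (of_int (px j)) ^ 4 * B ^ 4)"
  using normal_step[of E B "px j" "pz j" a b u] event_step[of E B "pz j" a b u] on E c
  by (cases "px j = 0"; auto simp: px_Suc pz_Suc)+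

text \<open>The first four path abscissae are -2, -3, -3, -2, hence units outside 2 and 3. Up to age
  4 the path is followed at all these primes without exception, which is where the bootstrap in
  \<open>crude\<close> starts.\<close>

lemma v_small_prime: "v (of_int (px 1)) = 1" "v (of_int (px 2)) = 1" "v (of_int (px 3)) = 1" "v (of_int (px 4)) = 1"
  using v2 v3 unfolding path_small by simp_all

end

section \<open>The orbit of the origin and its jumps at one prime\<close>

fun orbit :: "nat \<Rightarrow> rat \<times> rat \<times> rat" where
  "orbit 0 = (0, 0, 0)"
| "orbit (Suc n) = (case orbit n of (a, b, u) \<Rightarrow> (new_x a b u, new_z a b u, new_u a b u))"

definition ox :: "nat \<Rightarrow> rat" where "ox n = fst (orbit n)"
definition oz :: "nat \<Rightarrow> rat" where "oz n = fst (snd (orbit n))"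
definition ou :: "nat \<Rightarrow> rat" where "ou n = snd (snd (orbit n))"
definition og :: "nat \<Rightarrow> rat" where "og n = gate (ox n) (oz n)"

lemma orbit_0: "ox 0 = 0" "oz 0 = 0" "ou 0 = 0"
  by (simp_all add: ox_def oz_def ou_def)

lemma orbit_Suc: "ox (Suc n) = new_x (ox n) (oz n) (ou n)" "oz (Suc n) = new_z (ox n) (oz n) (ou n)"
   "ou (Suc n) = new_u (ox n) (oz n) (ou n)"
  by (simp_all add: ox_def oz_def ou_def split: prod.splits)

context nonarch begin

definition oh :: "nat \<Rightarrow> real" where "oh n = hh (ox n) (oz n) (ou n)"

definition ent :: "nat \<Rightarrow> bool" where "ent n \<longleftrightarrow> oh n ^ 5 * v (og n) < 1"

lemma oh_ge_1: "1 \<le> oh n" by (simp add: oh_def hh_ge)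

lemma oh_pos: "0 < oh n" using oh_ge_1[of n] by linarith

lemma oh_0: "oh 0 = 1" by (simp add: oh_def hh_def orbit_0)

lemma v_og_pos: "0 < v (og n)" by (simp add: og_def v_gate_pos)

lemma v_og_le: "v (og n) \<le> oh n ^ 4" by (simp add: og_def oh_def v_gate_le)

lemma oh_Suc: "oh (Suc n) = hh (new_x (ox n) (oz n) (ou n)) (new_z (ox n) (oz n) (ou n)) (new_u (ox n) (oz n) (ou n))"
  by (simp add: oh_def orbit_Suc)

lemma oh_entry:
  assumes "ent n"
  shows "oh (Suc n) = 1 / v (og n) ^ 2" "oh n ^ 10 < oh (Suc n)" "oh n < oh (Suc n)"
proof -
  show 1: "oh (Suc n) = 1 / v (og n) ^ 2" "oh n ^ 10 < oh (Suc n)"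
    using assms entry_step[of "ox n" "oz n" "ou n"] unfolding oh_Suc by (simp_all add: ent_def oh_def og_def)
  have "oh n \<le> oh n ^ 10" using oh_ge_1[of n] by (simp add: self_le_power)
  thus "oh n < oh (Suc n)" using 1 by linarith
qed

lemma oh_nonentry: "\<not> ent n \<Longrightarrow> oh (Suc n) \<le> oh n ^ 10"
  using nonentry_step[of "ox n" "oz n" "ou n"] unfolding oh_Suc by (simp add: ent_def oh_def og_def)

lemma onpath_start:
  assumes "oh n < oh (Suc n)"
  shows "onpath (oh n) (oh (Suc n)) (px 1) (pz 1) (ox (Suc n)) (oz (Suc n)) (ou (Suc n))"
  using increase_step[of "ox n" "oz n" "ou n"] err_new[of "ox n" "oz n" "ou n"] assms
  unfolding onpath_def path_small by (simp add: oh_Suc orbit_Suc oh_def)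

text \<open>The conditions of \<open>path_step\<close> at age \<open>j\<close>: the relevant path
  coordinate is not so divisible that the error \<open>E\<close> or a lower-order term of
  \<open>N\<close> overtakes the main term.\<close>

definition valid_age :: "real \<Rightarrow> real \<Rightarrow> nat \<Rightarrow> bool"
  where "valid_age E B j \<longleftrightarrow> (if px j = 0 then E < v (of_int (pz j)) * B \<and> E ^ 3 \<le> v (of_int (pz j)) ^ 2 * B
     else E < v (of_int (px j)) * B \<and> 1 \<le> v (of_int (px j)) ^ 4 * B)"

text \<open>Without an entry the bound \<open>oh (Suc k) <= oh k ^ 10\<close> keeps the height at
  its initial value 1. The last entry is singled out because growth is later measured from
  it.\<close>

lemma entry_exists:
  assumes "1 < oh n" shows "\<exists>m<n. ent m \<and> (\<forall>i. m < i \<and> i < n \<longrightarrow> \<not> ent i)"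
proof -
  have "\<exists>m<n. ent m"
  proof (rule ccontr)
    assume no: "\<not> (\<exists>m<n. ent m)"
    have "k \<le> n \<Longrightarrow> oh k = 1" for k
    proof (induction k)
      case 0 thus ?case by (simp add: oh_0)
    next
      case (Suc k)
      have "oh (Suc k) \<le> oh k ^ 10" using no Suc by (intro oh_nonentry) auto
      thus ?case using Suc oh_ge_1[of "Suc k"] by simp
    qed
    from this[of n] show False using assms by simp
  qed
  hence fin: "finite {m. m < n \<and> ent m}" "{m. m < n \<and> ent m} \<noteq> {}" by auto
  define m where "m = Max {m. m < n \<and> ent m}"
  have "m \<in> {m. m < n \<and> ent m}" unfolding m_def using fin by (rule Max_in)
  moreover have "\<not> ent i" if "m < i" "i < n" for i
  proof
    assume "ent i"
    hence "i \<le> m" unfolding m_def using that by (intro Max_ge fin(1)) simp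
    thus False using that by simp
  qed
  ultimately show ?thesis by blast
qed

end

context nonarch23 begin

lemma path_run:
  assumes inc: "oh n < oh (Suc n)" and j: "1 \<le> j"
    and ok: "\<And>i. 1 \<le> i \<Longrightarrow> i < j \<Longrightarrow> valid_age (oh n) (oh (Suc n)) i"
  shows "onpath (oh n) (oh (Suc n)) (px j) (pz j) (ox (n + j)) (oz (n + j)) (ou (n + j))"
  using j ok
proof (induction j rule: dec_induct)
  case base
  thus ?case using onpath_start[OF inc] by simp
next
  case (step j)
  have "valid_age (oh n) (oh (Suc n)) j" using step by auto
  thus ?case using path_step(1)[of "oh n" "oh (Suc n)" j "ox (n + j)" "oz (n + j)" "ou (n + j)"] step inc oh_ge_1[of n]
    by (auto simp: valid_age_def orbit_Suc)
qed

lemma path_oh: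
  assumes inc: "oh n < oh (Suc n)" and j: "1 \<le> j"
    and ok: "\<And>i. 1 \<le> i \<Longrightarrow> i < j \<Longrightarrow> valid_age (oh n) (oh (Suc n)) i"
  shows "oh (n + j) = oh (Suc n)"
  using onpath_hh[OF path_run[OF assms] oh_ge_1 inc] by (simp add: oh_def)

lemma path_gate:
  assumes inc: "oh n < oh (Suc n)" and j: "1 \<le> j"
    and ok: "\<And>i. 1 \<le> i \<Longrightarrow> i \<le> j \<Longrightarrow> valid_age (oh n) (oh (Suc n)) i"
  shows "v (og (n + j)) = (if px j = 0 then v (of_int (pz j)) ^ 2 * oh (Suc n) ^ 2
     else v (of_int (px j)) ^ 4 * oh (Suc n) ^ 4)"
proof -
  have on: "onpath (oh n) (oh (Suc n)) (px j) (pz j) (ox (n + j)) (oz (n + j)) (ou (n + j))"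
    by (rule path_run[OF inc j]) (use ok in auto)
  show ?thesis unfolding og_def
    using path_step(2)[OF on oh_ge_1 inc] ok[of j] j by (auto simp: valid_age_def)
qed

lemma fine_small:
  assumes inc: "oh n < oh (Suc n)" and j: "1 \<le> j" "j \<le> 4"
  shows "valid_age (oh n) (oh (Suc n)) j"
proof -
  have "j \<in> {1, 2, 3, 4}" using j by auto
  moreover have "px 1 \<noteq> 0" "px 2 \<noteq> 0" "px 3 \<noteq> 0" "px 4 \<noteq> 0" by (subst path_small, simp)+
  ultimately show ?thesis using v_small_prime inc oh_ge_1[of "Suc n"] by (auto simp: valid_age_def)
qed

lemma increase_const:
  assumes inc: "oh n < oh (Suc n)" and j: "1 \<le> j" "j \<le> 5"
  shows "oh (n + j) = oh (Suc n)"
  by (rule path_oh[OF inc j(1)]) (use fine_small[OF inc] j in auto)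

text \<open>A step may raise the height to its tenth power even without an entry. But any increase
  starts a path and is followed by a constant phase, so five steps together cost at most the
  exponent 10 <= 2 ^ 5. The base 2 has to stay well below the growth factor 8 of the total.\<close>

lemma rough_growth:
  assumes m: "ent m" and no: "\<And>i. m < i \<Longrightarrow> i < n \<Longrightarrow> \<not> ent i" and "m < n"
  shows "ln (oh n) \<le> 2 ^ (n - m) * ln (oh (Suc m))"
  using no \<open>m < n\<close>
proof (induction n rule: less_induct)
  case (less n)
  have L0: "0 \<le> ln (oh (Suc m))" using oh_ge_1 by simp
  obtain k where n: "n = Suc k" using less(3) by (cases n) auto
  show ?case
  proof (cases "k = m")
    case True thus ?thesis using L0 n by simp
  next
    case False
    hence k: "m < k" using less(3) n by simp
    show ?thesis
    proof (cases "oh k < oh n")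
      case False
      have "ln (oh n) \<le> ln (oh k)" using False oh_pos by (simp add: not_less)
      also have "\<dots> \<le> 2 ^ (k - m) * ln (oh (Suc m))" using less(1)[of k] less(2) k n by auto
      also have "\<dots> \<le> 2 ^ (n - m) * ln (oh (Suc m))" using L0 n k by (intro mult_right_mono power_increasing) auto
      finally show ?thesis .
    next
      case True
      \<comment> \<open>An increase at such an \<open>i\<close> would fix the height for the five
        times after it, among them both \<open>k\<close> and \<open>n = Suc k\<close>, although the
        height rises from \<open>k\<close> to \<open>n\<close>.\<close>
      have noinc: "\<not> oh i < oh (Suc i)" if "i < k" "k \<le> i + 4" for i
      proof
        assume inc: "oh i < oh (Suc i)"
        have "oh (i + (k - i)) = oh (Suc i)" by (rule increase_const[OF inc]) (use that in auto)
        moreover have "oh (i + (n - i)) = oh (Suc i)" by (rule increase_const[OF inc]) (use that n in auto)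
        ultimately show False using True that n by simp
      qed
      have "oh m < oh (Suc m)" by (rule oh_entry(3)[OF m])
      hence km: "m + 5 \<le> k" using noinc[of m] k by linarith
      define i where "i = k - 4"
      have ki: "k = i + 4" "m < i" using km by (auto simp: i_def)
      have "oh (Suc i) \<le> oh i" "oh (Suc (Suc i)) \<le> oh (Suc i)" "oh (Suc (Suc (Suc i))) \<le> oh (Suc (Suc i))"
        "oh k \<le> oh (Suc (Suc (Suc i)))"
        using noinc[of i] noinc[of "Suc i"] noinc[of "Suc (Suc i)"] noinc[of "Suc (Suc (Suc i))"] ki
        by (simp_all add: not_less eval_nat_numeral)
      hence "oh k \<le> oh i" by linarith
      hence 1: "ln (oh k) \<le> ln (oh i)" using oh_pos by simp
      have 2: "ln (oh i) \<le> 2 ^ (i - m) * ln (oh (Suc m))" using less(1)[of i] less(2) ki n by auto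
      have "oh n \<le> oh k ^ 10" unfolding n by (rule oh_nonentry) (use less(2) k n in auto)
      hence "ln (oh n) \<le> ln (oh k ^ 10)" by (intro ln_mono oh_pos zero_less_power)
      also have "\<dots> = 10 * ln (oh k)" using oh_pos by (simp add: ln_realpow)
      also have "\<dots> \<le> 32 * (2 ^ (i - m) * ln (oh (Suc m)))" using 1 2 L0
        mult_nonneg_nonneg[OF zero_le_power[of "2::real" "i - m"] L0] by linarith
      also have "\<dots> = 2 ^ (n - m) * ln (oh (Suc m))"
      proof -
        have "n - m = 5 + (i - m)" using ki n by auto
        thus ?thesis by (simp add: power_add)
      qed
      finally show ?thesis .
    qed
  qed
qed

end

section \<open>Linear recursions with infinitely many delays\<close>

text \<open>The full tail from exponent 5 on is (4/3) * 4 ^ -5 = 1/768.\<close>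

lemma geometric_tail_bound:
  fixes A :: "nat set"
  assumes "finite A" "\<And>j. j \<in> A \<Longrightarrow> 5 \<le> j"
  shows "(\<Sum>j\<in>A. (1/4::real) ^ j) \<le> 1 / 700"
proof -
  have 1: "(\<Sum>j\<in>{5..<k}. (1/4::real) ^ j) \<le> (4/3) * ((1/4) ^ 5 - (1/4) ^ k)" if "5 \<le> k" for k :: nat
    using that by (induction k rule: dec_induct) simp_all
  obtain k where k: "A \<subseteq> {..<k}" using finite_nat_iff_bounded assms by blast
  have "A \<subseteq> {5..<max k 5}" using k assms by fastforce
  hence "(\<Sum>j\<in>A. (1/4::real) ^ j) \<le> (\<Sum>j\<in>{5..<max k 5}. (1/4::real) ^ j)" by (intro sum_mono2) auto
  also have "\<dots> \<le> (4/3) * ((1/4) ^ 5 - (1/4) ^ (max k 5))" by (rule 1) simp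
  also have "\<dots> \<le> (4/3) * ((1/4) ^ 5)" by simp
  also have "\<dots> \<le> 1 / 700" by (simp add: power_divide)
  finally show ?thesis .
qed

lemma self_le_2_power: "real j \<le> 2 ^ j"
  using of_nat_less_two_power[of j, where 'a = real] by linarith

text \<open>A contraction argument. If the ratios are eventually within \<open>s\<close> of
  \<open>lam\<close>, then \<open>D (n - j) / D n\<close> is within
  \<open>j * 8 ^ -(j + 1) * s\<close> of \<open>lam ^ -j\<close>, because all ratios are at least 8.
  As every delay is at least 5, the delayed terms of the recursion move by a small fraction of
  \<open>s\<close>, so the next ratio is within \<open>s / 2\<close> plus the error of the
  recursion. The infinitely many delays are cut off at \<open>J\<close> before \<open>n\<close>
  grows.\<close>

lemma ratio_limit:
  fixes D :: "nat \<Rightarrow> real" and A :: "nat set"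
  assumes pos: "\<And>n. n \<ge> n0 \<Longrightarrow> D n > 0"
    and growth: "\<And>n. D (Suc n) \<ge> 8 * D n"
    and A5: "\<And>j. j \<in> A \<Longrightarrow> 5 \<le> j"
    and lam: "8 \<le> lam" "lam \<le> 9"
    and root: "(\<lambda>j. if j \<in> A then inverse lam ^ (j - 1) - inverse lam ^ j else 0) sums ((9 - lam) / 4)"
    and approx: "\<And>e. 0 < e \<Longrightarrow> eventually (\<lambda>J. eventually (\<lambda>n.
       \<bar>D (Suc n) - 9 * D n + 4 * (\<Sum>j\<in>A \<inter> {..J}. D (n - (j - 1)) - D (n - j))\<bar> \<le> e * D n) sequentially) sequentially"
  shows "(\<lambda>n. D (Suc n) / D n) \<longlonglongrightarrow> lam"
proof -
  define q where "q n = D (Suc n) / D n" for n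
  have q8: "8 \<le> q n" if "n \<ge> n0" for n using growth[of n] pos[OF that] by (simp add: q_def field_simps)
  have mono: "D (n - j) \<le> D (n - (j - 1))" if "n - j \<ge> n0" for n j
  proof (cases "j = 0 \<or> n < j")
    case False
    define k where "k = n - j"
    have k: "n - j = k" "n - (j - 1) = Suc k" using False by (auto simp: k_def)
    show ?thesis unfolding k using growth[of k] pos[of k] that unfolding k by linarith
  next
    case True
    hence "n - j = n - (j - 1)" by auto
    thus ?thesis by simp
  qed
  have step: "eventually (\<lambda>n. \<bar>q n - lam\<bar> \<le> s / 2 + e) sequentially"
    if s: "0 \<le> s" and ev: "eventually (\<lambda>n. \<bar>q n - lam\<bar> \<le> s) sequentially" and e: "0 < e" for s e
  proof -
    have l1: "eventually (\<lambda>J. eventually (\<lambda>n.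
       \<bar>D (Suc n) - 9 * D n + 4 * (\<Sum>j\<in>A \<inter> {..J}. D (n - (j - 1)) - D (n - j))\<bar> \<le> e / 2 * D n) sequentially) sequentially"
      by (rule approx) (use e in simp)
    have "(\<lambda>J. \<Sum>j\<le>J. if j \<in> A then inverse lam ^ (j - 1) - inverse lam ^ j else 0) \<longlonglongrightarrow> (9 - lam) / 4"
      using root by (simp add: sums_def_le)
    hence l2: "eventually (\<lambda>J. dist (\<Sum>j\<le>J. if j \<in> A then inverse lam ^ (j - 1) - inverse lam ^ j else 0) ((9 - lam) / 4) < e / 8) sequentially"
      using e by (intro tendstoD) auto
    have "eventually (\<lambda>J. eventually (\<lambda>n.
       \<bar>D (Suc n) - 9 * D n + 4 * (\<Sum>j\<in>A \<inter> {..J}. D (n - (j - 1)) - D (n - j))\<bar> \<le> e / 2 * D n) sequentially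
       \<and> dist (\<Sum>j\<le>J. if j \<in> A then inverse lam ^ (j - 1) - inverse lam ^ j else 0) ((9 - lam) / 4) < e / 8) sequentially"
      using l1 l2 by eventually_elim auto
    from eventually_happens'[OF sequentially_bot this] obtain J where J1: "eventually (\<lambda>n.
       \<bar>D (Suc n) - 9 * D n + 4 * (\<Sum>j\<in>A \<inter> {..J}. D (n - (j - 1)) - D (n - j))\<bar> \<le> e / 2 * D n) sequentially"
       and J2: "dist (\<Sum>j\<le>J. if j \<in> A then inverse lam ^ (j - 1) - inverse lam ^ j else 0) ((9 - lam) / 4) < e / 8"
      by auto
    have J2': "\<bar>(\<Sum>j\<in>A \<inter> {..J}. inverse lam ^ (j - 1) - inverse lam ^ j) - (9 - lam) / 4\<bar> < e / 8"
    proof -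
      have "(\<Sum>j\<le>J. if j \<in> A then inverse lam ^ (j - 1) - inverse lam ^ j else 0) = (\<Sum>j\<in>{..J} \<inter> A. inverse lam ^ (j - 1) - inverse lam ^ j)"
        by (rule sum.inter_restrict[symmetric]) simp
      thus ?thesis using J2 by (simp add: dist_real_def Int_commute)
    qed
    from ev obtain n1 where n1: "\<And>n. n \<ge> n1 \<Longrightarrow> \<bar>q n - lam\<bar> \<le> s" unfolding eventually_sequentially by blast
    from J1 obtain n2 where n2: "\<And>n. n \<ge> n2 \<Longrightarrow>
       \<bar>D (Suc n) - 9 * D n + 4 * (\<Sum>j\<in>A \<inter> {..J}. D (n - (j - 1)) - D (n - j))\<bar> \<le> e / 2 * D n" unfolding eventually_sequentially by blast
    have "\<bar>q n - lam\<bar> \<le> s / 2 + e" if n: "n \<ge> n0 + n1 + n2 + J" for n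
    proof -
      have Dn: "D n > 0" by (rule pos) (use n in simp)
      define a where "a j = D (n - j) / D n" for j
      \<comment> \<open>One factor at a time: each \<open>inverse (q m)\<close> is at most 1/8 and
        differs from \<open>inverse lam\<close> by at most \<open>s / 64\<close>.\<close>
      have ab: "\<bar>a j - inverse lam ^ j\<bar> \<le> real j * (1/8) ^ (j + 1) * s" if "j \<le> J" for j
        using that
      proof (induction j)
        case 0 thus ?case using Dn by (simp add: a_def)
      next
        case (Suc j)
        define m where "m = n - Suc j"
        have m: "m \<ge> n0" "m \<ge> n1" "n - j = Suc m" using n Suc by (auto simp: m_def)
        have Dm: "D m > 0" "D (Suc m) > 0" using pos m by auto
        have aS: "a (Suc j) = a j * inverse (q m)"
          using Dm Dn unfolding a_def q_def m(3) by (simp add: m_def field_simps)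
        have qm: "8 \<le> q m" by (rule q8[OF m(1)])
        have i8: "inverse (q m) \<le> 1 / 8" "0 \<le> inverse (q m)" using qm by (simp_all add: field_simps)
        have "inverse (q m) - inverse lam = (lam - q m) * (inverse (q m) * inverse lam)"
          using qm lam by (simp add: field_simps)
        hence "\<bar>inverse (q m) - inverse lam\<bar> = \<bar>q m - lam\<bar> * (inverse (q m) * inverse lam)"
          using qm lam by (simp add: abs_mult abs_minus_commute)
        also have "\<dots> \<le> s * ((1/8) * (1/8))"
          using n1[OF m(2)] i8 lam s by (intro mult_mono) (auto simp: field_simps)
        finally have d: "\<bar>inverse (q m) - inverse lam\<bar> \<le> s / 64" by simp
        have "a (Suc j) - inverse lam ^ Suc j = (a j - inverse lam ^ j) * inverse (q m) + inverse lam ^ j * (inverse (q m) - inverse lam)"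
          by (simp add: aS algebra_simps)
        hence "\<bar>a (Suc j) - inverse lam ^ Suc j\<bar> \<le> \<bar>(a j - inverse lam ^ j) * inverse (q m)\<bar> + \<bar>inverse lam ^ j * (inverse (q m) - inverse lam)\<bar>"
          by (simp only: abs_triangle_ineq)
        also have "\<dots> = \<bar>a j - inverse lam ^ j\<bar> * inverse (q m) + inverse lam ^ j * \<bar>inverse (q m) - inverse lam\<bar>"
          using i8 lam by (simp add: abs_mult)
        also have "\<dots> \<le> (real j * (1/8) ^ (j + 1) * s) * (1 / 8) + (1/8) ^ j * (s / 64)"
        proof (intro add_mono mult_mono)
          show "\<bar>a j - inverse lam ^ j\<bar> \<le> real j * (1/8) ^ (j + 1) * s" using Suc by simp
          show "inverse lam ^ j \<le> (1/8) ^ j"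
          proof (rule power_mono)
            show "inverse lam \<le> 1 / 8" using le_imp_inverse_le[of 8 lam] lam by simp
            show "0 \<le> inverse lam" using lam by simp
          qed
          show "0 \<le> real j * (1/8) ^ (j + 1) * s" using s by simp
        qed (use i8 d in auto)
        also have "\<dots> = real (Suc j) * (1/8) ^ (Suc j + 1) * s" by (simp add: algebra_simps)
        finally show ?case .
      qed
      have fin: "finite (A \<inter> {..J})" by simp
      have pw: "\<bar>(a (j - 1) - a j) - (inverse lam ^ (j - 1) - inverse lam ^ j)\<bar> \<le> 2 * (1/4) ^ j * s" if j: "j \<in> A \<inter> {..J}" for j
      proof -
        from j A5 have j5: "5 \<le> j" "j \<le> J" by auto
        have p8: "real j * (1/8) ^ j \<le> (1/4) ^ j"
        proof -
          have "real j * (1/8) ^ j \<le> 2 ^ j * (1/8) ^ j" by (intro mult_right_mono self_le_2_power) simp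
          also have "\<dots> = (1/4) ^ j" by (simp flip: power_mult_distrib)
          finally show ?thesis .
        qed
        have "real (j - 1) * (1/8) ^ (j - 1 + 1) * s \<le> (1/4) ^ j * s"
        proof (rule mult_right_mono[OF _ s])
          have "real (j - 1) * (1/8) ^ (j - 1 + 1) \<le> real j * (1/8) ^ j" using j5 by (intro mult_mono) auto
          thus "real (j - 1) * (1/8) ^ (j - 1 + 1) \<le> (1/4) ^ j" using p8 by linarith
        qed
        moreover have "real j * (1/8) ^ (j + 1) * s \<le> (1/4) ^ j * s"
        proof (rule mult_right_mono[OF _ s])
          have "real j * (1/8) ^ (j + 1) \<le> real j * (1/8) ^ j" by (intro mult_left_mono power_decreasing) auto
          thus "real j * (1/8) ^ (j + 1) \<le> (1/4) ^ j" using p8 by linarith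
        qed
        moreover have "\<bar>a (j - 1) - inverse lam ^ (j - 1)\<bar> \<le> real (j - 1) * (1/8) ^ (j - 1 + 1) * s"
          by (rule ab) (use j5 in simp)
        moreover have "\<bar>a j - inverse lam ^ j\<bar> \<le> real j * (1/8) ^ (j + 1) * s" by (rule ab[OF j5(2)])
        ultimately have 1: "\<bar>a (j - 1) - inverse lam ^ (j - 1)\<bar> \<le> (1/4) ^ j * s" "\<bar>a j - inverse lam ^ j\<bar> \<le> (1/4) ^ j * s"
          by (meson order_trans)+
        have "\<bar>(a (j - 1) - inverse lam ^ (j - 1)) - (a j - inverse lam ^ j)\<bar> \<le> (1/4) ^ j * s + (1/4) ^ j * s"
          by (rule order_trans[OF abs_triangle_ineq4 add_mono[OF 1]])
        thus ?thesis by (simp add: algebra_simps)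
      qed
      have "\<bar>(\<Sum>j\<in>A \<inter> {..J}. a (j - 1) - a j) - (\<Sum>j\<in>A \<inter> {..J}. inverse lam ^ (j - 1) - inverse lam ^ j)\<bar>
            \<le> (\<Sum>j\<in>A \<inter> {..J}. 2 * (1/4) ^ j * s)"
        unfolding sum_subtractf[symmetric] by (rule order_trans[OF sum_abs sum_mono[OF pw]])
      also have "\<dots> = 2 * s * (\<Sum>j\<in>A \<inter> {..J}. (1/4) ^ j)" by (simp add: sum_distrib_left algebra_simps)
      also have "\<dots> \<le> 2 * s * (1 / 700)" using s A5 by (intro mult_left_mono geometric_tail_bound) auto
      finally have S: "\<bar>(\<Sum>j\<in>A \<inter> {..J}. a (j - 1) - a j) - (\<Sum>j\<in>A \<inter> {..J}. inverse lam ^ (j - 1) - inverse lam ^ j)\<bar> \<le> s / 350" by simp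
      have "(\<Sum>j\<in>A \<inter> {..J}. a (j - 1) - a j) = (\<Sum>j\<in>A \<inter> {..J}. D (n - (j - 1)) - D (n - j)) / D n"
        unfolding a_def sum_divide_distrib diff_divide_distrib ..
      hence "(D (Suc n) - 9 * D n + 4 * (\<Sum>j\<in>A \<inter> {..J}. D (n - (j - 1)) - D (n - j))) / D n
        = q n - 9 + 4 * (\<Sum>j\<in>A \<inter> {..J}. a (j - 1) - a j)"
        using Dn by (simp add: q_def add_divide_distrib diff_divide_distrib)
      moreover have "\<bar>(D (Suc n) - 9 * D n + 4 * (\<Sum>j\<in>A \<inter> {..J}. D (n - (j - 1)) - D (n - j))) / D n\<bar> \<le> e / 2"
        using n2[of n] n Dn by (simp add: abs_divide divide_le_eq)
      ultimately have "\<bar>q n - 9 + 4 * (\<Sum>j\<in>A \<inter> {..J}. a (j - 1) - a j)\<bar> \<le> e / 2" by simp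
      moreover have "\<bar>x - lam\<bar> \<le> s / 2 + e" if "\<bar>x - 9 + 4 * P\<bar> \<le> e / 2" "\<bar>P - P'\<bar> \<le> s / 350" "\<bar>P' - (9 - lam) / 4\<bar> < e / 8"
        for x P P' :: real
      proof (rule abs_leI)
        note D = that(1)[THEN abs_le_D1] that(1)[THEN abs_le_D2] that(2)[THEN abs_le_D1] that(2)[THEN abs_le_D2]
          less_imp_le[OF that(3), THEN abs_le_D1] less_imp_le[OF that(3), THEN abs_le_D2]
        show "x - lam \<le> s / 2 + e" using D(1,4,6) s e by argo
        show "- (x - lam) \<le> s / 2 + e" using D(2,3,5) s e by argo
      qed
      ultimately show ?thesis using S J2' by blast
    qed
    thus ?thesis unfolding eventually_sequentially by blast
  qed
  \<comment> \<open>The delayed differences are nonnegative because \<open>D\<close> increases, so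
    the ratio is at most 9 + 1. Together with the lower bound 8 this starts the contraction at
    distance 2.\<close>
  have base: "eventually (\<lambda>n. \<bar>q n - lam\<bar> \<le> 2) sequentially"
  proof -
    have "(0::real) < 1" by simp
    from eventually_happens'[OF sequentially_bot approx[OF this]] obtain J where "eventually (\<lambda>n.
       \<bar>D (Suc n) - 9 * D n + 4 * (\<Sum>j\<in>A \<inter> {..J}. D (n - (j - 1)) - D (n - j))\<bar> \<le> 1 * D n) sequentially"
      by blast
    then obtain n2 where n2: "\<And>n. n \<ge> n2 \<Longrightarrow>
       \<bar>D (Suc n) - 9 * D n + 4 * (\<Sum>j\<in>A \<inter> {..J}. D (n - (j - 1)) - D (n - j))\<bar> \<le> D n" unfolding eventually_sequentially mult_1 by blast
    have "\<bar>q n - lam\<bar> \<le> 2" if n: "n \<ge> n0 + n2 + J" for n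
    proof -
      have Dn: "D n > 0" by (rule pos) (use n in simp)
      have "0 \<le> (\<Sum>j\<in>A \<inter> {..J}. D (n - (j - 1)) - D (n - j))"
        by (intro sum_nonneg) (use mono n in auto)
      hence "D (Suc n) \<le> 10 * D n" using n2[of n] n by linarith
      hence "q n \<le> 10" using Dn by (simp add: q_def field_simps)
      thus ?thesis using q8[of n] n lam by linarith
    qed
    thus ?thesis unfolding eventually_sequentially by blast
  qed
  have iter: "eventually (\<lambda>n. \<bar>q n - lam\<bar> \<le> 2 / 2 ^ k + 2 * e) sequentially" if e: "0 < e" for k e
  proof (induction k)
    case 0
    have "(2::real) \<le> 2 / 2 ^ 0 + 2 * e" using e by simp
    thus ?case using base by (auto elim!: eventually_mono)
  next
    case (Suc k)
    have "eventually (\<lambda>n. \<bar>q n - lam\<bar> \<le> (2 / 2 ^ k + 2 * e) / 2 + e) sequentially"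
      by (rule step[OF _ Suc e]) (use e in simp)
    moreover have "(2 / 2 ^ k + 2 * e) / 2 + e = 2 / 2 ^ Suc k + 2 * e" by simp
    ultimately show ?case by (simp only:)
  qed
  show ?thesis
  proof (rule tendstoI)
    fix e :: real assume e: "0 < e"
    obtain k where k: "2 / e * 2 < 2 ^ k" using real_arch_pow[of 2 "2 / e * 2"] by auto
    hence "2 / 2 ^ k < e / 2" using e by (simp add: field_simps)
    moreover have "eventually (\<lambda>n. \<bar>q n - lam\<bar> \<le> 2 / 2 ^ k + 2 * (e / 8)) sequentially" by (rule iter) (use e in simp)
    ultimately show "eventually (\<lambda>n. dist (D (Suc n) / D n) lam < e) sequentially"
      using e by (auto simp: dist_real_def q_def elim!: eventually_mono)
  qed
qed

text \<open>Intermediate value theorem: at 1/9 the linear part \<open>1 - 9 * y\<close> vanishes and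
  the series is nonnegative; at 1/8 the linear part is -1/8, and the series, whose exponents start
  at 5, is too small to compensate.\<close>

lemma characteristic_root_exists:
  fixes A :: "nat set"
  assumes A5: "\<And>j. j \<in> A \<Longrightarrow> 5 \<le> j"
  obtains y :: real where "1/9 \<le> y" "y \<le> 1/8"
    "4 * (1 - y) * suminf (\<lambda>j. (if j \<in> A then 1 else 0) * y ^ j) = 9 * y - 1"
proof -
  define c :: "nat \<Rightarrow> real" where "c j = (if j \<in> A then 1 else 0)" for j
  define S where "S y = suminf (\<lambda>j. c j * y ^ j)" for y
  have summ: "summable (\<lambda>j. c j * y ^ j)" if "0 \<le> y" "y \<le> 1/2" for y
  proof (rule summable_comparison_test')
    show "summable (\<lambda>j. y ^ j)" using that by (intro summable_geometric) simp
    show "norm (c j * y ^ j) \<le> y ^ j" for j using that by (simp add: c_def)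
  qed
  have cont: "isCont S y" if "0 \<le> y" "y \<le> 1/8" for y
    unfolding S_def by (rule isCont_powser[of c "1/2"]) (use summ that in auto)
  have S0: "0 \<le> S y" if "0 \<le> y" "y \<le> 1/2" for y
    unfolding S_def using that by (intro suminf_nonneg summ) (auto simp: c_def)
  have S8: "S (1/8) \<le> 1/1000"
  proof -
    have "S (1/8) = suminf (\<lambda>j. c (j + 5) * (1/8) ^ (j + 5)) + (\<Sum>j<5. c j * (1/8) ^ j)"
      unfolding S_def by (rule suminf_split_initial_segment[OF summ]) auto
    also have "(\<Sum>j<5. c j * (1/8) ^ j) = 0" using A5 by (intro sum.neutral) (force simp: c_def)
    also have "suminf (\<lambda>j. c (j + 5) * (1/8) ^ (j + 5)) \<le> suminf (\<lambda>j. (1/8) ^ 5 * (1/8) ^ j)"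
    proof (rule suminf_le)
      show "summable (\<lambda>j. c (j + 5) * (1 / 8) ^ (j + 5))" using summable_ignore_initial_segment[OF summ, of "1/8" 5] by simp
      show "summable (\<lambda>j. (1/8::real) ^ 5 * (1/8) ^ j)" by (intro summable_mult summable_geometric) simp
      show "c (j + 5) * (1 / 8) ^ (j + 5) \<le> (1/8) ^ 5 * (1/8) ^ j" for j
      proof -
        have "c (j + 5) * (1 / 8) ^ (j + 5) \<le> 1 * (1 / 8) ^ (j + 5)" unfolding c_def by (intro mult_right_mono) auto
        thus ?thesis unfolding power_add by (simp only: mult_1 mult.commute)
      qed
    qed
    also have "\<dots> = (1/8) ^ 5 * (8/7)" by (subst suminf_mult) (simp_all add: suminf_geometric summable_geometric)
    finally show ?thesis by (simp add: power_divide)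
  qed
  have "\<exists>y. 1/9 \<le> y \<and> y \<le> 1/8 \<and> 1 - 9 * y + 4 * (1 - y) * S y = 0"
  proof (rule IVT2)
    show "1 - 9 * (1/8) + 4 * (1 - 1/8) * S (1/8) \<le> 0" using S8 by simp
    show "0 \<le> 1 - 9 * (1/9) + 4 * (1 - 1/9) * S (1/9)" using S0[of "1/9"] by simp
    show "\<forall>y. 1/9 \<le> y \<and> y \<le> 1/8 \<longrightarrow> isCont (\<lambda>y. 1 - 9 * y + 4 * (1 - y) * S y) y"
      by (auto intro!: continuous_intros cont)
  qed simp
  thus thesis using that unfolding S_def c_def by fastforce
qed

text \<open>\<open>ln (D n)\<close> is a sum of logarithms of ratios up to a constant, so this is
  convergence of Cesaro means.\<close>

lemma root_of_ratio:
  fixes D :: "nat \<Rightarrow> real"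
  assumes pos: "\<And>n. n \<ge> n0 \<Longrightarrow> D n > 0" and l: "l > 0" and lim: "(\<lambda>n. D (Suc n) / D n) \<longlonglongrightarrow> l"
  shows "(\<lambda>n. ln (D n) / real n) \<longlonglongrightarrow> ln l"
proof (rule tendstoI)
  fix e :: real assume e: "0 < e"
  have "(\<lambda>n. ln (D (Suc n) / D n)) \<longlonglongrightarrow> ln l" using lim l by (intro tendsto_ln) auto
  hence "eventually (\<lambda>n. dist (ln (D (Suc n) / D n)) (ln l) < e / 2) sequentially" using e by (intro tendstoD) auto
  then obtain n1 where n1: "\<And>n. n \<ge> n1 \<Longrightarrow> \<bar>ln (D (Suc n) / D n) - ln l\<bar> < e / 2"
    by (auto simp: eventually_sequentially dist_real_def)
  define m where "m = max n0 n1"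
  have b: "\<bar>ln (D (m + k)) - ln (D m) - real k * ln l\<bar> \<le> real k * (e / 2)" for k
  proof (induction k)
    case (Suc k)
    have "ln (D (Suc (m + k)) / D (m + k)) = ln (D (Suc (m + k))) - ln (D (m + k))"
      using pos[of "m + k"] pos[of "Suc (m + k)"] by (intro ln_divide_pos) (auto simp: m_def)
    hence "ln (D (m + Suc k)) - ln (D m) - real (Suc k) * ln l
      = (ln (D (m + k)) - ln (D m) - real k * ln l) + (ln (D (Suc (m + k)) / D (m + k)) - ln l)"
      by (simp add: algebra_simps)
    moreover have "\<bar>ln (D (Suc (m + k)) / D (m + k)) - ln l\<bar> < e / 2" by (rule n1) (simp add: m_def)
    moreover have "real (Suc k) * (e / 2) = real k * (e / 2) + e / 2" by (simp add: algebra_simps)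
    ultimately show ?case using Suc by linarith
  qed simp
  have "(\<lambda>n. (\<bar>ln (D m)\<bar> + real m * \<bar>ln l\<bar>) / real n) \<longlonglongrightarrow> 0" by (rule lim_const_over_n)
  hence "eventually (\<lambda>n. dist ((\<bar>ln (D m)\<bar> + real m * \<bar>ln l\<bar>) / real n) 0 < e / 2) sequentially" using e by (intro tendstoD) auto
  thus "eventually (\<lambda>n. dist (ln (D n) / real n) (ln l) < e) sequentially"
    using eventually_ge_at_top[of "m + 1"]
  proof eventually_elim
    case (elim n)
    define k where "k = n - m"
    have nk: "n = m + k" "n > 0" using elim by (auto simp: k_def)
    have "ln (D n) - real n * ln l = (ln (D (m + k)) - ln (D m) - real k * ln l) + (ln (D m) - real m * ln l)"
      by (simp add: nk algebra_simps)
    hence "\<bar>ln (D n) - real n * ln l\<bar> \<le> real k * (e / 2) + (\<bar>ln (D m)\<bar> + real m * \<bar>ln l\<bar>)"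
      using b[of k] abs_mult[of "real m" "ln l"] abs_triangle_ineq4[of "ln (D m)" "real m * ln l"] by linarith
    also have "\<dots> < real n * e"
    proof -
      have "(\<bar>ln (D m)\<bar> + real m * \<bar>ln l\<bar>) < e / 2 * real n" using elim nk by (simp add: field_simps)
      moreover have "real k * (e / 2) \<le> real n * (e / 2)" using nk e by (intro mult_right_mono) auto
      ultimately show ?thesis by (simp add: field_simps)
    qed
    finally have "\<bar>ln (D n) - real n * ln l\<bar> / real n < e" using nk by (simp only: pos_divide_less_eq of_nat_0_less_iff mult.commute)
    moreover have "ln (D n) / real n - ln l = (ln (D n) - real n * ln l) / real n" using nk(2) by (simp add: diff_divide_distrib)
    ultimately show ?case by (simp add: dist_real_def abs_divide)
  qed
qed

section \<open>A Liouville inequality\<close>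

text \<open>The counting argument behind Siegel's lemma, by fraction-free Gaussian elimination: the
  pivot is multiplied into the other unknowns and never inverted, so the solution stays in
  \<open>R\<close>. It is applied to the ring generated by \<open>y\<close> and
  \<open>1 / y\<close>.\<close>

lemma homogeneous_solution_in_subring:
  fixes R :: "'a::field set" and A :: "nat \<Rightarrow> 'i \<Rightarrow> 'a"
  assumes R: "1 \<in> R" "\<And>x y. x \<in> R \<Longrightarrow> y \<in> R \<Longrightarrow> x + y \<in> R" "\<And>x y. x \<in> R \<Longrightarrow> y \<in> R \<Longrightarrow> x * y \<in> R"
      "\<And>x. x \<in> R \<Longrightarrow> - x \<in> R"
    and "finite I" "m < card I" and "\<And>l i. l < m \<Longrightarrow> i \<in> I \<Longrightarrow> A l i \<in> R"
  shows "\<exists>x. (\<forall>i\<in>I. x i \<in> R) \<and> (\<exists>i\<in>I. x i \<noteq> 0) \<and> (\<forall>l<m. (\<Sum>i\<in>I. A l i * x i) = 0)"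
  using assms(5-)
proof (induction m arbitrary: I A)
  case 0
  then obtain i where "i \<in> I" by fastforce
  thus ?case using R(1) by (intro exI[of _ "\<lambda>_. 1"]) auto
next
  case (Suc m)
  show ?case
  proof (cases "\<forall>i\<in>I. A m i = 0")
    case True
    from Suc.IH[of I A] Suc.prems obtain x where x: "\<forall>i\<in>I. x i \<in> R" "\<exists>i\<in>I. x i \<noteq> 0" "\<forall>l<m. (\<Sum>i\<in>I. A l i * x i) = 0"
      by auto
    thus ?thesis using True by (intro exI[of _ x]) (auto simp: less_Suc_eq)
  next
    case False
    then obtain p where p: "p \<in> I" "A m p \<noteq> 0" by auto
    let ?I = "I - {p}"
    have 0: "0 \<in> R" using R(1) R(2)[of 1 "-1"] R(4)[of 1] by simp
    have diff: "x - y \<in> R" if "x \<in> R" "y \<in> R" for x y using R(2)[of x "- y"] R(4)[of y] that by simp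
    have "\<exists>x. (\<forall>i\<in>?I. x i \<in> R) \<and> (\<exists>i\<in>?I. x i \<noteq> 0) \<and>
       (\<forall>l<m. (\<Sum>i\<in>?I. (A m p * A l i - A l p * A m i) * x i) = 0)"
    proof (rule Suc.IH)
      show "finite ?I" "m < card ?I" using Suc.prems p by auto
      show "A m p * A l i - A l p * A m i \<in> R" if "l < m" "i \<in> ?I" for l i
        using that Suc.prems(3) p by (intro diff R(3)) auto
    qed
    then obtain y where y: "\<forall>i\<in>?I. y i \<in> R" "\<exists>i\<in>?I. y i \<noteq> 0"
       "\<And>l. l < m \<Longrightarrow> (\<Sum>i\<in>?I. (A m p * A l i - A l p * A m i) * y i) = 0" by auto
    define x where "x i = (if i = p then - (\<Sum>i\<in>?I. A m i * y i) else A m p * y i)" for i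
    have sumR: "(\<Sum>i\<in>J. f i) \<in> R" if "finite J" "\<And>i. i \<in> J \<Longrightarrow> f i \<in> R" for J and f :: "'i \<Rightarrow> 'a"
      using that by (induction J) (auto intro: 0 R(2))
    have "\<forall>i\<in>I. x i \<in> R" unfolding x_def using Suc.prems y(1) p by (auto intro!: R(4) R(3) sumR)
    moreover have "\<exists>i\<in>I. x i \<noteq> 0" using y(2) p by (auto simp: x_def)
    moreover have "(\<Sum>i\<in>I. A l i * x i) = 0" if "l < Suc m" for l
    proof -
      have "(\<Sum>i\<in>I. A l i * x i) = A l p * x p + (\<Sum>i\<in>?I. A l i * x i)"
        using p Suc.prems by (intro sum.remove) auto
      also have "(\<Sum>i\<in>?I. A l i * x i) = (\<Sum>i\<in>?I. A l i * (A m p * y i))" by (intro sum.cong) (auto simp: x_def)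
      also have "A l p * x p = (\<Sum>i\<in>?I. - (A l p * A m i * y i))"
        by (simp add: x_def sum_distrib_left sum_negf mult.assoc)
      finally have e: "(\<Sum>i\<in>I. A l i * x i) = (\<Sum>i\<in>?I. (A m p * A l i - A l p * A m i) * y i)"
        by (simp add: sum.distrib[symmetric] algebra_simps)
      show ?thesis
      proof (cases "l = m")
        case True thus ?thesis unfolding e by simp
      next
        case False thus ?thesis unfolding e using that y(3) by simp
      qed
    qed
    ultimately show ?thesis by blast
  qed
qed

section \<open>The length of an integer polynomial\<close>

definition plen :: "int poly \<Rightarrow> int" where "plen p = (\<Sum>a\<leftarrow>coeffs p. \<bar>a\<bar>)"

lemma plen_0 [simp]: "plen 0 = 0" by (simp add: plen_def)

lemma plen_pCons [simp]: "plen (pCons a p) = \<bar>a\<bar> + plen p"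
  by (cases "p = 0 \<and> a = 0") (auto simp: plen_def cCons_def)

lemma plen_nonneg: "0 \<le> plen p"
  by (induction p) auto

lemma plen_add: "plen (p + q) \<le> plen p + plen q"
  by (induction p q rule: poly_induct2) auto

lemma plen_uminus [simp]: "plen (- p) = plen p"
  by (induction p) auto

lemma plen_diff: "plen (p - q) \<le> plen p + plen q"
  using plen_add[of p "- q"] by simp

lemma plen_smult [simp]: "plen (Polynomial.smult a p) = \<bar>a\<bar> * plen p"
  by (induction p) (auto simp: abs_mult algebra_simps)

lemma plen_mult: "plen (p * q) \<le> plen p * plen q"
proof (induction p)
  case (pCons a p)
  have "plen (pCons a p * q) \<le> plen (Polynomial.smult a q) + plen (pCons 0 (p * q))"
    by (simp only: mult_pCons_left plen_add)
  also have "\<dots> \<le> \<bar>a\<bar> * plen q + plen p * plen q" using pCons by simp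
  finally show ?case by (simp add: algebra_simps)
qed simp

lemma plen_power: "plen (p ^ n) \<le> plen p ^ n"
proof (induction n)
  case (Suc n)
  have "plen (p ^ Suc n) \<le> plen p * plen (p ^ n)" by (simp add: plen_mult)
  also have "\<dots> \<le> plen p * plen p ^ n" by (intro mult_left_mono Suc plen_nonneg)
  finally show ?case by simp
qed (simp add: plen_def)

lemma plen_monom [simp]: "plen (monom a n) = \<bar>a\<bar>"
  by (induction n) (auto simp: monom_0 monom_Suc)

lemma plen_sum: "plen (\<Sum>i\<in>A. f i) \<le> (\<Sum>i\<in>A. plen (f i))"
proof (induction A rule: infinite_finite_induct)
  case (insert x F)
  thus ?case using plen_add[of "f x" "sum f F"] by simp
qed auto

lemma plen_ge_1: "p \<noteq> 0 \<Longrightarrow> 1 \<le> plen p"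
proof (induction p)
  case (pCons a p)
  thus ?case using plen_nonneg[of p] by (cases "a = 0") auto
qed simp

lemma abs_coeff_le_plen: "\<bar>coeff p i\<bar> \<le> plen p"
proof (induction p arbitrary: i)
  case (pCons a p)
  thus ?case using plen_nonneg[of p] by (cases i) (auto simp: coeff_pCons add_increasing)
qed simp

lemma plen_eq_sum: "plen p = (\<Sum>i\<le>degree p. \<bar>coeff p i\<bar>)"
proof (induction p)
  case (pCons a p)
  show ?case
  proof (cases "p = 0")
    case False
    thus ?thesis using pCons by (simp add: sum.atMost_Suc_shift del: sum.atMost_Suc)
  qed simp
qed simp

lemma det_abs_le:
  fixes A :: "real mat"
  assumes A: "A \<in> carrier_mat n n" and b: "\<And>i j. i < n \<Longrightarrow> j < n \<Longrightarrow> \<bar>A $$ (i, j)\<bar> \<le> b"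
  shows "\<bar>det A\<bar> \<le> fact n * b ^ n"
proof -
  have "\<bar>det A\<bar> \<le> (\<Sum>p\<in>{p. p permutes {0..<n}}. \<bar>signof p * (\<Prod>i = 0..<n. A $$ (i, p i))\<bar>)"
    unfolding det_def'[OF A] by (rule sum_abs)
  also have "\<dots> \<le> (\<Sum>p\<in>{p. p permutes {0..<n}}. b ^ n)"
  proof (rule sum_mono)
    fix p assume "p \<in> {p. p permutes {0..<n}}"
    hence p: "p permutes {0..<n}" by simp
    have "\<bar>signof p * (\<Prod>i = 0..<n. A $$ (i, p i))\<bar> = (\<Prod>i = 0..<n. \<bar>A $$ (i, p i)\<bar>)"
      by (simp add: abs_mult abs_prod sign_def)
    also have "\<dots> \<le> (\<Prod>i = 0..<n. b)"
      using permutes_in_image[OF p] by (intro prod_mono) (auto intro!: b)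
    finally show "\<bar>signof p * (\<Prod>i = 0..<n. A $$ (i, p i))\<bar> \<le> b ^ n" by simp
  qed
  also have "\<dots> = fact n * b ^ n" by (simp add: card_permutations[of _ n])
  finally show ?thesis .
qed

text \<open>Multiplying \<open>M w = c w\<close> by the adjugate gives
  \<open>det M * w = c * (adj M * w)\<close>. In component 0, where \<open>w\<close> is 1, the
  nonzero integer \<open>det M\<close> becomes \<open>c\<close> times a quantity bounded through the
  cofactors.\<close>

lemma eigenvalue_lower_bound:
  fixes M :: "int mat" and w :: "nat \<Rightarrow> real"
  assumes M: "M \<in> carrier_mat n n" and det: "det M \<noteq> 0" and n: "0 < n"
    and b: "\<And>i j. i < n \<Longrightarrow> j < n \<Longrightarrow> real_of_int \<bar>M $$ (i, j)\<bar> \<le> b"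
    and w0: "w 0 = 1" and wle: "\<And>i. i < n \<Longrightarrow> \<bar>w i\<bar> \<le> W"
    and eig: "\<And>i. i < n \<Longrightarrow> (\<Sum>j<n. real_of_int (M $$ (i, j)) * w j) = c * w i"
  shows "1 \<le> \<bar>c\<bar> * (n * (fact (n - 1) * b ^ (n - 1) * W))"
proof -
  interpret of_int_hom: comm_ring_hom "of_int :: int \<Rightarrow> real" by unfold_locales auto
  define A where "A = map_mat (of_int :: int \<Rightarrow> real) M"
  have A: "A \<in> carrier_mat n n" using M by (simp add: A_def)
  have dA: "det A = of_int (det M)" unfolding A_def by (simp add: of_int_hom.hom_det)
  define x where "x = vec n w"
  have x: "x \<in> carrier_vec n" by (simp add: x_def)
  have Ax: "A *\<^sub>v x = c \<cdot>\<^sub>v x"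
  proof (rule eq_vecI)
    fix i assume "i < dim_vec (c \<cdot>\<^sub>v x)"
    hence i: "i < n" by (simp add: x_def)
    have "(A *\<^sub>v x) $ i = (\<Sum>j = 0..<n. real_of_int (M $$ (i, j)) * w j)"
      using i A M by (simp add: scalar_prod_def x_def A_def)
    also have "\<dots> = c * w i" using eig[OF i] by (simp add: atLeast0LessThan)
    finally show "(A *\<^sub>v x) $ i = (c \<cdot>\<^sub>v x) $ i" using i by (simp add: x_def)
  qed (use A in \<open>simp add: x_def\<close>)
  have adj: "adj_mat A \<in> carrier_mat n n" "adj_mat A * A = det A \<cdot>\<^sub>m 1\<^sub>m n" using adj_mat[OF A] by auto
  have "det A \<cdot>\<^sub>v x = (adj_mat A * A) *\<^sub>v x" unfolding adj
    by (rule eq_vecI) (use x in \<open>auto simp: scalar_prod_def sum.remove one_mat_def if_distrib if_distribR cong: if_cong\<close>)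
  also have "\<dots> = adj_mat A *\<^sub>v (c \<cdot>\<^sub>v x)" using assoc_mult_mat_vec[OF adj(1) A x] Ax by simp
  also have "\<dots> = c \<cdot>\<^sub>v (adj_mat A *\<^sub>v x)" using adj(1) x by (simp add: mult_mat_vec)
  finally have "(det A \<cdot>\<^sub>v x) $ 0 = (c \<cdot>\<^sub>v (adj_mat A *\<^sub>v x)) $ 0" by simp
  hence e: "det A = c * (\<Sum>j = 0..<n. adj_mat A $$ (0, j) * w j)"
    using n adj(1) w0 by (simp add: x_def scalar_prod_def)
  have a: "\<bar>adj_mat A $$ (0, j)\<bar> \<le> fact (n - 1) * b ^ (n - 1)" if j: "j < n" for j
  proof -
    have "adj_mat A $$ (0, j) = cofactor A j 0" using A n j by (simp add: adj_mat_def)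
    hence "\<bar>adj_mat A $$ (0, j)\<bar> = \<bar>det (mat_delete A j 0)\<bar>" by (simp add: cofactor_def abs_mult power_abs)
    also have "\<dots> \<le> fact (n - 1) * b ^ (n - 1)"
    proof (rule det_abs_le)
      show "mat_delete A j 0 \<in> carrier_mat (n - 1) (n - 1)" using A by (simp add: mat_delete_def)
      show "\<bar>mat_delete A j 0 $$ (i, k)\<bar> \<le> b" if "i < n - 1" "k < n - 1" for i k
        using A M that b by (auto simp: mat_delete_def A_def)
    qed
    finally show ?thesis .
  qed
  have b0: "0 \<le> b" using b[OF n n] by linarith
  have "1 \<le> \<bar>det M\<bar>" using det by linarith
  hence "real_of_int 1 \<le> real_of_int \<bar>det M\<bar>" by (simp only: of_int_le_iff)
  hence "1 \<le> \<bar>det A\<bar>" by (simp add: dA)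
  also have "\<dots> \<le> \<bar>c\<bar> * (\<Sum>j = 0..<n. \<bar>adj_mat A $$ (0, j) * w j\<bar>)" unfolding e abs_mult
    by (intro mult_left_mono order_trans[OF sum_abs]) (auto simp: abs_mult)
  also have "\<dots> \<le> \<bar>c\<bar> * (\<Sum>j = 0..<n. fact (n - 1) * b ^ (n - 1) * W)"
  proof (intro mult_left_mono sum_mono)
    fix j assume "j \<in> {0..<n}"
    thus "\<bar>adj_mat A $$ (0, j) * w j\<bar> \<le> fact (n - 1) * b ^ (n - 1) * W"
      unfolding abs_mult using b0 by (intro mult_mono a wle) auto
  qed simp
  finally show ?thesis by simp
qed


section \<open>Values of integer polynomials at an algebraic number\<close>

abbreviation ipoly :: "int poly \<Rightarrow> real \<Rightarrow> real"
  where "ipoly p x \<equiv> poly (map_poly real_of_int p) x"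

lemma of_int_poly_hom: "map_poly real_of_int (p + q) = map_poly real_of_int p + map_poly real_of_int q"
  "map_poly real_of_int (p * q) = map_poly real_of_int p * map_poly real_of_int q"
  by (intro poly_eqI; simp add: coeff_map_poly coeff_mult)+

lemma ipoly_simps [simp]: "ipoly (p + q) x = ipoly p x + ipoly q x" "ipoly (p * q) x = ipoly p x * ipoly q x"
  "ipoly 0 x = 0" "ipoly 1 x = 1" "ipoly (pCons a p) x = of_int a + x * ipoly p x"
  by (simp_all add: of_int_poly_hom map_poly_pCons)

lemma ipoly_minus [simp]: "ipoly (- p) x = - ipoly p x" "ipoly (p - q) x = ipoly p x - ipoly q x"
proof -
  show 1: "ipoly (- p) x = - ipoly p x" for p using ipoly_simps(1)[of p "- p" x] by simp
  show "ipoly (p - q) x = ipoly p x - ipoly q x" using ipoly_simps(1)[of p "- q" x] 1[of q] by simp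
qed

lemma ipoly_power [simp]: "ipoly (p ^ n) x = ipoly p x ^ n"
  by (induction n) auto

lemma ipoly_monom [simp]: "ipoly (Polynomial.monom a n) x = of_int a * x ^ n"
  by (induction n) (auto simp: monom_0 monom_Suc)

lemma ipoly_sum [simp]: "ipoly (\<Sum>i\<in>A. f i) x = (\<Sum>i\<in>A. ipoly (f i) x)"
  by (induction A rule: infinite_finite_induct) auto

lemma ipoly_altdef: "Polynomial.degree p \<le> n \<Longrightarrow> ipoly p x = (\<Sum>i\<le>n. of_int (poly.coeff p i) * x ^ i)"
  unfolding poly_altdef by (intro sum.mono_neutral_cong_left) (auto simp: coeff_map_poly degree_map_poly coeff_eq_0)

text \<open>The norm argument without conjugates: multiplication by the value of \<open>p\<close>,
  with powers of the leading coefficient \<open>a\<close> cleared, is an integer matrix in the basis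
  \<open>1, x, ..., x ^ (d - 1)\<close>, and its determinant is a nonzero integer. The shape of the
  bound matters. It is exponential in the degree but polynomial in the length, because the
  polynomials it is applied to have degree about \<open>2 ^ k\<close> and length only a power of
  \<open>k\<close>.\<close>

lemma liouville_inequality:
  fixes x :: real
  assumes "algebraic x"
  obtains C :: real and d :: nat where "1 \<le> C"
    "\<And>p n. ipoly p x \<noteq> 0 \<Longrightarrow> Polynomial.degree p \<le> n \<Longrightarrow> 1 \<le> \<bar>ipoly p x\<bar> * C ^ (n + 1) * real_of_int (plen p) ^ d"
proof -
  obtain q0 where "q0 \<noteq> 0" "ipoly q0 x = 0" using algebraicE'[OF assms] by blast
  hence ex: "\<exists>d. \<exists>q. q \<noteq> 0 \<and> ipoly q x = 0 \<and> Polynomial.degree q = d" by blast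
  define d where "d = (LEAST d. \<exists>q. q \<noteq> 0 \<and> ipoly q x = 0 \<and> Polynomial.degree q = d)"
  obtain q where q: "q \<noteq> 0" "ipoly q x = 0" "Polynomial.degree q = d"
    using LeastI_ex[OF ex] unfolding d_def by blast
  have min: "p = 0" if "ipoly p x = 0" "Polynomial.degree p < d" for p
    using not_less_Least[of "Polynomial.degree p" "\<lambda>d. \<exists>q. q \<noteq> 0 \<and> ipoly q x = 0 \<and> Polynomial.degree q = d"] that
    unfolding d_def by blast
  have d0: "0 < d"
  proof (rule ccontr)
    assume "\<not> 0 < d"
    then obtain a where "q = [:a:]" using q(3) degree_eq_zeroE by blast
    thus False using q by simp
  qed
  define a where "a = Polynomial.lead_coeff q"
  have a0: "a \<noteq> 0" using q(1) by (simp add: a_def)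
  have red: "of_int a * x ^ d = (\<Sum>i<d. of_int (- poly.coeff q i) * x ^ i)"
  proof -
    have "0 = (\<Sum>i\<le>d. of_int (poly.coeff q i) * x ^ i)" using q ipoly_altdef[of q d x] by simp
    also have "\<dots> = (\<Sum>i<d. of_int (poly.coeff q i) * x ^ i) + of_int a * x ^ d"
      using q by (simp add: a_def lessThan_Suc_atMost[symmetric])
    finally show ?thesis by (simp add: sum_negf)
  qed
  have indep: "\<forall>i<d. b i = 0" if "(\<Sum>i<d. of_int (b i) * x ^ i) = 0" for b :: "nat \<Rightarrow> int"
  proof -
    define p where "p = (\<Sum>i<d. Polynomial.monom (b i) i)"
    have "Polynomial.degree p \<le> d - 1" unfolding p_def
      by (intro degree_sum_le) (auto intro: order_trans[OF degree_monom_le])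
    hence "Polynomial.degree p < d" using d0 by simp
    moreover have "ipoly p x = 0" using that by (simp add: p_def)
    ultimately have "p = 0" by (intro min) auto
    moreover have "poly.coeff p i = b i" if "i < d" for i using that
      by (simp add: p_def coeff_sum coeff_monom if_distrib cong: if_cong)
    ultimately show ?thesis by simp
  qed
  define K where "K = plen q + \<bar>a\<bar> + 1"
  have K1: "1 \<le> K" using plen_nonneg[of q] by (simp add: K_def)
  \<comment> \<open>Rewriting \<open>a * x ^ d\<close> by lower powers keeps the coordinates
    integral, and each multiplication by \<open>a * x\<close> enlarges them by at most the factor
    \<open>K\<close>.\<close>
  have pw: "\<exists>c. of_int (a ^ n) * x ^ n = (\<Sum>i<d. of_int (c i) * x ^ i) \<and> (\<forall>i. \<bar>c i\<bar> \<le> K ^ n)" for n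
  proof (induction n)
    case 0
    have "(\<Sum>i<d. of_int (if i = 0 then 1 else 0) * x ^ i) = (\<Sum>i<d. if i = 0 then 1 else 0)"
      by (intro sum.cong) auto
    thus ?case using d0 by (intro exI[of _ "\<lambda>i. if i = 0 then 1 else 0"]) (auto simp: sum.delta)
  next
    case (Suc n)
    then obtain c where c: "of_int (a ^ n) * x ^ n = (\<Sum>i<d. of_int (c i) * x ^ i)" "\<And>i. \<bar>c i\<bar> \<le> K ^ n" by blast
    define c' where "c' i = (if i = 0 then 0 else a * c (i - 1)) - c (d - 1) * poly.coeff q i" for i
    obtain e where e: "d = Suc e" using d0 by (cases d) auto
    have "of_int (a ^ Suc n) * x ^ Suc n = of_int a * x * (of_int (a ^ n) * x ^ n)" by simp
    also have "\<dots> = (\<Sum>i<d. of_int (a * c i) * x ^ Suc i)" unfolding c sum_distrib_left by (intro sum.cong) auto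
    also have "\<dots> = (\<Sum>i<e. of_int (a * c i) * x ^ Suc i) + of_int (c e) * (of_int a * x ^ d)"
      by (simp add: e)
    also have "of_int (c e) * (of_int a * x ^ d) = (\<Sum>i<d. of_int (- (c e * poly.coeff q i)) * x ^ i)"
      unfolding red sum_distrib_left by (intro sum.cong) auto
    also have "(\<Sum>i<e. of_int (a * c i) * x ^ Suc i) = (\<Sum>i<d. of_int (if i = 0 then 0 else a * c (i - 1)) * x ^ i)"
      unfolding e by (simp add: sum.lessThan_Suc_shift del: sum.lessThan_Suc)
    finally have "of_int (a ^ Suc n) * x ^ Suc n = (\<Sum>i<d. of_int (c' i) * x ^ i)"
      by (simp add: c'_def e sum.distrib[symmetric] algebra_simps)
    moreover have "\<bar>c' i\<bar> \<le> K ^ Suc n" for i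
    proof -
      have "\<bar>c' i\<bar> \<le> \<bar>if i = 0 then 0 else a * c (i - 1)\<bar> + \<bar>c (d - 1) * poly.coeff q i\<bar>"
        unfolding c'_def by (rule abs_triangle_ineq4)
      also have "\<bar>if i = 0 then 0 else a * c (i - 1)\<bar> \<le> \<bar>a\<bar> * K ^ n"
        using c(2)[of "i - 1"] K1 by (auto simp: abs_mult intro: mult_left_mono)
      also have "\<bar>c (d - 1) * poly.coeff q i\<bar> \<le> K ^ n * plen q"
        unfolding abs_mult by (intro mult_mono c abs_coeff_le_plen) (use K1 in auto)
      also have "\<bar>a\<bar> * K ^ n + K ^ n * plen q \<le> K ^ Suc n" using K1 by (simp add: K_def algebra_simps)
      finally show ?thesis by simp
    qed
    ultimately show ?case by blast
  qed
  then obtain c where c: "\<And>n. of_int (a ^ n) * x ^ n = (\<Sum>i<d. of_int (c n i) * x ^ i)" "\<And>n i. \<bar>c n i\<bar> \<le> K ^ n"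
    by metis
  define W where "W = (\<Sum>i<d. \<bar>x ^ i\<bar>)"
  have W: "\<bar>x ^ i\<bar> \<le> W" if "i < d" for i unfolding W_def using that by (intro member_le_sum) auto
  have W1: "1 \<le> W" using W[OF d0] by simp
  define Q where "Q = real_of_int (\<bar>a\<bar> * K)"
  have aK: "1 \<le> \<bar>a\<bar>" using a0 by simp
  have "\<bar>a\<bar> * 1 \<le> \<bar>a\<bar> * K" "1 * K \<le> \<bar>a\<bar> * K" using aK K1 by (intro mult_mono; simp)+
  hence "1 \<le> \<bar>a\<bar> * K" "\<bar>a\<bar> \<le> \<bar>a\<bar> * K" "K \<le> \<bar>a\<bar> * K" using aK K1 by auto
  hence Q1: "1 \<le> Q" "real_of_int \<bar>a\<bar> \<le> Q" "real_of_int K \<le> Q" unfolding Q_def by linarith+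
  define C0 where "C0 = real d * fact (d - 1) * W"
  have C01: "1 \<le> C0"
  proof -
    have "1 * 1 * 1 \<le> real d * fact (d - 1) * W" using d0 W1 by (intro mult_mono) auto
    thus ?thesis by (simp add: C0_def)
  qed
  define C where "C = C0 * Q ^ (1 + d + 2 * d + 2 * d * d)"
  have key: "1 \<le> \<bar>ipoly p x\<bar> * C ^ (n + 1) * real_of_int (plen p) ^ d"
    if p: "ipoly p x \<noteq> 0" "Polynomial.degree p \<le> n" for p n
  proof -
    \<comment> \<open>Row \<open>k\<close> holds the coordinates of
      \<open>a ^ (n + d) * x ^ k\<close> times the value of \<open>p\<close>; the exponent
      \<open>n + d\<close> is large enough for all \<open>j + k\<close> with \<open>j <= n\<close>
      and \<open>k < d\<close>.\<close>
    define M where "M = Matrix.mat d d (\<lambda>(k, i). \<Sum>j\<le>n. poly.coeff p j * a ^ (n + d - (j + k)) * c (j + k) i)"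
    have M: "M \<in> carrier_mat d d" by (simp add: M_def)
    define g where "g = of_int (a ^ (n + d)) * ipoly p x"
    have g0: "g \<noteq> 0" using p a0 by (simp add: g_def)
    have eig: "(\<Sum>i<d. real_of_int (M $$ (k, i)) * x ^ i) = g * x ^ k" if k: "k < d" for k
    proof -
      have "(\<Sum>i<d. real_of_int (M $$ (k, i)) * x ^ i)
         = (\<Sum>i<d. \<Sum>j\<le>n. real_of_int (poly.coeff p j * a ^ (n + d - (j + k))) * (of_int (c (j + k) i) * x ^ i))"
        using k by (intro sum.cong) (auto simp: M_def sum_distrib_right mult.assoc)
      also have "\<dots> = (\<Sum>j\<le>n. \<Sum>i<d. real_of_int (poly.coeff p j * a ^ (n + d - (j + k))) * (of_int (c (j + k) i) * x ^ i))"
        by (rule sum.swap)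
      also have "\<dots> = (\<Sum>j\<le>n. real_of_int (poly.coeff p j * a ^ (n + d - (j + k))) * (of_int (a ^ (j + k)) * x ^ (j + k)))"
        unfolding c sum_distrib_left ..
      also have "\<dots> = (\<Sum>j\<le>n. g' j)" if "g' = (\<lambda>j. of_int (a ^ (n + d)) * x ^ k * (of_int (poly.coeff p j) * x ^ j))" for g'
      proof (intro sum.cong refl)
        fix j assume "j \<in> {..n}"
        hence "a ^ (n + d) = a ^ (n + d - (j + k)) * a ^ (j + k)" using k by (simp flip: power_add)
        thus "real_of_int (poly.coeff p j * a ^ (n + d - (j + k))) * (of_int (a ^ (j + k)) * x ^ (j + k)) = g' j"
          unfolding that by (simp add: power_add)
      qed
      finally show ?thesis unfolding g_def ipoly_altdef[OF p(2)] by (simp add: sum_distrib_left mult_ac)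
    qed
    \<comment> \<open>A kernel vector of the transpose would be an integer relation between the
      powers of \<open>x\<close> below \<open>d\<close>, against the minimality of
      \<open>d\<close>.\<close>
    have det: "Determinant.det M \<noteq> 0"
    proof
      assume "Determinant.det M = 0"
      hence "Determinant.det (transpose_mat M) = 0" using M by (simp add: det_transpose)
      then obtain u where u: "u \<in> carrier_vec d" "u \<noteq> 0\<^sub>v d" "transpose_mat M *\<^sub>v u = 0\<^sub>v d"
        using det_0_iff_vec_prod_zero[of "transpose_mat M" d] M by auto
      have 0: "(\<Sum>k<d. M $$ (k, i) * u $ k) = 0" if i: "i < d" for i
      proof -
        have "(transpose_mat M *\<^sub>v u) $ i = 0" using u i by simp
        thus ?thesis using M u(1) i by (simp add: scalar_prod_def atLeast0LessThan)
      qed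
      have "g * (\<Sum>k<d. of_int (u $ k) * x ^ k) = (\<Sum>k<d. of_int (u $ k) * (\<Sum>i<d. real_of_int (M $$ (k, i)) * x ^ i))"
        unfolding sum_distrib_left[of g] by (intro sum.cong) (auto simp: eig)
      also have "\<dots> = (\<Sum>i<d. \<Sum>k<d. of_int (u $ k) * (real_of_int (M $$ (k, i)) * x ^ i))"
        unfolding sum_distrib_left by (rule sum.swap)
      also have "\<dots> = (\<Sum>i<d. of_int (\<Sum>k<d. M $$ (k, i) * u $ k) * x ^ i)"
        unfolding of_int_sum sum_distrib_right by (intro sum.cong) (auto simp: mult_ac)
      also have "\<dots> = 0" using 0 by simp
      finally have "(\<Sum>k<d. of_int (u $ k) * x ^ k) = 0" using g0 by simp
      hence "\<forall>k<d. u $ k = 0" by (rule indep)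
      thus False using u by (auto simp: vec_eq_iff)
    qed
    define b where "b = real_of_int (plen p) * Q ^ (2 * (n + d))"
    have p0: "1 \<le> plen p" using p by (intro plen_ge_1) auto
    have b: "real_of_int \<bar>M $$ (k, i)\<bar> \<le> b" if "k < d" "i < d" for k i
    proof -
      have "real_of_int \<bar>M $$ (k, i)\<bar> \<le> (\<Sum>j\<le>n. real_of_int \<bar>poly.coeff p j * a ^ (n + d - (j + k)) * c (j + k) i\<bar>)"
      proof -
        have "\<bar>M $$ (k, i)\<bar> \<le> (\<Sum>j\<le>n. \<bar>poly.coeff p j * a ^ (n + d - (j + k)) * c (j + k) i\<bar>)"
          using that by (simp add: M_def sum_abs)
        hence "real_of_int \<bar>M $$ (k, i)\<bar> \<le> real_of_int (\<Sum>j\<le>n. \<bar>poly.coeff p j * a ^ (n + d - (j + k)) * c (j + k) i\<bar>)"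
          by (simp only: of_int_le_iff)
        thus ?thesis by (simp only: of_int_sum)
      qed
      also have "\<dots> \<le> (\<Sum>j\<le>n. real_of_int \<bar>poly.coeff p j\<bar> * Q ^ (2 * (n + d)))"
      proof (rule sum_mono)
        fix j assume j: "j \<in> {..n}"
        have 1: "real_of_int \<bar>a ^ (n + d - (j + k))\<bar> \<le> Q ^ (n + d)"
        proof -
          have "real_of_int \<bar>a\<bar> ^ (n + d - (j + k)) \<le> Q ^ (n + d - (j + k))" using Q1 by (intro power_mono) auto
          also have "\<dots> \<le> Q ^ (n + d)" by (intro power_increasing Q1) auto
          finally show ?thesis by (simp add: power_abs)
        qed
        have 2: "real_of_int \<bar>c (j + k) i\<bar> \<le> Q ^ (n + d)"
        proof -
          have "real_of_int \<bar>c (j + k) i\<bar> \<le> real_of_int (K ^ (j + k))" using c(2) by (simp only: of_int_le_iff)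
          also have "\<dots> = real_of_int K ^ (j + k)" by simp
          also have "\<dots> \<le> Q ^ (j + k)" using Q1 K1 by (intro power_mono) auto
          also have "\<dots> \<le> Q ^ (n + d)" using j that by (intro power_increasing Q1) auto
          finally show ?thesis .
        qed
        have "real_of_int \<bar>poly.coeff p j * a ^ (n + d - (j + k)) * c (j + k) i\<bar>
          = real_of_int \<bar>poly.coeff p j\<bar> * (real_of_int \<bar>a ^ (n + d - (j + k))\<bar> * real_of_int \<bar>c (j + k) i\<bar>)"
          by (simp add: abs_mult)
        also have "\<dots> \<le> real_of_int \<bar>poly.coeff p j\<bar> * (Q ^ (n + d) * Q ^ (n + d))"
          using Q1 by (intro mult_left_mono mult_mono 1 2) auto
        finally show "real_of_int \<bar>poly.coeff p j * a ^ (n + d - (j + k)) * c (j + k) i\<bar> \<le> real_of_int \<bar>poly.coeff p j\<bar> * Q ^ (2 * (n + d))"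
          by (simp only: mult_2 power_add[symmetric])
      qed
      also have "\<dots> = real_of_int (\<Sum>j\<le>n. \<bar>poly.coeff p j\<bar>) * Q ^ (2 * (n + d))" by (simp add: sum_distrib_right)
      also have "(\<Sum>j\<le>n. \<bar>poly.coeff p j\<bar>) = plen p" unfolding plen_eq_sum
        using p(2) by (intro sum.mono_neutral_right) (auto simp: coeff_eq_0)
      finally show ?thesis by (simp add: b_def)
    qed
    have "1 \<le> \<bar>g\<bar> * (d * (fact (d - 1) * b ^ (d - 1) * W))"
      by (rule eigenvalue_lower_bound[OF M det d0 b _ W eig]) auto
    also have "\<dots> = \<bar>g\<bar> * (C0 * b ^ (d - 1))" by (simp add: C0_def)
    also have "\<dots> \<le> (Q ^ (n + d) * \<bar>ipoly p x\<bar>) * (C0 * (real_of_int (plen p) ^ d * Q ^ (2 * (n + d) * d)))"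
    proof (intro mult_mono)
      have "real_of_int \<bar>a\<bar> ^ (n + d) \<le> Q ^ (n + d)" using Q1 by (intro power_mono) auto
      thus "\<bar>g\<bar> \<le> Q ^ (n + d) * \<bar>ipoly p x\<bar>" by (simp add: g_def abs_mult power_abs mult_right_mono)
      have b1: "1 \<le> b" unfolding b_def using mult_mono[of 1 "real_of_int (plen p)" 1 "Q ^ (2 * (n + d))"] p0 Q1 by (simp add: one_le_power)
      have "b ^ (d - 1) \<le> b ^ d" by (intro power_increasing b1) auto
      thus "b ^ (d - 1) \<le> real_of_int (plen p) ^ d * Q ^ (2 * (n + d) * d)"
        by (simp add: b_def power_mult_distrib power_mult)
    qed (use C01 Q1 p0 in \<open>auto intro!: zero_le_power simp: b_def\<close>)
    also have "\<dots> = \<bar>ipoly p x\<bar> * (C0 * Q ^ (n + d + 2 * (n + d) * d)) * real_of_int (plen p) ^ d"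
      by (simp add: power_add mult_ac)
    also have "\<dots> \<le> \<bar>ipoly p x\<bar> * C' ^ (n + 1) * real_of_int (plen p) ^ d" if "C' = C0 * Q ^ (1 + d + 2 * d + 2 * d * d)" for C'
    proof (intro mult_right_mono mult_left_mono)
      have "C0 * Q ^ (n + d + 2 * (n + d) * d) \<le> C0 ^ (n + 1) * Q ^ ((1 + d + 2 * d + 2 * d * d) * (n + 1))"
      proof (intro mult_mono power_increasing Q1)
        show "C0 \<le> C0 ^ (n + 1)" using C01 by (simp add: self_le_power)
        show "n + d + 2 * (n + d) * d \<le> (1 + d + 2 * d + 2 * d * d) * (n + 1)" by (simp add: algebra_simps)
      qed (use C01 Q1 in auto)
      thus "C0 * Q ^ (n + d + 2 * (n + d) * d) \<le> C' ^ (n + 1)" unfolding that power_mult_distrib power_mult .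
    qed (use p0 in auto)
    finally show ?thesis using C_def by blast
  qed
  have "1 \<le> Q ^ (1 + d + 2 * d + 2 * d * d)" by (intro one_le_power Q1)
  hence "1 * 1 \<le> C" unfolding C_def using C01 by (intro mult_mono) auto
  hence "1 \<le> C" by simp
  from that[OF this key] show thesis .
qed

section \<open>Transcendence by the method of Mahler\<close>

text \<open>The equation says that \<open>r = p / q\<close> solves
  \<open>c r(X ^ 2) = r(X) + m X\<close>. In lowest terms the denominator of \<open>r(X ^ 2)\<close>
  divides that of \<open>r\<close>, so \<open>r\<close> is a polynomial; then
  \<open>2 deg r <= max (deg r) 1\<close> leaves only constants, which cannot produce
  \<open>m X\<close>.\<close>

lemma functional_equation_no_rational_solution:
  fixes p q :: "real poly" and c :: real
  assumes q: "q \<noteq> 0" and c: "c \<noteq> 0" and m: "m \<noteq> 0"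
    and eq: "q * (Polynomial.smult c (pcompose p [:0, 0, 1:]) - [:0, m:] * pcompose q [:0, 0, 1:]) = pcompose q [:0, 0, 1:] * p"
  shows False
proof -
  define h where "h = gcd p q"
  let ?S = "\<lambda>f :: real poly. pcompose f [:0, 0, 1:]"
  have h0: "h \<noteq> 0" using q by (simp add: h_def)
  obtain p' q' where p': "p = p' * h" and q': "q = q' * h" and cop: "coprime p' q'"
    using gcd_coprime_exists[of p q] h0 unfolding h_def by blast
  have deg2: "Polynomial.degree [:0, 0, 1 :: real:] = 2" by simp
  have S0: "?S f \<noteq> 0" if "f \<noteq> 0" for f using that by (simp add: pcompose_eq_0_iff)
  have "(h * ?S h) * (q' * (Polynomial.smult c (?S p') - [:0, m:] * ?S q')) = (h * ?S h) * (?S q' * p')"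
    using eq unfolding p' q' by (simp add: pcompose_mult algebra_simps)
  hence eq': "q' * (Polynomial.smult c (?S p') - [:0, m:] * ?S q') = ?S q' * p'"
    using h0 S0[OF h0] by (simp only: mult_cancel_left mult_eq_0_iff) simp
  have "q' \<noteq> 0" using q q' by auto
  have "coprime (?S p') (?S q')"
  proof -
    obtain a b where "a * p' + b * q' = 1" using cop by (metis bezout_coefficients_fst_snd coprime_iff_gcd_eq_1)
    hence "?S (a * p' + b * q') = ?S 1" by simp
    hence "?S a * ?S p' + ?S b * ?S q' = 1" by (simp add: pcompose_add pcompose_mult pcompose_1)
    thus ?thesis by (intro coprimeI) (metis dvd_add dvd_mult)
  qed
  moreover have "?S q' dvd ?S p' * q'"
  proof -
    have "Polynomial.smult c (q' * ?S p') = ?S q' * (p' + [:0, m:] * q')" using eq' by (simp add: algebra_simps)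
    hence "?S q' dvd Polynomial.smult c (q' * ?S p')" by simp
    thus ?thesis using c by (simp add: dvd_smult_iff mult.commute)
  qed
  ultimately have "?S q' dvd q'" using coprime_dvd_mult_right_iff coprime_commute by blast
  hence "Polynomial.degree (?S q') \<le> Polynomial.degree q'" using \<open>q' \<noteq> 0\<close> by (rule dvd_imp_degree_le)
  hence "Polynomial.degree q' = 0" by (simp add: degree_pcompose)
  then obtain b where b: "q' = [:b:]" using degree_eq_zeroE by blast
  have b0: "b \<noteq> 0" using \<open>q' \<noteq> 0\<close> b by auto
  have "[:b:] * (Polynomial.smult c (?S p') - [:0, m * b:]) = [:b:] * p'" using eq' by (simp add: b mult_ac)
  hence e: "Polynomial.smult c (?S p') = p' + [:0, m * b:]" using b0 by (simp only: mult_cancel_left) (simp add: algebra_simps)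
  have d: "2 * Polynomial.degree p' = Polynomial.degree (p' + [:0, m * b:])"
    using arg_cong[OF e, of Polynomial.degree] c by (simp add: degree_pcompose)
  also have "\<dots> \<le> max (Polynomial.degree p') 1" by (intro degree_add_le) auto
  finally have "Polynomial.degree p' = 0" by linarith
  then obtain a where "p' = [:a:]" using degree_eq_zeroE by blast
  thus False using e m b0 by simp
qed

abbreviation eval2 :: "real poly poly \<Rightarrow> real \<Rightarrow> real \<Rightarrow> real"
  where "eval2 f x z \<equiv> poly (poly f [:z:]) x"

text \<open>Take a relation of minimal degree in the second variable. The functional equation of
  \<open>g\<close> turns it into another relation of the same degree; eliminating the leading term
  gives one of smaller degree, which is therefore 0, and its coefficient just below the leading
  place is the equation excluded by \<open>functional_equation_no_rational_solution\<close>.\<close>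

lemma mahler_sequence_independent:
  fixes w g :: "nat \<Rightarrow> real" and y :: real
  assumes w: "\<And>k. w (Suc k) = w k ^ 2" and inj: "inj w" and g: "\<And>k. g k = w k + y * g (Suc k)" and y: "y \<noteq> 0"
    and f: "f \<noteq> 0" "\<And>k. k \<ge> k0 \<Longrightarrow> eval2 f (w k) (g k) = 0"
  shows False
proof -
  define V where "V f \<longleftrightarrow> f \<noteq> 0 \<and> (\<exists>k0. \<forall>k\<ge>k0. eval2 f (w k) (g k) = 0)" for f
  have ex: "\<exists>d. \<exists>f. V f \<and> Polynomial.degree f = d" using f unfolding V_def by blast
  define d where "d = (LEAST d. \<exists>f. V f \<and> Polynomial.degree f = d)"
  obtain f where f: "V f" "Polynomial.degree f = d" using LeastI_ex[OF ex] unfolding d_def by blast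
  have min: "\<not> V h" if "Polynomial.degree h < d" for h
    using not_less_Least[of "Polynomial.degree h" "\<lambda>d. \<exists>f. V f \<and> Polynomial.degree f = d"] that
    unfolding d_def by blast
  obtain k0 where k0: "\<And>k. k \<ge> k0 \<Longrightarrow> eval2 f (w k) (g k) = 0" using f unfolding V_def by blast
  show False
  proof (cases "d = 0")
    case True
    then obtain a where a: "f = [:a:]" using f degree_eq_zeroE by blast
    have "a \<noteq> 0" using f a unfolding V_def by auto
    hence "finite {x. poly a x = 0}" by (rule poly_roots_finite)
    moreover have "w ` {k0..} \<subseteq> {x. poly a x = 0}" using k0 by (auto simp: a)
    ultimately have "finite (w ` {k0..})" using finite_subset by blast
    hence "finite {k0..}" using inj by (simp add: finite_image_iff inj_on_subset)
    thus False using infinite_Ici by blast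
  next
    case False
    let ?S = "\<lambda>f :: real poly. pcompose f [:0, 0, 1:]"
    let ?L = "[:[:0, - 1:], 1:] :: real poly poly"
    \<comment> \<open>The summands of \<open>F(X, Z) = y ^ d * f(X ^ 2, (Z - X) / y)\<close>. Since
      \<open>(g k - w k) / y = g (Suc k)\<close> and \<open>w k ^ 2 = w (Suc k)\<close>, the value
      of \<open>F\<close> at \<open>k\<close> is \<open>y ^ d\<close> times that of \<open>f\<close>
      at \<open>Suc k\<close>.\<close>
    define T where "T j = Polynomial.smult (Polynomial.smult (y ^ (d - j)) (?S (poly.coeff f j))) (?L ^ j)" for j
    define F where "F = (\<Sum>j\<le>d. T j)"
    have degL: "Polynomial.degree (?L ^ j) = j" for j by (simp add: degree_power_eq)
    have degT: "Polynomial.degree (T j) \<le> j" for j unfolding T_def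
      by (rule order_trans[OF degree_smult_le]) (simp add: degL)
    have degF: "Polynomial.degree F \<le> d" unfolding F_def
      by (intro degree_sum_le) (auto intro: order_trans[OF degT])
    have lcL: "poly.coeff (?L ^ j) j = 1" for j
    proof -
      have "Polynomial.lead_coeff (?L ^ j) = 1" by (simp add: lead_coeff_power)
      thus ?thesis by (simp add: degL)
    qed
    have subL: "poly.coeff (?L ^ Suc j) j = [:0, - real (Suc j):]" for j
    proof (induction j)
      case (Suc j)
      have "poly.coeff (?L ^ Suc (Suc j)) (Suc j) = [:0, - 1:] * poly.coeff (?L ^ Suc j) (Suc j) + poly.coeff (?L ^ Suc j) j"
        by (subst power_Suc) (simp del: power_Suc add: mult_pCons_left)
      also have "\<dots> = [:0, - real (Suc (Suc j)):]" unfolding Suc lcL by simp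
      finally show ?case .
    qed simp
    have evalF: "eval2 F (w k) (g k) = 0" if "k \<ge> k0" for k
    proof -
      have gk: "g k - w k = y * g (Suc k)" using g[of k] by simp
      have "eval2 F (w k) (g k) = (\<Sum>j\<le>d. y ^ (d - j) * poly (poly.coeff f j) (w (Suc k)) * (g k - w k) ^ j)"
        unfolding F_def T_def by (simp add: poly_sum poly_pcompose w power2_eq_square mult.assoc)
      also have "\<dots> = (\<Sum>j\<le>d. y ^ d * (poly (poly.coeff f j) (w (Suc k)) * g (Suc k) ^ j))"
        unfolding gk by (intro sum.cong refl) (auto simp: power_mult_distrib mult_ac simp flip: power_add)
      also have "\<dots> = y ^ d * eval2 f (w (Suc k)) (g (Suc k))"
        by (simp add: poly_altdef[of f] f(2) poly_sum sum_distrib_left)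
      also have "\<dots> = 0" using k0[of "Suc k"] that by simp
      finally show ?thesis .
    qed
    define a where "a = poly.coeff f d"
    define b where "b = poly.coeff f (d - 1)"
    have a0: "a \<noteq> 0" using f unfolding a_def V_def by auto
    have Fd: "poly.coeff F d = ?S a"
    proof -
      have "poly.coeff F d = (\<Sum>j\<le>d. poly.coeff (T j) d)" by (simp add: F_def coeff_sum)
      also have "\<dots> = (\<Sum>j\<in>{d}. poly.coeff (T j) d)"
        using degT by (intro sum.mono_neutral_right) (auto intro!: coeff_eq_0 le_less_trans[OF degT])
      finally show ?thesis by (simp add: T_def lcL a_def)
    qed
    have Fd1: "poly.coeff F (d - 1) = Polynomial.smult y (?S b) - [:0, real d:] * ?S a"
    proof -
      have "poly.coeff F (d - 1) = (\<Sum>j\<le>d. poly.coeff (T j) (d - 1))" by (simp add: F_def coeff_sum)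
      also have "\<dots> = (\<Sum>j\<in>{d - 1, d}. poly.coeff (T j) (d - 1))"
        using degT by (intro sum.mono_neutral_right) (auto intro!: coeff_eq_0 le_less_trans[OF degT])
      also have "\<dots> = poly.coeff (T (d - 1)) (d - 1) + poly.coeff (T d) (d - 1)" using False by simp
      also have "poly.coeff (T (d - 1)) (d - 1) = Polynomial.smult y (?S b)"
        using False by (simp add: T_def lcL b_def)
      also have "poly.coeff (T d) (d - 1) = - ([:0, real d:] * ?S a)"
        using False subL[of "d - 1"] by (simp add: T_def a_def)
      finally show ?thesis by simp
    qed
    define h where "h = Polynomial.smult a F - Polynomial.smult (?S a) f"
    have "Polynomial.degree h \<le> d" unfolding h_def
      by (intro degree_diff_le order_trans[OF degree_smult_le]) (use degF f in auto)
    moreover have "poly.coeff h d = 0" unfolding h_def by (simp add: Fd a_def)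
    ultimately have "h = 0 \<or> Polynomial.degree h < d" using False
      by (metis le_neq_implies_less leading_coeff_0_iff)
    moreover have "\<not> V h" if "h \<noteq> 0" using min calculation that by blast
    moreover have "\<forall>k\<ge>k0. eval2 h (w k) (g k) = 0" using k0 evalF by (simp add: h_def)
    ultimately have "h = 0" unfolding V_def by blast
    hence "poly.coeff h (d - 1) = 0" by simp
    hence "a * (Polynomial.smult y (?S b) - [:0, real d:] * ?S a) = ?S a * b"
      by (simp only: h_def coeff_diff coeff_smult Fd1 b_def[symmetric] right_minus_eq)
    thus False using functional_equation_no_rational_solution[OF a0 y, of "real d" b] False by simp
  qed
qed

lemma polynomial_times_exponential_small:
  fixes K :: real
  shows "eventually (\<lambda>k. K * (real k + 1) ^ M * (1/2) ^ (2 ^ k) < 1) sequentially"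
proof -
  have "((\<lambda>x::real. K * x powr real M * (1/2) powr x) \<longlongrightarrow> 0) at_top" by real_asymp
  moreover have "filterlim (\<lambda>k::nat. (2::real) ^ k) at_top sequentially" by real_asymp
  ultimately have "((\<lambda>k::nat. K * (2 ^ k) powr real M * (1/2) powr (2 ^ k)) \<longlongrightarrow> 0) sequentially"
    by (rule filterlim_compose)
  hence "((\<lambda>k::nat. \<bar>K * (2 ^ k) powr real M * (1/2) powr (2 ^ k)\<bar>) \<longlongrightarrow> 0) sequentially"
    by (rule tendsto_rabs_zero)
  hence "eventually (\<lambda>k::nat. \<bar>K * (2 ^ k) powr real M * (1/2) powr (2 ^ k)\<bar> < 1) sequentially"
    by (rule order_tendstoD) simp
  thus ?thesis
  proof (rule eventually_mono)
    fix k :: nat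
    assume *: "\<bar>K * (2 ^ k) powr real M * (1/2) powr (2 ^ k)\<bar> < (1::real)"
    have e1: "(2 ^ k) powr real M = ((2::real) ^ k) ^ M" by (rule powr_realpow) simp
    have e2: "(1/2) powr (2 ^ k) = (1/2::real) ^ (2 ^ k)" using powr_realpow[of "1/2::real" "2 ^ k"] by simp
    have "Suc k \<le> 2 ^ k" by (simp add: Suc_le_eq)
    hence "real (Suc k) \<le> real (2 ^ k)" by (simp only: of_nat_le_iff)
    hence "(real k + 1) ^ M \<le> (2 ^ k) ^ M" by (intro power_mono) auto
    define A where "A = (real k + 1) ^ M * (1/2) ^ (2 ^ k)"
    define A' where "A' = ((2::real) ^ k) ^ M * (1/2) ^ (2 ^ k)"
    have A: "0 \<le> A" unfolding A_def by (intro mult_nonneg_nonneg zero_le_power) simp_all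
    have AA': "A \<le> A'" unfolding A_def A'_def using \<open>(real k + 1) ^ M \<le> (2 ^ k) ^ M\<close>
      by (rule mult_right_mono) (rule zero_le_power, simp)
    have "K * A \<le> \<bar>K\<bar> * A" using A by (intro mult_right_mono) simp_all
    also have "\<dots> \<le> \<bar>K\<bar> * A'" using AA' by (intro mult_left_mono) simp_all
    also have "\<dots> = \<bar>K * A'\<bar>" using A AA' by (simp only: abs_mult)
    also have "\<dots> < 1" using * unfolding e1 e2 A'_def by (simp only: mult.assoc)
    finally show "K * (real k + 1) ^ M * (1/2) ^ (2 ^ k) < 1" unfolding A_def by (simp only: mult.assoc)
  qed
qed

lemma ipoly_smult [simp]: "ipoly (Polynomial.smult a p) x = of_int a * ipoly p x"
  using ipoly_simps(2)[of "[:a:]" p x] by simp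

lemma exponent_le: "15 * k + 20 \<le> (20::nat) * 2 ^ k"
proof (induction k)
  case (Suc k)
  have "(1::nat) \<le> 2 ^ k" by simp
  thus ?case using Suc by simp
qed simp

section \<open>Transcendence of the root of the characteristic equation\<close>

locale lacunary =
  fixes y :: real
  assumes y0: "0 < y" and y8: "y \<le> 1/8"
    and root: "4 * (1 - y) * suminf (\<lambda>k. y ^ (20 * 2 ^ Suc k - 15 * Suc k - 20)) = 9 * y - 1"
begin

text \<open>The power of \<open>y\<close> with exponent \<open>20 * 2 ^ i - 15 * i\<close> splits as
  \<open>b ^ i * w i\<close>. The linear part of the exponent goes into the coefficient, and
  \<open>g k\<close> becomes the value at \<open>w k\<close> of a power series with
  \<open>G(X) = X + b * G(X ^ 2)\<close>. Note that \<open>b\<close> itself depends on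
  \<open>y\<close>.\<close>

definition b :: real where "b = (1 / y) ^ 15"
definition w :: "nat \<Rightarrow> real" where "w k = y ^ (20 * 2 ^ k)"
definition g :: "nat \<Rightarrow> real" where "g k = suminf (\<lambda>i. b ^ i * w (k + i))"

lemma b0: "0 < b" using y0 by (simp add: b_def)

lemma y1: "y < 1" using y8 by simp

lemma w_Suc: "w (Suc k) = w k ^ 2" by (simp add: w_def mult.commute[of _ 2] flip: power_mult)

lemma w_pos: "0 < w k" using y0 by (simp add: w_def)

lemma w_add: "w (k + i) = w k ^ (2 ^ i)" by (simp add: w_def power_add mult.assoc flip: power_mult)

lemma bw_le: "b * w k \<le> 1/2"
proof -
  have "w k \<le> y ^ 20" unfolding w_def using y0 y1 by (intro power_decreasing) auto
  hence "b * w k \<le> b * y ^ 20" using b0 by simp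
  also have "\<dots> = y ^ 5" using y0 by (simp add: b_def power_divide field_simps flip: power_add)
  also have "\<dots> \<le> (1/8) ^ 5" using y0 y8 by (intro power_mono) auto
  also have "\<dots> \<le> 1/2" by (simp add: power_divide)
  finally show ?thesis .
qed

lemma w_le: "w k \<le> 1/2"
proof -
  have "w k \<le> y ^ 1" unfolding w_def using y0 y1 by (intro power_decreasing) auto
  thus ?thesis using y8 by simp
qed

lemma term_le: "b ^ i * w (k + i) \<le> w k * (1/2) ^ i"
proof (induction i)
  case (Suc i)
  have "b ^ Suc i * w (k + Suc i) = (b ^ i * w (k + i)) * (b * w (k + i))" by (simp add: w_Suc power2_eq_square)
  also have "\<dots> \<le> (w k * (1/2) ^ i) * (1/2)"
    using Suc bw_le
  proof (rule mult_mono)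
    show "0 \<le> w k * (1/2) ^ i" using less_imp_le[OF w_pos] by (intro mult_nonneg_nonneg zero_le_power) simp_all
    show "0 \<le> b * w (k + i)" using less_imp_le[OF w_pos] less_imp_le[OF b0] by (intro mult_nonneg_nonneg)
  qed
  finally show ?case by simp
qed simp

lemma term_nonneg: "0 \<le> b ^ i * w (k + i)" using b0 w_pos[of "k + i"] by simp

lemma summable_g: "summable (\<lambda>i. b ^ i * w (k + i))"
proof (rule summable_comparison_test')
  show "summable (\<lambda>i. w k * (1/2) ^ i)" by (intro summable_mult summable_geometric) simp
  show "norm (b ^ i * w (k + i)) \<le> w k * (1/2) ^ i" for i using term_le[of i k] term_nonneg[of i k] by simp
qed

lemma g_nonneg: "0 \<le> g k" unfolding g_def by (intro suminf_nonneg summable_g term_nonneg)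

lemma g_le: "g k \<le> 2 * w k"
proof -
  have "g k \<le> suminf (\<lambda>i. w k * (1/2) ^ i)" unfolding g_def
    by (intro suminf_le term_le summable_g summable_mult summable_geometric) simp
  also have "\<dots> = 2 * w k" by (subst suminf_mult) (simp_all add: summable_geometric suminf_geometric)
  finally show ?thesis .
qed

lemma g_split: "g k = (\<Sum>i<s. b ^ i * w k ^ (2 ^ i)) + b ^ s * g (k + s)"
proof -
  have "g k = suminf (\<lambda>i. b ^ (i + s) * w (k + (i + s))) + (\<Sum>i<s. b ^ i * w (k + i))"
    unfolding g_def by (rule suminf_split_initial_segment[OF summable_g])
  also have "suminf (\<lambda>i. b ^ (i + s) * w (k + (i + s))) = suminf (\<lambda>i. b ^ s * (b ^ i * w ((k + s) + i)))"
    by (simp add: power_add mult_ac add_ac)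
  also have "\<dots> = b ^ s * g (k + s)" unfolding g_def by (rule suminf_mult[OF summable_g])
  finally show ?thesis by (simp add: w_add)
qed

lemma g_rec: "g k = w k + b * g (Suc k)" using g_split[of k 1] by simp

text \<open>Integer polynomials in \<open>y\<close> for the numbers \<open>4 (1 - y) g k\<close>.
  The characteristic equation makes \<open>g 0\<close> rational in \<open>y\<close>:
  \<open>[:3, 5:]\<close> is \<open>9 y - 1\<close> plus \<open>4 (1 - y)\<close>, the latter for
  the term of exponent 0, with which \<open>g 0\<close> starts but the equation does not. The
  functional equation propagates this to all \<open>k\<close>.\<close>

primrec gp :: "nat \<Rightarrow> int poly" where
  "gp 0 = Polynomial.monom 1 20 * [:3, 5:]"
| "gp (Suc k) = Polynomial.monom 1 15 * (gp k - [:4, -4:] * Polynomial.monom 1 (20 * 2 ^ k))"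

lemma ipoly_gp: "ipoly (gp k) y = 4 * (1 - y) * g k"
proof (induction k)
  case 0
  have e: "b ^ i * w i = y ^ 20 * y ^ (20 * 2 ^ i - 15 * i - 20)" for i
  proof -
    have "y ^ (15 * i) * (y ^ 20 * y ^ (20 * 2 ^ i - 15 * i - 20)) = y ^ (20 * 2 ^ i)"
      using exponent_le[of i] by (simp flip: power_add)
    moreover have "b ^ i * y ^ (15 * i) = 1"
    proof -
      have "b * y ^ 15 = 1" using y0 by (simp add: b_def flip: power_mult_distrib)
      thus ?thesis unfolding power_mult power_mult_distrib[symmetric] by (simp only: power_one)
    qed
    ultimately show ?thesis unfolding w_def by (metis (no_types) mult.assoc mult_1)
  qed
  have s: "summable (\<lambda>i. y ^ (20 * 2 ^ i - 15 * i - 20))"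
  proof -
    have "summable (\<lambda>i. y ^ 20 * y ^ (20 * 2 ^ i - 15 * i - 20))" using summable_g[of 0] by (simp add: e)
    thus ?thesis using y0 by (subst (asm) summable_cmult_iff) simp
  qed
  have "g 0 = suminf (\<lambda>i. y ^ 20 * y ^ (20 * 2 ^ i - 15 * i - 20))" unfolding g_def by (simp add: e)
  also have "\<dots> = y ^ 20 * suminf (\<lambda>i. y ^ (20 * 2 ^ i - 15 * i - 20))" by (rule suminf_mult[OF s])
  also have "suminf (\<lambda>i. y ^ (20 * 2 ^ i - 15 * i - 20)) = suminf (\<lambda>k. y ^ (20 * 2 ^ Suc k - 15 * Suc k - 20)) + 1"
    using suminf_split_initial_segment[OF s, of 1] by simp
  finally have "4 * (1 - y) * g 0 = y ^ 20 * (4 * (1 - y) * suminf (\<lambda>k. y ^ (20 * 2 ^ Suc k - 15 * Suc k - 20)) + 4 * (1 - y))"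
    by (simp only: algebra_simps)
  thus ?case unfolding root by (simp add: algebra_simps)
next
  case (Suc k)
  have "y ^ 15 * b = 1" using y0 by (simp add: b_def flip: power_mult_distrib)
  moreover have "y ^ 15 * (g k - w k) = (y ^ 15 * b) * g (Suc k)" using g_rec[of k] by (simp only: add_diff_cancel_left' mult.assoc)
  ultimately have "g (Suc k) = y ^ 15 * (g k - w k)" by simp
  thus ?case by (simp add: Suc w_def) (simp add: algebra_simps)
qed

lemma degree_gp: "Polynomial.degree (gp k) \<le> 20 * 2 ^ k + 1"
proof (induction k)
  case 0
  have "Polynomial.degree (gp 0) \<le> 20 + 1" unfolding gp.simps
    by (rule order_trans[OF degree_mult_le]) (intro add_mono degree_monom_le, simp)
  thus ?case by simp
next
  case (Suc k)
  have "Polynomial.degree ([:4, -4:] * Polynomial.monom (1::int) (20 * 2 ^ k)) \<le> 1 + 20 * 2 ^ k"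
    by (rule order_trans[OF degree_mult_le]) (intro add_mono degree_monom_le, simp)
  hence "Polynomial.degree (gp k - [:4, -4:] * Polynomial.monom 1 (20 * 2 ^ k)) \<le> 20 * 2 ^ k + 1"
    using Suc by (intro degree_diff_le) auto
  hence "Polynomial.degree (gp (Suc k)) \<le> 15 + (20 * 2 ^ k + 1)" unfolding gp.simps
    by (intro order_trans[OF degree_mult_le] add_mono degree_monom_le)
  thus ?case using exponent_le[of k] by simp
qed

text \<open>Multiplication by a power of \<open>y\<close> does not change the length, so each step
  adds only the 8 of \<open>[:4, -4:]\<close>, although the degree bound doubles.\<close>

lemma plen_gp: "plen (gp k) \<le> 8 * (int k + 1)"
proof (induction k)
  case 0
  show ?case unfolding gp.simps by (rule order_trans[OF plen_mult]) simp
next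
  case (Suc k)
  have "plen (gp (Suc k)) \<le> plen (gp k - [:4, -4:] * Polynomial.monom 1 (20 * 2 ^ k))"
    unfolding gp.simps by (rule order_trans[OF plen_mult]) simp
  also have "\<dots> \<le> plen (gp k) + 8" using plen_mult[of "[:4, -4:]" "Polynomial.monom 1 (20 * 2 ^ k)"]
    by (intro order_trans[OF plen_diff]) simp
  finally show ?case using Suc by simp
qed

text \<open>The ring of integer polynomials in \<open>y\<close> and \<open>1 / y\<close>, which
  contains \<open>b\<close>. The coefficients of the auxiliary form are taken from it, so that one
  fixed power of \<open>y\<close> makes all of them integer polynomials in \<open>y\<close>.\<close>

definition R :: "real set" where "R = {x. \<exists>n p. y ^ n * x = ipoly p y}"

lemma R_ipoly: "ipoly p y \<in> R" unfolding R_def by (force intro: exI[of _ 0])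

lemma R_closed:
  "0 \<in> R" "1 \<in> R" "x \<in> R \<Longrightarrow> z \<in> R \<Longrightarrow> x + z \<in> R" "x \<in> R \<Longrightarrow> z \<in> R \<Longrightarrow> x * z \<in> R" "x \<in> R \<Longrightarrow> - x \<in> R"
proof -
  show "0 \<in> R" "1 \<in> R" using R_ipoly[of 0] R_ipoly[of 1] by simp_all
  show "- x \<in> R" if "x \<in> R"
    using that unfolding R_def by (auto) (metis ipoly_minus(1))
  assume "x \<in> R" "z \<in> R"
  then obtain n p m q where *: "y ^ n * x = ipoly p y" "y ^ m * z = ipoly q y" unfolding R_def by blast
  have "y ^ (n + m) * (x + z) = y ^ m * (y ^ n * x) + y ^ n * (y ^ m * z)" by (simp add: power_add algebra_simps)
  also have "\<dots> = ipoly (Polynomial.monom 1 m * p + Polynomial.monom 1 n * q) y" by (simp add: *)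
  finally show "x + z \<in> R" unfolding R_def by blast
  have "y ^ (n + m) * (x * z) = (y ^ n * x) * (y ^ m * z)" by (simp add: power_add algebra_simps)
  also have "\<dots> = ipoly (p * q) y" by (simp add: *)
  finally show "x * z \<in> R" unfolding R_def by blast
qed

lemma b_in_R: "b \<in> R"
proof -
  have "y ^ 15 * b = ipoly 1 y" using y0 by (simp add: b_def flip: power_mult_distrib)
  thus ?thesis unfolding R_def by blast
qed

lemma R_power: "x \<in> R \<Longrightarrow> x ^ n \<in> R" by (induction n) (auto intro: R_closed)

lemma R_sum: "(\<And>i. i \<in> A \<Longrightarrow> f i \<in> R) \<Longrightarrow> sum f A \<in> R"
  by (induction A rule: infinite_finite_induct) (auto intro: R_closed)

lemma R_common_denominator:
  assumes "finite I" "\<And>i. i \<in> I \<Longrightarrow> e i \<in> R"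
  shows "\<exists>n q. \<forall>i\<in>I. y ^ n * e i = ipoly (q i) y"
proof -
  have "\<forall>i\<in>I. \<exists>n p. y ^ n * e i = ipoly p y" using assms(2) unfolding R_def by blast
  then obtain n p where np: "\<And>i. i \<in> I \<Longrightarrow> y ^ n i * e i = ipoly (p i) y" by metis
  have "y ^ sum n I * e i = ipoly (Polynomial.monom 1 (sum n I - n i) * p i) y" if "i \<in> I" for i
  proof -
    have "n i \<le> sum n I" using assms(1) that by (intro member_le_sum) auto
    hence "y ^ sum n I = y ^ (sum n I - n i) * y ^ n i" by (simp flip: power_add)
    thus ?thesis using np[OF that] by (simp add: mult.assoc)
  qed
  thus ?thesis by (intro exI[of _ "sum n I"] exI[of _ "\<lambda>i. Polynomial.monom 1 (sum n I - n i) * p i"] ballI)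
qed

lemma R_coeff_mult: "(\<And>l. poly.coeff p l \<in> R) \<Longrightarrow> (\<And>l. poly.coeff q l \<in> R) \<Longrightarrow> poly.coeff (p * q) l \<in> R"
  unfolding coeff_mult by (intro R_sum R_closed)

lemma R_coeff_power: "(\<And>l. poly.coeff p l \<in> R) \<Longrightarrow> poly.coeff (p ^ n) l \<in> R"
proof (induction n arbitrary: l)
  case 0 thus ?case by (auto simp: coeff_1 intro: R_closed)
next
  case (Suc n) show ?case unfolding power_Suc by (rule R_coeff_mult[OF Suc.prems Suc.IH[OF Suc.prems]])
qed

text \<open>There are more coefficients than conditions for vanishing at the origin.\<close>

lemma auxiliary_form:
  obtains e :: "nat \<Rightarrow> nat \<Rightarrow> real" and B :: real where
    "\<And>i j. i \<le> N \<Longrightarrow> j \<le> N \<Longrightarrow> e i j \<in> R" "\<exists>i\<le>N. \<exists>j\<le>N. e i j \<noteq> 0"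
    "\<And>k. \<bar>\<Sum>i\<le>N. \<Sum>j\<le>N. e i j * w k ^ i * g k ^ j\<bar> \<le> B * w k ^ (N * N)"
proof -
  \<comment> \<open>The series is cut after \<open>s\<close> terms to a polynomial \<open>G\<close>;
    the tail is at most a constant times \<open>w k ^ (2 ^ s)\<close>, and
    \<open>2 ^ s > N * N\<close>.\<close>
  define s where "s = N * N"
  define G :: "real poly" where "G = (\<Sum>i<s. Polynomial.monom (b ^ i) (2 ^ i))"
  define I where "I = {..N} \<times> {..N}"
  define A where "A l ij = poly.coeff (Polynomial.monom 1 (fst ij) * G ^ snd ij) l" for l and ij :: "nat \<times> nat"
  have GR: "poly.coeff G l \<in> R" for l
    unfolding G_def coeff_sum by (intro R_sum) (auto intro: R_power b_in_R R_closed)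
  have AR: "A l ij \<in> R" for l ij unfolding A_def
    by (intro R_coeff_mult R_coeff_power GR) (auto intro: R_closed)
  have "\<exists>x. (\<forall>i\<in>I. x i \<in> R) \<and> (\<exists>i\<in>I. x i \<noteq> 0) \<and> (\<forall>l<N * N. (\<Sum>i\<in>I. A l i * x i) = 0)"
    by (rule homogeneous_solution_in_subring) (auto simp: I_def AR intro: R_closed)
  then obtain x where x: "\<And>i. i \<in> I \<Longrightarrow> x i \<in> R" "\<exists>i\<in>I. x i \<noteq> 0" "\<And>l. l < N * N \<Longrightarrow> (\<Sum>i\<in>I. A l i * x i) = 0"
    by blast
  define Q where "Q = (\<Sum>ij\<in>I. Polynomial.smult (x ij) (Polynomial.monom 1 (fst ij) * G ^ snd ij))"
  have Q0: "poly.coeff Q l = 0" if "l < N * N" for l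
    using x(3)[OF that] by (simp add: Q_def coeff_sum A_def mult.commute)
  define E where "E k z = (\<Sum>ij\<in>I. x ij * w k ^ fst ij * z ^ snd ij)" for k z
  have EQ: "E k (poly G (w k)) = poly Q (w k)" for k
    by (simp add: E_def Q_def poly_sum poly_monom mult.assoc)
  define B1 where "B1 = (\<Sum>l\<le>Polynomial.degree Q. \<bar>poly.coeff Q l\<bar>)"
  define B2 where "B2 = (\<Sum>ij\<in>I. \<bar>x ij\<bar> * (real N * (2 * b ^ s)))"
  have w01: "0 \<le> w k" "w k \<le> 1" for k using w_pos[of k] w_le[of k] by auto
  have Qle: "\<bar>poly Q (w k)\<bar> \<le> B1 * w k ^ (N * N)" for k
  proof -
    have "\<bar>poly Q (w k)\<bar> \<le> (\<Sum>l\<le>Polynomial.degree Q. \<bar>poly.coeff Q l * w k ^ l\<bar>)"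
      unfolding poly_altdef by (rule sum_abs)
    also have "\<dots> \<le> (\<Sum>l\<le>Polynomial.degree Q. \<bar>poly.coeff Q l\<bar> * w k ^ (N * N))"
    proof (intro sum_mono)
      fix l
      show "\<bar>poly.coeff Q l * w k ^ l\<bar> \<le> \<bar>poly.coeff Q l\<bar> * w k ^ (N * N)"
      proof (cases "l < N * N")
        case False
        hence "w k ^ l \<le> w k ^ (N * N)" using w01 by (intro power_decreasing) auto
        thus ?thesis using w01 by (simp add: abs_mult mult_left_mono)
      qed (simp add: Q0)
    qed
    finally show ?thesis by (simp add: B1_def sum_distrib_right)
  qed
  have Gg: "g k = poly G (w k) + b ^ s * g (k + s)" for k
    using g_split[of k s] by (simp add: G_def poly_sum poly_monom)
  have Ele: "\<bar>E k (g k) - E k (poly G (w k))\<bar> \<le> B2 * w k ^ (N * N)" for k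
  proof -
    have p0: "0 \<le> poly G (w k)" using b0 w01 by (simp add: G_def poly_sum poly_monom sum_nonneg)
    have g1: "g k \<le> 1" using g_le[of k] w_le[of k] by simp
    have bg: "0 \<le> b ^ s * g (k + s)" using b0 g_nonneg[of "k + s"] by simp
    have d: "\<bar>g k - poly G (w k)\<bar> \<le> 2 * b ^ s * w k ^ (N * N)"
    proof -
      have "w (k + s) \<le> w k ^ (N * N)" unfolding w_add using w01 less_exp[of s]
        by (intro power_decreasing) (auto simp: s_def)
      hence "g (k + s) \<le> 2 * w k ^ (N * N)" using g_le[of "k + s"] by linarith
      hence "b ^ s * g (k + s) \<le> b ^ s * (2 * w k ^ (N * N))" using b0 by (intro mult_left_mono) auto
      thus ?thesis using Gg[of k] bg by simp
    qed
    have "E k (g k) - E k (poly G (w k)) = (\<Sum>ij\<in>I. x ij * w k ^ fst ij * (g k ^ snd ij - poly G (w k) ^ snd ij))"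
      by (simp add: E_def algebra_simps sum_subtractf)
    also have "\<bar>\<dots>\<bar> \<le> (\<Sum>ij\<in>I. \<bar>x ij\<bar> * (real N * (2 * b ^ s * w k ^ (N * N))))"
    proof (rule order_trans[OF sum_abs sum_mono])
      fix ij assume ij: "ij \<in> I"
      have "norm (g k ^ snd ij - poly G (w k) ^ snd ij) \<le> real (snd ij) * norm (g k - poly G (w k))"
        by (rule norm_power_diff) (use g1 p0 bg Gg[of k] g_nonneg[of k] in auto)
      also have "\<dots> \<le> real N * (2 * b ^ s * w k ^ (N * N))"
        using d ij by (intro mult_mono) (auto simp: I_def)
      finally have 1: "\<bar>g k ^ snd ij - poly G (w k) ^ snd ij\<bar> \<le> real N * (2 * b ^ s * w k ^ (N * N))" by simp
      have "w k ^ fst ij \<le> 1" using w01 by (simp add: power_le_one)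
      hence "\<bar>x ij\<bar> * w k ^ fst ij \<le> \<bar>x ij\<bar>" by (simp add: mult_left_le)
      thus "\<bar>x ij * w k ^ fst ij * (g k ^ snd ij - poly G (w k) ^ snd ij)\<bar> \<le> \<bar>x ij\<bar> * (real N * (2 * b ^ s * w k ^ (N * N)))"
        using 1 w01(1)[of k] unfolding abs_mult by (intro mult_mono) auto
    qed
    also have "\<dots> = B2 * w k ^ (N * N)" unfolding B2_def sum_distrib_right by (intro sum.cong refl) (simp only: mult_ac)
    finally show ?thesis .
  qed
  show thesis
  proof (rule that[of "\<lambda>i j. x (i, j)" "B1 + B2"])
    show "x (i, j) \<in> R" if "i \<le> N" "j \<le> N" for i j using that x(1) by (simp add: I_def)
    show "\<exists>i\<le>N. \<exists>j\<le>N. x (i, j) \<noteq> 0" using x(2) by (auto simp: I_def)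
    fix k
    have "(\<Sum>i\<le>N. \<Sum>j\<le>N. x (i, j) * w k ^ i * g k ^ j) = E k (g k)"
      unfolding E_def I_def by (simp add: sum.cartesian_product case_prod_unfold)
    moreover have "\<bar>E k (g k)\<bar> \<le> (B1 + B2) * w k ^ (N * N)"
      using Ele[of k] Qle[of k] unfolding EQ distrib_right by linarith
    ultimately show "\<bar>\<Sum>i\<le>N. \<Sum>j\<le>N. x (i, j) * w k ^ i * g k ^ j\<bar> \<le> (B1 + B2) * w k ^ (N * N)" by simp
  qed
qed

lemma w_inj: "inj w"
proof (rule injI)
  fix i j assume "w i = w j"
  hence "20 * 2 ^ i = (20::nat) * 2 ^ j" unfolding w_def
    using y0 y1 by (metis power_inject_exp' less_irrefl)
  thus "i = j" by simp
qed

text \<open>The value \<open>E k\<close> of the auxiliary form is at most of order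
  \<open>y ^ (20 * N ^ 2 * 2 ^ k)\<close>, while the Liouville inequality bounds a nonzero value
  from below by about \<open>C ^ -(42 * N * 2 ^ k)\<close>. For large \<open>N\<close> the square
  wins, so \<open>E k\<close> vanishes for all large \<open>k\<close>, against
  \<open>mahler_sequence_independent\<close>.\<close>

theorem transcendental: "\<not> algebraic y"
proof
  assume "algebraic y"
  then obtain C d where C: "1 \<le> C" and L: "\<And>p n. ipoly p y \<noteq> 0 \<Longrightarrow> Polynomial.degree p \<le> n \<Longrightarrow>
      1 \<le> \<bar>ipoly p y\<bar> * C ^ (n + 1) * real_of_int (plen p) ^ d"
    using liouville_inequality by blast
  \<comment> \<open>42 bounds the degree of \<open>P k\<close> in units of \<open>N * 2 ^ k\<close>,
    up to a constant: 20 from the power of \<open>w k\<close>, 21 from that of \<open>gp k\<close>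
    and 1 from the factor \<open>[:4, -4:]\<close>.\<close>
  obtain N where N: "C ^ 42 * (y ^ 20) ^ N \<le> 1/2" "1 \<le> N"
  proof -
    have "y ^ 20 < 1" using y0 y1 by (simp add: power_less_one_iff)
    hence "(\<lambda>n. C ^ 42 * (y ^ 20) ^ n) \<longlonglongrightarrow> C ^ 42 * 0" using y0 by (intro tendsto_mult tendsto_const LIMSEQ_realpow_zero) auto
    hence "eventually (\<lambda>n. C ^ 42 * (y ^ 20) ^ n < 1/2) sequentially" by (intro order_tendstoD(2)) auto
    hence "eventually (\<lambda>n. C ^ 42 * (y ^ 20) ^ n < 1/2 \<and> 1 \<le> n) sequentially" using eventually_ge_at_top[of 1] by eventually_elim simp
    from eventually_happens'[OF sequentially_bot this] show thesis using that less_imp_le by blast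
  qed
  obtain e :: "nat \<Rightarrow> nat \<Rightarrow> real" and B where e: "\<And>i j. i \<le> N \<Longrightarrow> j \<le> N \<Longrightarrow> e i j \<in> R" "\<exists>i\<le>N. \<exists>j\<le>N. e i j \<noteq> 0"
    "\<And>k. \<bar>\<Sum>i\<le>N. \<Sum>j\<le>N. e i j * w k ^ i * g k ^ j\<bar> \<le> B * w k ^ (N * N)"
    using auxiliary_form[of N] by blast
  define E where "E k = (\<Sum>i\<le>N. \<Sum>j\<le>N. e i j * w k ^ i * g k ^ j)" for k
  define I where "I = {..N} \<times> {..N}"
  have "\<exists>n q. \<forall>ij\<in>I. y ^ n * e (fst ij) (snd ij) = ipoly (q ij) y"
    by (rule R_common_denominator) (auto simp: I_def e(1))
  then obtain n0 q where q: "\<And>ij. ij \<in> I \<Longrightarrow> y ^ n0 * e (fst ij) (snd ij) = ipoly (q ij) y" by blast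
  \<comment> \<open>\<open>gp k ^ j\<close> carries the factor \<open>(4 (1 - y)) ^ j\<close>; the
    power \<open>[:4, -4:] ^ (N - j)\<close> brings all terms to the common factor
    \<open>(4 (1 - y)) ^ N\<close>.\<close>
  define P where "P k = (\<Sum>ij\<in>I. q ij * Polynomial.monom 1 (20 * 2 ^ k * fst ij) * (gp k ^ snd ij * [:4, -4:] ^ (N - snd ij)))" for k
  define A where "A = (\<Sum>ij\<in>I. Polynomial.degree (q ij))"
  define Q where "Q = (\<Sum>ij\<in>I. plen (q ij))"
  have fI: "finite I" by (simp add: I_def)
  have PE: "ipoly (P k) y = y ^ n0 * (4 * (1 - y)) ^ N * E k" for k
  proof -
    have "ipoly (P k) y = (\<Sum>ij\<in>I. y ^ n0 * (4 * (1 - y)) ^ N * (e (fst ij) (snd ij) * w k ^ fst ij * g k ^ snd ij))"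
      unfolding P_def ipoly_sum
    proof (intro sum.cong refl)
      fix ij assume ij: "ij \<in> I"
      hence j: "snd ij \<le> N" by (auto simp: I_def)
      have l: "ipoly [:4, -4:] y = 4 * (1 - y)" by simp
      have "ipoly (q ij * Polynomial.monom 1 (20 * 2 ^ k * fst ij) * (gp k ^ snd ij * [:4, -4:] ^ (N - snd ij))) y
        = y ^ n0 * e (fst ij) (snd ij) * w k ^ fst ij * ((4 * (1 - y) * g k) ^ snd ij * (4 * (1 - y)) ^ (N - snd ij))"
        unfolding ipoly_simps(2) ipoly_power l ipoly_gp q[OF ij, symmetric] by (simp add: w_def power_mult)
      also have "(4 * (1 - y) * g k) ^ snd ij * (4 * (1 - y)) ^ (N - snd ij) = (4 * (1 - y)) ^ N * g k ^ snd ij"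
      proof -
        have "(4 * (1 - y)) ^ N = (4 * (1 - y)) ^ snd ij * (4 * (1 - y)) ^ (N - snd ij)" using j by (simp flip: power_add)
        thus ?thesis unfolding power_mult_distrib[of _ "g k"] by (simp only: mult_ac)
      qed
      finally show "ipoly (q ij * Polynomial.monom 1 (20 * 2 ^ k * fst ij) * (gp k ^ snd ij * [:4, -4:] ^ (N - snd ij))) y =
         y ^ n0 * (4 * (1 - y)) ^ N * (e (fst ij) (snd ij) * w k ^ fst ij * g k ^ snd ij)" by (simp only: mult_ac)
    qed
    also have "\<dots> = y ^ n0 * (4 * (1 - y)) ^ N * (\<Sum>ij\<in>I. e (fst ij) (snd ij) * w k ^ fst ij * g k ^ snd ij)"
      by (rule sum_distrib_left[symmetric])
    also have "(\<Sum>ij\<in>I. e (fst ij) (snd ij) * w k ^ fst ij * g k ^ snd ij) = E k"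
      unfolding E_def I_def by (simp add: sum.cartesian_product case_prod_unfold)
    finally show ?thesis .
  qed
  have degP: "Polynomial.degree (P k) \<le> A + 42 * N * 2 ^ k" for k
    unfolding P_def
  proof (intro degree_sum_le fI)
    fix ij assume ij: "ij \<in> I"
    have 1: "Polynomial.degree (q ij) \<le> A" unfolding A_def using fI ij by (intro member_le_sum) auto
    have 2: "Polynomial.degree (Polynomial.monom (1::int) (20 * 2 ^ k * fst ij)) \<le> 20 * 2 ^ k * N"
      using ij by (intro order_trans[OF degree_monom_le]) (auto simp: I_def)
    have 3: "Polynomial.degree (gp k ^ snd ij) \<le> (20 * 2 ^ k + 1) * N"
      using ij by (intro order_trans[OF degree_power_le] mult_mono degree_gp) (auto simp: I_def)
    have 4: "Polynomial.degree ([:4, -4::int:] ^ (N - snd ij)) \<le> 1 * N"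
      by (intro order_trans[OF degree_power_le] mult_mono) auto
    have "Polynomial.degree (q ij * Polynomial.monom 1 (20 * 2 ^ k * fst ij) * (gp k ^ snd ij * [:4, -4:] ^ (N - snd ij)))
      \<le> (A + 20 * 2 ^ k * N) + ((20 * 2 ^ k + 1) * N + 1 * N)"
      by (intro order_trans[OF degree_mult_le] add_mono 1 2 3 4)
    also have "\<dots> \<le> A + 42 * N * 2 ^ k"
    proof -
      have "N * 1 \<le> N * 2 ^ k" by (intro mult_left_mono) auto
      thus ?thesis by (simp add: algebra_simps)
    qed
    finally show "Polynomial.degree (q ij * Polynomial.monom 1 (20 * 2 ^ k * fst ij) * (gp k ^ snd ij * [:4, -4:] ^ (N - snd ij)))
      \<le> A + 42 * N * 2 ^ k" .
  qed
  have plenP: "plen (P k) \<le> Q * (8 * (int k + 1)) ^ N" for k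
  proof -
    have "plen (P k) \<le> (\<Sum>ij\<in>I. plen (q ij) * (8 * (int k + 1)) ^ N)"
      unfolding P_def
    proof (intro order_trans[OF plen_sum] sum_mono)
      fix ij assume ij: "ij \<in> I"
      have 3: "plen (gp k ^ snd ij) \<le> (8 * (int k + 1)) ^ snd ij"
        by (intro order_trans[OF plen_power] power_mono plen_gp plen_nonneg)
      have "plen ([:4, -4:] ^ (N - snd ij)) \<le> plen [:4, -4:] ^ (N - snd ij)" by (rule plen_power)
      also have "\<dots> \<le> (8 * (int k + 1)) ^ (N - snd ij)" by (intro power_mono) auto
      finally have 4: "plen ([:4, -4:] ^ (N - snd ij)) \<le> (8 * (int k + 1)) ^ (N - snd ij)" .
      have "plen (gp k ^ snd ij * [:4, -4:] ^ (N - snd ij)) \<le> (8 * (int k + 1)) ^ snd ij * (8 * (int k + 1)) ^ (N - snd ij)"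
        by (intro order_trans[OF plen_mult] mult_mono 3 4 plen_nonneg) simp
      also have "\<dots> = (8 * (int k + 1)) ^ N" using ij by (simp add: I_def mem_Times_iff flip: power_add)
      finally have 5: "plen (gp k ^ snd ij * [:4, -4:] ^ (N - snd ij)) \<le> (8 * (int k + 1)) ^ N" .
      have "plen (q ij * Polynomial.monom 1 (20 * 2 ^ k * fst ij)) \<le> plen (q ij)"
        using plen_mult[of "q ij" "Polynomial.monom 1 (20 * 2 ^ k * fst ij)"] by (simp only: plen_monom abs_one mult_1_right)
      thus "plen (q ij * Polynomial.monom 1 (20 * 2 ^ k * fst ij) * (gp k ^ snd ij * [:4, -4:] ^ (N - snd ij))) \<le> plen (q ij) * (8 * (int k + 1)) ^ N"
        by (rule order_trans[OF plen_mult mult_mono[OF _ 5 plen_nonneg plen_nonneg]])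
    qed
    thus ?thesis by (simp add: Q_def sum_distrib_right)
  qed
  define K where "K = 4 ^ N * B * C ^ (A + 1) * (real_of_int Q * 8 ^ N) ^ d"
  have key: "1 \<le> K * (real k + 1) ^ (N * d) * (1/2) ^ (2 ^ k)" if Ek: "E k \<noteq> 0" for k
  proof -
    have B0: "0 \<le> B * w k ^ (N * N)" using e(3)[of k] by linarith
    have P0: "ipoly (P k) y \<noteq> 0" using Ek y0 y1 by (simp add: PE)
    have a: "\<bar>ipoly (P k) y\<bar> \<le> 4 ^ N * (B * w k ^ (N * N))"
    proof -
      have "\<bar>ipoly (P k) y\<bar> = y ^ n0 * (4 * (1 - y)) ^ N * \<bar>E k\<bar>" using y0 y1 by (simp add: PE abs_mult)
      also have "\<dots> \<le> 1 * 4 ^ N * (B * w k ^ (N * N))"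
      proof (intro mult_mono)
        show "y ^ n0 \<le> 1" using y0 y1 by (intro power_le_one) auto
        show "(4 * (1 - y)) ^ N \<le> 4 ^ N" using y0 y1 by (intro power_mono) auto
        show "\<bar>E k\<bar> \<le> B * w k ^ (N * N)" unfolding E_def by (rule e(3))
      qed (use y0 y1 in auto)
      finally show ?thesis by simp
    qed
    have b: "C ^ (A + 42 * N * 2 ^ k + 1) * w k ^ (N * N) \<le> C ^ (A + 1) * (1/2) ^ (2 ^ k)"
    proof -
      have "C ^ (A + 42 * N * 2 ^ k + 1) * w k ^ (N * N) = C ^ (A + 1) * (C ^ (42 * N * 2 ^ k) * y ^ (20 * N * N * 2 ^ k))"
        unfolding w_def by (simp add: power_add mult_ac flip: power_mult)
      moreover have "C ^ (42 * N * 2 ^ k) * y ^ (20 * N * N * 2 ^ k) \<le> (1/2) ^ (2 ^ k)"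
      proof -
      have "C ^ (42 * N * 2 ^ k) * y ^ (20 * N * N * 2 ^ k) = ((C ^ 42 * (y ^ 20) ^ N) ^ N) ^ (2 ^ k)"
        by (simp only: power_mult power_mult_distrib)
      also have "\<dots> \<le> ((1/2) ^ N) ^ (2 ^ k)" using C y0 N by (intro power_mono) auto
      also have "\<dots> \<le> ((1/2) ^ 1) ^ (2 ^ k)" using N(2) by (intro power_mono power_decreasing) auto
      finally show ?thesis by (simp only: power_one_right)
      qed
      ultimately show ?thesis using C by (simp only: mult_left_mono zero_le_power order_trans[OF zero_le_one])
    qed
    have c: "real_of_int (plen (P k)) ^ d \<le> (real_of_int Q * 8 ^ N) ^ d * (real k + 1) ^ (N * d)"
    proof -
      have "real_of_int (plen (P k)) \<le> real_of_int (Q * (8 * (int k + 1)) ^ N)" using plenP[of k] by (simp only: of_int_le_iff)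
      also have "\<dots> = real_of_int Q * 8 ^ N * (real k + 1) ^ N"
        by (simp only: of_int_mult of_int_power of_int_add of_int_of_nat_eq of_int_numeral of_int_1 power_mult_distrib mult.assoc)
      finally have "real_of_int (plen (P k)) ^ d \<le> (real_of_int Q * 8 ^ N * (real k + 1) ^ N) ^ d"
        using plen_nonneg by (intro power_mono) auto
      thus ?thesis by (simp only: power_mult_distrib power_mult)
    qed
    have Q0: "0 \<le> real_of_int Q" by (simp add: Q_def plen_nonneg sum_nonneg)
    have "1 \<le> \<bar>ipoly (P k) y\<bar> * C ^ (A + 42 * N * 2 ^ k + 1) * real_of_int (plen (P k)) ^ d" by (rule L[OF P0 degP])
    also have "\<dots> \<le> (4 ^ N * (B * w k ^ (N * N))) * C ^ (A + 42 * N * 2 ^ k + 1) * ((real_of_int Q * 8 ^ N) ^ d * (real k + 1) ^ (N * d))"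
      by (intro mult_mono a c) (use C B0 plen_nonneg in auto)
    also have "\<dots> = (4 ^ N * B * ((real_of_int Q * 8 ^ N) ^ d * (real k + 1) ^ (N * d))) * (C ^ (A + 42 * N * 2 ^ k + 1) * w k ^ (N * N))"
      by (simp only: mult_ac)
    also have "\<dots> \<le> (4 ^ N * B * ((real_of_int Q * 8 ^ N) ^ d * (real k + 1) ^ (N * d))) * (C ^ (A + 1) * (1/2) ^ (2 ^ k))"
    proof (rule mult_left_mono[OF b])
      have "0 \<le> B" using B0 zero_less_power[OF w_pos[of k], of "N * N"] by (simp add: zero_le_mult_iff)
      thus "0 \<le> 4 ^ N * B * ((real_of_int Q * 8 ^ N) ^ d * (real k + 1) ^ (N * d))" using Q0 by simp
    qed
    also have "\<dots> = K * (real k + 1) ^ (N * d) * (1/2) ^ (2 ^ k)" unfolding K_def by (simp only: mult_ac)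
    finally show ?thesis .
  qed
  have "eventually (\<lambda>k. E k = 0) sequentially"
    using polynomial_times_exponential_small[of K "N * d"]
    by (rule eventually_mono) (use key not_less in blast)
  then obtain k0 where k0: "\<And>k. k \<ge> k0 \<Longrightarrow> E k = 0" unfolding eventually_sequentially by blast
  define f where "f = (\<Sum>j\<le>N. Polynomial.monom (\<Sum>i\<le>N. Polynomial.monom (e i j) i) j)"
  have cf: "poly.coeff (poly.coeff f j) i = e i j" if "i \<le> N" "j \<le> N" for i j
    using that by (simp add: f_def coeff_sum)
  show False
  proof (rule mahler_sequence_independent[OF w_Suc w_inj g_rec, of f k0])
    show "b \<noteq> 0" using b0 by simp
    show "f \<noteq> 0" using e(2) cf by fastforce
    fix k assume "k \<ge> k0"
    have "eval2 f (w k) (g k) = (\<Sum>j\<le>N. \<Sum>i\<le>N. e i j * w k ^ i * g k ^ j)"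
      by (simp add: f_def poly_sum poly_monom sum_distrib_right flip: power_mult_distrib)
    also have "\<dots> = E k" unfolding E_def by (rule sum.swap)
    finally show "eval2 f (w k) (g k) = 0" using k0[OF \<open>k \<ge> k0\<close>] by simp
  qed
qed

end

section \<open>Valuations and heights over the rationals\<close>

abbreviation is_prime :: "nat \<Rightarrow> bool"
  where "is_prime \<equiv> Factorial_Ring.prime"

section \<open>Valuations of rational numbers at a prime\<close>

definition pval :: "nat \<Rightarrow> rat \<Rightarrow> int"
  where "pval p x = int (multiplicity (int p) (fst (quotient_of x))) - int (multiplicity (int p) (snd (quotient_of x)))"

lemma rat_fraction:
  fixes x :: rat
  obtains a b :: int where "0 < b" "x = of_int a / of_int b"
  using quotient_of_div quotient_of_denom_pos by (metis surj_pair)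

lemma rat_fraction2:
  fixes x y :: rat
  obtains a c b :: int where "0 < b" "x = of_int a / of_int b" "y = of_int c / of_int b"
proof -
  obtain a b where 1: "0 < b" "x = of_int a / of_int b" by (rule rat_fraction)
  obtain c d where 2: "0 < d" "y = of_int c / of_int d" by (rule rat_fraction)
  show thesis by (rule that[of "b * d" "a * d" "c * b"]) (use 1 2 in \<open>simp_all add: field_simps\<close>)
qed

lemma pval_fraction:
  assumes p: "is_prime p" and "a \<noteq> 0" "b \<noteq> 0"
  shows "pval p (of_int a / of_int b) = int (multiplicity (int p) a) - int (multiplicity (int p) b)"
proof -
  obtain n d where nd: "quotient_of (of_int a / of_int b) = (n, d)" by force
  have d: "d > 0" using quotient_of_denom_pos[OF nd] .
  have e: "of_int a / of_int b = (of_int n / of_int d :: rat)" using quotient_of_div[OF nd] .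
  have "n \<noteq> 0" using e assms d by auto
  have "of_int (a * d) = (of_int (n * b) :: rat)" using e assms d by (simp add: field_simps)
  hence ad: "a * d = n * b" by (simp only: of_int_eq_iff)
  have pe: "prime_elem (int p)" using p by simp
  have "multiplicity (int p) a + multiplicity (int p) d = multiplicity (int p) n + multiplicity (int p) b"
    using arg_cong[OF ad, of "multiplicity (int p)"] assms d \<open>n \<noteq> 0\<close>
    by (simp add: prime_elem_multiplicity_mult_distrib[OF pe])
  thus ?thesis unfolding pval_def nd by simp
qed

lemma pval_int: "is_prime p \<Longrightarrow> a \<noteq> 0 \<Longrightarrow> pval p (of_int a) = int (multiplicity (int p) a)"
  using pval_fraction[of p a 1] by simp

lemma pval_mult:
  assumes p: "is_prime p" and "x \<noteq> 0" "y \<noteq> 0"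
  shows "pval p (x * y) = pval p x + pval p y"
proof -
  obtain a b where 1: "0 < b" "x = of_int a / of_int b" by (rule rat_fraction)
  obtain c d where 2: "0 < d" "y = of_int c / of_int d" by (rule rat_fraction)
  have nz: "a \<noteq> 0" "c \<noteq> 0" "b \<noteq> 0" "d \<noteq> 0" using assms 1 2 by auto
  have pe: "prime_elem (int p)" using p by simp
  have "x * y = of_int (a * c) / of_int (b * d)" by (simp add: 1 2)
  hence "pval p (x * y) = int (multiplicity (int p) (a * c)) - int (multiplicity (int p) (b * d))"
    using pval_fraction[OF p, of "a * c" "b * d"] nz by simp
  thus ?thesis using nz unfolding 1 2 by (simp add: pval_fraction[OF p] prime_elem_multiplicity_mult_distrib[OF pe])
qed

lemma pval_add:
  assumes p: "is_prime p" and "x \<noteq> 0" "y \<noteq> 0" "x + y \<noteq> 0"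
  shows "min (pval p x) (pval p y) \<le> pval p (x + y)"
proof -
  obtain b a c where 1: "0 < b" "x = of_int a / of_int b" "y = of_int c / of_int b" by (rule rat_fraction2)
  have s: "x + y = of_int (a + c) / of_int b" by (simp add: 1 add_divide_distrib)
  have nz: "a \<noteq> 0" "c \<noteq> 0" "b \<noteq> 0" "a + c \<noteq> 0" using assms 1 s by auto
  let ?k = "min (multiplicity (int p) a) (multiplicity (int p) c)"
  have "int p ^ ?k dvd a + c" by (intro dvd_add multiplicity_dvd') auto
  hence "?k \<le> multiplicity (int p) (a + c)" using p nz by (intro multiplicity_geI) (auto simp: prime_gt_0_nat not_prime_unit)
  thus ?thesis unfolding s unfolding 1 using nz by (simp only: pval_fraction[OF p nz(1,3)] pval_fraction[OF p nz(2,3)] pval_fraction[OF p nz(4,3)])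
qed

definition pabs :: "nat \<Rightarrow> rat \<Rightarrow> real"
  where "pabs p x = (if x = 0 then 0 else real p powr (- real_of_int (pval p x)))"

lemma nonarch_pabs: "is_prime p \<Longrightarrow> nonarch (pabs p)"
proof
  assume p: "is_prime p"
  hence p1: "1 < real p" using prime_gt_1_nat by simp
  fix x y
  show "0 \<le> pabs p x" by (simp add: pabs_def)
  show "pabs p x = 0 \<longleftrightarrow> x = 0" using p1 by (simp add: pabs_def)
  show "pabs p (x * y) = pabs p x * pabs p y"
    using p by (simp add: pabs_def pval_mult powr_diff powr_minus_divide)
  show "pabs p (x + y) \<le> max (pabs p x) (pabs p y)"
  proof (cases "x = 0 \<or> y = 0 \<or> x + y = 0")
    case True thus ?thesis by (auto simp: pabs_def le_max_iff_disj)
  next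
    case False
    hence "min (pval p x) (pval p y) \<le> pval p (x + y)" using p by (intro pval_add) auto
    hence "pval p x \<le> pval p (x + y) \<or> pval p y \<le> pval p (x + y)" by linarith
    hence "pabs p (x + y) \<le> pabs p x \<or> pabs p (x + y) \<le> pabs p y" using False p1 by (auto simp: pabs_def)
    thus ?thesis by linarith
  qed
qed

lemma pabs_int_coprime: "is_prime p \<Longrightarrow> \<not> int p dvd n \<Longrightarrow> pabs p (of_int n) = 1"
  using pval_int[of p n] prime_gt_0_nat[of p] by (auto simp: pabs_def not_dvd_imp_multiplicity_0)

text \<open>A power of \<open>p\<close> that divides \<open>n\<close> is at most the absolute value
  of \<open>n\<close>. The bound does not depend on \<open>p\<close>, so it controls the path
  coordinates at all primes at once.\<close>

lemma pabs_int_lower: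
  assumes p: "is_prime p" and n: "n \<noteq> 0" shows "1 / real_of_int \<bar>n\<bar> \<le> pabs p (of_int n)"
proof -
  have "int p ^ multiplicity (int p) n \<le> \<bar>n\<bar>" using n multiplicity_dvd[of "int p" n]
    by (metis abs_of_nat dvd_imp_le_int of_nat_power)
  hence "real_of_int (int p ^ multiplicity (int p) n) \<le> real_of_int \<bar>n\<bar>" by (simp only: of_int_le_iff)
  hence "real p ^ multiplicity (int p) n \<le> real_of_int \<bar>n\<bar>" by simp
  moreover have "pabs p (of_int n) = 1 / real p ^ multiplicity (int p) n"
    using n p prime_gt_0_nat[OF p] by (simp add: pabs_def pval_int powr_minus_divide powr_realpow)
  ultimately show ?thesis using prime_gt_0_nat[OF p] by (simp add: frac_le)
qed

lemma pabs_int_large_prime: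
  assumes p: "is_prime p" and n: "n \<noteq> 0" "\<bar>n\<bar> < int p" shows "pabs p (of_int n) = 1"
  using p n by (intro pabs_int_coprime) (auto dest: zdvd_not_zless dvd_imp_le_int)

lemma nonarch23_pabs:
  assumes p: "is_prime p" "5 \<le> p" shows "nonarch23 (pabs p)"
proof -
  interpret nonarch "pabs p" by (rule nonarch_pabs[OF p(1)])
  show ?thesis
  proof
    show "pabs p 2 = 1" using pabs_int_large_prime[OF p(1), of 2] p(2) by simp
    show "pabs p 3 = 1" using pabs_int_large_prime[OF p(1), of 3] p(2) by simp
  qed
qed

lemma pabs_23: "p = 2 \<or> p = 3 \<Longrightarrow> pabs p 12 < 1"
proof -
  assume p: "p = 2 \<or> p = 3"
  have "is_prime 3"
  proof (clarsimp simp: prime_nat_iff')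
    fix n :: nat assume n: "n dvd 3" "2 \<le> n" "n < 3"
    hence "n = 2" by simp
    hence "(2::nat) dvd 3" using n(1) by simp
    thus False by presburger
  qed
  hence pr: "is_prime p" using p by auto
  have "0 < multiplicity (int p) 12" using p by (auto simp: multiplicity_gt_zero_iff)
  hence "0 < pval p 12" using pval_int[OF pr, of 12] by simp
  thus ?thesis using pr prime_gt_1_nat[OF pr] by (simp add: pabs_def powr_less_one)
qed

lemma finite_pabs_neq_1:
  assumes "x \<noteq> 0" shows "finite {p. is_prime p \<and> pabs p x \<noteq> 1}"
proof -
  obtain a b where 1: "0 < b" "x = of_int a / of_int b" by (rule rat_fraction)
  have nz: "a \<noteq> 0" "b \<noteq> 0" using assms 1 by auto
  have "{p. is_prime p \<and> pabs p x \<noteq> 1} \<subseteq> {..nat (\<bar>a\<bar> + \<bar>b\<bar>)}"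
  proof (clarsimp)
    fix p assume p: "is_prime p" "pabs p x \<noteq> 1"
    interpret nonarch "pabs p" by (rule nonarch_pabs[OF p(1)])
    show "p \<le> nat (\<bar>a\<bar> + \<bar>b\<bar>)"
    proof (rule ccontr)
      assume "\<not> p \<le> nat (\<bar>a\<bar> + \<bar>b\<bar>)"
      hence "\<bar>a\<bar> < int p" "\<bar>b\<bar> < int p" by linarith+
      hence "pabs p x = 1" using nz unfolding 1 v_divide by (simp add: pabs_int_large_prime[OF p(1)])
      thus False using p by simp
    qed
  qed
  thus ?thesis using finite_subset by blast
qed

lemma finite_pabs_gt_1: "finite {p. is_prime p \<and> 1 < pabs p x}"
proof (cases "x = 0")
  case True thus ?thesis by (simp add: pabs_def)
next
  case False show ?thesis by (rule finite_subset[OF _ finite_pabs_neq_1[OF False]]) auto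
qed

section \<open>The product formula\<close>

lemma ln_int_eq_sum:
  assumes S: "finite S" "\<And>p. p \<in> S \<Longrightarrow> is_prime p" "\<And>p. is_prime p \<Longrightarrow> int p dvd n \<Longrightarrow> p \<in> S" and n: "n \<noteq> 0"
  shows "(\<Sum>p\<in>S. real (multiplicity (int p) n) * ln (real p)) = ln (real_of_int \<bar>n\<bar>)"
proof -
  define m where "m = nat \<bar>n\<bar>"
  have m: "m \<noteq> 0" using n by (simp add: m_def)
  have mult: "multiplicity (int p) n = multiplicity p m" if "is_prime p" for p
  proof -
    have "\<not> int p ^ Suc (multiplicity p m) dvd n"
    proof
      assume "int p ^ Suc (multiplicity p m) dvd n"
      hence "p ^ Suc (multiplicity p m) dvd m" by (simp add: m_def flip: of_nat_power int_dvd_int_iff del: power_Suc)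
      thus False using m that by (metis Suc_n_not_le_n multiplicity_geI not_prime_unit)
    qed
    moreover have "int p ^ multiplicity p m dvd n"
      using multiplicity_dvd[of p m] by (simp add: m_def flip: of_nat_power int_dvd_int_iff)
    ultimately show ?thesis by (intro multiplicity_eqI)
  qed
  have sub: "prime_factors m \<subseteq> S"
  proof
    fix p assume "p \<in> prime_factors m"
    hence "is_prime p" "p dvd m" by auto
    thus "p \<in> S" using S(3) by (metis abs_dvd_iff dvd_abs_iff int_dvd_int_iff int_nat_eq m_def abs_ge_zero)
  qed
  have "real m = (\<Prod>p\<in>prime_factors m. real p ^ multiplicity p m)"
    using prime_factorization_nat[of m] m by (metis (no_types, lifting) gr0I of_nat_power of_nat_prod prod.cong)
  hence "ln (real m) = (\<Sum>p\<in>prime_factors m. ln (real p ^ multiplicity p m))"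
    by (simp only:) (rule ln_prod, auto intro!: zero_less_power prime_gt_0_nat dest: in_prime_factors_imp_prime)
  also have "\<dots> = (\<Sum>p\<in>prime_factors m. real (multiplicity p m) * ln (real p))"
    by (intro sum.cong refl ln_realpow)
  also have "\<dots> = (\<Sum>p\<in>S. real (multiplicity p m) * ln (real p))"
    using S sub by (intro sum.mono_neutral_left) (auto simp: prime_factors_multiplicity)
  also have "\<dots> = (\<Sum>p\<in>S. real (multiplicity (int p) n) * ln (real p))"
    using S(2) by (intro sum.cong refl) (simp add: mult)
  finally show ?thesis by (simp add: m_def)
qed

theorem product_formula:
  assumes S: "finite S" "\<And>p. p \<in> S \<Longrightarrow> is_prime p" "\<And>p. is_prime p \<Longrightarrow> p \<notin> S \<Longrightarrow> pabs p x = 1" and x: "x \<noteq> 0"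
  shows "(\<Sum>p\<in>S. ln (pabs p x)) = - ln (real_of_rat \<bar>x\<bar>)"
proof -
  obtain a b where 1: "0 < b" "x = of_int a / of_int b" by (rule rat_fraction)
  have nz: "a \<noteq> 0" "b \<noteq> 0" using x 1 by auto
  define S' where "S' = S \<union> {p. is_prime p \<and> (int p dvd a \<or> int p dvd b)}"
  have fd: "finite {p. is_prime p \<and> int p dvd n}" if "n \<noteq> 0" for n
  proof (rule finite_subset)
    show "{p. is_prime p \<and> int p dvd n} \<subseteq> {..nat \<bar>n\<bar>}"
    proof (rule subsetI)
      fix p assume "p \<in> {p. is_prime p \<and> int p dvd n}"
      hence "\<bar>int p\<bar> \<le> \<bar>n\<bar>" by (intro dvd_imp_le_int[OF that]) simp
      thus "p \<in> {..nat \<bar>n\<bar>}" unfolding atMost_iff by linarith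
    qed
  qed simp
  have "finite S'"
  proof -
    have "{p. is_prime p \<and> (int p dvd a \<or> int p dvd b)} = {p. is_prime p \<and> int p dvd a} \<union> {p. is_prime p \<and> int p dvd b}" by auto
    thus ?thesis using S fd nz by (simp add: S'_def)
  qed
  have pS': "is_prime p" if "p \<in> S'" for p using that S by (auto simp: S'_def)
  have "(\<Sum>p\<in>S. ln (pabs p x)) = (\<Sum>p\<in>S'. ln (pabs p x))"
  proof (rule sum.mono_neutral_left[OF \<open>finite S'\<close>])
    show "S \<subseteq> S'" by (simp add: S'_def)
    show "\<forall>p\<in>S' - S. ln (pabs p x) = 0"
    proof
      fix p assume "p \<in> S' - S"
      hence "pabs p x = 1" using S(3) pS' by blast
      thus "ln (pabs p x) = 0" by simp
    qed
  qed
  also have "\<dots> = (\<Sum>p\<in>S'. real (multiplicity (int p) b) * ln (real p) - real (multiplicity (int p) a) * ln (real p))"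
  proof (intro sum.cong refl)
    fix p assume "p \<in> S'"
    hence p: "is_prime p" by (rule pS')
    show "ln (pabs p x) = real (multiplicity (int p) b) * ln (real p) - real (multiplicity (int p) a) * ln (real p)"
      using x prime_gt_0_nat[OF p] unfolding pabs_def 1 by (simp add: pval_fraction[OF p nz] ln_powr algebra_simps)
  qed
  also have "\<dots> = ln (real_of_int \<bar>b\<bar>) - ln (real_of_int \<bar>a\<bar>)"
  proof -
    have "p \<in> S'" if "is_prime p" "int p dvd a \<or> int p dvd b" for p using that by (simp add: S'_def)
    hence "(\<Sum>p\<in>S'. real (multiplicity (int p) b) * ln (real p)) = ln (real_of_int \<bar>b\<bar>)"
      "(\<Sum>p\<in>S'. real (multiplicity (int p) a) * ln (real p)) = ln (real_of_int \<bar>a\<bar>)"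
      using ln_int_eq_sum[OF \<open>finite S'\<close> pS' _ nz(2)] ln_int_eq_sum[OF \<open>finite S'\<close> pS' _ nz(1)] by blast+
    thus ?thesis unfolding sum_subtractf by (simp only:)
  qed
  also have "\<dots> = - ln (real_of_rat \<bar>x\<bar>)"
    using nz by (simp add: 1 abs_divide of_rat_divide ln_div flip: of_int_abs)
  finally show ?thesis .
qed

section \<open>The rationals inside their algebraic closure: embeddings and places\<close>

lemma qbar_ring_simps [simp]:
  "carrier qbar_ring = UNIV" "x \<otimes>\<^bsub>qbar_ring\<^esub> y = x * y" "x \<oplus>\<^bsub>qbar_ring\<^esub> y = x + y"
  "\<one>\<^bsub>qbar_ring\<^esub> = 1" "\<zero>\<^bsub>qbar_ring\<^esub> = 0"
  by (simp_all add: ring_of_type_algebra_def)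

lemma qbar_field: "Ring.field qbar_ring" by (rule field_from_type_algebra)

interpretation qbar: cring qbar_ring by (rule cring_from_type_algebra)

lemma qbar_a_inv [simp]: "\<ominus>\<^bsub>qbar_ring\<^esub> x = - x"
  using qbar.minus_equality[of "- x" x] by simp

lemma qbar_m_inv [simp]: "x \<noteq> 0 \<Longrightarrow> inv\<^bsub>qbar_ring\<^esub> x = inverse x"
  using qbar.comm_inv_char[of x "inverse x"] by simp

lemma subfield_Rats: "subfield \<rat> qbar_ring"
  by (rule field.subfieldI'[OF qbar_field]) (auto intro!: qbar.subringI)

text \<open>The whole orbit has rational coordinates, so its heights are computed over the
  rationals.\<close>

lemma generate_field_rational:
  assumes "S \<subseteq> \<rat>" shows "generate_field qbar_ring S = \<rat>"
proof
  show "generate_field qbar_ring S \<subseteq> \<rat>" using assms by (intro field.generate_field_min_subfield1[OF qbar_field] subfield_Rats) auto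
  let ?G = "generate_field qbar_ring S"
  have one: "1 \<in> ?G" using generate_field.one[of qbar_ring S] by simp
  have neg: "- x \<in> ?G" if "x \<in> ?G" for x using generate_field.a_inv[OF that] by simp
  have add: "x + y \<in> ?G" if "x \<in> ?G" "y \<in> ?G" for x y using generate_field.eng_add[OF that] by simp
  have zero: "0 \<in> ?G" using add[OF one neg[OF one]] by simp
  have nat: "of_nat n \<in> ?G" for n by (induction n) (auto intro: zero one add)
  have int: "of_int n \<in> ?G" for n by (cases n rule: int_cases2) (auto intro: nat neg)
  show "\<rat> \<subseteq> ?G"
  proof
    fix x :: qbar assume "x \<in> \<rat>"
    then obtain c where "x = of_rat c" by (auto elim: Rats_cases)
    moreover obtain a b where ab: "0 < b" "c = of_int a / of_int b" by (rule rat_fraction)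
    ultimately have x: "x = of_int a * inverse (of_int b)" by (simp add: of_rat_mult of_rat_inverse divide_inverse)
    have "inverse (of_int b) \<in> ?G" using generate_field.m_inv[OF int[of b]] ab by simp
    thus "x \<in> ?G" unfolding x using generate_field.eng_mult[OF int[of a], of "inverse (of_int b)"] by simp
  qed
qed

lemma dim_Rats: "ring.dim qbar_ring \<rat> \<rat> = 1"
  unfolding qbar.dim_def
  by (rule the_equality) (use qbar.dimension_one[OF subfield_Rats] qbar.dimension_is_inj[OF subfield_Rats] in blast)+

definition qr :: "qbar \<Rightarrow> rat" where "qr x = (THE c. of_rat c = x)"

lemma qr_of_rat [simp]: "qr (of_rat c) = c" by (simp add: qr_def)

lemma embedding_of_rat:
  assumes "s \<in> embeddings \<rat>" shows "s (of_rat c) = of_rat c"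
proof -
  have h: "s (x + y) = s x + s y" "s (x * y) = s x * s y" if "x \<in> \<rat>" "y \<in> \<rat>" for x y
    using assms that by (auto simp: embeddings_def Ring.ring_hom_def ring_of_type_algebra_def)
  have "s 1 = 1" using assms by (auto simp: embeddings_def Ring.ring_hom_def ring_of_type_algebra_def)
  note h = h this
  have 0: "s 0 = 0" using h(1)[of 0 0] by simp
  have nat: "s (of_nat n) = of_nat n" for n by (induction n) (auto simp: 0 h)
  have neg: "s (- x) = - s x" if "x \<in> \<rat>" for x using h(1)[of x "- x"] that 0 by (simp add: eq_neg_iff_add_eq_0 add.commute)
  have int: "s (of_int n) = of_int n" for n by (cases n rule: int_cases2) (auto simp: nat neg)
  obtain a b where ab: "0 < b" "c = of_int a / of_int b" by (rule rat_fraction)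
  have "of_rat c * (of_int b :: qbar) = of_int a" using ab by (simp add: of_rat_divide)
  hence "s (of_rat c) * of_int b = of_int a" by (metis h(2) int Rats_of_int Rats_of_rat)
  moreover have "of_rat c * (of_int b :: complex) = of_int a" using ab by (simp add: of_rat_divide)
  ultimately have "s (of_rat c) * of_int b = of_rat c * of_int b" by simp
  thus ?thesis using ab(1) by simp
qed

lemma embeddings_Rats: "embeddings \<rat> = {restrict (\<lambda>x. of_rat (qr x)) \<rat>}"
proof -
  have "restrict (\<lambda>x. of_rat (qr x)) \<rat> \<in> embeddings \<rat>"
    by (auto simp: embeddings_def Ring.ring_hom_def ring_of_type_algebra_def elim!: Rats_cases
       simp flip: of_rat_add of_rat_mult) (metis of_rat_1 qr_of_rat)
  moreover have "s = restrict (\<lambda>x. of_rat (qr x)) \<rat>" if s: "s \<in> embeddings \<rat>" for s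
  proof (rule extensionalityI)
    show "s \<in> extensional \<rat>" using s by (simp add: embeddings_def)
    fix x :: qbar assume "x \<in> \<rat>"
    thus "s x = restrict (\<lambda>x. of_rat (qr x)) \<rat> x" using embedding_of_rat[OF s] by (auto elim!: Rats_cases)
  qed simp
  ultimately show ?thesis by blast
qed

definition place :: "nat \<Rightarrow> qbar \<Rightarrow> int"
  where "place p = restrict (\<lambda>x. pval p (qr x)) (\<rat> - {0})"

lemma place_of_rat: "c \<noteq> 0 \<Longrightarrow> place p (of_rat c) = pval p c" by (simp add: place_def)

lemma pval_power: "is_prime p \<Longrightarrow> pval p (of_nat p ^ k) = int k"
  using pval_int[of p "int p ^ k"] prime_gt_1_nat[of p] by (simp add: multiplicity_same_power)

lemma pval_inverse: "is_prime p \<Longrightarrow> x \<noteq> 0 \<Longrightarrow> pval p (inverse x) = - pval p x"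
proof -
  assume p: "is_prime p" and x: "x \<noteq> 0"
  have "pval p 1 = 0" using pval_power[OF p, of 0] by simp
  thus ?thesis using pval_mult[OF p x, of "inverse x"] x by simp
qed

lemma place_in_finite_places:
  assumes p: "is_prime p" shows "place p \<in> finite_places \<rat>"
proof -
  have "k \<in> place p ` (\<rat> - {0})" for k
  proof -
    define c :: rat where "c = (if k \<ge> 0 then of_nat p ^ nat k else inverse (of_nat p ^ nat (- k)))"
    have c: "c \<noteq> 0" "pval p c = k" using prime_gt_0_nat[OF p] by (auto simp: c_def pval_power[OF p] pval_inverse[OF p])
    hence "k = place p (of_rat c)" by (simp add: place_of_rat)
    thus ?thesis using c by (intro image_eqI[of _ _ "of_rat c"]) auto
  qed
  hence "place p ` (\<rat> - {0}) = UNIV" by blast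
  moreover have "place p (x * y) = place p x + place p y" if "x \<in> \<rat> - {0}" "y \<in> \<rat> - {0}" for x y
  proof -
    obtain a b where ab: "x = of_rat a" "y = of_rat b" using \<open>x \<in> \<rat> - {0}\<close> \<open>y \<in> \<rat> - {0}\<close> by (auto elim!: Rats_cases)
    have nz: "a \<noteq> 0" "b \<noteq> 0" "a * b \<noteq> 0" using that unfolding ab by auto
    show ?thesis unfolding ab of_rat_mult[symmetric] using pval_mult[OF p nz(1,2)] by (simp only: place_of_rat nz not_False_eq_True)
  qed
  moreover have "min (place p x) (place p y) \<le> place p (x + y)" if "x \<in> \<rat> - {0}" "y \<in> \<rat> - {0}" "x + y \<noteq> 0" for x y
  proof -
    obtain a b where ab: "x = of_rat a" "y = of_rat b" using \<open>x \<in> \<rat> - {0}\<close> \<open>y \<in> \<rat> - {0}\<close> by (auto elim!: Rats_cases)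
    have nz: "a \<noteq> 0" "b \<noteq> 0" "a + b \<noteq> 0" using that unfolding ab of_rat_add[symmetric] by auto
    show ?thesis unfolding ab of_rat_add[symmetric] using pval_add[OF p nz] by (simp only: place_of_rat nz not_False_eq_True)
  qed
  ultimately show ?thesis unfolding finite_places_def by (auto simp: place_def)
qed

text \<open>The nonarchimedean half of Ostrowski's theorem. The least positive integer with positive
  value is a prime \<open>p\<close>; division with remainder shows that integers prime to
  \<open>p\<close> have value 0, so the valuation is a multiple of the one at \<open>p\<close>, and
  surjectivity makes the multiple 1.\<close>

lemma finite_place_is_place:
  assumes v: "v \<in> finite_places \<rat>" shows "\<exists>p. is_prime p \<and> v = place p"
proof -
  define u where "u c = v (of_rat c)" for c :: rat
  have mult: "u (x * y) = u x + u y" if "x \<noteq> 0" "y \<noteq> 0" for x y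
    using v that by (simp add: finite_places_def u_def of_rat_mult)
  have add: "min (u x) (u y) \<le> u (x + y)" if "x \<noteq> 0" "y \<noteq> 0" "x + y \<noteq> 0" for x y
  proof -
    have "(of_rat x + of_rat y :: qbar) \<noteq> 0" using that by (simp flip: of_rat_add)
    thus ?thesis using v that by (simp add: finite_places_def u_def of_rat_add)
  qed
  have surj: "\<exists>c. c \<noteq> 0 \<and> u c = 1"
  proof -
    have "1 \<in> v ` (\<rat> - {0})" using v by (simp add: finite_places_def)
    thus ?thesis by (auto simp: u_def elim!: Rats_cases)
  qed
  have u1: "u 1 = 0" using mult[of 1 1] by simp
  have um1: "u (-1) = 0" using mult[of "-1" "-1"] u1 by simp
  have neg: "u (- x) = u x" if "x \<noteq> 0" for x using mult[of "-1" x] that um1 by simp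
  have nonneg: "0 \<le> u (of_nat (Suc n))" for n
  proof (induction n)
    case (Suc n) thus ?case using add[of "of_nat (Suc n)" 1] u1 by (simp add: add.commute)
  qed (simp add: u1)
  have nonneg': "0 \<le> u (of_int n)" if "n \<noteq> 0" for n
  proof -
    have "nat \<bar>n\<bar> = Suc (nat \<bar>n\<bar> - 1)" using that by simp
    moreover have "u (of_int n) = u (of_nat (nat \<bar>n\<bar>))" using that neg[of "of_int n"] by (simp add: abs_if)
    ultimately show ?thesis using nonneg by metis
  qed
  have ex: "\<exists>n>0. 0 < u (of_nat n)"
  proof (rule ccontr)
    assume "\<not> (\<exists>n>0. 0 < u (of_nat n))"
    have z: "u (of_nat n) = 0" if "0 < n" for n
    proof -
      have "\<not> 0 < u (of_nat n)" using \<open>\<not> (\<exists>n>0. 0 < u (of_nat n))\<close> that by blast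
      moreover have "0 \<le> u (of_nat n)" using nonneg[of "n - 1"] that by simp
      ultimately show ?thesis by simp
    qed
    have z': "u (of_int n) = 0" if "n \<noteq> 0" for n
    proof (cases "0 < n")
      case True thus ?thesis using z[of "nat n"] by simp
    next
      case False
      thus ?thesis using z[of "nat (- n)"] neg[of "of_int n"] that by simp
    qed
    obtain c where c: "c \<noteq> 0" "u c = 1" using surj by blast
    obtain a b where ab: "0 < b" "c = of_int a / of_int b" by (rule rat_fraction)
    have "u (c * of_int b) = u c + u (of_int b)" using c ab by (intro mult) auto
    moreover have "c * of_int b = of_int a" using ab by simp
    ultimately show False using z'[of a] z'[of b] c ab by auto
  qed
  define p where "p = (LEAST n. 0 < n \<and> 0 < u (of_nat n))"
  have p: "0 < p" "0 < u (of_nat p)" using LeastI_ex[OF ex] by (auto simp: p_def)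
  have least: "u (of_nat n) = 0" if "0 < n" "n < p" for n
    using not_less_Least[of n "\<lambda>n. 0 < n \<and> 0 < u (of_nat n)"] that nonneg[of "n - 1"] unfolding p_def by force
  have pp: "is_prime p"
    unfolding prime_nat_iff
  proof (intro conjI allI impI)
    show "1 < p" using p u1 by (cases "p = 1") auto
    fix m assume "m dvd p"
    then obtain k where k: "p = m * k" by blast
    show "m = 1 \<or> m = p"
    proof (rule ccontr)
      assume *: "\<not> (m = 1 \<or> m = p)"
      have mk: "0 < m" "0 < k" using p k by (auto intro: Nat.gr0I)
      have "m \<le> p" "k \<le> p" using k mk by simp_all
      moreover have "k \<noteq> p"
      proof
        assume "k = p"
        hence "m * k = 1 * k" using k by (metis mult_1)
        thus False using mk * by (simp only: mult_cancel2) simp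
      qed
      ultimately have "m < p" "k < p" using * by (simp_all add: order_less_le)
      moreover have "u (of_nat p) = u (of_nat m) + u (of_nat k)" using mult[of "of_nat m" "of_nat k"] mk k by simp
      ultimately show False using least mk p by auto
    qed
  qed
  have zero: "u (of_int n) = 0" if n: "n \<noteq> 0" "\<not> int p dvd n" for n
  proof (rule ccontr)
    assume "u (of_int n) \<noteq> 0"
    hence un: "0 < u (of_int n)" using nonneg'[OF n(1)] by simp
    define r q where "r = n mod int p" and "q = n div int p"
    have nr: "n = q * int p + r" by (simp add: r_def q_def)
    have r: "0 < r" "r < int p"
    proof -
      have "r \<noteq> 0" using n(2) by (simp add: r_def dvd_eq_mod_eq_0)
      moreover have "0 \<le> r" "r < int p" using p by (simp_all add: r_def)
      ultimately show "0 < r" "r < int p" by simp_all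
    qed
    have ur: "u (of_int r) = 0" using least[of "nat r"] r by simp
    show False
    proof (cases "q = 0")
      case True thus False using nr ur un by simp
    next
      case False
      have "u (of_int (- (q * int p))) = u (of_int q) + u (of_nat p)"
        using neg[of "of_int (q * int p)"] mult[of "of_int q" "of_nat p"] False p by simp
      hence "0 < u (of_int (- (q * int p)))" using nonneg'[OF False] p by simp
      moreover have "of_int n + of_int (- (q * int p)) = (of_int r :: rat)"
        unfolding of_int_add[symmetric] of_int_eq_iff using nr by linarith
      moreover have "min (u (of_int n)) (u (of_int (- (q * int p)))) \<le> u (of_int n + of_int (- (q * int p)))"
        using False p n r calculation by (intro add) auto
      ultimately show False using un ur by simp
    qed
  qed
  have pow: "u (of_int (int p ^ k)) = int k * u (of_nat p)" for k
  proof (induction k)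
    case (Suc k)
    have "u (of_nat p * of_nat p ^ k) = u (of_nat p) + u (of_nat p ^ k)" by (rule mult) (use p in simp_all)
    thus ?case using Suc by (simp add: algebra_simps)
  qed (simp add: u1)
  have int: "u (of_int n) = u (of_nat p) * int (multiplicity (int p) n)" if n: "n \<noteq> 0" for n
  proof -
    obtain m where m: "n = int p ^ multiplicity (int p) n * m" "\<not> int p dvd m"
      using multiplicity_decompose'[OF n, of "int p"] prime_gt_1_nat[OF pp] by auto
    have "m \<noteq> 0" using m n by auto
    have "u (of_int n) = u (of_int (int p ^ multiplicity (int p) n)) + u (of_int m)"
      by (subst m(1), subst of_int_mult, rule mult) (use p \<open>m \<noteq> 0\<close> in auto)
    thus ?thesis using zero[OF \<open>m \<noteq> 0\<close> m(2)] pow by simp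
  qed
  have all: "u c = u (of_nat p) * pval p c" if c: "c \<noteq> 0" for c
  proof -
    obtain a b where ab: "0 < b" "c = of_int a / of_int b" by (rule rat_fraction)
    have nz: "a \<noteq> 0" "b \<noteq> 0" using ab c by auto
    have "u (c * of_int b) = u c + u (of_int b)" using c ab by (intro mult) auto
    moreover have "c * of_int b = of_int a" using ab by simp
    ultimately show ?thesis using int[OF nz(1)] int[OF nz(2)] unfolding ab(2) pval_fraction[OF pp nz]
      by (simp add: algebra_simps)
  qed
  obtain c where "c \<noteq> 0" "u c = 1" using surj by blast
  hence "u (of_nat p) * pval p c = 1" using all by simp
  hence "u (of_nat p) = 1" using p by (simp add: zmult_eq_1_iff)
  hence all': "u c = pval p c" if "c \<noteq> 0" for c using all[OF that] by simp
  have "v = place p"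
  proof (rule extensionalityI)
    show "v \<in> extensional (\<rat> - {0})" using v by (simp add: finite_places_def)
    show "place p \<in> extensional (\<rat> - {0})" by (simp add: place_def)
    fix x :: qbar assume "x \<in> \<rat> - {0}"
    then obtain c where "x = of_rat c" "c \<noteq> 0" by (auto elim!: Rats_cases)
    thus "v x = place p x" using all'[of c] by (simp add: place_of_rat u_def)
  qed
  thus ?thesis using pp by blast
qed

lemma finite_places_Rats: "finite_places \<rat> = place ` {p. is_prime p}"
  using finite_place_is_place place_in_finite_places by blast

lemma inj_place: "inj_on place {p. is_prime p}"
proof (rule inj_onI, clarsimp)
  fix p q assume p: "is_prime p" and q: "is_prime q" and e: "place p = place q"
  have "pval p (of_nat p) = pval q (of_nat p)"
    using arg_cong[OF e, of "\<lambda>v. v (of_rat (of_nat p))"] prime_gt_0_nat[OF p] by (simp only: place_of_rat of_nat_eq_0_iff)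
  moreover have "pval p (of_nat p) = 1" using pval_power[OF p, of 1] by simp
  ultimately have "multiplicity (int q) (int p) \<noteq> 0" using pval_int[OF q, of "int p"] prime_gt_0_nat[OF p] by simp
  hence "int q dvd int p" by (metis not_dvd_imp_multiplicity_0)
  hence "q dvd p" by simp
  thus "p = q" using primes_dvd_imp_eq[OF q p] by simp
qed

lemma pabs_le_1_iff: "is_prime p \<Longrightarrow> pabs p c \<le> 1 \<longleftrightarrow> c = 0 \<or> 0 \<le> pval p c"
  and pabs_less_1_iff: "is_prime p \<Longrightarrow> pabs p c < 1 \<longleftrightarrow> c = 0 \<or> 0 < pval p c"
  using prime_gt_1_nat[of p] powr_le_cancel_iff[of "real p" "- real_of_int (pval p c)" 0]
    powr_less_cancel_iff[of "real p" "- real_of_int (pval p c)" 0]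
  by (auto simp: pabs_def)

lemma pabs_dvd: "is_prime p \<Longrightarrow> int p dvd n \<Longrightarrow> pabs p (of_int n) < 1"
  using prime_elem_multiplicity_eq_zero_iff[of "int p" n]
  by (cases "n = 0") (auto simp: pabs_less_1_iff pval_int)

text \<open>The residue classes are those of \<open>0, ..., p - 1\<close>: a fraction with
  denominator prime to \<open>p\<close> is congruent to an integer by a Bezout inverse of its
  denominator.\<close>

lemma residue_card_place:
  assumes p: "is_prime p" shows "residue_card \<rat> (place p) = p"
proof -
  interpret nonarch "pabs p" by (rule nonarch_pabs[OF p])
  define V where "V = valuation_ring \<rat> (place p)"
  define r where "r = {(x, y). x \<in> V \<and> y \<in> V \<and> (x = y \<or> place p (x - y) > 0)}"
  have VR: "of_rat c \<in> V \<longleftrightarrow> pabs p c \<le> 1" for c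
    by (cases "c = 0") (simp_all add: V_def valuation_ring_def pabs_le_1_iff[OF p] place_of_rat)
  have V: "V = of_rat ` {c. pabs p c \<le> 1}"
  proof
    show "of_rat ` {c. pabs p c \<le> 1} \<subseteq> V" using VR by blast
    show "V \<subseteq> of_rat ` {c. pabs p c \<le> 1}"
    proof
      fix x assume "x \<in> V"
      then obtain c where "x = of_rat c" by (auto simp: V_def valuation_ring_def elim: Rats_cases)
      thus "x \<in> of_rat ` {c. pabs p c \<le> 1}" using VR \<open>x \<in> V\<close> by blast
    qed
  qed
  have r: "(of_rat c, of_rat d) \<in> r \<longleftrightarrow> pabs p c \<le> 1 \<and> pabs p d \<le> 1 \<and> pabs p (c - d) < 1" for c d
  proof (cases "c = d")
    case False
    hence "place p (of_rat c - of_rat d) = pval p (c - d)" by (simp add: place_of_rat flip: of_rat_diff)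
    thus ?thesis using False unfolding r_def V by (auto simp: pabs_less_1_iff[OF p])
  qed (auto simp: r_def V)
  have rV: "r \<subseteq> V \<times> V" by (auto simp: r_def)
  have eq: "equiv V r"
  proof (rule equivI)
    show "r \<subseteq> V \<times> V" by (rule rV)
    show "refl_on V r" by (auto simp: refl_on_def r_def)
    show "sym r"
    proof (rule symI)
      fix x y assume xy: "(x, y) \<in> r"
      then obtain c d where cd: "x = of_rat c" "y = of_rat d" using rV V by blast
      have "pabs p (d - c) = pabs p (c - d)" using v_minus[of "c - d"] by simp
      thus "(y, x) \<in> r" using xy unfolding cd r by simp
    qed
    show "trans r"
    proof (rule transI)
      fix x y z assume xyz: "(x, y) \<in> r" "(y, z) \<in> r"
      then obtain c d e where cd: "x = of_rat c" "y = of_rat d" "z = of_rat e" using rV V by blast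
      show "(x, z) \<in> r" using xyz v_add[of "c - d" "d - e"] unfolding cd r by auto
    qed
  qed
  have "V // r = (\<lambda>i. r `` {of_rat (of_nat i)}) ` {..<p}"
  proof
    show "(\<lambda>i. r `` {of_rat (of_nat i)}) ` {..<p} \<subseteq> V // r"
    proof
      fix C assume "C \<in> (\<lambda>i. r `` {of_rat (of_nat i)}) ` {..<p}"
      then obtain i where "C = r `` {of_rat (of_nat i)}" by blast
      moreover have "of_rat (of_nat i) \<in> V" unfolding VR by (rule v_nat_le_1)
      ultimately show "C \<in> V // r" by (simp only: quotientI)
    qed
    show "V // r \<subseteq> (\<lambda>i. r `` {of_rat (of_nat i)}) ` {..<p}"
    proof
      fix C assume "C \<in> V // r"
      then obtain c where c: "pabs p c \<le> 1" "C = r `` {of_rat c}" by (auto simp: V elim!: quotientE)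
      obtain a b where ab: "quotient_of c = (a, b)" by force
      have b: "b > 0" "coprime a b" "c = of_int a / of_int b"
        using ab quotient_of_denom_pos quotient_of_coprime quotient_of_div by blast+
      have nb: "\<not> int p dvd b"
      proof
        assume d: "int p dvd b"
        hence "\<not> int p dvd a" using b(2) p by (metis coprime_common_divisor not_prime_unit prime_nat_int_transfer)
        hence "pabs p (of_int a) = 1" by (rule pabs_int_coprime[OF p])
        moreover have "pabs p (of_int b) < 1" using d by (rule pabs_dvd[OF p])
        ultimately show False using c(1) b v_pos[of "of_int b"] unfolding b(3) v_divide by (simp add: divide_le_eq_1)
      qed
      hence "coprime (int p) b" using p by (intro prime_imp_coprime) simp_all
      hence "coprime b (int p)" by (simp only: coprime_commute)
      then obtain s t where st: "s * b + t * int p = 1" by (metis bezout_coefficients_fst_snd coprime_iff_gcd_eq_1)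
      define i where "i = nat ((a * s) mod int p)"
      have i: "int i = (a * s) mod int p" "i < p" using prime_gt_0_nat[OF p] by (auto simp: i_def nat_less_iff)
      have "a - int i * b = a * (s * b + t * int p) - int i * b" using st by simp
      also have "\<dots> = (a * s - int i) * b + a * t * int p" by (simp add: algebra_simps)
      also have "int p dvd \<dots>"
      proof -
        have "int p dvd a * s - int i" unfolding i by (rule dvd_minus_mod)
        thus ?thesis by simp
      qed
      finally have dv: "int p dvd a - int i * b" .
      have "pabs p (of_int (a - int i * b)) < 1"
        using dv by (rule pabs_dvd[OF p])
      moreover have "c - of_nat i = of_int (a - int i * b) / of_int b" using b by (simp add: field_simps)
      moreover have "pabs p (of_int b) = 1" by (rule pabs_int_coprime[OF p nb])
      ultimately have "pabs p (c - of_nat i) < 1" by (simp add: v_divide)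
      hence "(of_rat c, of_rat (of_nat i)) \<in> r" unfolding r using c v_nat_le_1 by simp
      hence "C = r `` {of_rat (of_nat i)}" using equiv_class_eq[OF eq] c by simp
      thus "C \<in> (\<lambda>i. r `` {of_rat (of_nat i)}) ` {..<p}" using i by blast
    qed
  qed
  moreover have "inj_on (\<lambda>i. r `` {of_rat (of_nat i)}) {..<p}"
  proof (rule inj_onI)
    fix i j assume ij: "i \<in> {..<p}" "j \<in> {..<p}" "r `` {of_rat (of_nat i)} = r `` {of_rat (of_nat j)}"
    have "of_rat (of_nat j) \<in> V" unfolding V using v_nat_le_1 by blast
    hence "(of_rat (of_nat i), of_rat (of_nat j)) \<in> r" using eq_equiv_class[OF ij(3) eq] by blast
    hence "pabs p (of_nat i - of_nat j) < 1" unfolding r by blast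
    hence "pabs p (of_int (int i - int j)) \<noteq> 1" by simp
    hence "int i - int j = 0" using pabs_int_large_prime[OF p, of "int i - int j"] ij by fastforce
    thus "i = j" by simp
  qed
  ultimately have "card (V // r) = p" by (simp add: card_image)
  thus ?thesis unfolding residue_card_def V_def r_def by simp
qed

lemma finite_abs_place: "is_prime p \<Longrightarrow> finite_abs \<rat> (place p) (of_rat c) = pabs p c"
  by (simp add: finite_abs_def residue_card_place place_of_rat pabs_def)

text \<open>The coordinate \<open>c 0 = 1\<close> makes every local maximum at least 1, so outside
  \<open>S\<close>, where all coordinates are integral, the contribution is exactly
  \<open>ln 1\<close>.\<close>

theorem height_over_rational:
  fixes c :: "nat \<Rightarrow> rat"
  assumes c0: "c 0 = 1" and S: "finite S" "\<And>p. p \<in> S \<Longrightarrow> is_prime p"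
    and out: "\<And>p i. is_prime p \<Longrightarrow> p \<notin> S \<Longrightarrow> i \<le> d \<Longrightarrow> pabs p (c i) \<le> 1"
  shows "height_over d \<rat> (\<lambda>i. of_rat (c i)) =
    ln (Max ((\<lambda>i. real_of_rat \<bar>c i\<bar>) ` {..d})) + (\<Sum>p\<in>S. ln (Max ((\<lambda>i. pabs p (c i)) ` {..d})))"
proof -
  have 1: "cmod (restrict (\<lambda>x. of_rat (qr x)) \<rat> (of_rat (c i))) = real_of_rat \<bar>c i\<bar>" for i
  proof -
    have "(of_rat (c i) :: complex) = complex_of_real (real_of_rat (c i))"
      by (cases "c i") (simp add: of_rat_rat)
    thus ?thesis by simp
  qed
  have "infsum (\<lambda>v. ln (Max ((\<lambda>i. finite_abs \<rat> v (of_rat (c i))) ` {..d}))) (finite_places \<rat>)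
    = infsum ((\<lambda>v. ln (Max ((\<lambda>i. finite_abs \<rat> v (of_rat (c i))) ` {..d}))) \<circ> place) {p. is_prime p}"
    unfolding finite_places_Rats by (rule infsum_reindex[OF inj_place])
  also have "\<dots> = infsum (\<lambda>p. ln (Max ((\<lambda>i. pabs p (c i)) ` {..d}))) S"
  proof (rule infsum_cong_neutral)
    fix p assume p: "p \<in> {p. is_prime p} - S"
    interpret nonarch "pabs p" using p by (intro nonarch_pabs) simp
    have "Max ((\<lambda>i. pabs p (c i)) ` {..d}) = 1"
    proof (rule Max_eqI)
      show "y \<le> 1" if "y \<in> (\<lambda>i. pabs p (c i)) ` {..d}" for y using that out p by auto
      show "1 \<in> (\<lambda>i. pabs p (c i)) ` {..d}" using c0 by (intro image_eqI[of _ _ 0]) simp_all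
    qed simp
    thus "((\<lambda>v. ln (Max ((\<lambda>i. finite_abs \<rat> v (of_rat (c i))) ` {..d}))) \<circ> place) p = 0"
      using p by (simp add: finite_abs_place)
  qed (use S(2) in \<open>auto simp: finite_abs_place\<close>)
  also have "\<dots> = (\<Sum>p\<in>S. ln (Max ((\<lambda>i. pabs p (c i)) ` {..d})))" using S by simp
  finally show ?thesis by (simp add: height_over_def embeddings_Rats dim_Rats 1 del: restrict_apply)
qed

section \<open>Forms and rational maps\<close>

definition monomial_value :: "(nat \<Rightarrow> 'b::comm_ring_1) \<Rightarrow> (nat \<Rightarrow>\<^sub>0 nat) \<Rightarrow> 'b"
  where "monomial_value x m = (\<Prod>i\<in>Poly_Mapping.keys m. x i ^ Poly_Mapping.lookup m i)"

lemma monomial_value_superset: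
  "finite A \<Longrightarrow> Poly_Mapping.keys m \<subseteq> A \<Longrightarrow> monomial_value x m = (\<Prod>i\<in>A. x i ^ Poly_Mapping.lookup m i)"
  unfolding monomial_value_def by (rule prod.mono_neutral_left) (auto simp: in_keys_iff)

lemma monomial_value_add: "monomial_value x (m + n) = monomial_value x m * monomial_value x n"
proof -
  let ?A = "Poly_Mapping.keys m \<union> Poly_Mapping.keys n"
  have "monomial_value x (m + n) = (\<Prod>i\<in>?A. x i ^ Poly_Mapping.lookup (m + n) i)"
    using Poly_Mapping.keys_add[of m n] by (intro monomial_value_superset) auto
  also have "\<dots> = (\<Prod>i\<in>?A. x i ^ Poly_Mapping.lookup m i) * (\<Prod>i\<in>?A. x i ^ Poly_Mapping.lookup n i)"
    by (simp add: lookup_add power_add prod.distrib)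
  also have "\<dots> = monomial_value x m * monomial_value x n"
    by (subst (1 2) monomial_value_superset[of ?A]) auto
  finally show ?thesis .
qed

lemma mpoly_eval_alt: "mpoly_eval h x p = (\<Sum>m\<in>Poly_Mapping.keys p. h (Poly_Mapping.lookup p m) * monomial_value x m)"
  by (simp add: mpoly_eval_def monomial_value_def)

lemma mpoly_as_sum: "(p :: mpoly) = (\<Sum>m\<in>Poly_Mapping.keys p. Poly_Mapping.single m (Poly_Mapping.lookup p m))"
proof (rule poly_mapping_eqI)
  fix k
  have "Poly_Mapping.lookup (\<Sum>m\<in>Poly_Mapping.keys p. Poly_Mapping.single m (Poly_Mapping.lookup p m)) k
    = (\<Sum>m\<in>Poly_Mapping.keys p. if m = k then Poly_Mapping.lookup p m else 0)"
    by (simp add: lookup_sum lookup_single when_def)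
  also have "\<dots> = Poly_Mapping.lookup p k" by (simp add: sum.delta in_keys_iff)
  finally show "Poly_Mapping.lookup p k = Poly_Mapping.lookup (\<Sum>m\<in>Poly_Mapping.keys p. Poly_Mapping.single m (Poly_Mapping.lookup p m)) k" ..
qed

text \<open>Evaluation at a vector and substitution of forms are one construction with two
  coefficient maps; the ring laws are proved once for both.\<close>

locale coefficient_hom =
  fixes h :: "qbar \<Rightarrow> 'b::comm_ring_1"
  assumes h_add: "h (a + b) = h a + h b" and h_mult: "h (a * b) = h a * h b" and h_1: "h 1 = 1"
begin

lemma h_0: "h 0 = 0" using h_add[of 0 0] by simp

lemma eval_add: "mpoly_eval h x (p + q) = mpoly_eval h x p + mpoly_eval h x q"
  unfolding mpoly_eval_alt by (rule setsum_keys_plus_distrib) (simp_all add: h_0 h_add algebra_simps)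

lemma eval_0: "mpoly_eval h x 0 = 0" by (simp add: mpoly_eval_alt)

lemma eval_sum: "mpoly_eval h x (sum f A) = (\<Sum>i\<in>A. mpoly_eval h x (f i))"
  by (induction A rule: infinite_finite_induct) (simp_all add: eval_0 eval_add)

lemma eval_single: "mpoly_eval h x (Poly_Mapping.single m a) = h a * monomial_value x m"
  by (cases "a = 0") (simp_all add: mpoly_eval_alt h_0)

lemma eval_mult: "mpoly_eval h x (p * q) = mpoly_eval h x p * mpoly_eval h x q"
proof -
  let ?s = "\<lambda>p m. Poly_Mapping.single m (Poly_Mapping.lookup (p :: mpoly) m)"
  have "p * q = (\<Sum>m\<in>Poly_Mapping.keys p. ?s p m) * (\<Sum>n\<in>Poly_Mapping.keys q. ?s q n)"
    using mpoly_as_sum[of p] mpoly_as_sum[of q] by metis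
  also have "\<dots> = (\<Sum>m\<in>Poly_Mapping.keys p. \<Sum>n\<in>Poly_Mapping.keys q.
      Poly_Mapping.single (m + n) (Poly_Mapping.lookup p m * Poly_Mapping.lookup q n))"
    by (simp add: sum_product mult_single)
  finally have "mpoly_eval h x (p * q) = (\<Sum>m\<in>Poly_Mapping.keys p. \<Sum>n\<in>Poly_Mapping.keys q.
      (h (Poly_Mapping.lookup p m) * monomial_value x m) * (h (Poly_Mapping.lookup q n) * monomial_value x n))"
    by (simp add: eval_sum eval_single h_mult monomial_value_add mult_ac)
  thus ?thesis unfolding mpoly_eval_alt by (simp add: sum_product)
qed

lemma eval_1: "mpoly_eval h x 1 = 1"
  using eval_single[of x 0 1] by (simp add: h_1 monomial_value_def)

lemma eval_power: "mpoly_eval h x (p ^ n) = mpoly_eval h x p ^ n"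
  by (induction n) (simp_all add: eval_1 eval_mult)

lemma eval_diff: "mpoly_eval h x (p - q) = mpoly_eval h x p - mpoly_eval h x q"
  using eval_add[of x "p - q" q] by (simp add: algebra_simps)

lemma eval_numeral: "mpoly_eval h x (numeral k) = numeral k"
proof -
  have "mpoly_eval h x (of_nat n) = of_nat n" for n by (induction n) (simp_all add: eval_0 eval_1 eval_add)
  from this[of "numeral k"] show ?thesis by simp
qed

lemma eval_var: "mpoly_eval h x (mpoly_var i) = x i"
  unfolding mpoly_var_def by (simp add: eval_single h_1 monomial_value_def)

lemmas eval_simps = eval_0 eval_1 eval_add eval_diff eval_mult eval_power eval_numeral eval_var

end

interpretation val: coefficient_hom "\<lambda>c :: qbar. c" by unfold_locales simp_all

interpretation sub: coefficient_hom "Poly_Mapping.single 0 :: qbar \<Rightarrow> mpoly"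
  by unfold_locales (simp_all add: single_add mult_single)

lemmas value_simps = val.eval_simps[folded mpoly_value_def]
lemmas subst_simps = sub.eval_simps[folded mpoly_subst_def]

lemma mpoly_eval_scale:
  assumes p: "homogeneous d e p"
  shows "mpoly_eval h (\<lambda>i. c * x i) p = c ^ e * mpoly_eval h x p"
proof -
  have "monomial_value (\<lambda>i. c * x i) m = c ^ e * monomial_value x m" if "m \<in> Poly_Mapping.keys p" for m
  proof -
    have "monomial_value (\<lambda>i. c * x i) m = (\<Prod>i\<in>Poly_Mapping.keys m. c ^ Poly_Mapping.lookup m i) * monomial_value x m"
      by (simp add: monomial_value_def power_mult_distrib prod.distrib)
    also have "(\<Prod>i\<in>Poly_Mapping.keys m. c ^ Poly_Mapping.lookup m i) = c ^ e"
      using p that by (simp add: homogeneous_def flip: power_sum)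
    finally show ?thesis .
  qed
  thus ?thesis by (simp add: mpoly_eval_alt sum_distrib_left mult_ac)
qed

lemma degree_superset:
  "finite A \<Longrightarrow> Poly_Mapping.keys m \<subseteq> A \<Longrightarrow>
    (\<Sum>i\<in>Poly_Mapping.keys m. Poly_Mapping.lookup m i) = (\<Sum>i\<in>A. Poly_Mapping.lookup (m :: nat \<Rightarrow>\<^sub>0 nat) i)"
  by (rule sum.mono_neutral_left) (auto simp: in_keys_iff)

lemma homogeneous_alt:
  "homogeneous d e p \<longleftrightarrow> (\<forall>m\<in>Poly_Mapping.keys p. Poly_Mapping.keys m \<subseteq> {..d} \<and> (\<Sum>i\<le>d. Poly_Mapping.lookup m i) = e)"
  unfolding homogeneous_def using degree_superset[of "{..d}"] by auto

lemma homogeneous_0 [simp]: "homogeneous d e 0" by (simp add: homogeneous_def)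

lemma homogeneous_add: "homogeneous d e p \<Longrightarrow> homogeneous d e q \<Longrightarrow> homogeneous d e (p + q)"
  using Poly_Mapping.keys_add[of p q] unfolding homogeneous_def by blast

lemma homogeneous_diff: "homogeneous d e p \<Longrightarrow> homogeneous d e q \<Longrightarrow> homogeneous d e (p - q)"
  using keys_diff[of p q] unfolding homogeneous_def by blast

lemma homogeneous_mult:
  assumes "homogeneous d e p" "homogeneous d f q" shows "homogeneous d (e + f) (p * q)"
  unfolding homogeneous_alt
proof
  fix m assume "m \<in> Poly_Mapping.keys (p * q)"
  then obtain a b where ab: "m = a + b" "a \<in> Poly_Mapping.keys p" "b \<in> Poly_Mapping.keys q" using keys_mult[of p q] by blast
  have "Poly_Mapping.keys m \<subseteq> {..d}"
    using assms ab Poly_Mapping.keys_add[of a b] unfolding homogeneous_alt by blast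
  moreover have "(\<Sum>i\<le>d. Poly_Mapping.lookup m i) = e + f"
    using assms ab by (simp add: homogeneous_alt lookup_add sum.distrib)
  ultimately show "Poly_Mapping.keys m \<subseteq> {..d} \<and> (\<Sum>i\<le>d. Poly_Mapping.lookup m i) = e + f" ..
qed

lemma homogeneous_numeral_mult: "homogeneous d e p \<Longrightarrow> homogeneous d e (numeral k * p)"
proof -
  have "homogeneous d 0 (Poly_Mapping.single 0 (numeral k))" by (simp add: homogeneous_def del: single_numeral)
  hence "homogeneous d 0 (numeral k)" by simp
  thus "homogeneous d e p \<Longrightarrow> ?thesis" using homogeneous_mult[of d 0 "numeral k" e p] by simp
qed

lemma homogeneous_power: "homogeneous d e p \<Longrightarrow> homogeneous d (n * e) (p ^ n)"
proof (induction n)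
  case 0
  have "homogeneous d 0 (Poly_Mapping.single 0 1)" by (simp add: homogeneous_def)
  thus ?case by simp
next
  case (Suc n) thus ?case using homogeneous_mult[of d e p "n * e" "p ^ n"] by simp
qed

lemma homogeneous_var: "i \<le> d \<Longrightarrow> homogeneous d 1 (mpoly_var i)"
  by (simp add: homogeneous_def mpoly_var_def)

section \<open>Classes of points and of tuples of forms\<close>

definition proj_class :: "nat \<Rightarrow> (nat \<Rightarrow> qbar) \<Rightarrow> point"
  where "proj_class d x = scaling_rel d `` {x}"

lemma equiv_scaling_rel: "equiv (coord_vectors d) (scaling_rel d)"
proof (rule equivI)
  show "scaling_rel d \<subseteq> coord_vectors d \<times> coord_vectors d" by (auto simp: scaling_rel_def)
  show "refl_on (coord_vectors d) (scaling_rel d)"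
    by (auto simp: refl_on_def scaling_rel_def intro: exI[of _ 1])
  show "sym (scaling_rel d)"
  proof (rule symI, clarsimp simp: scaling_rel_def)
    fix x and c :: qbar assume "c \<noteq> 0"
    thus "\<exists>e. e \<noteq> 0 \<and> x = (\<lambda>i. e * (c * x i))" by (intro exI[of _ "inverse c"]) auto
  qed
  show "trans (scaling_rel d)"
  proof (rule transI)
    fix x y z assume xy: "(x, y) \<in> scaling_rel d" and yz: "(y, z) \<in> scaling_rel d"
    obtain a where a: "a \<noteq> 0" "y = (\<lambda>i. a * x i)" using xy by (auto simp: scaling_rel_def)
    obtain b where b: "b \<noteq> 0" "z = (\<lambda>i. b * y i)" using yz by (auto simp: scaling_rel_def)
    have "\<exists>c. c \<noteq> 0 \<and> z = (\<lambda>i. c * x i)" using a b by (intro exI[of _ "b * a"]) (simp add: mult.assoc)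
    thus "(x, z) \<in> scaling_rel d" using xy yz by (auto simp: scaling_rel_def)
  qed
qed

lemma proj_class_mem: "x \<in> coord_vectors d \<Longrightarrow> x \<in> proj_class d x"
  using equiv_class_self[OF equiv_scaling_rel] by (simp add: proj_class_def)

lemma proj_class_in_space: "x \<in> coord_vectors d \<Longrightarrow> proj_class d x \<in> proj_space d"
  by (simp add: proj_class_def proj_space_def quotientI)

lemma mem_proj_class: "y \<in> proj_class d x \<longleftrightarrow> x \<in> coord_vectors d \<and> y \<in> coord_vectors d \<and> (\<exists>c. c \<noteq> 0 \<and> y = (\<lambda>i. c * x i))"
  by (auto simp: proj_class_def scaling_rel_def)

lemma proj_space_eq_class: "q \<in> proj_space d \<Longrightarrow> x \<in> q \<Longrightarrow> q = proj_class d x \<and> x \<in> coord_vectors d"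
proof -
  assume q: "q \<in> proj_space d" and x: "x \<in> q"
  from q obtain y where y: "q = scaling_rel d `` {y}" unfolding proj_space_def by (elim quotientE)
  hence yx: "(y, x) \<in> scaling_rel d" using x by simp
  have "q = scaling_rel d `` {x}" unfolding y by (rule equiv_class_eq[OF equiv_scaling_rel yx])
  thus ?thesis using yx by (simp add: proj_class_def scaling_rel_def)
qed

lemma proj_class_scale: "x \<in> coord_vectors d \<Longrightarrow> c \<noteq> 0 \<Longrightarrow> proj_class d (\<lambda>i. c * x i) = proj_class d x"
proof -
  assume x: "x \<in> coord_vectors d" and c: "c \<noteq> 0"
  have "(\<lambda>i. c * x i) \<in> proj_class d x" using x c by (auto simp: mem_proj_class coord_vectors_def)
  thus ?thesis using proj_space_eq_class[OF proj_class_in_space[OF x]] by blast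
qed

definition tuple_class :: "nat \<Rightarrow> (nat \<Rightarrow> mpoly) \<Rightarrow> rational_map"
  where "tuple_class d F = tuple_rel d `` {F}"

lemma tuple_class_self: "F \<in> form_tuples d \<Longrightarrow> F \<in> tuple_class d F"
  by (auto simp: tuple_class_def tuple_rel_def mult.commute)

lemma tuple_class_in_maps: "F \<in> form_tuples d \<Longrightarrow> tuple_class d F \<in> rational_maps d"
  by (simp add: tuple_class_def rational_maps_def quotientI)

text \<open>For another representing tuple \<open>H\<close> the relations
  \<open>F i * H j = F j * H i\<close> make the values of \<open>F\<close> and \<open>H\<close>
  proportional, and by homogeneity the choice of coordinate vector does not matter either. So the
  description in \<open>rat_apply\<close> has exactly one solution.\<close>

lemma rat_apply_class:
  assumes F: "F \<in> form_tuples d" and x: "x \<in> coord_vectors d" and nz: "\<exists>i. mpoly_value x (F i) \<noteq> 0"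
  shows "rat_apply d (tuple_class d F) (proj_class d x) = proj_class d (\<lambda>i. mpoly_value x (F i))"
    and "proj_class d x \<notin> indeterminacy_locus d (tuple_class d F)"
proof -
  obtain e where e: "\<And>i. i \<le> d \<Longrightarrow> homogeneous d e (F i)" and F0: "\<And>i. i > d \<Longrightarrow> F i = 0"
    using F by (auto simp: form_tuples_def)
  let ?w = "\<lambda>i. mpoly_value x (F i)"
  have w: "?w \<in> coord_vectors d" using F0 nz by (auto simp: coord_vectors_def value_simps)
  show "proj_class d x \<notin> indeterminacy_locus d (tuple_class d F)"
    using tuple_class_self[OF F] proj_class_mem[OF x] nz by (auto simp: indeterminacy_locus_def)
  show "rat_apply d (tuple_class d F) (proj_class d x) = proj_class d ?w"
    unfolding rat_apply_def
  proof (rule the_equality)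
    show "proj_class d ?w \<in> proj_space d \<and> (\<exists>F\<in>tuple_class d F. \<exists>x\<in>proj_class d x. (\<lambda>i. mpoly_value x (F i)) \<in> proj_class d ?w)"
      using proj_class_in_space[OF w] tuple_class_self[OF F] proj_class_mem[OF x] proj_class_mem[OF w] by blast
    fix q assume "q \<in> proj_space d \<and> (\<exists>F\<in>tuple_class d F. \<exists>x\<in>proj_class d x. (\<lambda>i. mpoly_value x (F i)) \<in> q)"
    then obtain H y where q: "q \<in> proj_space d" "H \<in> tuple_class d F" "y \<in> proj_class d x" "(\<lambda>i. mpoly_value y (H i)) \<in> q" by blast
    obtain c where c: "c \<noteq> 0" "y = (\<lambda>i. c * x i)" using q(3) by (auto simp: mem_proj_class)
    let ?v = "\<lambda>i. mpoly_value y (H i)"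
    have v: "q = proj_class d ?v" "?v \<in> coord_vectors d" using proj_space_eq_class[OF q(1,4)] by auto
    have Fy: "mpoly_value y (F i) = c ^ e * ?w i" for i
    proof (cases "i \<le> d")
      case True thus ?thesis unfolding c(2) mpoly_value_def by (intro mpoly_eval_scale[OF e])
    qed (simp add: F0 value_simps)
    have cross: "?w i * ?v j = ?w j * ?v i" for i j
    proof -
      have "F i * H j = F j * H i" using q(2) by (auto simp: tuple_class_def tuple_rel_def)
      hence "mpoly_value y (F i) * ?v j = mpoly_value y (F j) * ?v i" by (simp flip: value_simps)
      thus ?thesis using c(1) by (simp add: Fy)
    qed
    obtain k where k: "?v k \<noteq> 0" using v(2) by (auto simp: coord_vectors_def)
    have "?w k \<noteq> 0"
    proof
      assume "?w k = 0"
      hence "?w i = 0" for i using cross[of i k] k by simp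
      thus False using nz by simp
    qed
    have "?w = (\<lambda>i. (?w k / ?v k) * ?v i)"
      using cross[of _ k] k by (auto simp: field_simps)
    hence "proj_class d ?w = proj_class d ?v"
      using proj_class_scale[OF v(2), of "?w k / ?v k"] k \<open>?w k \<noteq> 0\<close> by (metis divide_eq_0_iff)
    thus "q = proj_class d ?w" using v by simp
  qed
qed

text \<open>\<open>rat_comp\<close> runs over all representatives \<open>F\<close> and
  \<open>G\<close>, not just the given pair. Homogeneity relates them by
  \<open>F0 k ^ e' * G(F) = F k ^ e' * G(F0)\<close>, and \<open>G(F0)\<close> is parallel to
  \<open>G0(F0)\<close>, which is \<open>M\<close> times the identity tuple. Cancelling nonzero
  forms shows that every composite is parallel to the identity.\<close>

lemma rat_comp_eq_id:
  assumes F0: "F0 \<in> form_tuples d" and G0: "G0 \<in> form_tuples d" and M: "M \<noteq> 0" "homogeneous d e M"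
    and FG: "\<And>i. i \<le> d \<Longrightarrow> mpoly_subst F0 (G0 i) = mpoly_var i * M"
  shows "rat_comp d (tuple_class d G0) (tuple_class d F0) = rat_id d"
proof -
  let ?x = "\<lambda>i. if i \<le> d then mpoly_var i else 0"
  have FG': "mpoly_subst F0 (G0 i) = ?x i * M" for i
  proof (cases "i \<le> d")
    case False
    hence "G0 i = 0" using G0 by (auto simp: form_tuples_def)
    thus ?thesis using False by (simp add: subst_simps)
  qed (simp add: FG)
  have var0: "mpoly_var i \<noteq> 0" for i by (auto simp: mpoly_var_def dest: arg_cong[of _ _ Poly_Mapping.keys])
  have xform: "?x \<in> form_tuples d"
  proof -
    have "\<forall>i\<le>d. homogeneous d 1 (?x i)" by (auto intro: homogeneous_var simp del: One_nat_def)
    moreover have "?x 0 \<noteq> 0" "\<forall>i>d. ?x i = 0" using var0[of 0] by simp_all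
    ultimately show ?thesis unfolding form_tuples_def by blast
  qed
  have tr: "(C, H) \<in> tuple_rel d \<Longrightarrow> (\<And>i j. C i * ?x j = C j * ?x i) \<Longrightarrow> (?x, H) \<in> tuple_rel d" for C H
  proof -
    assume CH: "(C, H) \<in> tuple_rel d" and cx: "\<And>i j. C i * ?x j = C j * ?x i"
    then obtain k where k: "C k \<noteq> 0" by (auto simp: tuple_rel_def form_tuples_def)
    have c: "C i * H j = C j * H i" for i j using CH by (auto simp: tuple_rel_def)
    have "?x i * H j = ?x j * H i" for i j
    proof -
      have "(C k * C k) * (?x i * H j) = (C k * ?x i) * (C k * H j)" by (simp only: mult_ac)
      also have "\<dots> = (C i * ?x k) * (C j * H k)" using cx[of k i] c[of k j] by (simp only:)
      also have "\<dots> = (C j * ?x k) * (C i * H k)" by (simp only: mult_ac)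
      also have "\<dots> = (C k * ?x j) * (C k * H i)" using cx[of k j] c[of k i] by (simp only:)
      also have "\<dots> = (C k * C k) * (?x j * H i)" by (simp only: mult_ac)
      finally show ?thesis using k by (simp only: mult_cancel_left mult_eq_0_iff) simp
    qed
    thus "(?x, H) \<in> tuple_rel d" using CH xform by (simp add: tuple_rel_def)
  qed
  show ?thesis
  proof
    show "rat_comp d (tuple_class d G0) (tuple_class d F0) \<subseteq> rat_id d"
    proof
      fix H assume "H \<in> rat_comp d (tuple_class d G0) (tuple_class d F0)"
      then obtain G F where G: "G \<in> tuple_class d G0" and F: "F \<in> tuple_class d F0"
        and H: "((\<lambda>i. mpoly_subst F (G i)), H) \<in> tuple_rel d" by (auto simp: rat_comp_def)
      let ?C = "\<lambda>i. mpoly_subst F (G i)"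
      have Gf: "G \<in> form_tuples d" and Ff: "F \<in> form_tuples d" and GG: "\<And>i j. G0 i * G j = G0 j * G i"
        and FF: "\<And>i j. F0 i * F j = F0 j * F i"
        using G F by (auto simp: tuple_class_def tuple_rel_def)
      obtain e' where e': "\<And>i. i \<le> d \<Longrightarrow> homogeneous d e' (G i)" and Gd: "\<And>i. i > d \<Longrightarrow> G i = 0"
        using Gf by (auto simp: form_tuples_def)
      obtain k where k: "F0 k \<noteq> 0" using F0 by (auto simp: form_tuples_def)
      have scal: "F0 k ^ e' * ?C i = F k ^ e' * mpoly_subst F0 (G i)" for i
      proof (cases "i \<le> d")
        case True
        have "F0 k ^ e' * ?C i = mpoly_eval (Poly_Mapping.single 0) (\<lambda>i. F0 k * F i) (G i)"
          unfolding mpoly_subst_def by (rule mpoly_eval_scale[OF e'[OF True], symmetric])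
        also have "(\<lambda>i. F0 k * F i) = (\<lambda>i. F k * F0 i)" using FF[of k] by (simp add: mult.commute)
        also have "mpoly_eval (Poly_Mapping.single 0) (\<lambda>i. F k * F0 i) (G i) = F k ^ e' * mpoly_subst F0 (G i)"
          unfolding mpoly_subst_def by (rule mpoly_eval_scale[OF e'[OF True]])
        finally show ?thesis .
      qed (simp add: Gd subst_simps)
      have GM: "?x i * mpoly_subst F0 (G j) = ?x j * mpoly_subst F0 (G i)" for i j
      proof -
        have "mpoly_subst F0 (G0 i) * mpoly_subst F0 (G j) = mpoly_subst F0 (G0 j) * mpoly_subst F0 (G i)"
          using arg_cong[OF GG[of i j], of "mpoly_subst F0"] by (simp only: subst_simps)
        hence "M * (?x i * mpoly_subst F0 (G j)) = M * (?x j * mpoly_subst F0 (G i))" unfolding FG' by (simp only: mult_ac)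
        thus ?thesis using M(1) by (simp only: mult_cancel_left) simp
      qed
      have "?C i * ?x j = ?C j * ?x i" for i j
      proof -
        have "F0 k ^ e' * (?C i * ?x j) = (F0 k ^ e' * ?C i) * ?x j" by (simp only: mult.assoc)
        also have "\<dots> = F k ^ e' * (?x j * mpoly_subst F0 (G i))" unfolding scal by (simp only: mult_ac)
        also have "\<dots> = F k ^ e' * (?x i * mpoly_subst F0 (G j))" unfolding GM[of i j] ..
        also have "\<dots> = (F0 k ^ e' * ?C j) * ?x i" unfolding scal by (simp only: mult_ac)
        also have "\<dots> = F0 k ^ e' * (?C j * ?x i)" by (simp only: mult.assoc)
        finally show ?thesis using k by (simp only: mult_cancel_left power_eq_0_iff) simp
      qed
      from tr[OF H this] show "H \<in> rat_id d" by (simp add: rat_id_def)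
    qed
    show "rat_id d \<subseteq> rat_comp d (tuple_class d G0) (tuple_class d F0)"
    proof
      fix H assume "H \<in> rat_id d"
      hence H: "H \<in> form_tuples d" "\<And>i j. ?x i * H j = ?x j * H i" by (auto simp: rat_id_def tuple_rel_def)
      let ?C = "\<lambda>i. mpoly_subst F0 (G0 i)"
      have "?C \<in> form_tuples d"
      proof -
        have "homogeneous d (1 + e) (?C i)" if "i \<le> d" for i
          unfolding FG[OF that] by (intro homogeneous_mult homogeneous_var that M)
        moreover have "?C 0 \<noteq> 0" using M(1) var0 by (simp add: FG)
        moreover have "?C i = 0" if "i > d" for i using that by (simp add: FG')
        ultimately show ?thesis unfolding form_tuples_def by blast
      qed
      moreover have "?C i * H j = ?C j * H i" for i j
      proof -
        have "?C i * H j = M * (?x i * H j)" unfolding FG' by (simp only: mult_ac)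
        also have "\<dots> = M * (?x j * H i)" unfolding H(2)[of i j] ..
        also have "\<dots> = ?C j * H i" unfolding FG' by (simp only: mult_ac)
        finally show ?thesis .
      qed
      ultimately have "(?C, H) \<in> tuple_rel d" using H(1) by (simp add: tuple_rel_def)
      thus "H \<in> rat_comp d (tuple_class d G0) (tuple_class d F0)"
        using tuple_class_self[OF F0] tuple_class_self[OF G0] by (auto simp: rat_comp_def)
    qed
  qed
qed

section \<open>The map\<close>

definition gate_form :: "'a::comm_ring_1 \<Rightarrow> 'a \<Rightarrow> 'a \<Rightarrow> 'a"
  where "gate_form t x z = t ^ 4 + 12 * (z ^ 2 * t ^ 2 + x ^ 4)"

definition kick_form :: "'a::comm_ring_1 \<Rightarrow> 'a \<Rightarrow> 'a \<Rightarrow> 'a \<Rightarrow> 'a"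
  where "kick_form t x z u = (let N = gate_form t x z in u * (N ^ 2 - 18 * z ^ 2 * t ^ 2 * N) + t ^ 9)"

text \<open>Homogenisation with \<open>v 0\<close> as the extra coordinate: the affine map
  multiplied by \<open>N ^ 2\<close>, of degree 9 because \<open>N\<close> has degree 4. Coordinates
  beyond 3 only get the common factor \<open>N ^ 2\<close>, so one formula and one orbit serve all
  \<open>d >= 3\<close>. The ring is left open because the same expression is read as a tuple of
  forms, as a map on rational vectors and under substitution.\<close>

definition forward :: "nat \<Rightarrow> (nat \<Rightarrow> 'a::comm_ring_1) \<Rightarrow> nat \<Rightarrow> 'a"
  where "forward d v i = (let N = gate_form (v 0) (v 1) (v 2); U = kick_form (v 0) (v 1) (v 2) (v 3) in
    if i = 1 then (v 1 + v 2) * N ^ 2 - 2 * U else if i = 2 then v 2 * N ^ 2 + U else if i = 3 then U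
    else if i \<le> d then v i * N ^ 2 else 0)"

text \<open>Writing primes for new coordinates, \<open>z = z' - u'\<close> and
  \<open>x = x' - z' + 3 u'\<close> recover the old \<open>N\<close> first; then
  \<open>u' = u (1 - 18 z^2 / N) + 1 / N ^ 2\<close> is affine in \<open>u\<close> and can be
  solved. The common denominator is \<open>N * K\<close>.\<close>

definition backward :: "nat \<Rightarrow> (nat \<Rightarrow> 'a::comm_ring_1) \<Rightarrow> nat \<Rightarrow> 'a"
  where "backward d v i = (let z = v 2 - v 3; x = v 1 - v 2 + 3 * v 3; t = v 0; N = gate_form t x z; K = N - 18 * z ^ 2 * t ^ 2 in
    if i = 1 then x * N * K else if i = 2 then z * N * K else if i = 3 then v 3 * N ^ 2 - t ^ 9
    else if i \<le> d then v i * N * K else 0)"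

lemma gate_form_scale: "gate_form (c * t) (c * x) (c * z) = c ^ 4 * gate_form t x z"
  by (simp add: gate_form_def power_mult_distrib algebra_simps flip: power_add)

lemma backward_forward:
  fixes v :: "nat \<Rightarrow> 'a::comm_ring_1"
  assumes "3 \<le> d" "i \<le> d"
  defines "N \<equiv> gate_form (v 0) (v 1) (v 2)"
  shows "backward d (forward d v) i = v i * (N ^ 19 * (N - 18 * v 2 ^ 2 * v 0 ^ 2))"
proof -
  define U where "U = kick_form (v 0) (v 1) (v 2) (v 3)"
  have f: "forward d v 0 = N ^ 2 * v 0" "forward d v 1 = (v 1 + v 2) * N ^ 2 - 2 * U" "forward d v 2 = v 2 * N ^ 2 + U" "forward d v 3 = U"
    unfolding forward_def Let_def N_def U_def by (simp_all add: mult.commute)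
  have fi: "forward d v i = v i * N ^ 2" if "i \<noteq> 1" "i \<noteq> 2" "i \<noteq> 3"
    unfolding forward_def Let_def N_def using that assms by simp
  have z: "forward d v 2 - forward d v 3 = N ^ 2 * v 2" unfolding f by (simp add: algebra_simps)
  have x: "forward d v 1 - forward d v 2 + 3 * forward d v 3 = N ^ 2 * v 1" unfolding f by (simp add: algebra_simps)
  have NN: "gate_form (N ^ 2 * v 0) (N ^ 2 * v 1) (N ^ 2 * v 2) = N ^ 9"
    unfolding gate_form_scale N_def[symmetric] by (simp flip: power_mult power_Suc2)
  have K: "N ^ 9 - 18 * (N ^ 2 * v 2) ^ 2 * (N ^ 2 * v 0) ^ 2 = N ^ 8 * (N - 18 * v 2 ^ 2 * v 0 ^ 2)"
    by (simp add: power_mult_distrib algebra_simps flip: power_mult power_add power_Suc power_Suc2)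
  have U: "U = v 3 * (N ^ 2 - 18 * v 2 ^ 2 * v 0 ^ 2 * N) + v 0 ^ 9" by (simp add: U_def kick_form_def Let_def N_def)
  have p: "N ^ 2 * N ^ 9 * N ^ 8 = N ^ 19" by (simp flip: power_add)
  have e: "(N ^ 2 * y) * N ^ 9 * (N ^ 8 * K) = y * (N ^ 19 * K)" for y K :: 'a
    unfolding p[symmetric] by (simp only: mult_ac)
  have e3: "U * (N ^ 9) ^ 2 - (N ^ 2 * v 0) ^ 9 = v 3 * (N ^ 19 * (N - 18 * v 2 ^ 2 * v 0 ^ 2))"
  proof -
    have 1: "(N ^ 9) ^ 2 = N ^ 18" "(N ^ 2 * v 0) ^ 9 = N ^ 18 * v 0 ^ 9" "N ^ 19 = N ^ 18 * N"
      by (simp_all add: power_mult_distrib flip: power_mult power_Suc2)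
    show ?thesis unfolding U 1 by (simp add: algebra_simps power2_eq_square)
  qed
  show ?thesis
    unfolding backward_def Let_def z x unfolding f(1,4) NN K
    using e[of "v i"] e[of "v 1"] e[of "v 2"] e3 fi assms(2) by (auto simp: mult.commute[of "v i" "N ^ 2"])
qed

lemma forward_backward:
  fixes v :: "nat \<Rightarrow> 'a::comm_ring_1"
  assumes "3 \<le> d" "i \<le> d"
  defines "N \<equiv> gate_form (v 0) (v 1 - v 2 + 3 * v 3) (v 2 - v 3)"
  shows "forward d (backward d v) i = v i * (N ^ 2 * (N * (N - 18 * (v 2 - v 3) ^ 2 * v 0 ^ 2)) ^ 9)"
proof -
  define z where "z = v 2 - v 3"
  define x where "x = v 1 - v 2 + 3 * v 3"
  define K where "K = N - 18 * z ^ 2 * v 0 ^ 2"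
  define c where "c = N * K"
  have NN: "N = gate_form (v 0) x z" by (simp add: N_def x_def z_def)
  have b: "backward d v 0 = c * v 0" "backward d v 1 = c * x" "backward d v 2 = c * z" "backward d v 3 = v 3 * N ^ 2 - v 0 ^ 9"
    unfolding backward_def Let_def z_def[symmetric] x_def[symmetric] NN[symmetric] K_def[symmetric] c_def by (simp_all add: mult_ac)
  have bi: "backward d v i = c * v i" if "i \<noteq> 1" "i \<noteq> 2" "i \<noteq> 3"
    unfolding backward_def Let_def z_def[symmetric] x_def[symmetric] NN[symmetric] K_def[symmetric] c_def
    using that assms by (simp add: mult_ac)
  have g: "gate_form (c * v 0) (c * x) (c * z) = c ^ 4 * N" by (simp only: gate_form_scale NN)
  have u: "kick_form (c * v 0) (c * x) (c * z) (v 3 * N ^ 2 - v 0 ^ 9) = v 3 * (N ^ 2 * c ^ 9)"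
  proof -
    have "(c ^ 4 * N) ^ 2 - 18 * (c * z) ^ 2 * (c * v 0) ^ 2 * (c ^ 4 * N) = c ^ 8 * (N * (N - 18 * z ^ 2 * v 0 ^ 2))"
      by (simp add: power_mult_distrib algebra_simps power2_eq_square flip: power_add power_mult)
        (simp add: power_add[symmetric] power_numeral_reduce mult_ac)
    also have "\<dots> = c ^ 9" unfolding K_def[symmetric] c_def[symmetric] by (simp flip: power_Suc2)
    finally show ?thesis unfolding kick_form_def Let_def g by (simp add: algebra_simps power_mult_distrib)
  qed
  have cN: "(c ^ 4 * N) ^ 2 = c ^ 8 * N ^ 2" by (simp add: power_mult_distrib flip: power_mult)
  have e: "(c * y) * (c ^ 8 * N ^ 2) = y * (N ^ 2 * c ^ 9)" for y
  proof -
    have "c ^ 9 = c * c ^ 8" by (simp flip: power_Suc)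
    thus ?thesis by (simp only: mult_ac)
  qed
  have e2: "(c * z) * (c ^ 8 * N ^ 2) + v 3 * (N ^ 2 * c ^ 9) = v 2 * (N ^ 2 * c ^ 9)"
    unfolding e by (simp add: z_def algebra_simps)
  have e1: "(c * x + c * z) * (c ^ 8 * N ^ 2) - 2 * (v 3 * (N ^ 2 * c ^ 9)) = v 1 * (N ^ 2 * c ^ 9)"
    unfolding distrib_right e by (simp add: x_def z_def algebra_simps)
  have "forward d (backward d v) i = v i * (N ^ 2 * c ^ 9)"
    unfolding forward_def Let_def b g u cN using e1 e2 e[of "v i"] bi assms(2) by auto
  thus ?thesis by (simp only: c_def K_def z_def)
qed

lemma forward_hom:
  assumes "\<And>a b. f (a + b) = f a + f b" "\<And>a b. f (a * b) = f a * f b" "\<And>a b. f (a - b) = f a - f b"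
    "\<And>a n. f (a ^ n) = f a ^ n" "\<And>k. f (numeral k) = numeral k" "f 0 = 0"
  shows "f (forward d v i) = forward d (\<lambda>i. f (v i)) i" "f (backward d v i) = backward d (\<lambda>i. f (v i)) i"
  by (simp_all add: forward_def backward_def Let_def gate_form_def kick_form_def assms)

lemma value_forward: "mpoly_value x (forward d mpoly_var i) = forward d x i"
  by (subst forward_hom) (simp_all add: value_simps)

lemma subst_forward: "mpoly_subst F (forward d mpoly_var i) = forward d F i"
  "mpoly_subst F (backward d mpoly_var i) = backward d F i"
  by (subst forward_hom; simp add: subst_simps)+

lemma homogeneous_gate_form:
  "homogeneous d 1 t \<Longrightarrow> homogeneous d 1 x \<Longrightarrow> homogeneous d 1 z \<Longrightarrow> homogeneous d 4 (gate_form t x z)"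
  unfolding gate_form_def
  using homogeneous_power[of d 1 t 4] homogeneous_power[of d 1 x 4]
    homogeneous_mult[OF homogeneous_power[of d 1 z 2] homogeneous_power[of d 1 t 2]]
  by (intro homogeneous_add homogeneous_numeral_mult) simp_all

lemma homogeneous_gate_form2:
  "homogeneous d 1 t \<Longrightarrow> homogeneous d 1 x \<Longrightarrow> homogeneous d 1 z \<Longrightarrow> homogeneous d 4 (gate_form t x z - 18 * z ^ 2 * t ^ 2)"
  using homogeneous_mult[OF homogeneous_power[of d 1 z 2] homogeneous_power[of d 1 t 2]]
  unfolding mult.assoc
  by (intro homogeneous_diff homogeneous_numeral_mult homogeneous_gate_form) simp_all

lemma homogeneous_kick_form:
  assumes "homogeneous d 1 t" "homogeneous d 1 x" "homogeneous d 1 z" "homogeneous d 1 u"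
  shows "homogeneous d 9 (kick_form t x z u)"
proof -
  let ?N = "gate_form t x z"
  have N: "homogeneous d 4 ?N" using assms by (intro homogeneous_gate_form)
  have "homogeneous d 8 (z ^ 2 * t ^ 2 * ?N)"
    using homogeneous_mult[OF homogeneous_mult[OF homogeneous_power[OF assms(3), of 2] homogeneous_power[OF assms(1), of 2]] N] by simp
  hence "homogeneous d 8 (?N ^ 2 - 18 * (z ^ 2 * t ^ 2 * ?N))"
    using homogeneous_power[OF N, of 2] by (intro homogeneous_diff homogeneous_numeral_mult) simp_all
  hence "homogeneous d 9 (u * (?N ^ 2 - 18 * (z ^ 2 * t ^ 2 * ?N)))" using homogeneous_mult[OF assms(4)] by fastforce
  thus ?thesis unfolding kick_form_def Let_def mult.assoc
    using homogeneous_power[OF assms(1), of 9] by (intro homogeneous_add) simp_all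
qed

lemma homogeneous_forward:
  assumes "3 \<le> d" "i \<le> d" shows "homogeneous d 9 (forward d mpoly_var i)"
proof -
  have v: "homogeneous d 1 (mpoly_var 0)" "homogeneous d 1 (mpoly_var 1)" "homogeneous d 1 (mpoly_var 2)"
    "homogeneous d 1 (mpoly_var 3)" "homogeneous d 1 (mpoly_var i)" by (rule homogeneous_var, use assms in simp)+
  note U = homogeneous_kick_form[OF v(1-4)]
  have N: "homogeneous d 8 (gate_form (mpoly_var 0) (mpoly_var 1) (mpoly_var 2) ^ 2)"
    using homogeneous_power[OF homogeneous_gate_form[OF v(1-3)], of 2] by simp
  have xN: "homogeneous d 9 (x * gate_form (mpoly_var 0) (mpoly_var 1) (mpoly_var 2) ^ 2)" if "homogeneous d 1 x" for x
    using homogeneous_mult[OF that N] by simp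
  have "homogeneous d 9 ((mpoly_var 1 + mpoly_var 2) * gate_form (mpoly_var 0) (mpoly_var 1) (mpoly_var 2) ^ 2
      - 2 * kick_form (mpoly_var 0) (mpoly_var 1) (mpoly_var 2) (mpoly_var 3))"
    "homogeneous d 9 (mpoly_var 2 * gate_form (mpoly_var 0) (mpoly_var 1) (mpoly_var 2) ^ 2
      + kick_form (mpoly_var 0) (mpoly_var 1) (mpoly_var 2) (mpoly_var 3))"
    by (intro homogeneous_add homogeneous_diff homogeneous_numeral_mult xN v U)+
  thus ?thesis unfolding forward_def Let_def
    using U xN[OF v(5)] by (auto simp del: One_nat_def)
qed

lemma homogeneous_backward:
  assumes "3 \<le> d" "i \<le> d" shows "homogeneous d 9 (backward d mpoly_var i)"
proof -
  have v: "homogeneous d 1 (mpoly_var 0)" "homogeneous d 1 (mpoly_var 1)" "homogeneous d 1 (mpoly_var 2)"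
    "homogeneous d 1 (mpoly_var 3)" "homogeneous d 1 (mpoly_var i)" by (rule homogeneous_var, use assms in simp)+
  let ?x = "mpoly_var 1 - mpoly_var 2 + 3 * mpoly_var 3" and ?z = "mpoly_var 2 - mpoly_var 3"
  have xz: "homogeneous d 1 ?x" "homogeneous d 1 ?z"
    using v by (auto intro!: homogeneous_add homogeneous_diff homogeneous_numeral_mult)
  note N = homogeneous_gate_form[OF v(1) xz] and K = homogeneous_gate_form2[OF v(1) xz]
  have xNK: "homogeneous d 9 (x * gate_form (mpoly_var 0) ?x ?z * (gate_form (mpoly_var 0) ?x ?z - 18 * ?z ^ 2 * mpoly_var 0 ^ 2))"
    if "homogeneous d 1 x" for x
    using homogeneous_mult[OF homogeneous_mult[OF that N] K] by simp
  have U: "homogeneous d 9 (mpoly_var 3 * gate_form (mpoly_var 0) ?x ?z ^ 2 - mpoly_var 0 ^ 9)"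
    using homogeneous_mult[OF v(4) homogeneous_power[OF N, of 2]] homogeneous_power[OF v(1), of 9]
    by (intro homogeneous_diff) simp_all
  show ?thesis unfolding backward_def Let_def using U xNK[OF v(5)] xNK[OF xz(1)] xNK[OF xz(2)]
    by (auto simp del: One_nat_def)
qed

definition phi :: "nat \<Rightarrow> rational_map"
  where "phi d = tuple_class d (forward d mpoly_var)"

lemma nonzero_by_value: "mpoly_value x p \<noteq> 0 \<Longrightarrow> p \<noteq> 0" by (auto simp: value_simps)

abbreviation unit_vec :: "nat \<Rightarrow> qbar" where "unit_vec i \<equiv> (if i = 0 then 1 else 0)"

lemma forward_form_tuple: "3 \<le> d \<Longrightarrow> forward d mpoly_var \<in> form_tuples d"
proof -
  assume d: "3 \<le> d"
  have "mpoly_value unit_vec (forward d mpoly_var 0) \<noteq> 0"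
    unfolding value_forward by (simp add: forward_def gate_form_def Let_def)
  hence "forward d mpoly_var 0 \<noteq> 0" by (rule nonzero_by_value)
  moreover have "forward d mpoly_var i = 0" if "i > d" for i using that d by (simp add: forward_def Let_def)
  ultimately show ?thesis using homogeneous_forward[OF d] unfolding form_tuples_def by blast
qed

lemma backward_form_tuple: "3 \<le> d \<Longrightarrow> backward d mpoly_var \<in> form_tuples d"
proof -
  assume d: "3 \<le> d"
  have "mpoly_value unit_vec (backward d mpoly_var 0) \<noteq> 0"
    by (simp add: backward_def gate_form_def Let_def value_simps)
  hence "backward d mpoly_var 0 \<noteq> 0" by (rule nonzero_by_value)
  moreover have "backward d mpoly_var i = 0" if "i > d" for i using that d by (simp add: backward_def Let_def)
  ultimately show ?thesis using homogeneous_backward[OF d] unfolding form_tuples_def by blast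
qed

theorem birational_phi:
  assumes d: "3 \<le> d" shows "birational d (phi d)"
proof -
  have v: "homogeneous d 1 (mpoly_var 0)" "homogeneous d 1 (mpoly_var 1)" "homogeneous d 1 (mpoly_var 2)"
    "homogeneous d 1 (mpoly_var 3)" by (rule homogeneous_var, use d in simp)+
  let ?x = "mpoly_var 1 - mpoly_var 2 + 3 * mpoly_var 3" and ?z = "mpoly_var 2 - mpoly_var 3"
  have xz: "homogeneous d 1 ?x" "homogeneous d 1 ?z"
    using v by (auto intro!: homogeneous_add homogeneous_diff homogeneous_numeral_mult)
  let ?N = "gate_form (mpoly_var 0) (mpoly_var 1) (mpoly_var 2) :: mpoly"
  let ?M = "?N ^ 19 * (?N - 18 * mpoly_var 2 ^ 2 * mpoly_var 0 ^ 2)"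
  let ?N' = "gate_form (mpoly_var 0) ?x ?z :: mpoly"
  let ?M' = "?N' ^ 2 * (?N' * (?N' - 18 * ?z ^ 2 * mpoly_var 0 ^ 2)) ^ 9"
  have "rat_comp d (tuple_class d (backward d mpoly_var)) (phi d) = rat_id d"
    unfolding phi_def
  proof (rule rat_comp_eq_id[OF forward_form_tuple[OF d] backward_form_tuple[OF d]])
    show "?M \<noteq> 0" by (rule nonzero_by_value[of unit_vec]) (simp add: value_simps gate_form_def)
    show "homogeneous d (19 * 4 + 4) ?M"
      by (intro homogeneous_mult homogeneous_power homogeneous_gate_form homogeneous_gate_form2 v)
    show "mpoly_subst (forward d mpoly_var) (backward d mpoly_var i) = mpoly_var i * ?M" if "i \<le> d" for i
      unfolding subst_forward by (rule backward_forward[OF d that])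
  qed
  moreover have "rat_comp d (phi d) (tuple_class d (backward d mpoly_var)) = rat_id d"
    unfolding phi_def
  proof (rule rat_comp_eq_id[OF backward_form_tuple[OF d] forward_form_tuple[OF d]])
    show "?M' \<noteq> 0" by (rule nonzero_by_value[of unit_vec]) (simp add: value_simps gate_form_def)
    show "homogeneous d (2 * 4 + 9 * (4 + 4)) ?M'"
      by (intro homogeneous_mult homogeneous_power homogeneous_gate_form homogeneous_gate_form2 v xz)
    show "mpoly_subst (backward d mpoly_var) (forward d mpoly_var i) = mpoly_var i * ?M'" if "i \<le> d" for i
      unfolding subst_forward by (rule forward_backward[OF d that])
  qed
  ultimately show ?thesis unfolding birational_def
    using tuple_class_in_maps[OF forward_form_tuple[OF d]] tuple_class_in_maps[OF backward_form_tuple[OF d]]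
    unfolding phi_def by blast
qed

section \<open>The orbit\<close>

definition orbit_vec :: "nat \<Rightarrow> nat \<Rightarrow> rat"
  where "orbit_vec n i = (if i = 0 then 1 else if i = 1 then ox n else if i = 2 then oz n else if i = 3 then ou n else 0)"

definition orbit_point :: "nat \<Rightarrow> nat \<Rightarrow> point"
  where "orbit_point d n = proj_class d (\<lambda>i. of_rat (orbit_vec n i))"

lemma forward_orbit_vec: "3 \<le> d \<Longrightarrow> forward d (orbit_vec n) i = og n ^ 2 * orbit_vec (Suc n) i"
proof -
  assume d: "3 \<le> d"
  have N: "gate_form (orbit_vec n 0) (orbit_vec n 1) (orbit_vec n 2) = og n"
    by (simp add: orbit_vec_def gate_form_def gate_def og_def)
  have N0: "og n \<noteq> 0" by (simp add: og_def)
  have U: "kick_form (orbit_vec n 0) (orbit_vec n 1) (orbit_vec n 2) (orbit_vec n 3) = og n ^ 2 * ou (Suc n)"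
  proof -
    have u: "ou (Suc n) = ou n - 18 * ou n * oz n ^ 2 / og n + 1 / og n ^ 2" by (simp add: orbit_Suc new_u_def og_def)
    have 1: "og n ^ 2 * (18 * ou n * oz n ^ 2 / og n) = 18 * ou n * oz n ^ 2 * og n" "og n ^ 2 * (1 / og n ^ 2) = 1"
      using N0 by (simp_all add: power2_eq_square)
    show ?thesis unfolding kick_form_def Let_def N u distrib_left right_diff_distrib 1
      by (simp add: orbit_vec_def algebra_simps)
  qed
  show ?thesis unfolding forward_def Let_def N U using d
    by (simp add: orbit_vec_def orbit_Suc(1,2) new_x_def new_z_def orbit_Suc(3)[symmetric] algebra_simps)
qed

lemma orbit_vec_coord: "3 \<le> d \<Longrightarrow> (\<lambda>i. of_rat (orbit_vec n i)) \<in> coord_vectors d"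
  by (auto simp: coord_vectors_def orbit_vec_def intro!: exI[of _ 0])

lemma phi_orbit_point:
  assumes d: "3 \<le> d"
  shows "rat_apply d (phi d) (orbit_point d n) = orbit_point d (Suc n)"
    and "orbit_point d n \<notin> indeterminacy_locus d (phi d)"
proof -
  let ?v = "\<lambda>i. of_rat (orbit_vec n i) :: qbar"
  have val: "mpoly_value ?v (forward d mpoly_var i) = of_rat (og n ^ 2) * of_rat (orbit_vec (Suc n) i)" for i
  proof -
    have "mpoly_value ?v (forward d mpoly_var i) = of_rat (forward d (orbit_vec n) i)"
      unfolding value_forward by (rule forward_hom(1)[symmetric]) (simp_all add: of_rat_add of_rat_mult of_rat_diff of_rat_power)
    thus ?thesis unfolding forward_orbit_vec[OF d] by (simp add: of_rat_mult)
  qed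
  have N0: "(of_rat (og n ^ 2) :: qbar) \<noteq> 0" by (simp add: og_def)
  have nz: "\<exists>i. mpoly_value ?v (forward d mpoly_var i) \<noteq> 0"
    unfolding val using N0 by (intro exI[of _ 0]) (simp add: orbit_vec_def)
  show "rat_apply d (phi d) (orbit_point d n) = orbit_point d (Suc n)"
    unfolding phi_def orbit_point_def rat_apply_class(1)[OF forward_form_tuple[OF d] orbit_vec_coord[OF d] nz]
    unfolding val by (rule proj_class_scale[OF orbit_vec_coord[OF d] N0])
  show "orbit_point d n \<notin> indeterminacy_locus d (phi d)"
    unfolding phi_def orbit_point_def by (rule rat_apply_class(2)[OF forward_form_tuple[OF d] orbit_vec_coord[OF d] nz])
qed

lemma phi_iterate: "3 \<le> d \<Longrightarrow> (rat_apply d (phi d) ^^ n) (orbit_point d 0) = orbit_point d n"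
  by (induction n) (simp_all add: phi_orbit_point)

lemma orbit_point_with_orbit: "3 \<le> d \<Longrightarrow> orbit_point d 0 \<in> points_with_orbit d (phi d)"
  unfolding points_with_orbit_def
  using proj_class_in_space[OF orbit_vec_coord] phi_orbit_point(2) phi_iterate
  by (auto simp: orbit_point_def)

lemma normalized_orbit_point:
  assumes d: "3 \<le> d" shows "normalized_coords (orbit_point d n) = (\<lambda>i. of_rat (orbit_vec n i))"
  unfolding normalized_coords_def
proof (rule the_equality)
  let ?v = "\<lambda>i. of_rat (orbit_vec n i) :: qbar"
  have v0: "?v 0 = 1" by (simp add: orbit_vec_def)
  show "?v \<in> orbit_point d n \<and> (\<exists>k. ?v k = 1 \<and> (\<forall>i<k. ?v i = 0))"
    using proj_class_mem[OF orbit_vec_coord[OF d]] v0 unfolding orbit_point_def by blast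
  fix x assume x: "x \<in> orbit_point d n \<and> (\<exists>k. x k = 1 \<and> (\<forall>i<k. x i = 0))"
  then obtain k c where k: "x k = 1" "\<And>i. i < k \<Longrightarrow> x i = 0" and c: "c \<noteq> 0" "x = (\<lambda>i. c * ?v i)"
    unfolding orbit_point_def mem_proj_class by blast
  have x0: "x 0 = c" using c v0 by simp
  hence "k = 0" using k(2)[of 0] c(1) by (cases k) auto
  hence "c = 1" using k(1) x0 by simp
  thus "x = ?v" using c by simp
qed

section \<open>Masses at a single prime\<close>

context nonarch begin

text \<open>\<open>mass\<close> is the local height; \<open>peak\<close> and \<open>dip\<close>
  split \<open>ln |N|\<close> into its positive and negative parts, which the product formula
  balances against each other.\<close>

definition mass :: "nat \<Rightarrow> real" where "mass n = ln (oh n)"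
definition dip :: "nat \<Rightarrow> real" where "dip n = max 0 (- ln (v (og n)))"
definition peak :: "nat \<Rightarrow> real" where "peak n = max 0 (ln (v (og n)))"

definition allfine :: "nat \<Rightarrow> nat \<Rightarrow> bool"
  where "allfine J m \<longleftrightarrow> (\<forall>i. 1 \<le> i \<and> i \<le> J \<longrightarrow> valid_age (oh m) (oh (Suc m)) i)"

text \<open>The current height stems from an entry of age at most \<open>J\<close> that is able to
  follow the path through all ages up to \<open>J\<close>. Everything else is counted with its full
  mass in \<open>bad_mass\<close>.\<close>

definition good :: "nat \<Rightarrow> nat \<Rightarrow> bool"
  where "good J n \<longleftrightarrow> (\<exists>j. 1 \<le> j \<and> j \<le> J \<and> j \<le> n \<and> ent (n - j) \<and> allfine J (n - j))"

definition bad_mass :: "nat \<Rightarrow> nat \<Rightarrow> real"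
  where "bad_mass J n = (if good J n then 0 else mass n)"

lemma mass_nonneg: "0 \<le> mass n" using oh_ge_1[of n] by (simp add: mass_def)
lemma dip_nonneg: "0 \<le> dip n" by (simp add: dip_def)
lemma peak_nonneg: "0 \<le> peak n" by (simp add: peak_def)
lemma bad_mass_nonneg: "0 \<le> bad_mass J n" by (simp add: bad_mass_def mass_nonneg)

lemma peak_dip: "peak n - dip n = ln (v (og n))" by (simp add: peak_def dip_def)

lemma peak_le: "peak n \<le> 4 * mass n"
proof -
  have "ln (v (og n)) \<le> ln (oh n ^ 4)" using v_og_le[of n] v_og_pos[of n] by (subst ln_le_cancel_iff) (auto intro: order.strict_trans2)
  also have "\<dots> = 4 * mass n" using oh_pos[of n] by (simp add: mass_def ln_realpow)
  finally show ?thesis using mass_nonneg[of n] by (simp add: peak_def)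
qed

lemma dip_le: "\<not> ent n \<Longrightarrow> dip n \<le> 5 * mass n"
proof -
  assume "\<not> ent n"
  hence "0 \<le> ln (oh n ^ 5 * v (og n))" by (simp add: ent_def)
  also have "\<dots> = ln (oh n ^ 5) + ln (v (og n))" using oh_pos[of n] v_og_pos[of n] by (intro ln_mult_pos) auto
  also have "\<dots> = 5 * mass n + ln (v (og n))" using oh_pos[of n] by (simp add: mass_def ln_realpow)
  finally show ?thesis using mass_nonneg[of n] by (simp add: dip_def)
qed

lemma mass_entry: "ent n \<Longrightarrow> mass (Suc n) = 2 * dip n"
proof -
  assume e: "ent n"
  have "v (og n) \<le> oh n ^ 5 * v (og n)" using oh_ge_1[of n] v_og_pos[of n] by simp
  hence "v (og n) < 1" using e by (simp add: ent_def)
  hence "ln (v (og n)) < 0" using v_og_pos[of n] by (simp add: ln_less_zero)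
  moreover have "mass (Suc n) = - 2 * ln (v (og n))"
    using v_og_pos[of n] by (simp add: mass_def oh_entry(1)[OF e] ln_div ln_realpow)
  ultimately show ?thesis by (simp add: dip_def)
qed

lemma mass_nonentry: "\<not> ent n \<Longrightarrow> mass (Suc n) \<le> 10 * mass n"
proof -
  assume "\<not> ent n"
  hence "oh (Suc n) \<le> oh n ^ 10" by (rule oh_nonentry)
  hence "ln (oh (Suc n)) \<le> ln (oh n ^ 10)" using oh_pos[of "Suc n"] by (subst ln_le_cancel_iff) (auto intro: order.strict_trans2)
  thus ?thesis using oh_pos[of n] by (simp add: mass_def ln_realpow)
qed

end

context nonarch23 begin

text \<open>On the path the gate has size at least 1, so there is neither a dip nor a second entry
  while it is followed. Hence the age at a good prime is unique.\<close>

lemma good_path: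
  assumes e: "ent m" and f: "allfine J m" and j: "1 \<le> j"
  shows "j \<le> Suc J \<Longrightarrow> mass (m + j) = mass (Suc m)"
    and "j \<le> J \<Longrightarrow> v (og (m + j)) = (if px j = 0 then v (of_int (pz j)) ^ 2 * oh (Suc m) ^ 2 else v (of_int (px j)) ^ 4 * oh (Suc m) ^ 4)"
    and "j \<le> J \<Longrightarrow> 1 \<le> v (og (m + j))"
    and "j \<le> J \<Longrightarrow> \<not> ent (m + j)"
    and "j \<le> J \<Longrightarrow> dip (m + j) = 0"
proof -
  note inc = oh_entry(3)[OF e]
  show "mass (m + j) = mass (Suc m)" if "j \<le> Suc J"
    unfolding mass_def using path_oh[OF inc j] f that by (simp add: allfine_def)
  assume J: "j \<le> J"
  show g: "v (og (m + j)) = (if px j = 0 then v (of_int (pz j)) ^ 2 * oh (Suc m) ^ 2 else v (of_int (px j)) ^ 4 * oh (Suc m) ^ 4)"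
    by (rule path_gate[OF inc j]) (use f J in \<open>simp add: allfine_def\<close>)
  have fj: "valid_age (oh m) (oh (Suc m)) j" using f j J by (simp add: allfine_def)
  show v1: "1 \<le> v (og (m + j))"
  proof (cases "px j = 0")
    case True
    hence "1 \<le> v (of_int (pz j)) * oh (Suc m)" using fj oh_ge_1[of m] by (simp add: valid_age_def)
    hence "1 \<le> (v (of_int (pz j)) * oh (Suc m)) ^ 2" by (rule one_le_power)
    thus ?thesis unfolding g using True by (simp add: power_mult_distrib)
  next
    case False
    hence "1 \<le> v (of_int (px j)) * oh (Suc m)" using fj oh_ge_1[of m] by (simp add: valid_age_def)
    hence "1 \<le> (v (of_int (px j)) * oh (Suc m)) ^ 4" by (rule one_le_power)
    thus ?thesis unfolding g using False by (simp add: power_mult_distrib)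
  qed
  have "1 * 1 \<le> oh (m + j) ^ 5 * v (og (m + j))" using v1 oh_ge_1[of "m + j"] by (intro mult_mono one_le_power) auto
  thus "\<not> ent (m + j)" by (simp add: ent_def)
  show "dip (m + j) = 0" using v1 by (simp add: dip_def)
qed

lemma goodE:
  assumes "good J n"
  obtains m j where "n = m + j" "1 \<le> j" "j \<le> J" "ent m" "allfine J m"
proof -
  obtain j where "1 \<le> j \<and> j \<le> J \<and> j \<le> n \<and> ent (n - j) \<and> allfine J (n - j)" using assms unfolding good_def by blast
  thus thesis by (intro that[of "n - j" j]) auto
qed

lemma good_dip: "good J n \<Longrightarrow> dip n = 0" and good_not_ent: "good J n \<Longrightarrow> \<not> ent n"
  by (erule goodE, use good_path in blast)+

text \<open>On the path both sides vanish. At an entry the new mass is exactly twice the dip, and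
  the overwritten old mass is counted as bad, since a good prime cannot enter. Otherwise the bounds
  10 for the new mass and 5 for the dip leave at most 1 + 2 * 5 = 11 masses.\<close>

lemma mass_step: "\<bar>mass (Suc n) - mass n - 2 * dip n\<bar> \<le> 11 * bad_mass J n"
proof (cases "good J n")
  case True
  then obtain m j where m: "n = m + j" "1 \<le> j" "j \<le> J" "ent m" "allfine J m" by (rule goodE)
  have "mass (m + Suc j) = mass (Suc m)" "mass (m + j) = mass (Suc m)"
    using good_path(1)[OF m(4,5), of "Suc j"] good_path(1)[OF m(4,5), of j] m(2,3) by simp_all
  hence "mass (Suc n) = mass n" using m(1) by simp
  thus ?thesis using good_dip[OF True] bad_mass_nonneg[of J n] by simp
next
  case False
  hence b: "bad_mass J n = mass n" by (simp add: bad_mass_def)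
  show ?thesis
  proof (cases "ent n")
    case True
    thus ?thesis using mass_entry[OF True] mass_nonneg[of n] by (simp add: b)
  next
    case f: False
    show ?thesis using mass_nonentry[OF f] dip_le[OF f] mass_nonneg[of n] mass_nonneg[of "Suc n"] dip_nonneg[of n]
      unfolding b by (intro abs_leI) linarith+
  qed
qed

text \<open>The height is traced to the last entry, at \<open>m\<close>. If that is older than
  \<open>J\<close>, rough growth gives \<open>2 ^ (n - m)\<close> times twice the dip at
  \<open>m\<close>; if it is recent, it cannot follow the path up to age \<open>J\<close>, and its
  mass is at most \<open>K\<close> by hypothesis.\<close>

lemma bad_mass_le:
  assumes K: "0 \<le> K" "\<And>m. ent m \<Longrightarrow> \<not> allfine J m \<Longrightarrow> mass (Suc m) \<le> K"
  shows "bad_mass J n \<le> (\<Sum>j\<in>{J<..n}. 2 ^ (j + 1) * dip (n - j)) + 2 ^ J * K"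
proof (cases "good J n \<or> mass n = 0")
  case True
  hence "bad_mass J n = 0" by (auto simp: bad_mass_def)
  moreover have "0 \<le> (\<Sum>j\<in>{J<..n}. 2 ^ (j + 1) * dip (n - j))" by (intro sum_nonneg mult_nonneg_nonneg dip_nonneg) simp
  ultimately show ?thesis using K(1) by simp
next
  case False
  hence "oh n \<noteq> 1" by (auto simp: mass_def)
  hence "1 < oh n" using oh_ge_1[of n] by simp
  then obtain m where m: "m < n" "ent m" "\<And>i. m < i \<Longrightarrow> i < n \<Longrightarrow> \<not> ent i" using entry_exists by blast
  have r: "mass n \<le> 2 ^ (n - m) * mass (Suc m)" unfolding mass_def by (rule rough_growth[OF m(2,3,1)])
  have b: "bad_mass J n = mass n" using False by (simp add: bad_mass_def)
  have S0: "0 \<le> (\<Sum>j\<in>{J<..n}. 2 ^ (j + 1) * dip (n - j))" by (intro sum_nonneg mult_nonneg_nonneg dip_nonneg) simp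
  show ?thesis
  proof (cases "n - m \<le> J")
    case True
    have "\<not> allfine J m"
    proof
      assume "allfine J m"
      hence "good J n" unfolding good_def using m True by (intro exI[of _ "n - m"]) simp
      thus False using False by simp
    qed
    hence "mass (Suc m) \<le> K" by (rule K(2)[OF m(2)])
    moreover have "(2::real) ^ (n - m) \<le> 2 ^ J" using True by (intro power_increasing) auto
    ultimately have "2 ^ (n - m) * mass (Suc m) \<le> 2 ^ J * K" using mass_nonneg by (intro mult_mono) auto
    thus ?thesis using r b S0 by linarith
  next
    case f: False
    have "2 ^ (n - m) * mass (Suc m) = 2 ^ ((n - m) + 1) * dip (n - (n - m))" using mass_entry[OF m(2)] m(1) by simp
    also have "\<dots> \<le> (\<Sum>j\<in>{J<..n}. 2 ^ (j + 1) * dip (n - j))"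
      by (rule member_le_sum[of "n - m" _ "\<lambda>j. 2 ^ (j + 1) * dip (n - j)"]) (use f dip_nonneg in auto)
    finally show ?thesis using r b K(1) by (simp add: add_increasing2)
  qed
qed

text \<open>At a good prime the gate has size \<open>B ^ 4\<close> up to a path coordinate, so the
  peak is 4 times the mass; at an event age it is \<open>B ^ 2\<close>, and the missing two masses
  are 4 times the dip of the entry. \<open>L\<close> absorbs the path coordinates and
  \<open>K\<close> the entries that leave the path.\<close>

lemma peak_formula:
  fixes n :: nat
  assumes K: "0 \<le> K" "\<And>m. ent m \<Longrightarrow> \<not> allfine J m \<Longrightarrow> mass (Suc m) \<le> K"
    and L: "0 \<le> L" "\<And>j. 1 \<le> j \<Longrightarrow> j \<le> J \<Longrightarrow> \<bar>ln (v (of_int (if px j = 0 then pz j else px j)))\<bar> \<le> L"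
      "\<And>j. 1 \<le> j \<Longrightarrow> j \<le> J \<Longrightarrow> px j = 0 \<Longrightarrow> pz j \<noteq> 0"
  defines "I \<equiv> {j. 1 \<le> j \<and> j \<le> J \<and> j \<le> n \<and> px j = 0}"
  shows "\<bar>peak n - 4 * mass n + 4 * (\<Sum>j\<in>I. dip (n - j))\<bar>
    \<le> 4 * bad_mass J n + 20 * (\<Sum>j\<in>I. bad_mass J (n - j)) + 4 * L + 4 * real J * K"
proof -
  have finI: "finite I" by (rule finite_subset[of _ "{..J}"]) (auto simp: I_def)
  have cI: "card I \<le> J"
  proof -
    have "I \<subseteq> {1..J}" unfolding I_def by auto
    thus ?thesis using card_mono[of "{1..J}" I] by simp
  qed
  have tj: "dip (n - j) \<le> 5 * bad_mass J (n - j) + K" if "\<not> (ent (n - j) \<and> allfine J (n - j))" for j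
  proof (cases "ent (n - j)")
    case True
    hence "mass (Suc (n - j)) \<le> K" using that K(2) by blast
    hence "dip (n - j) \<le> K" using mass_entry[OF True] dip_nonneg[of "n - j"] by linarith
    thus ?thesis using bad_mass_nonneg[of J "n - j"] by linarith
  next
    case False
    show ?thesis
    proof (cases "good J (n - j)")
      case True thus ?thesis using good_dip[OF True] K(1) bad_mass_nonneg[of J "n - j"] by simp
    next
      case f: False thus ?thesis using dip_le[OF False] K(1) by (simp add: bad_mass_def)
    qed
  qed
  have sum_le: "4 * (\<Sum>j\<in>I'. dip (n - j)) \<le> 20 * (\<Sum>j\<in>I. bad_mass J (n - j)) + 4 * real J * K"
    if I': "I' \<subseteq> I" "\<And>j. j \<in> I' \<Longrightarrow> \<not> (ent (n - j) \<and> allfine J (n - j))" for I'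
  proof -
    have fI': "finite I'" using I'(1) finI finite_subset by blast
    have "(\<Sum>j\<in>I'. dip (n - j)) \<le> (\<Sum>j\<in>I'. 5 * bad_mass J (n - j) + K)" by (intro sum_mono tj I'(2))
    also have "\<dots> = 5 * (\<Sum>j\<in>I'. bad_mass J (n - j)) + real (card I') * K" by (simp add: sum.distrib sum_distrib_left)
    also have "\<dots> \<le> 5 * (\<Sum>j\<in>I. bad_mass J (n - j)) + real J * K"
    proof (intro add_mono mult_left_mono mult_right_mono sum_mono2 finI I'(1) bad_mass_nonneg K(1))
      have "card I' \<le> card I" by (rule card_mono[OF finI I'(1)])
      thus "real (card I') \<le> real J" using cI by simp
    qed simp
    finally show ?thesis by linarith
  qed
  show ?thesis
  proof (cases "good J n")
    case False
    have "\<not> (ent (n - j) \<and> allfine J (n - j))" if "j \<in> I" for j using False that unfolding good_def I_def by blast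
    hence s: "4 * (\<Sum>j\<in>I. dip (n - j)) \<le> 20 * (\<Sum>j\<in>I. bad_mass J (n - j)) + 4 * real J * K" by (intro sum_le) auto
    have "0 \<le> (\<Sum>j\<in>I. dip (n - j))" "0 \<le> (\<Sum>j\<in>I. bad_mass J (n - j))" by (intro sum_nonneg dip_nonneg bad_mass_nonneg)+
    moreover have "bad_mass J n = mass n" using False by (simp add: bad_mass_def)
    moreover have "0 \<le> 4 * real J * K" using K(1) by simp
    ultimately show ?thesis using s peak_le[of n] peak_nonneg[of n] L(1) mass_nonneg[of n]
      by (intro abs_leI) linarith+
  next
    case True
    then obtain m j0 where m: "n = m + j0" "1 \<le> j0" "j0 \<le> J" "ent m" "allfine J m" by (rule goodE)
    have j0I: "j0 \<in> I \<longleftrightarrow> px j0 = 0" using m by (simp add: I_def)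
    \<comment> \<open>Two entries that both follow the path cannot lie within \<open>J\<close> steps
      of each other, since the later one would occur on the path of the earlier one.\<close>
    have uniq: "\<not> (ent (n - j) \<and> allfine J (n - j))" if j: "j \<in> I - {j0}" for j
    proof
      assume *: "ent (n - j) \<and> allfine J (n - j)"
      have jI: "1 \<le> j" "j \<le> J" "j \<le> n" "j \<noteq> j0" using j by (auto simp: I_def)
      show False
      proof (cases "j < j0")
        case True
        hence "n - j = m + (j0 - j)" "1 \<le> j0 - j" "j0 - j \<le> J" using m by auto
        thus False using good_path(4)[OF m(4,5), of "j0 - j"] * by simp
      next
        case False
        hence "m = (n - j) + (j - j0)" "1 \<le> j - j0" "j - j0 \<le> J" using m jI by auto
        thus False using good_path(4)[of "n - j" J "j - j0"] * m(4) by simp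
      qed
    qed
    have s: "4 * (\<Sum>j\<in>I - {j0}. dip (n - j)) \<le> 20 * (\<Sum>j\<in>I. bad_mass J (n - j)) + 4 * real J * K"
      by (rule sum_le) (use uniq in auto)
    have s0: "0 \<le> (\<Sum>j\<in>I - {j0}. dip (n - j))" by (intro sum_nonneg dip_nonneg)
    have sI: "(\<Sum>j\<in>I. dip (n - j)) = (if px j0 = 0 then dip m else 0) + (\<Sum>j\<in>I - {j0}. dip (n - j))"
    proof (cases "px j0 = 0")
      case True
      hence "j0 \<in> I" using j0I by simp
      thus ?thesis using sum.remove[OF finI, of j0 "\<lambda>j. dip (n - j)"] True m(1) by simp
    next
      case False
      hence "I - {j0} = I" using j0I by blast
      thus ?thesis using False by simp
    qed
    have mn: "mass n = 2 * dip m" using good_path(1)[OF m(4,5,2)] m(1,3) mass_entry[OF m(4)] by simp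
    have v1: "1 \<le> v (og n)" using good_path(3)[OF m(4,5,2,3)] m(1) by simp
    hence pk: "peak n = ln (v (og n))" by (simp add: peak_def)
    have mSuc: "ln (oh (Suc m)) = mass n" using mass_entry[OF m(4)] mn by (simp add: mass_def)
    have dev: "\<bar>peak n - 4 * mass n + 4 * (if px j0 = 0 then dip m else 0)\<bar> \<le> 4 * L"
    proof (cases "px j0 = 0")
      case True
      have nz: "of_int (pz j0) \<noteq> (0::rat)" using L(3)[OF m(2,3) True] by simp
      have "peak n = 2 * ln (v (of_int (pz j0))) + 2 * mass n"
      proof -
        have "v (og n) = v (of_int (pz j0)) ^ 2 * oh (Suc m) ^ 2" using good_path(2)[OF m(4,5,2,3)] m(1) True by simp
        hence "peak n = ln (v (of_int (pz j0)) ^ 2) + ln (oh (Suc m) ^ 2)"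
          unfolding pk using v_pos[OF nz] oh_pos[of "Suc m"] by (simp only: ln_mult_pos zero_less_power)
        thus ?thesis using v_pos[OF nz] oh_pos[of "Suc m"] mSuc by (simp add: ln_realpow)
      qed
      thus ?thesis using L(2)[OF m(2,3)] True mn L(1) by simp
    next
      case False
      hence nz: "of_int (px j0) \<noteq> (0::rat)" by simp
      have "peak n = 4 * ln (v (of_int (px j0))) + 4 * mass n"
      proof -
        have "v (og n) = v (of_int (px j0)) ^ 4 * oh (Suc m) ^ 4" using good_path(2)[OF m(4,5,2,3)] m(1) False by simp
        hence "peak n = ln (v (of_int (px j0)) ^ 4) + ln (oh (Suc m) ^ 4)"
          unfolding pk using v_pos[OF nz] oh_pos[of "Suc m"] by (simp only: ln_mult_pos zero_less_power)
        thus ?thesis using v_pos[OF nz] oh_pos[of "Suc m"] mSuc by (simp add: ln_realpow)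
      qed
      thus ?thesis using L(2)[OF m(2,3)] False by simp
    qed
    have "\<bar>x + 4 * (c + S)\<bar> \<le> 4 * b + T + 4 * L + k"
      if "\<bar>x + 4 * c\<bar> \<le> 4 * L" "4 * S \<le> T + k" "0 \<le> S" "0 \<le> b" for x c S T b k :: real
      using that unfolding abs_le_iff by (intro conjI) argo+
    from this[OF dev s s0 bad_mass_nonneg[of J n]] show ?thesis unfolding sI .
  qed
qed

lemma allfine_4: "ent m \<Longrightarrow> allfine 4 m"
  unfolding allfine_def using fine_small[OF oh_entry(3)] by blast

text \<open>\<open>E ^ 10 < B\<close> and \<open>R ^ 10 < B\<close> combine to
  \<open>(E * R) ^ 5 < B\<close>. This room is enough for the inequalities in
  \<open>valid_age\<close> when the path coordinate has size at least \<open>1 / R\<close>.\<close>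

lemma fine_large:
  assumes e: "ent m" and R: "1 \<le> R" "R ^ 10 < oh (Suc m)"
    and v1: "px j \<noteq> 0 \<Longrightarrow> 1 / R \<le> v (of_int (px j))" "px j = 0 \<Longrightarrow> 1 / R \<le> v (of_int (pz j))"
  shows "valid_age (oh m) (oh (Suc m)) j"
proof -
  define E B where "E = oh m" and "B = oh (Suc m)"
  have E: "1 \<le> E" "E ^ 10 < B" unfolding E_def B_def by (rule oh_ge_1, rule oh_entry(2)[OF e])
  have B: "R ^ 10 < B" "0 < B" using R oh_pos by (auto simp: B_def)
  have ER: "(E * R) ^ 5 < B"
  proof (rule power_less_imp_less_base)
    have "((E * R) ^ 5) ^ 2 = E ^ 10 * R ^ 10" by (simp add: power_mult_distrib flip: power_mult)
    also have "\<dots> < B * B" using E B R by (intro mult_strict_mono) auto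
    finally show "((E * R) ^ 5) ^ 2 < B ^ 2" by (simp only: power2_eq_square)
  qed (use B in simp)
  have "E * R \<le> (E * R) ^ 5" using E R mult_mono[of 1 E 1 R] by (intro self_le_power) auto
  hence a: "E * R < B" using ER by linarith
  have b: "R ^ 4 \<le> B"
  proof -
    have "R ^ 4 \<le> R ^ 10" using R by (intro power_increasing) auto
    thus ?thesis using B by linarith
  qed
  have c: "E ^ 3 * R ^ 2 \<le> B"
  proof -
    have "E ^ 3 * R ^ 2 \<le> E ^ 5 * R ^ 5" using E R by (intro mult_mono power_increasing) auto
    thus ?thesis using ER by (simp add: power_mult_distrib)
  qed
  have main: "E < x * B \<and> 1 \<le> x ^ 4 * B \<and> E ^ 3 \<le> x ^ 2 * B" if x: "1 / R \<le> x" for x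
  proof -
    have x1: "1 \<le> R * x" using x R by (simp add: field_simps)
    have R0: "0 < R" "0 \<le> x" using R x by (auto intro: order_trans[rotated])
    have "R * E < R * (x * B)"
    proof -
      have "1 * B \<le> (R * x) * B" using x1 B by (intro mult_right_mono) auto
      thus ?thesis using a by (simp add: mult_ac)
    qed
    moreover have "R ^ 4 * 1 \<le> R ^ 4 * (x ^ 4 * B)"
    proof -
      have "1 * B \<le> (R * x) ^ 4 * B" using x1 B by (intro mult_right_mono one_le_power) auto
      thus ?thesis using b by (simp add: power_mult_distrib mult_ac)
    qed
    moreover have "R ^ 2 * E ^ 3 \<le> R ^ 2 * (x ^ 2 * B)"
    proof -
      have "1 * B \<le> (R * x) ^ 2 * B" using x1 B by (intro mult_right_mono one_le_power) auto
      thus ?thesis using c by (simp add: power_mult_distrib mult_ac)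
    qed
    ultimately show ?thesis using R0(1) by (simp only: mult_less_cancel_left_pos mult_le_cancel_left_pos zero_less_power)
  qed
  show ?thesis using main v1 unfolding valid_age_def E_def[symmetric] B_def[symmetric] by auto
qed

end

text \<open>As long as the coordinates are integral, \<open>N\<close> is 1 plus a multiple of 12 and
  hence a unit; then every division is by a unit and integrality persists.\<close>

lemma small_prime_trivial:
  assumes "nonarch v" "v 12 < 1"
  shows "nonarch.oh v n = 1" "v (og n) = 1"
proof -
  interpret nonarch v by fact
  have g1: "v (gate a b) = 1" if "v a \<le> 1" "v b \<le> 1" for a b
  proof -
    have "v (b ^ 2 + a ^ 4) \<le> 1" by (rule v_add_le) (use that v_nonneg in \<open>simp_all add: v_power power_le_one\<close>)
    hence "v (12 * (b ^ 2 + a ^ 4)) < 1" unfolding v_mult using assms(2) v_nonneg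
      by (metis mult_left_le order.strict_trans1)
    thus ?thesis unfolding gate_def using v_add_eq[of "12 * (b ^ 2 + a ^ 4)" 1] by simp
  qed
  have all: "v (ox n) \<le> 1 \<and> v (oz n) \<le> 1 \<and> v (ou n) \<le> 1" for n
  proof (induction n)
    case (Suc n)
    have g: "v (gate (ox n) (oz n)) = 1" using g1 Suc by blast
    have k: "v (18 * ou n * oz n ^ 2 / gate (ox n) (oz n)) \<le> 1"
    proof -
      have "v (18 * (ou n * oz n ^ 2)) \<le> 1"
        by (rule v_num_mult_le) (use Suc v_nonneg in \<open>simp add: v_mult v_power mult_le_one power_le_one\<close>)
      thus ?thesis using g by (simp add: v_divide mult.assoc)
    qed
    have u: "v (ou (Suc n)) \<le> 1" unfolding orbit_Suc new_u_def
      by (intro v_add_le v_diff_le k) (use Suc g in \<open>simp_all add: v_divide v_power\<close>)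
    have z: "v (oz (Suc n)) \<le> 1" using u Suc unfolding orbit_Suc new_z_def by (intro v_add_le) auto
    have x: "v (ox (Suc n)) \<le> 1" using u Suc unfolding orbit_Suc new_x_def by (intro v_add_le v_diff_le v_num_mult_le) auto
    show ?case using u z x by blast
  qed (simp add: orbit_0)
  have "hh (ox n) (oz n) (ou n) = 1" unfolding hh_def using all[of n] by (simp add: max_def)
  thus "oh n = 1" by (simp add: oh_def)
  show "v (og n) = 1" unfolding og_def using g1 all[of n] by blast
qed

section \<open>The closed form of the path\<close>

definition seg_start :: "nat \<Rightarrow> nat" where "seg_start k = 20 * 2 ^ k - 15 * k - 20"
definition seg_len :: "nat \<Rightarrow> nat" where "seg_len k = 20 * 2 ^ k - 15"

lemma seg_start_Suc: "seg_start (Suc k) = seg_start k + seg_len k"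
  using exponent_le[of k] exponent_le[of "Suc k"] by (simp add: seg_start_def seg_len_def)

lemma seg_len_ge: "5 \<le> seg_len k"
proof -
  have "(1::nat) \<le> 2 ^ k" by simp
  thus ?thesis unfolding seg_len_def by arith
qed

lemma int_seg_len: "int (seg_len k) = 20 * 2 ^ k - 15"
  using exponent_le[of k] by (simp add: seg_len_def of_nat_diff)

text \<open>Between events \<open>z\<close> grows by 1 per step and \<open>x\<close> is quadratic in
  the step number, with zeros at both ends of the segment; the second zero is the next event. An
  event multiplies \<open>z\<close> by about -2, so the start value \<open>5 * 2 ^ k - 5\<close> of
  \<open>z\<close> roughly doubles from segment to segment, and the length with it.\<close>

lemma path_segment_from:
  assumes "px (seg_start k) = 0" "- 2 * pz (seg_start k) = 10 - 10 * 2 ^ k" "1 \<le> i" "i \<le> seg_len k"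
  shows "2 * px (seg_start k + i) = int i * (int i - int (seg_len k)) \<and> pz (seg_start k + i) = 10 - 10 * 2 ^ k + int i"
  using assms(3,4)
proof (induction i rule: dec_induct)
  case base
  show ?case using assms(1,2) by (simp add: px_Suc pz_Suc int_seg_len)
next
  case (step i)
  have i: "0 < i" "i < seg_len k" using step by auto
  hence "int i * (int i - int (seg_len k)) \<noteq> 0" by simp
  hence "px (seg_start k + i) \<noteq> 0" using step by auto
  hence "px (seg_start k + Suc i) = px (seg_start k + i) + pz (seg_start k + i) - 2" "pz (seg_start k + Suc i) = pz (seg_start k + i) + 1"
    by (simp_all add: px_Suc pz_Suc)
  thus ?case using step by (simp add: int_seg_len algebra_simps)
qed

lemma path_segment_start: "px (seg_start k) = 0 \<and> - 2 * pz (seg_start k) = 10 - 10 * 2 ^ k"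
proof (induction k)
  case 0 show ?case by (simp add: seg_start_def path_0)
next
  case (Suc k)
  have "2 * px (seg_start k + seg_len k) = 0 \<and> pz (seg_start k + seg_len k) = 10 - 10 * 2 ^ k + int (seg_len k)"
    using path_segment_from[of k "seg_len k"] Suc seg_len_ge[of k] by simp
  thus ?case by (simp add: seg_start_Suc int_seg_len)
qed

lemma path_segment:
  "1 \<le> i \<Longrightarrow> i \<le> seg_len k \<Longrightarrow> 2 * px (seg_start k + i) = int i * (int i - int (seg_len k)) \<and> pz (seg_start k + i) = 10 - 10 * 2 ^ k + int i"
  using path_segment_from path_segment_start by blast

definition events :: "nat set" where "events = {j. 1 \<le> j \<and> px j = 0}"

lemma strict_mono_seg_start: "strict_mono seg_start"
proof -
  have "0 < seg_len k" for k using seg_len_ge[of k] by linarith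
  thus ?thesis unfolding strict_mono_Suc_iff by (simp add: seg_start_Suc)
qed

lemma events_eq: "events = range (\<lambda>k. seg_start (Suc k))"
proof
  show "range (\<lambda>k. seg_start (Suc k)) \<subseteq> events"
  proof
    fix j assume "j \<in> range (\<lambda>k. seg_start (Suc k))"
    then obtain k where j: "j = seg_start (Suc k)" by blast
    have "1 \<le> j" unfolding j seg_start_Suc using seg_len_ge[of k] by linarith
    thus "j \<in> events" using path_segment_start[of "Suc k"] by (simp add: events_def j)
  qed
  show "events \<subseteq> range (\<lambda>k. seg_start (Suc k))"
  proof
    fix j assume "j \<in> events"
    hence j: "1 \<le> j" "px j = 0" by (auto simp: events_def)
    have "\<exists>k. j \<le> seg_start k" using strict_mono_imp_increasing[OF strict_mono_seg_start, of j] by blast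
    define k where "k = (LEAST k. j \<le> seg_start k)"
    have k: "j \<le> seg_start k" unfolding k_def by (rule LeastI_ex) fact
    have "k \<noteq> 0"
    proof
      assume "k = 0"
      hence "seg_start k = 0" by (simp add: seg_start_def)
      thus False using k j by simp
    qed
    then obtain l where l: "k = Suc l" using not0_implies_Suc by blast
    have "seg_start l < j" using not_less_Least[of l "\<lambda>k. j \<le> seg_start k"] unfolding k_def[symmetric] l by simp
    define i where "i = j - seg_start l"
    have i: "1 \<le> i" "i \<le> seg_len l" "j = seg_start l + i" using \<open>seg_start l < j\<close> k seg_start_Suc[of l] by (auto simp: i_def l)
    have "int i * (int i - int (seg_len l)) = 0" using path_segment[OF i(1,2)] j i(3) by simp
    hence "i = seg_len l" using i by simp
    hence "j = seg_start (Suc l)" using i seg_start_Suc by simp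
    thus "j \<in> range (\<lambda>k. seg_start (Suc k))" by blast
  qed
qed

lemma events_ge_5: "j \<in> events \<Longrightarrow> 5 \<le> j"
proof -
  assume "j \<in> events"
  then obtain k where j: "j = seg_start (Suc k)" by (auto simp: events_eq)
  have "seg_start 1 \<le> seg_start (Suc k)" using strict_mono_mono[OF strict_mono_seg_start] by (auto simp: mono_def)
  thus ?thesis using j by (simp add: seg_start_def)
qed

lemma event_pz_nonzero: "j \<in> events \<Longrightarrow> pz j \<noteq> 0"
proof -
  assume "j \<in> events"
  then obtain k where j: "j = seg_start (Suc k)" by (auto simp: events_eq)
  have 1: "(1::int) \<le> 2 ^ k" by simp
  show ?thesis
  proof
    assume "pz j = 0"
    hence "10 - 10 * 2 ^ Suc k = (0::int)" using path_segment_start[of "Suc k"] j by simp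
    thus False using 1 unfolding power_Suc by linarith
  qed
qed

section \<open>Total masses\<close>

definition gmass :: "nat \<Rightarrow> nat \<Rightarrow> real" where "gmass p n = nonarch.mass (pabs p) n"
definition gdip :: "nat \<Rightarrow> nat \<Rightarrow> real" where "gdip p n = nonarch.dip (pabs p) n"
definition gpeak :: "nat \<Rightarrow> nat \<Rightarrow> real" where "gpeak p n = nonarch.peak (pabs p) n"
definition gbad :: "nat \<Rightarrow> nat \<Rightarrow> nat \<Rightarrow> real" where "gbad J p n = nonarch.bad_mass (pabs p) J n"

text \<open>The finitely many primes that see anything at time \<open>n\<close>. The totals become
  finite sums, and \<open>upto\<close> provides a common range for comparing several times.\<close>

definition active :: "nat \<Rightarrow> nat set"
  where "active n = {p. is_prime p \<and> (gmass p n \<noteq> 0 \<or> pabs p (og n) \<noteq> 1)}"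

definition upto :: "nat \<Rightarrow> nat set" where "upto n = (\<Union>k\<le>n. active k)"

definition total :: "(nat \<Rightarrow> nat \<Rightarrow> real) \<Rightarrow> nat \<Rightarrow> real"
  where "total f n = (\<Sum>p\<in>active n. f p n)"

lemma finite_active: "finite (active n)"
proof -
  have "active n \<subseteq> {p. is_prime p \<and> 1 < pabs p (ox n)} \<union> {p. is_prime p \<and> 1 < pabs p (oz n)}
     \<union> {p. is_prime p \<and> 1 < pabs p (ou n)} \<union> {p. is_prime p \<and> pabs p (og n) \<noteq> 1}"
  proof
    fix p assume p: "p \<in> active n"
    hence pr: "is_prime p" by (simp add: active_def)
    interpret nonarch "pabs p" by (rule nonarch_pabs[OF pr])
    have "gmass p n = 0" if "pabs p (ox n) \<le> 1" "pabs p (oz n) \<le> 1" "pabs p (ou n) \<le> 1"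
      using that by (simp add: gmass_def mass_def oh_def hh_def max_def)
    thus "p \<in> {p. is_prime p \<and> 1 < pabs p (ox n)} \<union> {p. is_prime p \<and> 1 < pabs p (oz n)}
     \<union> {p. is_prime p \<and> 1 < pabs p (ou n)} \<union> {p. is_prime p \<and> pabs p (og n) \<noteq> 1}"
      using p by (auto simp: active_def not_less)
  qed
  moreover have "og n \<noteq> 0" by (simp add: og_def)
  ultimately show ?thesis
    using finite_pabs_gt_1 finite_pabs_neq_1 by (elim finite_subset) (simp only: finite_Un simp_thms)
qed

lemma finite_upto: "finite (upto n)" by (simp add: upto_def finite_active)

lemma upto_prime: "p \<in> upto n \<Longrightarrow> is_prime p" by (auto simp: upto_def active_def)

lemma inactive:
  assumes p: "is_prime p" "p \<notin> active n"
  shows "gmass p n = 0" "gdip p n = 0" "gpeak p n = 0" "gbad J p n = 0"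
proof -
  interpret nonarch "pabs p" by (rule nonarch_pabs[OF p(1)])
  have "gmass p n = 0" "pabs p (og n) = 1" using p by (auto simp: active_def)
  thus "gmass p n = 0" "gdip p n = 0" "gpeak p n = 0" "gbad J p n = 0"
    by (simp_all add: gmass_def gdip_def gpeak_def gbad_def dip_def peak_def bad_mass_def)
qed

lemma total_upto:
  assumes "k \<le> n" "\<And>p. is_prime p \<Longrightarrow> p \<notin> active k \<Longrightarrow> f p k = 0"
  shows "total f k = (\<Sum>p\<in>upto n. f p k)"
  unfolding total_def
proof (rule sum.mono_neutral_left[OF finite_upto])
  show "active k \<subseteq> upto n" using assms(1) by (auto simp: upto_def)
  show "\<forall>p\<in>upto n - active k. f p k = 0" using assms(2) upto_prime by blast
qed

lemma totals:
  assumes "k \<le> n"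
  shows "total gmass k = (\<Sum>p\<in>upto n. gmass p k)" "total gdip k = (\<Sum>p\<in>upto n. gdip p k)"
    "total gpeak k = (\<Sum>p\<in>upto n. gpeak p k)" "total (gbad J) k = (\<Sum>p\<in>upto n. gbad J p k)"
  by (intro total_upto[OF assms] inactive; assumption)+

lemma gnonneg: "is_prime p \<Longrightarrow> 0 \<le> gmass p n" "is_prime p \<Longrightarrow> 0 \<le> gdip p n" "is_prime p \<Longrightarrow> 0 \<le> gpeak p n"
  "is_prime p \<Longrightarrow> 0 \<le> gbad J p n"
  unfolding gmass_def gdip_def gpeak_def gbad_def
  using nonarch.mass_nonneg nonarch.dip_nonneg nonarch.peak_nonneg nonarch.bad_mass_nonneg nonarch_pabs by auto

lemma total_nonneg: "0 \<le> total gmass n" "0 \<le> total gdip n" "0 \<le> total gpeak n" "0 \<le> total (gbad J) n"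
  unfolding total_def by (intro sum_nonneg gnonneg; simp add: active_def)+

lemma prime_cases: "is_prime p \<Longrightarrow> 5 \<le> p \<or> p = 2 \<or> p = 3"
proof -
  assume p: "is_prime p"
  have "\<not> is_prime 4"
  proof
    assume "is_prime 4"
    hence "(2::nat) = 1 \<or> (2::nat) = 4" unfolding prime_nat_iff by (metis dvd_def num_double numeral_times_numeral)
    thus False by simp
  qed
  moreover have "2 \<le> p" using prime_ge_2_nat[OF p] .
  ultimately show ?thesis using p by (cases "p = 4") auto
qed

lemma small_prime_zero:
  assumes "p = 2 \<or> p = 3" "is_prime p"
  shows "gmass p n = 0" "gdip p n = 0" "gpeak p n = 0" "gbad J p n = 0"
proof -
  have "p \<notin> active n" using small_prime_trivial[OF nonarch_pabs[OF assms(2)] pabs_23[OF assms(1)], of n]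
    by (simp add: active_def gmass_def nonarch.mass_def[OF nonarch_pabs[OF assms(2)]])
  thus "gmass p n = 0" "gdip p n = 0" "gpeak p n = 0" "gbad J p n = 0" using inactive assms(2) by auto
qed

lemma gmass_step:
  assumes p: "is_prime p" shows "\<bar>gmass p (Suc n) - gmass p n - 2 * gdip p n\<bar> \<le> 11 * gbad J p n"
proof (cases "5 \<le> p")
  case True
  interpret nonarch23 "pabs p" by (rule nonarch23_pabs[OF p True])
  show ?thesis unfolding gmass_def gdip_def gbad_def by (rule mass_step)
next
  case False
  hence "p = 2 \<or> p = 3" using prime_cases[OF p] by simp
  thus ?thesis using small_prime_zero[OF _ p] by simp
qed

text \<open>At primes beyond this bound every entry follows the path up to age \<open>J\<close>.\<close>

definition path_bound :: "nat \<Rightarrow> nat"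
  where "path_bound J = 1 + (\<Sum>i\<le>J. nat \<bar>px i\<bar> + nat \<bar>pz i\<bar>)"

lemma path_bound: "i \<le> J \<Longrightarrow> \<bar>px i\<bar> < int (path_bound J) \<and> \<bar>pz i\<bar> < int (path_bound J)"
proof -
  assume "i \<le> J"
  hence "nat \<bar>px i\<bar> + nat \<bar>pz i\<bar> \<le> (\<Sum>i\<le>J. nat \<bar>px i\<bar> + nat \<bar>pz i\<bar>)"
    by (intro member_le_sum[of i "{..J}" "\<lambda>i. nat \<bar>px i\<bar> + nat \<bar>pz i\<bar>"]) auto
  hence "nat \<bar>px i\<bar> < path_bound J" "nat \<bar>pz i\<bar> < path_bound J" unfolding path_bound_def by linarith+
  thus ?thesis by linarith
qed

lemma path_pabs_lower:
  assumes "is_prime p" "i \<le> J" and n: "n = px i \<or> n = pz i" "n \<noteq> 0"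
  shows "1 / real (path_bound J) \<le> pabs p (of_int n)"
proof -
  have "\<bar>n\<bar> \<le> int (path_bound J)" "0 < \<bar>n\<bar>" using path_bound[OF assms(2)] n by auto
  hence "real_of_int \<bar>n\<bar> \<le> real (path_bound J)" "0 < real_of_int \<bar>n\<bar>" by linarith+
  hence "1 / real (path_bound J) \<le> 1 / real_of_int \<bar>n\<bar>" by (intro frac_le) auto
  thus ?thesis using pabs_int_lower[OF assms(1) n(2)] by linarith
qed

lemma path_pabs_eq_1:
  assumes "is_prime p" "path_bound J \<le> p" "i \<le> J" and n: "n = px i \<or> n = pz i" "n \<noteq> 0"
  shows "pabs p (of_int n) = 1"
  by (rule pabs_int_large_prime[OF assms(1) n(2)]) (use path_bound[OF assms(3)] assms(2) n(1) in auto)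

text \<open>A bound on the mass of entries that leave the path by age \<open>J\<close>. Only primes
  below \<open>path_bound J\<close> can have such entries, so the sum over all primes is bounded in
  terms of \<open>J\<close> alone; for \<open>J = 4\<close> it is 0.\<close>

definition exc :: "nat \<Rightarrow> nat \<Rightarrow> real"
  where "exc J p = (if J = 4 \<or> path_bound J \<le> p then 0 else 10 * ln (real (path_bound J)))"

lemma path_bound_ge_1: "1 \<le> real (path_bound J)"
proof -
  have "1 \<le> path_bound J" by (simp add: path_bound_def)
  thus ?thesis by simp
qed

lemma exc_nonneg: "0 \<le> exc J p" using path_bound_ge_1[of J] by (simp add: exc_def)

text \<open>\<open>fine_large\<close> is used twice: with \<open>R = 1\<close> at primes beyond all
  path coordinates, where these are units, and with \<open>R = path_bound J\<close> at the remaining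
  primes.\<close>

lemma exceptional_mass:
  assumes p: "is_prime p" "5 \<le> p" and e: "nonarch.ent (pabs p) m" and nf: "\<not> nonarch.allfine (pabs p) J m"
  shows "nonarch.mass (pabs p) (Suc m) \<le> exc J p"
proof -
  interpret nonarch23 "pabs p" by (rule nonarch23_pabs[OF p])
  have J: "J \<noteq> 4" using allfine_4[OF e] nf by auto
  have ev: "pz i \<noteq> 0" if "1 \<le> i" "px i = 0" for i using event_pz_nonzero[of i] that by (simp add: events_def)
  have small: "\<not> path_bound J \<le> p"
  proof
    assume b: "path_bound J \<le> p"
    have "valid_age (oh m) (oh (Suc m)) i" if i: "1 \<le> i" "i \<le> J" for i
    proof (rule fine_large[OF e, of 1])
      show "1 ^ 10 < oh (Suc m)" using oh_entry(3)[OF e] oh_ge_1[of m] by simp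
    qed (use path_pabs_eq_1[OF p(1) b i(2)] ev[OF i(1)] in auto)
    thus False using nf by (simp add: allfine_def)
  qed
  have "\<not> real (path_bound J) ^ 10 < oh (Suc m)"
  proof
    assume b: "real (path_bound J) ^ 10 < oh (Suc m)"
    have "valid_age (oh m) (oh (Suc m)) i" if i: "1 \<le> i" "i \<le> J" for i
      by (rule fine_large[OF e path_bound_ge_1[of J] b]) (use path_pabs_lower[OF p(1) i(2)] ev[OF i(1)] in auto)
    thus False using nf by (simp add: allfine_def)
  qed
  hence "ln (oh (Suc m)) \<le> ln (real (path_bound J) ^ 10)"
    using oh_pos[of "Suc m"] path_bound_ge_1[of J] by (subst ln_le_cancel_iff) auto
  also have "\<dots> = exc J p" using J small path_bound_ge_1[of J] by (simp add: exc_def ln_realpow)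
  finally show ?thesis by (simp add: mass_def)
qed

lemma gbad_le:
  assumes p: "is_prime p"
  shows "gbad J p n \<le> (\<Sum>j\<in>{J<..n}. 2 ^ (j + 1) * gdip p (n - j)) + 2 ^ J * exc J p"
proof (cases "5 \<le> p")
  case True
  interpret nonarch23 "pabs p" by (rule nonarch23_pabs[OF p True])
  show ?thesis unfolding gdip_def gbad_def by (intro bad_mass_le exc_nonneg exceptional_mass p True)
next
  case False
  hence "p = 2 \<or> p = 3" using prime_cases[OF p] by simp
  thus ?thesis using small_prime_zero[OF _ p] exc_nonneg by simp
qed

definition past_events :: "nat \<Rightarrow> nat \<Rightarrow> nat set"
  where "past_events J n = {j. 1 \<le> j \<and> j \<le> J \<and> j \<le> n \<and> px j = 0}"

lemma gpeak_formula:
  assumes p: "is_prime p"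
  shows "\<bar>gpeak p n - 4 * gmass p n + 4 * (\<Sum>j\<in>past_events J n. gdip p (n - j))\<bar>
    \<le> 4 * gbad J p n + 20 * (\<Sum>j\<in>past_events J n. gbad J p (n - j)) + (4 + 4 * real J) * exc J p"
proof (cases "5 \<le> p")
  case True
  interpret nonarch23 "pabs p" by (rule nonarch23_pabs[OF p True])
  have dev: "\<bar>ln (pabs p (of_int (if px j = 0 then pz j else px j)))\<bar> \<le> exc J p" if j: "1 \<le> j" "j \<le> J" for j
  proof -
    let ?n = "if px j = 0 then pz j else px j"
    have n: "?n = px j \<or> ?n = pz j" "?n \<noteq> 0" using event_pz_nonzero[of j] j by (auto simp: events_def)
    consider "J = 4" | "path_bound J \<le> p" | "J \<noteq> 4" "\<not> path_bound J \<le> p" by blast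
    thus ?thesis
    proof cases
      case 1
      hence "j = 1 \<or> j = 2 \<or> j = 3 \<or> j = 4" using j by auto
      hence "pabs p (of_int ?n) = 1" using v_small_prime path_small by auto
      thus ?thesis using exc_nonneg by simp
    next
      case 2
      thus ?thesis using path_pabs_eq_1[OF p 2 j(2) n] exc_nonneg by simp
    next
      case 3
      have l: "1 / real (path_bound J) \<le> pabs p (of_int ?n)" by (rule path_pabs_lower[OF p j(2) n])
      have "ln (1 / real (path_bound J)) \<le> ln (pabs p (of_int ?n))"
      proof (subst ln_le_cancel_iff)
        show "0 < pabs p (of_int ?n)" by (rule v_pos) (use n in simp)
      qed (use l path_bound_ge_1[of J] in simp_all)
      moreover have "ln (pabs p (of_int ?n)) \<le> 0" using v_int_le_1[of ?n] v_pos[of "of_int ?n"] n by (simp add: ln_le_zero_iff)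
      ultimately show ?thesis using 3 path_bound_ge_1[of J] by (simp add: exc_def ln_div)
    qed
  qed
  have "\<bar>peak n - 4 * mass n + 4 * (\<Sum>j\<in>past_events J n. dip (n - j))\<bar>
    \<le> 4 * bad_mass J n + 20 * (\<Sum>j\<in>past_events J n. bad_mass J (n - j)) + 4 * exc J p + 4 * real J * exc J p"
    unfolding past_events_def
    by (intro peak_formula exc_nonneg exceptional_mass p True dev) (use event_pz_nonzero in \<open>auto simp: events_def\<close>)
  thus ?thesis unfolding gmass_def gdip_def gbad_def gpeak_def by (simp add: algebra_simps)
next
  case False
  hence "p = 2 \<or> p = 3" using prime_cases[OF p] by simp
  thus ?thesis using small_prime_zero[OF _ p] exc_nonneg by simp
qed

definition exc_const :: "nat \<Rightarrow> real"
  where "exc_const J = (if J = 4 then 0 else real (path_bound J) * (10 * ln (real (path_bound J))))"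

lemma exc_const_nonneg: "0 \<le> exc_const J" using path_bound_ge_1[of J] by (simp add: exc_const_def)

lemma sum_exc: "finite S \<Longrightarrow> (\<Sum>p\<in>S. exc J p) \<le> exc_const J"
proof -
  assume S: "finite S"
  show ?thesis
  proof (cases "J = 4")
    case False
    have "(\<Sum>p\<in>S. exc J p) = (\<Sum>p\<in>S \<inter> {..<path_bound J}. exc J p)"
      using S by (intro sum.mono_neutral_right) (auto simp: exc_def)
    also have "\<dots> = real (card (S \<inter> {..<path_bound J})) * (10 * ln (real (path_bound J)))"
      using False by (simp add: exc_def)
    also have "\<dots> \<le> real (path_bound J) * (10 * ln (real (path_bound J)))"
      using path_bound_ge_1[of J] card_mono[of "{..<path_bound J}" "S \<inter> {..<path_bound J}"]
      by (intro mult_right_mono) auto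
    finally show ?thesis using False by (simp add: exc_const_def)
  qed (simp add: exc_def exc_const_def)
qed

lemma total_step: "\<bar>total gmass (Suc n) - total gmass n - 2 * total gdip n\<bar> \<le> 11 * total (gbad J) n"
proof -
  have "total gmass (Suc n) - total gmass n - 2 * total gdip n = (\<Sum>p\<in>upto (Suc n). gmass p (Suc n) - gmass p n - 2 * gdip p n)"
    by (simp add: totals[of _ "Suc n"] sum_subtractf sum_distrib_left)
  also have "\<bar>\<dots>\<bar> \<le> (\<Sum>p\<in>upto (Suc n). 11 * gbad J p n)"
    by (rule order_trans[OF sum_abs sum_mono]) (rule gmass_step[OF upto_prime])
  also have "\<dots> = 11 * total (gbad J) n" by (simp add: totals[of _ "Suc n"] sum_distrib_left)
  finally show ?thesis .
qed

lemma total_bad_le: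
  "total (gbad J) n \<le> (\<Sum>j\<in>{J<..n}. 2 ^ (j + 1) * total gdip (n - j)) + 2 ^ J * exc_const J"
proof -
  have "total (gbad J) n \<le> (\<Sum>p\<in>upto n. (\<Sum>j\<in>{J<..n}. 2 ^ (j + 1) * gdip p (n - j)) + 2 ^ J * exc J p)"
    unfolding totals(4)[OF order_refl] by (intro sum_mono gbad_le upto_prime)
  also have "\<dots> = (\<Sum>j\<in>{J<..n}. 2 ^ (j + 1) * total gdip (n - j)) + 2 ^ J * (\<Sum>p\<in>upto n. exc J p)"
    unfolding sum.distrib sum_distrib_left[symmetric]
    by (subst sum.swap) (simp add: totals[of _ n] sum_distrib_left)
  also have "\<dots> \<le> (\<Sum>j\<in>{J<..n}. 2 ^ (j + 1) * total gdip (n - j)) + 2 ^ J * exc_const J"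
    by (intro add_left_mono mult_left_mono sum_exc finite_upto) simp
  finally show ?thesis .
qed

lemma total_peak_formula:
  "\<bar>total gpeak n - 4 * total gmass n + 4 * (\<Sum>j\<in>past_events J n. total gdip (n - j))\<bar>
    \<le> 4 * total (gbad J) n + 20 * (\<Sum>j\<in>past_events J n. total (gbad J) (n - j)) + (4 + 4 * real J) * exc_const J"
proof -
  have sw: "(\<Sum>j\<in>past_events J n. total f (n - j)) = (\<Sum>p\<in>upto n. \<Sum>j\<in>past_events J n. f p (n - j))"
    if "\<And>k. k \<le> n \<Longrightarrow> total f k = (\<Sum>p\<in>upto n. f p k)" for f
    by (subst sum.swap) (simp add: that)
  have "total gpeak n - 4 * total gmass n + 4 * (\<Sum>j\<in>past_events J n. total gdip (n - j))
    = (\<Sum>p\<in>upto n. gpeak p n - 4 * gmass p n + 4 * (\<Sum>j\<in>past_events J n. gdip p (n - j)))"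
    by (simp add: sw[OF totals(2)] totals[of n n] sum.distrib sum_subtractf sum_distrib_left)
  also have "\<bar>\<dots>\<bar> \<le> (\<Sum>p\<in>upto n. 4 * gbad J p n + 20 * (\<Sum>j\<in>past_events J n. gbad J p (n - j)) + (4 + 4 * real J) * exc J p)"
    by (rule order_trans[OF sum_abs sum_mono]) (rule gpeak_formula[OF upto_prime])
  also have "\<dots> = 4 * total (gbad J) n + 20 * (\<Sum>j\<in>past_events J n. total (gbad J) (n - j)) + (4 + 4 * real J) * (\<Sum>p\<in>upto n. exc J p)"
    by (simp add: sw[OF totals(4)] totals[of n n] sum.distrib sum_distrib_left)
  also have "\<dots> \<le> 4 * total (gbad J) n + 20 * (\<Sum>j\<in>past_events J n. total (gbad J) (n - j)) + (4 + 4 * real J) * exc_const J"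
    by (intro add_left_mono mult_left_mono sum_exc finite_upto) simp
  finally show ?thesis .
qed

lemma total_product_formula: "total gdip n = total gpeak n + ln (real_of_rat (og n))"
proof -
  have "total gpeak n - total gdip n = (\<Sum>p\<in>active n. ln (pabs p (og n)))"
    unfolding total_def sum_subtractf[symmetric]
  proof (intro sum.cong refl)
    fix p assume "p \<in> active n"
    then interpret nonarch "pabs p" by (intro nonarch_pabs) (simp add: active_def)
    show "gpeak p n - gdip p n = ln (pabs p (og n))" unfolding gpeak_def gdip_def by (rule peak_dip)
  qed
  also have "\<dots> = - ln (real_of_rat \<bar>og n\<bar>)"
    by (rule product_formula[OF finite_active]) (auto simp: active_def og_def)
  also have "\<bar>og n\<bar> = og n" using gate_ge_1[of "ox n" "oz n"] by (simp add: og_def)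
  finally show ?thesis by simp
qed

section \<open>The recursion for the heights\<close>

abbreviation "D \<equiv> total gmass"

lemma og_ge_1: "1 \<le> real_of_rat (og n)"
  using gate_ge_1[of "ox n" "oz n"] by (simp add: og_def)

lemma dip_ge_peak: "total gpeak n \<le> total gdip n"
  using total_product_formula[of n] og_ge_1[of n] by simp

lemma no_past_events_4: "past_events 4 n = {}"
  using events_ge_5 by (force simp: past_events_def events_def)

lemma growth_aux:
  assumes "\<And>k. k < n \<Longrightarrow> 8 * D k \<le> D (Suc k)"
  shows "i \<le> n \<Longrightarrow> 8 ^ i * D (n - i) \<le> D n"
proof (induction i)
  case (Suc i)
  have "8 * D (n - Suc i) \<le> D (Suc (n - Suc i))" by (rule assms) (use Suc.prems in simp)
  also have "Suc (n - Suc i) = n - i" using Suc.prems by simp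
  finally have 1: "8 * D (n - Suc i) \<le> D (n - i)" .
  have "8 ^ Suc i * D (n - Suc i) = 8 ^ i * (8 * D (n - Suc i))" by simp
  also have "\<dots> \<le> 8 ^ i * D (n - i)" using 1 by (rule mult_left_mono) simp
  also have "\<dots> \<le> D n" using Suc by simp
  finally show ?case .
qed simp

text \<open>What entered \<open>j\<close> steps ago has grown by at most about \<open>2 ^ j\<close>,
  while the total has grown by about \<open>8 ^ j\<close> at least; the quotient gives the ratio
  1/4.\<close>

lemma bad_terms:
  assumes "\<And>k. k < n \<Longrightarrow> 8 * D k \<le> D (Suc k)" "\<And>k. k < n \<Longrightarrow> 2 * total gdip k \<le> D (Suc k)"
  shows "(\<Sum>j\<in>{J<..n}. 2 ^ (j + 1) * total gdip (n - j)) \<le> 8 * D n * (\<Sum>j\<in>{J<..n}. (1/4) ^ j)"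
  unfolding sum_distrib_left
proof (rule sum_mono)
  fix j assume j: "j \<in> {J<..n}"
  then obtain i where i: "j = Suc i" "i < n" by (cases j) auto
  have "2 ^ (j + 1) * total gdip (n - j) = 2 ^ j * (2 * total gdip (n - j))" by simp
  also have "\<dots> \<le> 2 ^ j * D (n - i)"
    using assms(2)[of "n - j"] i by (intro mult_left_mono) (auto simp: Suc_diff_Suc)
  also have "\<dots> \<le> 2 ^ j * (D n / 8 ^ i)"
    using growth_aux[where n = n and i = i, OF assms(1)] i by (intro mult_left_mono) (simp_all add: field_simps)
  also have "\<dots> = 8 * D n * (2 ^ j / 8 ^ j)" by (simp add: i)
  also have "2 ^ j / 8 ^ j = (1/4::real) ^ j" by (simp flip: power_divide)
  finally show "2 ^ (j + 1) * total gdip (n - j) \<le> 8 * D n * (1/4) ^ j" .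
qed

text \<open>Bootstrap with \<open>J = 4\<close>, where neither exceptional primes nor events occur.
  Growth by 8 up to time \<open>n\<close> makes the old entries a small fraction of
  \<open>D n\<close>; then the dips are at least nearly \<open>4 * D n\<close>, so
  \<open>D (Suc n)\<close> is at least nearly \<open>9 * D n\<close>, which leaves room for the
  factor 8.\<close>

lemma crude: "total (gbad 4) n \<le> D n / 50 \<and> 8 * D n \<le> D (Suc n) \<and> 2 * total gdip n \<le> D (Suc n)"
proof (induction n rule: less_induct)
  case (less n)
  have "total (gbad 4) n \<le> (\<Sum>j\<in>{4<..n}. 2 ^ (j + 1) * total gdip (n - j))"
    using total_bad_le[of 4 n] by (simp add: exc_const_def)
  also have "\<dots> \<le> 8 * D n * (\<Sum>j\<in>{4<..n}. (1/4) ^ j)" by (rule bad_terms) (use less in auto)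
  also have "\<dots> \<le> 8 * D n * (1 / 700)"
    using total_nonneg(1)[of n] by (intro mult_left_mono geometric_tail_bound) auto
  finally have O: "total (gbad 4) n \<le> 8 * D n * (1 / 700)" .
  have "\<bar>total gpeak n - 4 * D n\<bar> \<le> 4 * total (gbad 4) n"
    using total_peak_formula[of n 4] by (simp add: no_past_events_4 exc_const_def)
  hence p: "4 * D n - 4 * total (gbad 4) n \<le> total gdip n" using dip_ge_peak[of n] by linarith
  have s: "D n + 2 * total gdip n - 11 * total (gbad 4) n \<le> D (Suc n)" using total_step[of n 4] by linarith
  show ?case using O p s total_nonneg(1)[of n] by (intro conjI) linarith+
qed

lemma growth: "8 * D n \<le> D (Suc n)" using crude by blast

lemma D_decay: "i \<le> n \<Longrightarrow> 8 ^ i * D (n - i) \<le> D n" by (rule growth_aux[OF growth])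

lemma D_2_pos: "0 < D 2"
proof -
  \<comment> \<open>The growth estimate is homogeneous and requires a nonzero start. The origin goes
    to \<open>(-2, 1, 1)\<close>, where \<open>N\<close> is 1 + 12 * (1 + 16).\<close>
  have "og 1 = 205" by (simp add: og_def orbit_0 orbit_Suc new_x_def new_z_def new_u_def gate_def)
  hence "0 < ln (real_of_rat (og 1))" by simp
  hence "0 < total gdip 1" using total_product_formula[of 1] total_nonneg(3)[of 1] by linarith
  thus ?thesis using crude[of 1] by (simp add: numeral_2_eq_2)
qed

lemma D_lower: "2 \<le> n \<Longrightarrow> D 2 / 64 * 8 ^ n \<le> D n"
proof -
  assume n: "2 \<le> n"
  have n2: "n - (n - 2) = 2" using n by simp
  have le: "8 ^ (n - 2) * D 2 \<le> D n" using D_decay[of "n - 2" n] unfolding n2 by simp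
  have "(8::real) ^ n = 8 ^ (n - 2 + 2)" using n by (simp only: le_add_diff_inverse2)
  hence 8: "(8::real) ^ n = 8 ^ (n - 2) * 64" unfolding power_add by simp
  have "D 2 / 64 * 8 ^ n = 8 ^ (n - 2) * D 2" unfolding 8 by simp
  thus ?thesis using le by (simp only:)
qed

lemma D_pos: "2 \<le> n \<Longrightarrow> 0 < D n"
proof -
  assume n: "2 \<le> n"
  have "0 < D 2 / 64 * 8 ^ n" using D_2_pos by simp
  thus ?thesis using D_lower[OF n] by linarith
qed

lemma filterlim_D_lower: "filterlim (\<lambda>n::nat. D 2 / 64 * 8 ^ n) at_top sequentially"
proof (rule filterlim_tendsto_pos_mult_at_top[OF tendsto_const])
  show "0 < D 2 / 64" using D_2_pos by simp
  show "filterlim (\<lambda>n::nat. (8::real) ^ n) at_top sequentially" by real_asymp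
qed

lemma geometric_sum_tail: "(\<Sum>j\<in>{J<..n}. (1/4::real) ^ j) \<le> (1/3) * (1/4) ^ J"
proof (cases "J \<le> n")
  case True
  have "(\<Sum>j\<in>{J<..n}. (1/4::real) ^ j) = (1/3) * ((1/4) ^ J - (1/4) ^ n)"
    using True
  proof (induction n rule: dec_induct)
    case (step n)
    have "{J<..Suc n} = insert (Suc n) {J<..n}" using step(1) by auto
    thus ?case using step by simp
  qed simp
  thus ?thesis by simp
qed simp

lemma total_bad_small: "total (gbad J) n \<le> 3 * (1/4) ^ J * D n + 2 ^ J * exc_const J"
proof -
  have "total (gbad J) n \<le> (\<Sum>j\<in>{J<..n}. 2 ^ (j + 1) * total gdip (n - j)) + 2 ^ J * exc_const J" by (rule total_bad_le)
  also have "(\<Sum>j\<in>{J<..n}. 2 ^ (j + 1) * total gdip (n - j)) \<le> 8 * D n * (\<Sum>j\<in>{J<..n}. (1/4) ^ j)"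
    by (rule bad_terms) (use crude in auto)
  also have "8 * D n * (\<Sum>j\<in>{J<..n}. (1/4) ^ j) \<le> 8 * D n * ((1/3) * (1/4) ^ J)"
    using total_nonneg(1)[of n] by (intro mult_left_mono geometric_sum_tail) auto
  also have "\<dots> \<le> 3 * (1/4) ^ J * D n" using mult_nonneg_nonneg[OF total_nonneg(1)[of n], of "(1/4) ^ J"] by simp
  finally show ?thesis by simp
qed

text \<open>The factor \<open>1 - 18 z^2 / N\<close> has absolute value at most 1, because
  \<open>18 z^2 <= 2 N\<close>. So \<open>u\<close> gains at most 1 per step, and \<open>x\<close>
  and \<open>z\<close> grow at most exponentially; in logarithms the archimedean contributions are
  linear in \<open>n\<close>.\<close>

lemma coordinate_growth: "\<bar>ox n\<bar> \<le> 6 ^ n \<and> \<bar>oz n\<bar> \<le> 6 ^ n \<and> \<bar>ou n\<bar> \<le> 6 ^ n"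
proof (induction n)
  case (Suc n)
  define N where "N = gate (ox n) (oz n)"
  have N1: "1 \<le> N" unfolding N_def by (rule gate_ge_1)
  have zN: "18 * oz n ^ 2 \<le> 2 * N"
    using zero_le_power2[of "oz n"] zero_le_even_power[of 4 "ox n"] unfolding N_def gate_def by (simp add: algebra_simps)
  define r where "r = 18 * oz n ^ 2 / N"
  have r: "0 \<le> r" "r \<le> 2" using zN N1 by (simp_all add: r_def divide_le_eq)
  have i: "0 \<le> 1 / N ^ 2" "1 / N ^ 2 \<le> 1" using N1 by (simp_all add: divide_le_eq one_le_power)
  have "ou (Suc n) = ou n * (1 - r) + 1 / N ^ 2" unfolding orbit_Suc new_u_def N_def[symmetric] r_def by (simp add: algebra_simps)
  hence "\<bar>ou (Suc n)\<bar> \<le> \<bar>ou n * (1 - r)\<bar> + 1" using i abs_triangle_ineq[of "ou n * (1 - r)" "1 / N ^ 2"] by simp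
  moreover have "\<bar>ou n * (1 - r)\<bar> \<le> \<bar>ou n\<bar> * 1" unfolding abs_mult using r by (intro mult_left_mono) auto
  ultimately have u: "\<bar>ou (Suc n)\<bar> \<le> \<bar>ou n\<bar> + 1" by simp
  have one: "(1::rat) \<le> 6 ^ n" by simp
  have z: "\<bar>oz (Suc n)\<bar> \<le> \<bar>oz n\<bar> + \<bar>ou (Suc n)\<bar>" unfolding orbit_Suc new_z_def by (rule abs_triangle_ineq)
  have x: "\<bar>ox (Suc n)\<bar> \<le> \<bar>ox n\<bar> + \<bar>oz n\<bar> + 2 * \<bar>ou (Suc n)\<bar>" unfolding orbit_Suc new_x_def by linarith
  have p: "(6::rat) ^ Suc n = 6 * 6 ^ n" by simp
  show ?case unfolding p using u z x Suc one by (intro conjI) linarith+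
qed (simp add: orbit_0)

lemma ln_6_power: "ln ((6::real) ^ n) \<le> 5 * real n"
proof -
  have "ln (6::real) \<le> 5" using ln_le_minus_one[of "6::real"] by simp
  thus ?thesis by (simp add: ln_realpow mult.commute mult_left_mono)
qed

lemma ln_og_le: "ln (real_of_rat (og n)) \<le> 24 + 20 * real n"
proof -
  have "oz n ^ 2 \<le> (6 ^ n) ^ 2" "ox n ^ 4 \<le> (6 ^ n) ^ 4"
    using coordinate_growth[of n] power_mono[of "\<bar>oz n\<bar>" "6 ^ n" 2] power_mono[of "\<bar>ox n\<bar>" "6 ^ n" 4] by (simp_all add: power_even_abs)
  moreover have "((6::rat) ^ n) ^ 2 \<le> (6 ^ n) ^ 4" "(1::rat) \<le> (6 ^ n) ^ 4" by (intro power_increasing one_le_power; simp)+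
  moreover have "1 + 12 * (a + b) \<le> 25 * y" if "a \<le> s" "b \<le> y" "s \<le> y" "1 \<le> y" for a b s y :: rat
  proof -
    have "12 * (a + b) \<le> 12 * (y + y)" using that by (intro mult_left_mono add_mono) auto
    hence "1 + 12 * (a + b) \<le> y + 12 * (y + y)" using that(4) by (rule add_mono[rotated])
    thus ?thesis by simp
  qed
  ultimately have "og n \<le> 25 * (6 ^ n) ^ 4" unfolding og_def gate_def by blast
  hence "real_of_rat (og n) \<le> real_of_rat (25 * (6 ^ n) ^ 4)" by (simp only: of_rat_less_eq)
  also have "\<dots> = 25 * 6 ^ (4 * n)" by (simp add: of_rat_mult of_rat_power mult.commute flip: power_mult)
  finally have "ln (real_of_rat (og n)) \<le> ln (25 * 6 ^ (4 * n))" using og_ge_1[of n] by (subst ln_le_cancel_iff) auto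
  also have "\<dots> = ln 25 + ln (6 ^ (4 * n))" by (rule ln_mult_pos) simp_all
  also have "\<dots> \<le> 24 + 20 * real n" using ln_6_power[of "4 * n"] ln_le_minus_one[of "25::real"] by simp
  finally show ?thesis .
qed

text \<open>A chain of approximations: \<open>D (Suc n) - D n\<close> is twice the total dip, the
  dips equal the peaks up to \<open>ln N\<close>, the peaks are \<open>4 * D n\<close> minus 4 times
  the dips at the event delays, and twice a past dip is again a difference of values of
  \<open>D\<close>. What remains is a multiple of \<open>D n\<close> with a factor tending to 0 in
  \<open>J\<close>, and a term linear in \<open>n\<close>.\<close>

lemma recursion_error:
  assumes n: "J \<le> n"
  shows "\<bar>D (Suc n) - 9 * D n + 4 * (\<Sum>j\<in>events \<inter> {..J}. D (n - (j - 1)) - D (n - j))\<bar>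
    \<le> 309 * (1/4) ^ J * D n + ((19 + 84 * real J) * (2 ^ J * exc_const J) + 2 * ((4 + 4 * real J) * exc_const J) + 48 + 40 * real n)"
proof -
  define I where "I = events \<inter> {..J}"
  have I: "past_events J n = I" using n by (auto simp: I_def past_events_def events_def)
  have finI: "finite I" by (simp add: I_def)
  have cI: "card I \<le> J"
  proof -
    have "I \<subseteq> {1..J}" by (auto simp: I_def events_def)
    thus ?thesis using card_mono[of "{1..J}" I] by simp
  qed
  define K where "K = 2 ^ J * exc_const J"
  define C where "C = (4 + 4 * real J) * exc_const J"
  define q where "q = 3 * (1/4::real) ^ J"
  have K0: "0 \<le> K" using exc_const_nonneg by (simp add: K_def)
  have q0: "0 \<le> q" by (simp add: q_def)
  let ?O = "total (gbad J)"
  have e1: "\<bar>D (Suc n) - D n - 2 * total gdip n\<bar> \<le> 11 * ?O n" by (rule total_step)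
  have e2: "\<bar>total gpeak n - 4 * D n + 4 * (\<Sum>j\<in>I. total gdip (n - j))\<bar> \<le> 4 * ?O n + 20 * (\<Sum>j\<in>I. ?O (n - j)) + C"
    using total_peak_formula[of n J] unfolding I C_def .
  have e3: "\<bar>(\<Sum>j\<in>I. D (n - (j - 1)) - D (n - j)) - 2 * (\<Sum>j\<in>I. total gdip (n - j))\<bar> \<le> 11 * (\<Sum>j\<in>I. ?O (n - j))"
  proof -
    have "(\<Sum>j\<in>I. D (n - (j - 1)) - D (n - j)) - 2 * (\<Sum>j\<in>I. total gdip (n - j))
      = (\<Sum>j\<in>I. D (Suc (n - j)) - D (n - j) - 2 * total gdip (n - j))"
    proof -
      have "n - (j - 1) = Suc (n - j)" if "j \<in> I" for j using that n by (auto simp: I_def events_def)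
      thus ?thesis by (simp add: sum_subtractf sum_distrib_left)
    qed
    also have "\<bar>\<dots>\<bar> \<le> (\<Sum>j\<in>I. 11 * ?O (n - j))" by (rule order_trans[OF sum_abs sum_mono]) (rule total_step)
    finally show ?thesis by (simp add: sum_distrib_left)
  qed
  have o: "?O n \<le> q * D n + K" unfolding q_def K_def by (rule total_bad_small)
  have os: "(\<Sum>j\<in>I. ?O (n - j)) \<le> q * D n + real J * K"
  proof -
    have "(\<Sum>j\<in>I. ?O (n - j)) \<le> (\<Sum>j\<in>I. (q * D n) * (1/4) ^ j + K)"
    proof (rule sum_mono)
      fix j assume j: "j \<in> I"
      have "8 ^ j * D (n - j) \<le> D n" using j n by (intro D_decay) (simp add: I_def)
      hence "D (n - j) \<le> D n * (1/8) ^ j" by (simp add: field_simps power_divide)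
      also have "\<dots> \<le> D n * (1/4) ^ j" using total_nonneg(1)[of n] by (intro mult_left_mono power_mono) auto
      finally have "q * D (n - j) \<le> q * (D n * (1/4) ^ j)" using q0 by (rule mult_left_mono)
      thus "?O (n - j) \<le> (q * D n) * (1/4) ^ j + K"
        using total_bad_small[of J "n - j"] unfolding q_def[symmetric] K_def[symmetric] by (simp only: mult.assoc)
    qed
    also have "\<dots> = (q * D n) * (\<Sum>j\<in>I. (1/4) ^ j) + real (card I) * K" by (simp add: sum.distrib sum_distrib_left)
    also have "\<dots> \<le> (q * D n) * 1 + real J * K"
    proof (intro add_mono mult_left_mono mult_right_mono K0)
      have "(\<Sum>j\<in>I. (1/4::real) ^ j) \<le> 1 / 700" by (rule geometric_tail_bound[OF finI]) (use events_ge_5 in \<open>auto simp: I_def\<close>)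
      thus "(\<Sum>j\<in>I. (1/4::real) ^ j) \<le> 1" by simp
      show "0 \<le> q * D n" using q0 total_nonneg(1) by simp
    qed (use cI in simp)
    finally show ?thesis by simp
  qed
  have l: "total gdip n - total gpeak n \<le> 24 + 20 * real n" "0 \<le> total gdip n - total gpeak n"
    using total_product_formula[of n] ln_og_le[of n] og_ge_1[of n] by simp_all
  \<comment> \<open>The weights are 19 = 11 + 2 * 4 for the present bad mass and 84 = 2 * 20 + 4 *
    11 for the past one, with sum 103.\<close>
  have gen: "\<bar>d1 - 9 * d + 4 * S\<bar> \<le> 103 * x + (19 * k + 84 * jk + 2 * C + 48 + 40 * t)"
    if "\<bar>d1 - d - 2 * m\<bar> \<le> 11 * b" "\<bar>a - 4 * d + 4 * T\<bar> \<le> 4 * b + 20 * B + C" "\<bar>S - 2 * T\<bar> \<le> 11 * B"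
      "b \<le> x + k" "B \<le> x + jk" "m - a \<le> 24 + 20 * t" "0 \<le> m - a" for d1 d S x k jk t m b a T B :: real
  proof -
    have "d1 - d - 2 * m \<le> 11 * b" "-(d1 - d - 2 * m) \<le> 11 * b" "a - 4 * d + 4 * T \<le> 4 * b + 20 * B + C"
      "-(a - 4 * d + 4 * T) \<le> 4 * b + 20 * B + C" "S - 2 * T \<le> 11 * B" "-(S - 2 * T) \<le> 11 * B"
      using that(1-3) by (simp_all only: abs_le_iff)
    thus ?thesis unfolding abs_le_iff using that(4-7) by (intro conjI) argo+
  qed
  have "\<bar>D (Suc n) - 9 * D n + 4 * (\<Sum>j\<in>I. D (n - (j - 1)) - D (n - j))\<bar>
    \<le> 103 * (q * D n) + (19 * K + 84 * (real J * K) + 2 * C + 48 + 40 * real n)"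
    by (rule gen[OF e1 e2 e3 o os l])
  thus ?thesis unfolding I_def[symmetric] K_def[symmetric] C_def[symmetric] by (simp add: q_def algebra_simps)
qed

text \<open>\<open>J\<close> is chosen first to make the multiple of \<open>D n\<close> small; the
  rest is linear in \<open>n\<close> with constants depending on \<open>J\<close>, and loses against
  the exponential lower bound for \<open>D n\<close>.\<close>

lemma recursion:
  assumes e: "0 < e"
  shows "eventually (\<lambda>J. eventually (\<lambda>n.
    \<bar>D (Suc n) - 9 * D n + 4 * (\<Sum>j\<in>events \<inter> {..J}. D (n - (j - 1)) - D (n - j))\<bar> \<le> e * D n) sequentially) sequentially"
proof -
  have "(\<lambda>J::nat. 309 * (1/4::real) ^ J) \<longlonglongrightarrow> 0" by real_asymp
  hence "eventually (\<lambda>J. 309 * (1/4::real) ^ J < e / 2) sequentially" by (rule order_tendstoD) (use e in simp)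
  thus ?thesis
  proof (rule eventually_mono)
    fix J :: nat assume J: "309 * (1/4::real) ^ J < e / 2"
    define c where "c = (19 + 84 * real J) * (2 ^ J * exc_const J) + 2 * ((4 + 4 * real J) * exc_const J) + 48"
    have "(\<lambda>n::nat. (c + 40 * real n) / 8 ^ n) \<longlonglongrightarrow> 0" by real_asymp
    hence "eventually (\<lambda>n::nat. (c + 40 * real n) / 8 ^ n < e / 2 * (D 2 / 64)) sequentially"
      by (rule order_tendstoD) (use e D_2_pos in simp)
    moreover have "eventually (\<lambda>n. J + 2 \<le> n) sequentially" by (rule eventually_ge_at_top)
    ultimately show "eventually (\<lambda>n. \<bar>D (Suc n) - 9 * D n + 4 * (\<Sum>j\<in>events \<inter> {..J}. D (n - (j - 1)) - D (n - j))\<bar> \<le> e * D n) sequentially"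
    proof eventually_elim
      case (elim n)
      have "c + 40 * real n \<le> e / 2 * (D 2 / 64) * 8 ^ n" using elim(1) by (simp add: divide_less_eq)
      also have "\<dots> = e / 2 * (D 2 / 64 * 8 ^ n)" by (simp only: mult.assoc)
      also have "\<dots> \<le> e / 2 * D n" using D_lower[of n] elim(2) e by (intro mult_left_mono) auto
      finally have 1: "c + 40 * real n \<le> e / 2 * D n" .
      have 2: "309 * (1/4) ^ J * D n \<le> e / 2 * D n" using J total_nonneg(1)[of n] by (intro mult_right_mono) auto
      have "\<bar>D (Suc n) - 9 * D n + 4 * (\<Sum>j\<in>events \<inter> {..J}. D (n - (j - 1)) - D (n - j))\<bar> \<le> 309 * (1/4) ^ J * D n + (c + 40 * real n)"
        unfolding c_def by (rule recursion_error) (use elim(2) in simp)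
      also have "\<dots> \<le> e / 2 * D n + e / 2 * D n" using 1 2 by (rule add_mono[rotated])
      finally show ?case by (simp add: field_simps)
    qed
  qed
qed

lemma degree_exists:
  obtains y :: real where "lacunary y" "(\<lambda>n. D (Suc n) / D n) \<longlonglongrightarrow> 1 / y" "1/9 \<le> y" "y \<le> 1/8"
proof -
  obtain y :: real where y: "1/9 \<le> y" "y \<le> 1/8"
    "4 * (1 - y) * suminf (\<lambda>j. (if j \<in> events then 1 else 0) * y ^ j) = 9 * y - 1"
    using characteristic_root_exists[OF events_ge_5] by blast
  let ?c = "\<lambda>j. (if j \<in> events then 1 else 0) * y ^ j"
  have "suminf (\<lambda>k. ?c (seg_start (Suc k))) = suminf ?c"
  proof (rule suminf_mono_reindex)
    show "strict_mono (\<lambda>k. seg_start (Suc k))"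
      using strict_mono_seg_start by (simp add: strict_mono_def)
    show "?c n = 0" if "n \<notin> range (\<lambda>k. seg_start (Suc k))" for n using that by (simp add: events_eq)
  qed
  moreover have "?c (seg_start (Suc k)) = y ^ (20 * 2 ^ Suc k - 15 * Suc k - 20)" for k
    using events_eq by (auto simp: seg_start_def)
  ultimately have lac: "lacunary y" using y by unfold_locales simp_all
  have summ: "summable ?c"
  proof (rule summable_comparison_test')
    show "summable (\<lambda>j. y ^ j)" using y by (intro summable_geometric) simp
    show "norm (?c j) \<le> y ^ j" for j using y by simp
  qed
  have "(\<lambda>j. (1 - y) / y * ?c j) sums ((1 - y) / y * suminf ?c)" by (intro sums_mult summable_sums summ)
  also have "(1 - y) / y * suminf ?c = (9 - 1 / y) / 4"
  proof -
    have "(1 - y) / y * suminf ?c = (4 * (1 - y) * suminf ?c) / (4 * y)" using y by (simp add: field_simps)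
    also have "\<dots> = (9 - 1 / y) / 4" unfolding y(3) using y by (simp add: field_simps)
    finally show ?thesis .
  qed
  also have "(\<lambda>j. (1 - y) / y * ?c j) = (\<lambda>j. if j \<in> events then inverse (1 / y) ^ (j - 1) - inverse (1 / y) ^ j else 0)"
  proof
    fix j
    show "(1 - y) / y * ?c j = (if j \<in> events then inverse (1 / y) ^ (j - 1) - inverse (1 / y) ^ j else 0)"
    proof (cases "j \<in> events")
      case True
      then obtain i where "j = Suc i" using events_ge_5[of j] by (cases j) auto
      thus ?thesis using True y by (simp add: field_simps)
    qed simp
  qed
  finally have root: "(\<lambda>j. if j \<in> events then inverse (1 / y) ^ (j - 1) - inverse (1 / y) ^ j else 0) sums ((9 - 1 / y) / 4)" .
  have "(\<lambda>n. D (Suc n) / D n) \<longlonglongrightarrow> 1 / y"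
    by (rule ratio_limit[OF D_pos growth events_ge_5 _ _ root recursion]) (use y in \<open>simp_all add: field_simps\<close>)
  thus thesis using that lac y by blast
qed

section \<open>Heights along the orbit\<close>

lemma Max_pabs_orbit_vec:
  assumes d: "3 \<le> d" and p: "is_prime p"
  shows "Max ((\<lambda>i. pabs p (orbit_vec n i)) ` {..d}) = nonarch.oh (pabs p) n"
proof -
  interpret nonarch "pabs p" by (rule nonarch_pabs[OF p])
  show ?thesis
  proof (rule Max_eqI)
    show "y \<le> oh n" if y: "y \<in> (\<lambda>i. pabs p (orbit_vec n i)) ` {..d}" for y
      using y by (auto simp: orbit_vec_def oh_def hh_def le_max_iff_disj)
    have "oh n = pabs p (orbit_vec n 0) \<or> oh n = pabs p (orbit_vec n 1) \<or> oh n = pabs p (orbit_vec n 2) \<or> oh n = pabs p (orbit_vec n 3)"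
      by (auto simp: orbit_vec_def oh_def hh_def max_def)
    thus "oh n \<in> (\<lambda>i. pabs p (orbit_vec n i)) ` {..d}" using d by (auto simp: image_iff intro: bexI[rotated])
  qed simp
qed

lemma height_orbit_point:
  assumes d: "3 \<le> d"
  shows "height d (orbit_point d n) = ln (Max ((\<lambda>i. real_of_rat \<bar>orbit_vec n i\<bar>) ` {..d})) + D n"
proof -
  have out: "pabs p (orbit_vec n i) \<le> 1" if p: "is_prime p" "p \<notin> active n" "i \<le> d" for p i
  proof -
    interpret nonarch "pabs p" by (rule nonarch_pabs[OF p(1)])
    have "mass n = 0" using inactive(1)[OF p(1,2)] by (simp add: gmass_def)
    hence "oh n = 1" using oh_pos[of n] by (simp add: mass_def)
    moreover have "pabs p (orbit_vec n i) \<le> Max ((\<lambda>i. pabs p (orbit_vec n i)) ` {..d})" using p(3) by (intro Max_ge) auto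
    ultimately show ?thesis using Max_pabs_orbit_vec[OF d p(1)] by simp
  qed
  have "height d (orbit_point d n) = height_over d \<rat> (\<lambda>i. of_rat (orbit_vec n i))"
    unfolding height_def field_of_definition_def normalized_orbit_point[OF d]
    by (subst generate_field_rational) auto
  also have "\<dots> = ln (Max ((\<lambda>i. real_of_rat \<bar>orbit_vec n i\<bar>) ` {..d})) + (\<Sum>p\<in>active n. ln (Max ((\<lambda>i. pabs p (orbit_vec n i)) ` {..d})))"
    by (rule height_over_rational[OF _ finite_active _ out]) (auto simp: orbit_vec_def active_def)
  also have "(\<Sum>p\<in>active n. ln (Max ((\<lambda>i. pabs p (orbit_vec n i)) ` {..d}))) = D n"
    unfolding total_def
  proof (intro sum.cong refl)
    fix p assume "p \<in> active n"
    hence p: "is_prime p" by (simp add: active_def)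
    show "ln (Max ((\<lambda>i. pabs p (orbit_vec n i)) ` {..d})) = gmass p n"
      by (simp add: Max_pabs_orbit_vec[OF d p] gmass_def nonarch.mass_def[OF nonarch_pabs[OF p]])
  qed
  finally show ?thesis .
qed

lemma height_bounds:
  assumes d: "3 \<le> d"
  shows "D n \<le> height d (orbit_point d n)" "height d (orbit_point d n) \<le> D n + 5 * real n"
proof -
  define mx where "mx = Max ((\<lambda>i. real_of_rat \<bar>orbit_vec n i\<bar>) ` {..d})"
  have "real_of_rat \<bar>orbit_vec n 0\<bar> \<le> mx" unfolding mx_def by (intro Max_ge) auto
  hence X1: "1 \<le> mx" by (simp add: orbit_vec_def)
  have "mx \<le> 6 ^ n" unfolding mx_def
  proof (rule Max.boundedI)
    fix a assume "a \<in> (\<lambda>i. real_of_rat \<bar>orbit_vec n i\<bar>) ` {..d}"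
    then obtain i where a: "a = real_of_rat \<bar>orbit_vec n i\<bar>" by blast
    have "\<bar>orbit_vec n i\<bar> \<le> 6 ^ n" using coordinate_growth[of n] by (auto simp: orbit_vec_def)
    hence "a \<le> real_of_rat (6 ^ n)" unfolding a by (simp only: of_rat_less_eq)
    thus "a \<le> 6 ^ n" by (simp add: of_rat_power)
  qed auto
  hence "ln mx \<le> ln (6 ^ n)" using X1 by (subst ln_le_cancel_iff) auto
  hence "ln mx \<le> 5 * real n" using ln_6_power[of n] by linarith
  moreover have "0 \<le> ln mx" using X1 by simp
  ultimately show "D n \<le> height d (orbit_point d n)" "height d (orbit_point d n) \<le> D n + 5 * real n"
    unfolding height_orbit_point[OF d] mx_def[symmetric] by simp_all
qed

lemma height_root_limit:
  assumes d: "3 \<le> d" and l: "0 < l" and lim: "(\<lambda>n. D (Suc n) / D n) \<longlonglongrightarrow> l"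
  shows "(\<lambda>n. height_plus d (orbit_point d n) powr (1 / real n)) \<longlonglongrightarrow> l"
proof -
  let ?h = "\<lambda>n. height_plus d (orbit_point d n)"
  have h1: "1 \<le> ?h n" for n by (simp add: height_plus_def)
  have lD: "(\<lambda>n. ln (D n) / real n) \<longlonglongrightarrow> ln l" by (rule root_of_ratio[OF D_pos l lim])
  have lD2: "(\<lambda>n. ln (D n) / real n + ln (5 * real n + 2) / real n) \<longlonglongrightarrow> ln l + 0"
    by (intro tendsto_add lD) real_asymp
  note filterlim_D_lower
  hence "eventually (\<lambda>n. 1 \<le> D 2 / 64 * 8 ^ n) sequentially" unfolding filterlim_at_top by blast
  hence ev: "eventually (\<lambda>n. 1 \<le> D n \<and> 2 \<le> n) sequentially" using eventually_ge_at_top[of 2]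
    by eventually_elim (use D_lower in force)
  have "(\<lambda>n. ln (?h n) / real n) \<longlonglongrightarrow> ln l"
  proof (rule tendsto_sandwich[OF _ _ lD])
    show "eventually (\<lambda>n. ln (D n) / real n \<le> ln (?h n) / real n) sequentially" using ev
    proof eventually_elim
      case (elim n)
      have "D n \<le> ?h n" using height_bounds(1)[OF d, of n] by (simp add: height_plus_def)
      hence "ln (D n) \<le> ln (?h n)" using elim by (subst ln_le_cancel_iff) auto
      thus ?case using elim by (simp add: divide_right_mono)
    qed
    show "eventually (\<lambda>n. ln (?h n) / real n \<le> ln (D n) / real n + ln (5 * real n + 2) / real n) sequentially" using ev
    proof eventually_elim
      case (elim n)
      have "?h n \<le> D n * 1 + 1 * (5 * real n + 1)" using height_bounds[OF d, of n] elim by (simp add: height_plus_def)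
      also have "\<dots> \<le> D n * 1 + D n * (5 * real n + 1)" using elim by (intro add_left_mono mult_right_mono) auto
      also have "\<dots> = D n * (5 * real n + 2)" by (simp add: algebra_simps)
      finally have "ln (?h n) \<le> ln (D n * (5 * real n + 2))" using elim h1[of n] by (subst ln_le_cancel_iff) auto
      also have "\<dots> = ln (D n) + ln (5 * real n + 2)" using elim by (intro ln_mult_pos) auto
      finally have "ln (?h n) / real n \<le> (ln (D n) + ln (5 * real n + 2)) / real n" by (intro divide_right_mono) auto
      thus ?case by (simp add: add_divide_distrib)
    qed
    show "(\<lambda>n. ln (D n) / real n + ln (5 * real n + 2) / real n) \<longlonglongrightarrow> ln l" using lD2 by simp
  qed
  hence "(\<lambda>n. exp (ln (?h n) / real n)) \<longlonglongrightarrow> exp (ln l)" by (rule tendsto_exp)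
  moreover have "exp (ln (?h n) / real n) = ?h n powr (1 / real n)" for n
    using h1[of n] by (simp add: powr_def)
  ultimately show ?thesis using l by simp
qed

lemma arith_degree_orbit_point:
  assumes d: "3 \<le> d" and l: "0 < l" and lim: "(\<lambda>n. D (Suc n) / D n) \<longlonglongrightarrow> l"
  shows "has_arith_degree d (phi d) (orbit_point d 0) l"
proof -
  have "(\<lambda>n. ereal (height_plus d (orbit_point d n) powr (1 / real n))) \<longlonglongrightarrow> ereal l"
    using height_root_limit[OF assms] by (rule tendsto_ereal)
  thus ?thesis unfolding has_arith_degree_def upper_arith_degree_def lower_arith_degree_def phi_iterate[OF d]
    using lim_imp_Limsup lim_imp_Liminf sequentially_bot by blast
qed

text \<open>A bound on all entries would leave only finitely many primes with a recent entry, while primes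
  without one carry at most a fiftieth of the total mass.\<close>

lemma entries_unbounded:
  "\<exists>p n. is_prime p \<and> 5 \<le> p \<and> nonarch.ent (pabs p) n \<and> R < nonarch.oh (pabs p) (Suc n)"
proof (rule ccontr)
  assume no: "\<not> ?thesis"
  define S where "S = max R 2"
  have b: "nonarch.oh (pabs p) (Suc n) \<le> S" if "is_prime p" "5 \<le> p" "nonarch.ent (pabs p) n" for p n
  proof -
    have "\<not> R < nonarch.oh (pabs p) (Suc n)" using no that by blast
    thus ?thesis by (simp add: S_def)
  qed
  have S2: "2 \<le> S" by (simp add: S_def)
  \<comment> \<open>At a good prime the gate at the entry is divisible by \<open>p\<close>, so the
    jump has size at least \<open>p ^ 2\<close>. If all jumps are at most \<open>S\<close>, then so
    is every good prime.\<close>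
  have one: "gmass p n \<le> gbad 4 p n + (if real p \<le> S then ln S else 0)" if p: "is_prime p" for p n
  proof (cases "5 \<le> p")
    case True
    interpret nonarch23 "pabs p" by (rule nonarch23_pabs[OF p True])
    show ?thesis
    proof (cases "good 4 n")
      case good: True
      then obtain m j where m: "n = m + j" "1 \<le> j" "j \<le> 4" "ent m" "allfine 4 m" by (rule goodE)
      have W: "mass n = ln (oh (Suc m))" using good_path(1)[OF m(4,5,2)] m by (simp add: mass_def)
      have oS: "oh (Suc m) \<le> S" by (rule b[OF p True m(4)])
      have "v (og m) < 1" if "v = pabs p" for v
      proof -
        have "1 * pabs p (og m) \<le> oh m ^ 5 * pabs p (og m)"
          by (intro mult_right_mono one_le_power oh_ge_1 v_nonneg)
        thus ?thesis unfolding that using m(4) by (simp add: ent_def)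
      qed
      hence lt: "pabs p (og m) < 1" by blast
      hence "0 < pval p (og m)" using pabs_less_1_iff[OF p, of "og m"] by (simp add: og_def)
      hence "real p powr 1 \<le> real p powr (real_of_int (pval p (og m)))" using True by (intro powr_mono) auto
      hence "real p * pabs p (og m) \<le> 1" using True by (simp add: pabs_def og_def powr_minus field_simps)
      hence "(real p * pabs p (og m)) ^ 2 \<le> 1" using v_og_pos[of m] by (intro power_le_one) auto
      hence "real p ^ 2 \<le> oh (Suc m)" unfolding oh_entry(1)[OF m(4)] using v_og_pos[of m] by (simp add: power_mult_distrib field_simps)
      moreover have "real p \<le> real p ^ 2" using True by (intro self_le_power) auto
      ultimately have "real p \<le> S" using oS by linarith
      moreover have "ln (oh (Suc m)) \<le> ln S" using oS oh_pos[of "Suc m"] by (subst ln_le_cancel_iff) auto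
      ultimately show ?thesis using W bad_mass_nonneg[of 4 n] by (simp add: gmass_def gbad_def)
    next
      case False
      thus ?thesis using S2 by (simp add: gmass_def gbad_def bad_mass_def)
    qed
  next
    case False
    hence "p = 2 \<or> p = 3" using prime_cases[OF p] by simp
    thus ?thesis using small_prime_zero[OF _ p] S2 by simp
  qed
  define c where "c = real (nat \<lfloor>S\<rfloor> + 1) * ln S"
  have bound: "D n \<le> D n / 50 + c" for n
  proof -
    have "D n \<le> (\<Sum>p\<in>active n. gbad 4 p n + (if real p \<le> S then ln S else 0))"
      unfolding total_def by (intro sum_mono one) (simp add: active_def)
    also have "\<dots> = total (gbad 4) n + (\<Sum>p\<in>active n. if real p \<le> S then ln S else 0)" by (simp add: sum.distrib total_def)
    also have "(\<Sum>p\<in>active n. if real p \<le> S then ln S else 0) = (\<Sum>p\<in>active n \<inter> {..nat \<lfloor>S\<rfloor>}. ln S)"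
    proof -
      have "real p \<le> S \<longleftrightarrow> p \<le> nat \<lfloor>S\<rfloor>" for p using S2 by (simp add: le_nat_iff le_floor_iff)
      thus ?thesis unfolding sum.inter_restrict[OF finite_active] by (intro sum.cong refl) (simp only: atMost_iff)
    qed
    also have "\<dots> = real (card (active n \<inter> {..nat \<lfloor>S\<rfloor>})) * ln S" by simp
    also have "\<dots> \<le> c" unfolding c_def
    proof (rule mult_right_mono)
      have "card (active n \<inter> {..nat \<lfloor>S\<rfloor>}) \<le> nat \<lfloor>S\<rfloor> + 1"
        using card_mono[of "{..nat \<lfloor>S\<rfloor>}" "active n \<inter> {..nat \<lfloor>S\<rfloor>}"] by simp
      thus "real (card (active n \<inter> {..nat \<lfloor>S\<rfloor>})) \<le> real (nat \<lfloor>S\<rfloor> + 1)" by (simp only: of_nat_le_iff)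
    qed (use S2 in simp)
    finally show ?thesis using crude[of n] by linarith
  qed
  note filterlim_D_lower
  hence "eventually (\<lambda>n. 2 * c + 1 \<le> D 2 / 64 * 8 ^ n) sequentially" unfolding filterlim_at_top by blast
  hence "eventually (\<lambda>n. 2 * c + 1 \<le> D 2 / 64 * 8 ^ n \<and> 2 \<le> n) sequentially" using eventually_ge_at_top[of 2] by eventually_elim simp
  from eventually_happens'[OF sequentially_bot this] obtain n where n: "2 * c + 1 \<le> D 2 / 64 * 8 ^ n" "2 \<le> n" by blast
  hence "2 * c + 1 \<le> D n" using D_lower[OF n(2)] by linarith
  moreover have "0 \<le> c" using S2 by (simp add: c_def)
  ultimately show False using bound[of n] by linarith
qed

section \<open>Zariski density\<close>

context nonarch begin

lemma v_sum_le: "0 \<le> c \<Longrightarrow> (\<And>i. i \<in> A \<Longrightarrow> v (f i) \<le> c) \<Longrightarrow> v (sum f A) \<le> c"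
  by (induction A rule: infinite_finite_induct) (auto intro: v_add_le)

text \<open>\<open>s\<close> and \<open>s'\<close> agree to relative precision \<open>E / B\<close>
  on the scale \<open>B ^ e\<close>. The exponent \<open>e\<close> plays the role of a degree, so
  that closeness passes to monomials.\<close>

definition close :: "real \<Rightarrow> real \<Rightarrow> nat \<Rightarrow> rat \<Rightarrow> rat \<Rightarrow> bool"
  where "close E B e s s' \<longleftrightarrow> v s \<le> B ^ e \<and> v s' \<le> B ^ e \<and> v (s - s') * B \<le> E * B ^ e"

lemma close_mult:
  assumes "close E B e s s'" "close E B f t t'" and B: "0 < B" and E: "0 \<le> E"
  shows "close E B (e + f) (s * t) (s' * t')"
proof -
  have "s * t - s' * t' = s * (t - t') + (s - s') * t'" by (simp add: algebra_simps)
  moreover have "v (s * (t - t')) \<le> E * B ^ (e + f) / B"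
  proof -
    have "v s * (v (t - t') * B) \<le> B ^ e * (E * B ^ f)"
      by (rule mult_mono) (use assms v_nonneg in \<open>auto simp: close_def\<close>)
    hence "v (s * (t - t')) * B \<le> E * B ^ (e + f)" by (simp only: v_mult power_add mult_ac)
    thus ?thesis using B by (simp only: pos_le_divide_eq)
  qed
  moreover have "v ((s - s') * t') \<le> E * B ^ (e + f) / B"
  proof -
    have "(v (s - s') * B) * v t' \<le> (E * B ^ e) * B ^ f"
      by (rule mult_mono) (use assms v_nonneg in \<open>auto simp: close_def\<close>)
    hence "v ((s - s') * t') * B \<le> E * B ^ (e + f)" by (simp only: v_mult power_add mult_ac)
    thus ?thesis using B by (simp only: pos_le_divide_eq)
  qed
  ultimately have "v (s * t - s' * t') \<le> E * B ^ (e + f) / B" by (simp only: v_add_le)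
  hence "v (s * t - s' * t') * B \<le> E * B ^ (e + f)" using B by (simp add: field_simps)
  moreover have "v (s * t) \<le> B ^ (e + f)" "v (s' * t') \<le> B ^ (e + f)"
    unfolding v_mult power_add using assms by (auto simp: close_def v_nonneg intro!: mult_mono)
  ultimately show ?thesis by (simp add: close_def)
qed

lemma close_1: "0 < B \<Longrightarrow> 0 \<le> E \<Longrightarrow> close E B 0 1 1" by (simp add: close_def)

lemma close_power:
  assumes "close E B 1 s s'" "0 < B" "0 \<le> E" shows "close E B n (s ^ n) (s' ^ n)"
proof (induction n)
  case 0 show ?case using close_1[OF assms(2,3)] by simp
next
  case (Suc n) thus ?case using close_mult[OF assms(1) Suc assms(2,3)] by simp
qed

end

text \<open>After a huge jump at one prime the orbit is \<open>u * (px j, pz j, 1)\<close> with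
  relative error \<open>E / B\<close>, and monomials of lower degree are smaller by a factor
  \<open>B\<close>. The relation then forces the integer value of the leading form to have size at
  most \<open>E / B\<close> at that prime. A nonzero integer of absolute value \<open>Y\<close> has
  size at least \<open>1 / Y\<close>, which contradicts \<open>E ^ 10 < B\<close> and
  \<open>Y ^ 10 < B\<close>.\<close>

lemma top_form_vanishes:
  fixes k :: "'i \<Rightarrow> int" and a b c :: "'i \<Rightarrow> nat"
  assumes A: "finite A" and deg: "\<And>i. i \<in> A \<Longrightarrow> a i + b i + c i \<le> g"
    and van: "\<And>n. (\<Sum>i\<in>A. of_int (k i) * (ox n ^ a i * oz n ^ b i * ou n ^ c i)) = 0"
    and j: "1 \<le> j"
  shows "(\<Sum>i\<in>{i \<in> A. a i + b i + c i = g}. k i * (px j ^ a i * pz j ^ b i)) = 0"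
proof (rule ccontr)
  let ?y = "\<Sum>i\<in>{i \<in> A. a i + b i + c i = g}. k i * (px j ^ a i * pz j ^ b i)"
  assume y: "?y \<noteq> 0"
  define Y where "Y = real_of_int \<bar>?y\<bar>"
  have Y1: "1 \<le> Y"
  proof -
    have "1 \<le> \<bar>?y\<bar>" using y by linarith
    hence "real_of_int 1 \<le> real_of_int \<bar>?y\<bar>" by (simp only: of_int_le_iff)
    thus ?thesis by (simp only: Y_def of_int_1)
  qed
  obtain p m where p: "is_prime p" "5 \<le> p" and e: "nonarch.ent (pabs p) m"
    and big: "max (real (path_bound j) ^ 10) (Y ^ 10) < nonarch.oh (pabs p) (Suc m)"
    using entries_unbounded[of "max (real (path_bound j) ^ 10) (Y ^ 10)"] by blast
  interpret nonarch23 "pabs p" by (rule nonarch23_pabs[OF p])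
  define E B where "E = oh m" and "B = oh (Suc m)"
  have E: "1 \<le> E" "E ^ 10 < B" unfolding E_def B_def by (rule oh_ge_1, rule oh_entry(2)[OF e])
  have B: "1 \<le> B" "Y ^ 10 < B" "0 < B" using big oh_ge_1[of "Suc m"] oh_pos[of "Suc m"] by (simp_all add: B_def)
  have "valid_age (oh m) (oh (Suc m)) i" if i: "1 \<le> i" "i \<le> j" for i
  proof (rule fine_large[OF e path_bound_ge_1[of j]])
    have ev: "pz i \<noteq> 0" if "px i = 0" using event_pz_nonzero[of i] that i by (simp add: events_def)
    show "real (path_bound j) ^ 10 < oh (Suc m)" using big by simp
    show "px i \<noteq> 0 \<Longrightarrow> 1 / real (path_bound j) \<le> pabs p (of_int (px i))"
      "px i = 0 \<Longrightarrow> 1 / real (path_bound j) \<le> pabs p (of_int (pz i))"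
      using path_pabs_lower[OF p(1) i(2)] ev by auto
  qed
  hence on: "onpath E B (px j) (pz j) (ox (m + j)) (oz (m + j)) (ou (m + j))"
    unfolding E_def B_def by (intro path_run oh_entry(3)[OF e] j) simp
  define x z u where "x = ox (m + j)" and "z = oz (m + j)" and "u = ou (m + j)"
  have u: "pabs p u = B" and dx: "pabs p (x - of_int (px j) * u) \<le> E" and dz: "pabs p (z - of_int (pz j) * u) \<le> E"
    using on by (simp_all add: onpath_def x_def z_def u_def)
  have EB: "E < B"
  proof -
    have "E \<le> E ^ 10" using E by (intro self_le_power) auto
    thus ?thesis using E by linarith
  qed
  have "hh x z u = B" unfolding x_def z_def u_def by (rule onpath_hh[OF on E(1) EB])
  hence xz: "pabs p x \<le> B" "pabs p z \<le> B" using hh_ge(2)[where a = x and b = z and u = u] hh_ge(3)[where a = x and b = z and u = u] by simp_all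
  have cl: "close E B 1 x (of_int (px j) * u)" "close E B 1 z (of_int (pz j) * u)" "close E B 1 u u"
    using xz dx dz u B E v_int_mult_le[of u B] by (simp_all add: close_def mult_right_mono)
  have "g \<noteq> 0"
  proof
    assume "g = 0"
    hence z: "a i = 0" "b i = 0" "c i = 0" if "i \<in> A" for i using deg[OF that] by auto
    have "{i \<in> A. a i + b i + c i = g} = A" using z \<open>g = 0\<close> by auto
    hence "?y = (\<Sum>i\<in>A. k i)" using z by (simp cong: sum.cong)
    moreover have "(\<Sum>i\<in>A. of_int (k i) :: rat) = 0" using van[of 0] z by (simp cong: sum.cong)
    hence "(\<Sum>i\<in>A. k i) = 0" by (simp flip: of_int_sum)
    ultimately show False using y by simp
  qed
  let ?M = "\<lambda>i. if a i + b i + c i = g then (of_int (px j) ^ a i * of_int (pz j) ^ b i) * u ^ g else 0"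
  have tm: "pabs p (x ^ a i * z ^ b i * u ^ c i - ?M i) * B \<le> E * B ^ g" if i: "i \<in> A" for i
  proof -
    have cm: "close E B (a i + b i + c i) (x ^ a i * z ^ b i * u ^ c i) ((of_int (px j) * u) ^ a i * (of_int (pz j) * u) ^ b i * u ^ c i)"
      using B E by (intro close_mult close_power cl) auto
    show ?thesis
    proof (cases "a i + b i + c i = g")
      case True
      have "(of_int (px j) * u) ^ a i * (of_int (pz j) * u) ^ b i * u ^ c i = ?M i"
        using True by (simp add: power_mult_distrib power_add[symmetric] mult_ac flip: True) (simp add: power_add mult_ac)
      thus ?thesis using cm unfolding True by (simp add: close_def)
    next
      case False
      hence d: "Suc (a i + b i + c i) \<le> g" using deg[OF i] by simp
      have "pabs p (x ^ a i * z ^ b i * u ^ c i) * B \<le> B ^ (a i + b i + c i) * B" using cm B by (intro mult_right_mono) (auto simp: close_def)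
      also have "\<dots> = B ^ Suc (a i + b i + c i)" by simp
      also have "\<dots> \<le> B ^ g" using B d by (intro power_increasing) auto
      also have "\<dots> \<le> E * B ^ g" using E B by simp
      finally show ?thesis using False by simp
    qed
  qed
  have sumM: "(\<Sum>i\<in>A. of_int (k i) * ?M i) = of_int ?y * u ^ g"
  proof -
    have "(\<Sum>i\<in>A. of_int (k i) * ?M i) = (\<Sum>i\<in>{i \<in> A. a i + b i + c i = g}. of_int (k i) * (of_int (px j) ^ a i * of_int (pz j) ^ b i) * u ^ g)"
      using A by (intro sum.mono_neutral_cong_right) (auto simp: mult_ac)
    also have "\<dots> = of_int ?y * u ^ g" by (simp add: sum_distrib_right)
    finally show ?thesis .
  qed
  have "pabs p (\<Sum>i\<in>A. of_int (k i) * (x ^ a i * z ^ b i * u ^ c i - ?M i)) \<le> E * B ^ g / B"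
  proof (rule v_sum_le)
    show "0 \<le> E * B ^ g / B" using E B by simp
    show "pabs p (of_int (k i) * (x ^ a i * z ^ b i * u ^ c i - ?M i)) \<le> E * B ^ g / B" if "i \<in> A" for i
    proof (rule v_int_mult_le)
      show "pabs p (x ^ a i * z ^ b i * u ^ c i - ?M i) \<le> E * B ^ g / B" using tm[OF that] B(3) by (simp only: pos_le_divide_eq)
    qed
  qed
  also have "(\<Sum>i\<in>A. of_int (k i) * (x ^ a i * z ^ b i * u ^ c i - ?M i)) = - (of_int ?y * u ^ g)"
    unfolding right_diff_distrib sum_subtractf sumM using van[of "m + j"] by (simp only: x_def z_def u_def diff_0)
  finally have "pabs p (of_int ?y * u ^ g) \<le> E * B ^ g / B" by (simp only: v_minus)
  hence "pabs p (of_int ?y) * B ^ g \<le> E * B ^ g / B" by (simp only: v_mult v_power u)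
  hence "pabs p (of_int ?y) \<le> E / B" using B(3) by (simp add: field_simps)
  moreover have "1 / Y \<le> pabs p (of_int ?y)" unfolding Y_def by (rule pabs_int_lower[OF p(1) y])
  ultimately have "1 / Y \<le> E / B" by linarith
  hence "B \<le> E * Y" using B(3) Y1 by (simp add: field_simps)
  moreover have "E * Y < B"
  proof -
    have "((E * Y) ^ 5) ^ 2 = E ^ 10 * Y ^ 10" by (simp add: power_mult_distrib flip: power_mult)
    also have "\<dots> < B * B" using E B Y1 by (intro mult_strict_mono) auto
    finally have "((E * Y) ^ 5) ^ 2 < B ^ 2" by (simp only: power2_eq_square)
    hence "(E * Y) ^ 5 < B" by (rule power_less_imp_less_base) (use B in simp)
    moreover have "E * Y \<le> (E * Y) ^ 5" using E Y1 mult_mono[of 1 E 1 Y] by (intro self_le_power) auto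
    ultimately show ?thesis by linarith
  qed
  ultimately show False by linarith
qed

text \<open>The path points lie on infinitely many conics, one for each segment.\<close>

lemma path_not_on_curve:
  fixes k :: "'i \<Rightarrow> int" and a b :: "'i \<Rightarrow> nat"
  assumes A: "finite A" and inj: "inj_on (\<lambda>i. (a i, b i)) A" and deg: "\<And>i. i \<in> A \<Longrightarrow> a i + b i \<le> g"
    and van: "\<And>j. 1 \<le> j \<Longrightarrow> (\<Sum>i\<in>A. k i * (px j ^ a i * pz j ^ b i)) = 0"
    and i0: "i0 \<in> A"
  shows "k i0 = 0"
proof -
  define Q :: "rat \<Rightarrow> rat \<Rightarrow> rat" where "Q x z = (\<Sum>i\<in>A. of_int (k i) * (x ^ a i * z ^ b i))" for x z
  have path0: "Q (of_int (px j)) (of_int (pz j)) = 0" if "1 \<le> j" for j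
  proof -
    have "Q (of_int (px j)) (of_int (pz j)) = of_int (\<Sum>i\<in>A. k i * (px j ^ a i * pz j ^ b i))" by (simp add: Q_def)
    thus ?thesis unfolding van[OF that] by simp
  qed
  let ?T = "\<lambda>l. of_nat (seg_len l) :: rat"
  \<comment> \<open>Segment \<open>l\<close> runs on a conic with parameter \<open>s\<close>, where
    \<open>10 * 2 ^ l\<close> is written as \<open>(T + 15) / 2\<close> for the segment length
    \<open>T\<close>. The restriction of \<open>Q\<close> has degree at most \<open>2 * g\<close>
    and more than \<open>2 * g\<close> roots.\<close>
  have step1: "Q (s * (s - ?T l) / 2) (10 - (?T l + 15) / 2 + s) = 0" if l: "2 * g < seg_len l" for l s
  proof -
    define P where "P = (\<Sum>i\<in>A. Polynomial.smult (of_int (k i)) ([:0, - ?T l / 2, 1 / 2:] ^ a i * [:10 - (?T l + 15) / 2, 1:] ^ b i))"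
    have ev: "poly P s = Q (s * (s - ?T l) / 2) (10 - (?T l + 15) / 2 + s)" for s
    proof -
      have "poly [:0, - ?T l / 2, 1 / 2:] s = s * (s - ?T l) / 2" by (simp add: algebra_simps diff_divide_distrib)
      moreover have "poly [:10 - (?T l + 15) / 2, 1:] s = 10 - (?T l + 15) / 2 + s" by simp
      ultimately show ?thesis by (simp only: P_def Q_def poly_sum poly_smult poly_mult poly_power)
    qed
    have degP: "Polynomial.degree P \<le> 2 * g" unfolding P_def
    proof (intro degree_sum_le A)
      fix i assume i: "i \<in> A"
      have d1: "Polynomial.degree ([:0, - ?T l / 2, 1 / 2:] ^ a i) \<le> 2 * a i"
        by (rule order_trans[OF degree_power_le]) simp
      have d2: "Polynomial.degree ([:10 - (?T l + 15) / 2, 1:] ^ b i) \<le> 1 * b i"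
        by (rule order_trans[OF degree_power_le]) simp
      have "Polynomial.degree ([:0, - ?T l / 2, 1 / 2:] ^ a i * [:10 - (?T l + 15) / 2, 1:] ^ b i) \<le> 2 * a i + 1 * b i"
        by (rule order_trans[OF degree_mult_le add_mono[OF d1 d2]])
      also have "\<dots> \<le> 2 * g" using deg[OF i] by simp
      finally show "Polynomial.degree (Polynomial.smult (of_int (k i)) ([:0, - ?T l / 2, 1 / 2:] ^ a i * [:10 - (?T l + 15) / 2, 1:] ^ b i)) \<le> 2 * g"
        by (rule order_trans[OF degree_smult_le])
    qed
    have roots: "poly P (of_nat i) = 0" if i: "1 \<le> i" "i \<le> seg_len l" for i
    proof -
      have "2 * px (seg_start l + i) = int i * (int i - int (seg_len l))" and z: "pz (seg_start l + i) = 10 - 10 * 2 ^ l + int i"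
        using path_segment[OF i] by auto
      hence "rat_of_int (2 * px (seg_start l + i)) = of_int (int i * (int i - int (seg_len l)))" by (simp only:)
      hence x: "of_int (px (seg_start l + i)) = of_nat i * (of_nat i - ?T l) / 2" by simp
      have "rat_of_int (int (seg_len l)) = of_int (20 * 2 ^ l - 15)" by (simp only: int_seg_len)
      hence "?T l = 20 * 2 ^ l - 15" by simp
      hence "of_int (pz (seg_start l + i)) = 10 - (?T l + 15) / 2 + of_nat i" unfolding z by simp
      thus ?thesis unfolding ev using path0[of "seg_start l + i"] x i by simp
    qed
    have "P = 0"
    proof (rule ccontr)
      assume P: "P \<noteq> 0"
      have "card ((of_nat :: nat \<Rightarrow> rat) ` {1..seg_len l}) \<le> card {x. poly P x = 0}"
        using roots by (intro card_mono poly_roots_finite[OF P]) auto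
      also have "\<dots> \<le> 2 * g" using card_poly_roots_bound[OF P] degP by linarith
      finally show False using l by (simp add: card_image inj_on_def)
    qed
    thus ?thesis using ev[of s] by simp
  qed
  \<comment> \<open>For fixed \<open>s\<close> the restriction is a polynomial in the segment length
    with infinitely many roots, so the length may be replaced by a free \<open>t\<close>.\<close>
  have step2: "Q (s * (s - t) / 2) (10 - (t + 15) / 2 + s) = 0" for s t
  proof -
    define P where "P = (\<Sum>i\<in>A. Polynomial.smult (of_int (k i)) ([:s * s / 2, - s / 2:] ^ a i * [:10 - 15 / 2 + s, - 1 / 2:] ^ b i))"
    have ev: "poly P t = Q (s * (s - t) / 2) (10 - (t + 15) / 2 + s)" for t
    proof -
      have "poly [:s * s / 2, - s / 2:] t = s * (s - t) / 2" by (simp add: algebra_simps diff_divide_distrib)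
      moreover have "poly [:10 - 15 / 2 + s, - 1 / 2:] t = 10 - (t + 15) / 2 + s" by (simp add: add_divide_distrib)
      ultimately show ?thesis by (simp only: P_def Q_def poly_sum poly_smult poly_mult poly_power)
    qed
    have mono: "strict_mono seg_len"
    proof (rule strict_monoI_Suc)
      show "seg_len n < seg_len (Suc n)" for n using exponent_le[of n] by (simp add: seg_len_def)
    qed
    have "P = 0"
    proof (rule ccontr)
      assume "P \<noteq> 0"
      hence "finite {x. poly P x = 0}" by (rule poly_roots_finite)
      moreover have "?T ` {2 * g + 1..} \<subseteq> {x. poly P x = 0}"
      proof
        fix x assume "x \<in> ?T ` {2 * g + 1..}"
        then obtain l where l: "x = ?T l" "2 * g + 1 \<le> l" by auto
        have "l \<le> seg_len l" using strict_mono_imp_increasing[OF mono] .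
        thus "x \<in> {x. poly P x = 0}" using step1[of l s] l ev by simp
      qed
      ultimately have "finite (?T ` {2 * g + 1..})" using finite_subset by blast
      moreover have "inj_on ?T {2 * g + 1..}" using strict_mono_imp_inj_on[OF mono] by (simp add: inj_on_def)
      ultimately have "finite {2 * g + 1..}" by (rule finite_imageD)
      thus False using infinite_Ici by blast
    qed
    thus ?thesis using ev[of t] by simp
  qed
  \<comment> \<open>The choice \<open>t = 2 * s + 5 - 2 * z\<close> holds the second coordinate at
    \<open>z\<close> while the first runs through the nonconstant quadratic \<open>h\<close>, so
    \<open>Q\<close> vanishes identically in its first variable.\<close>
  have step3: "(\<Sum>i\<in>{i \<in> A. a i = a i0}. of_int (k i) * z ^ b i) = 0" for z :: rat
  proof -
    define P where "P = (\<Sum>i\<in>A. Polynomial.monom (of_int (k i) * z ^ b i) (a i))"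
    define h where "h = [:0, (2 * z - 5) / 2, - 1 / 2:]"
    have "poly (pcompose P h) s = 0" for s
    proof -
      have h: "poly h s = s * (s - (2 * s + 5 - 2 * z)) / 2" by (simp add: h_def field_simps)
      have z: "10 - ((2 * s + 5 - 2 * z) + 15) / 2 + s = z" by (simp add: field_simps)
      have "Q (poly h s) z = 0" using step2[of s "2 * s + 5 - 2 * z"] unfolding h z .
      moreover have "poly P x = Q x z" for x by (simp add: P_def Q_def poly_sum poly_monom mult_ac)
      ultimately show ?thesis by (simp add: poly_pcompose)
    qed
    hence "pcompose P h = 0" using poly_all_0_iff_0 by blast
    hence "P = 0" by (rule pcompose_eq_0) (simp add: h_def)
    hence "poly.coeff P (a i0) = 0" by simp
    moreover have "poly.coeff P (a i0) = (\<Sum>i\<in>A. if a i = a i0 then of_int (k i) * z ^ b i else 0)"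
      by (simp add: P_def coeff_sum)
    ultimately show ?thesis using A by (simp add: sum.inter_filter)
  qed
  define S where "S = (\<Sum>i\<in>{i \<in> A. a i = a i0}. Polynomial.monom (of_int (k i) :: rat) (b i))"
  have "poly S z = 0" for z using step3[of z] by (simp add: S_def poly_sum poly_monom)
  hence "S = 0" using poly_all_0_iff_0 by blast
  hence "poly.coeff S (b i0) = 0" by simp
  moreover have "poly.coeff S (b i0) = (\<Sum>i\<in>{i \<in> A. a i = a i0}. if b i = b i0 then of_int (k i) else 0)"
    by (simp add: S_def coeff_sum)
  moreover have "\<dots> = (\<Sum>i\<in>{i0}. of_int (k i))"
    using A i0 inj by (intro sum.mono_neutral_cong_right) (auto simp: inj_on_def)
  ultimately show ?thesis by simp
qed

text \<open>In the leading form the exponent of \<open>u\<close> is determined by the other two, so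
  after setting \<open>u = 1\<close> its terms are still distinct monomials, and the path can be
  tested against them.\<close>

lemma orbit_not_on_surface:
  fixes k :: "'i \<Rightarrow> int" and a b c :: "'i \<Rightarrow> nat"
  assumes A: "finite A" and inj: "inj_on (\<lambda>i. (a i, b i, c i)) A"
    and van: "\<And>n. (\<Sum>i\<in>A. of_int (k i) * (ox n ^ a i * oz n ^ b i * ou n ^ c i)) = 0"
  shows "\<forall>i\<in>A. k i = 0"
proof (rule ccontr)
  assume "\<not> (\<forall>i\<in>A. k i = 0)"
  define A' where "A' = {i \<in> A. k i \<noteq> 0}"
  have A': "finite A'" "A' \<noteq> {}" using A \<open>\<not> (\<forall>i\<in>A. k i = 0)\<close> by (auto simp: A'_def)
  define g where "g = Max ((\<lambda>i. a i + b i + c i) ` A')"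
  have deg: "a i + b i + c i \<le> g" if "i \<in> A'" for i unfolding g_def using A' that by (intro Max_ge) auto
  have "g \<in> (\<lambda>i. a i + b i + c i) ` A'" unfolding g_def using A' by (intro Max_in) auto
  then obtain i0 where i0: "i0 \<in> A'" "a i0 + b i0 + c i0 = g" by auto
  let ?G = "{i \<in> A'. a i + b i + c i = g}"
  have van': "(\<Sum>i\<in>A'. of_int (k i) * (ox n ^ a i * oz n ^ b i * ou n ^ c i)) = 0" for n
  proof -
    have "(\<Sum>i\<in>A'. of_int (k i) * (ox n ^ a i * oz n ^ b i * ou n ^ c i)) = (\<Sum>i\<in>A. of_int (k i) * (ox n ^ a i * oz n ^ b i * ou n ^ c i))"
      using A by (intro sum.mono_neutral_left) (auto simp: A'_def)
    thus ?thesis using van by simp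
  qed
  have "k i0 = 0"
  proof (rule path_not_on_curve[of ?G a b g k])
    show "finite ?G" using A' by simp
    show "inj_on (\<lambda>i. (a i, b i)) ?G"
    proof (rule inj_onI)
      fix i i' assume i: "i \<in> ?G" "i' \<in> ?G" "(a i, b i) = (a i', b i')"
      hence "c i = c i'" by simp
      thus "i = i'" using i inj by (auto simp: inj_on_def A'_def)
    qed
    show "a i + b i \<le> g" if "i \<in> ?G" for i using that by auto
    show "(\<Sum>i\<in>?G. k i * (px j ^ a i * pz j ^ b i)) = 0" if "1 \<le> j" for j
      by (rule top_form_vanishes[OF A'(1) deg van' that])
    show "i0 \<in> ?G" using i0 by simp
  qed
  thus False using i0 by (simp add: A'_def)
qed

text \<open>The orbit is rational, but forms have coefficients in the algebraic closure. Applying a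
  functional that is linear over the rationals and takes one chosen coefficient to 1 turns a
  relation on the orbit into a rational one that is still nontrivial.\<close>

lemma rational_functional:
  fixes c0 :: qbar assumes "c0 \<noteq> 0"
  obtains f :: "qbar \<Rightarrow> rat" where "\<And>x y. f (x + y) = f x + f y" "\<And>r x. f (x * of_rat r) = f x * r" "f c0 = 1"
proof -
  interpret V: vector_space "\<lambda>r x. of_rat r * x :: qbar"
    by unfold_locales (simp_all add: of_rat_add of_rat_mult algebra_simps)
  have ind: "V.independent {c0}" using assms by (simp add: V.dependent_single)
  define B where "B = V.extend_basis {c0}"
  have B: "V.independent B" "V.span B = UNIV" "c0 \<in> B"
    using V.independent_extend_basis[OF ind] V.span_extend_basis[OF ind] V.extend_basis_superset[OF ind] by (auto simp: B_def)
  show thesis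
  proof (rule that[of "\<lambda>x. V.representation B x c0"])
    show "V.representation B (x + y) c0 = V.representation B x c0 + V.representation B y c0" for x y
      using V.representation_add[OF B(1), of y x] B(2) by simp
    show "V.representation B (x * of_rat r) c0 = V.representation B x c0 * r" for x r
      using V.representation_scale[OF B(1), of x r] B(2) by (simp add: mult.commute)
    show "V.representation B c0 c0 = 1" using V.representation_basis[OF B(1,3)] by simp
  qed
qed

lemma common_denominator:
  fixes f :: "'i \<Rightarrow> rat" assumes "finite A"
  obtains q :: int and k where "q \<noteq> 0" "\<And>i. i \<in> A \<Longrightarrow> of_int q * f i = of_int (k i)"
proof -
  have "\<exists>q k. q \<noteq> 0 \<and> (\<forall>i\<in>A. of_int q * f i = of_int (k i))" using assms
  proof (induction A rule: finite_induct)
    case empty show ?case by (intro exI[of _ 1]) simp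
  next
    case (insert i A)
    then obtain q k where qk: "q \<noteq> 0" "\<And>i. i \<in> A \<Longrightarrow> of_int q * f i = of_int (k i)" by blast
    obtain n d where nd: "0 < d" "f i = of_int n / of_int d" by (rule rat_fraction)
    have "of_int (q * d) * f i' = of_int (if i' = i then q * n else d * k i')" if "i' \<in> insert i A" for i'
    proof (cases "i' = i")
      case True thus ?thesis using nd by simp
    next
      case False
      have "of_int (q * d) * f i' = of_int d * (of_int q * f i')" by simp
      also have "of_int q * f i' = of_int (k i')" using that False by (intro qk(2)) simp
      finally show ?thesis using False by simp
    qed
    thus ?case using qk(1) nd(1) by (intro exI[of _ "q * d"] exI[of _ "\<lambda>i'. if i' = i then q * n else d * k i'"]) auto
  qed
  thus thesis using that by blast
qed

lemma form_vanishing_on_orbit: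
  assumes F: "homogeneous 3 e F" and van: "\<And>n. mpoly_value (\<lambda>i. of_rat (orbit_vec n i)) F = 0"
  shows "F = 0"
proof (rule ccontr)
  assume "F \<noteq> 0"
  hence "Poly_Mapping.keys F \<noteq> {}" by simp
  then obtain m0 where m0: "m0 \<in> Poly_Mapping.keys F" by blast
  let ?l = "Poly_Mapping.lookup"
  have nz: "?l F m0 \<noteq> 0" using m0 by (simp add: in_keys_iff)
  obtain f where f: "\<And>x y. f (x + y) = f x + f y" "\<And>r x. f (x * of_rat r) = f x * r" "f (?l F m0) = 1"
  proof (rule rational_functional[OF nz])
    fix f :: "qbar \<Rightarrow> rat"
    assume "\<And>x y. f (x + y) = f x + f y" "\<And>r x. f (x * of_rat r) = f x * r" "f (?l F m0) = 1"
    thus thesis by (rule that)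
  qed
  have f0: "f 0 = 0" using f(1)[of 0 0] by simp
  have fsum: "f (sum h A) = (\<Sum>i\<in>A. f (h i))" for h :: "(nat \<Rightarrow>\<^sub>0 nat) \<Rightarrow> qbar" and A
    by (induction A rule: infinite_finite_induct) (simp_all add: f0 f(1))
  have mon: "monomial_value (\<lambda>i. of_rat (orbit_vec n i) :: qbar) m = of_rat (ox n ^ ?l m 1 * oz n ^ ?l m 2 * ou n ^ ?l m 3)"
    if "m \<in> Poly_Mapping.keys F" for m n
  proof -
    have "Poly_Mapping.keys m \<subseteq> {..3}" using F that unfolding homogeneous_def by blast
    hence "monomial_value (\<lambda>i. of_rat (orbit_vec n i)) m = (\<Prod>i\<in>{..3}. of_rat (orbit_vec n i) ^ ?l m i :: qbar)"
      by (intro monomial_value_superset) auto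
    also have "{..3} = {0, 1, 2, 3::nat}" by auto
    also have "(\<Prod>i\<in>{0, 1, 2, 3::nat}. of_rat (orbit_vec n i) ^ ?l m i :: qbar) = of_rat (ox n ^ ?l m 1 * oz n ^ ?l m 2 * ou n ^ ?l m 3)"
      by (simp add: orbit_vec_def of_rat_mult of_rat_power mult_ac)
    finally show ?thesis .
  qed
  have rel: "(\<Sum>m\<in>Poly_Mapping.keys F. f (?l F m) * (ox n ^ ?l m 1 * oz n ^ ?l m 2 * ou n ^ ?l m 3)) = 0" for n
  proof -
    have "f (mpoly_value (\<lambda>i. of_rat (orbit_vec n i)) F) = (\<Sum>m\<in>Poly_Mapping.keys F. f (?l F m) * (ox n ^ ?l m 1 * oz n ^ ?l m 2 * ou n ^ ?l m 3))"
      unfolding mpoly_value_def mpoly_eval_alt fsum by (intro sum.cong refl) (simp only: mon f(2))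
    thus ?thesis using van[of n] f0 by simp
  qed
  obtain q :: int and k where q: "q \<noteq> 0" "\<And>m. m \<in> Poly_Mapping.keys F \<Longrightarrow> of_int q * f (?l F m) = of_int (k m)"
    using common_denominator[OF finite_keys, of F "\<lambda>m. f (?l F m)"] by blast
  have "\<forall>m\<in>Poly_Mapping.keys F. k m = 0"
  proof (rule orbit_not_on_surface[of _ "\<lambda>m. ?l m 1" "\<lambda>m. ?l m 2" "\<lambda>m. ?l m 3"])
    \<comment> \<open>Homogeneity recovers the exponent of variable 0, which is invisible on the
      orbit because the coordinate there is 1.\<close>
    show "inj_on (\<lambda>m. (?l m 1, ?l m 2, ?l m 3)) (Poly_Mapping.keys F)"
    proof (rule inj_onI)
      fix m m' assume m: "m \<in> Poly_Mapping.keys F" "m' \<in> Poly_Mapping.keys F" "(?l m 1, ?l m 2, ?l m 3) = (?l m' 1, ?l m' 2, ?l m' 3)"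
      have h: "Poly_Mapping.keys m \<subseteq> {..3} \<and> (\<Sum>i\<le>3. ?l m i) = e" "Poly_Mapping.keys m' \<subseteq> {..3} \<and> (\<Sum>i\<le>3. ?l m' i) = e"
        using F m(1,2) unfolding homogeneous_alt by blast+
      have s: "{..3} = {0, 1, 2, 3::nat}" by auto
      have "?l m 0 = ?l m' 0" using h m(3) unfolding s by simp
      moreover have "?l m i = ?l m' i" if "i > 3" for i
      proof -
        have "i \<notin> {..3}" using that by simp
        hence "i \<notin> Poly_Mapping.keys m" "i \<notin> Poly_Mapping.keys m'" using h by blast+
        thus ?thesis by (simp add: in_keys_iff)
      qed
      ultimately have "?l m i = ?l m' i" for i
        using m(3) by (cases "i > 3") (auto simp: not_less le_Suc_eq numeral_3_eq_3 numeral_2_eq_2)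
      thus "m = m'" by (rule poly_mapping_eqI)
    qed
    show "(\<Sum>m\<in>Poly_Mapping.keys F. of_int (k m) * (ox n ^ ?l m 1 * oz n ^ ?l m 2 * ou n ^ ?l m 3)) = 0" for n
    proof -
      have "(\<Sum>m\<in>Poly_Mapping.keys F. of_int (k m) * (ox n ^ ?l m 1 * oz n ^ ?l m 2 * ou n ^ ?l m 3))
        = (\<Sum>m\<in>Poly_Mapping.keys F. of_int q * (f (?l F m) * (ox n ^ ?l m 1 * oz n ^ ?l m 2 * ou n ^ ?l m 3)))"
        by (intro sum.cong refl) (simp only: q(2)[symmetric] mult.assoc)
      also have "\<dots> = 0" unfolding sum_distrib_left[symmetric] rel by simp
      finally show ?thesis .
    qed
  qed simp
  hence "k m0 = 0" using m0 by blast
  thus False using q(2)[OF m0] q(1) f(3) by simp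
qed

lemma zariski_dense_orbit: "zariski_closure 3 (forward_orbit 3 (phi 3) (orbit_point 3 0)) = proj_space 3"
proof -
  let ?O = "forward_orbit 3 (phi 3) (orbit_point 3 0)"
  have mem: "orbit_point 3 n \<in> ?O" for n using phi_iterate[of 3 n] by (auto simp: forward_orbit_def)
  have "Z = proj_space 3" if Z: "zariski_closed 3 Z" "?O \<subseteq> Z" for Z
  proof -
    obtain S where S: "\<And>F. F \<in> S \<Longrightarrow> \<exists>e. homogeneous 3 e F" "Z = zero_locus 3 S" using Z(1) by (auto simp: zariski_closed_def)
    have F0: "F = 0" if FS: "F \<in> S" for F
    proof -
      obtain e where e: "homogeneous 3 e F" using S(1)[OF FS] by blast
      show ?thesis
      proof (rule form_vanishing_on_orbit[OF e])
        fix n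
        have "orbit_point 3 n \<in> zero_locus 3 S" using mem Z(2) S(2) by blast
        moreover have "(\<lambda>i. of_rat (orbit_vec n i)) \<in> orbit_point 3 n"
          unfolding orbit_point_def by (rule proj_class_mem[OF orbit_vec_coord]) simp
        ultimately show "mpoly_value (\<lambda>i. of_rat (orbit_vec n i)) F = 0" using FS by (auto simp: zero_locus_def)
      qed
    qed
    have "mpoly_value x F = 0" if "F \<in> S" for x F unfolding F0[OF that] by (rule value_simps)
    thus ?thesis unfolding S(2) zero_locus_def by auto
  qed
  moreover have "zariski_closed 3 (proj_space 3)"
    unfolding zariski_closed_def by (intro exI[of _ "{}"]) (auto simp: zero_locus_def)
  moreover have "?O \<subseteq> proj_space 3"
    using phi_iterate[of 3] proj_class_in_space[OF orbit_vec_coord[of 3]] by (auto simp: forward_orbit_def orbit_point_def)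
  ultimately have "{Z. zariski_closed 3 Z \<and> ?O \<subseteq> Z} = {proj_space 3}" by blast
  thus ?thesis unfolding zariski_closure_def by simp
qed

theorem corollaryC:
  fixes d :: nat
  assumes "d \<ge> 3"
  shows "\<exists>\<phi> P \<alpha>. birational d \<phi> \<and> P \<in> points_with_orbit d \<phi> \<and>
           has_arith_degree d \<phi> P \<alpha> \<and> \<not> algebraic \<alpha> \<and>
           (d = 3 \<longrightarrow> zariski_closure d (forward_orbit d \<phi> P) = proj_space d)"
proof -
  obtain y where y: "lacunary y" "(\<lambda>n. D (Suc n) / D n) \<longlonglongrightarrow> 1 / y" "1/9 \<le> y" by (rule degree_exists)
  have "\<not> algebraic (1 / y)"
  proof
    assume "algebraic (1 / y)"
    hence "algebraic (inverse (1 / y))" by (rule algebraic_inverse)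
    thus False using lacunary.transcendental[OF y(1)] by simp
  qed
  moreover have "has_arith_degree d (phi d) (orbit_point d 0) (1 / y)"
    by (rule arith_degree_orbit_point[OF assms _ y(2)]) (use y(3) in simp)
  ultimately show ?thesis
    using birational_phi[OF assms] orbit_point_with_orbit[OF assms] zariski_dense_orbit by blast
qed

end
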